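(* Let $A\subset\mathbb R^q$ be Borel with $p_A:=\mathbb P(\mathbf Z\in A)>0$. Assume the weights satisfy Condition (W) below. Then for any $M\ge2$, as $n\to\infty$, the process $$\mathcal D^*_{n,M,A}(\mathbf u_0,\mathbf u_1,\dots,\mathbf u_M):=\big(\mathbb D_n(\mathbf u_0,A),\mathbb D^*_{n,1}(\mathbf u_1,A),\dots,\mathbb D^*_{n,M}(\mathbf u_M,A)\big),\quad \mathbf u_j\in[0,1]^p,$$ converges weakly in $\ell^\infty([0,1]^{p(M+1)},\mathbb R^{M+1})$ to a process that concatenates $M+1$ independent copies of $\mathbb B(\cdot,A)$, where $\mathbb B(\cdot,A)$ is a centered Gaussian process on $[0,1]^p$ with covariance $\mathbb E[\mathbb B(\mathbf u,A)\mathbb B(\mathbf u',A)]=p_AC(\mathbf u\wedge\mathbf u'|A)-p_A^2C(\mathbf u|A)C(\mathbf u'|A)$.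
   Context: Let $(\mathbf X,\mathbf Z)$ be a random vector in $\mathbb R^p\times\mathbb R^q$ and $(\mathbf X_1,\mathbf Z_1),\dots,(\mathbf X_n,\mathbf Z_n)$ i.i.d. copies. Vector inequalities and $\wedge$ are componentwise. The conditional margins $F_k(t|A):=\mathbb P(X_k\le t\mid\mathbf Z\in A)$ are continuous (standing assumption); $C(\cdot|A)$ is the conditional copula of $\mathbf X$ given $\mathbf Z\in A$. Let $U^A_{i,k}:=F_k(X_{i,k}|A)$, $\mathbf U^A_i=(U^A_{i,1},\dots,U^A_{i,p})$, $\mathbf U^A:=(F_1(X_1|A),\dots,F_p(X_p|A))$, $D(\mathbf u,A):=\mathbb P(\mathbf U^A\le\mathbf u,\mathbf Z\in A)$, $D_n(\mathbf u,A):=n^{-1}\sum_i\mathbf 1(\mathbf U^A_i\le\mathbf u,\mathbf Z_i\in A)$, $\mathbb D_n(\mathbf u,A):=\sqrt n(D_n-D)(\mathbf u,A)$. Let $\hat p_A:=n^{-1}\sum_i\mathbf 1(\mathbf Z_i\in A)$, $F_{n,k}(t|A):=\frac1{n\hat p_A}\sum_i\mathbf 1(X_{i,k}\le t,\mathbf Z_i\in A)$, generalized inverse $F^{-1}(u):=\inf\{t:F(t)\ge u\}$, and $\overline D_n(\mathbf u,A):=n^{-1}\sum_i\mathbf 1\big(X_{i,k}\le F^{-1}_{n,k}(u_k|A)\ \forall k,\ \mathbf Z_i\in A\big)$. Exchangeable bootstrap: for each $n$, $\mathbf W_n=(W_{n,1},\dots,W_{n,n})$ is an exchangeable nonnegative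 random vector, independent of the sample, with $\overline W_n:=n^{-1}\sum_iW_{n,i}$, and $$\mathbb D^*_n(\mathbf u,A):=\frac1{\sqrt n}\sum_{i=1}^nW_{n,i}\mathbf 1\big(X_{i,k}\le F^{-1}_{n,k}(u_k|A)\ \forall k,\ \mathbf Z_i\in A\big)-\sqrt n\,\overline W_n\overline D_n(\mathbf u,A).$$ $\mathbb D^*_{n,1},\dots,\mathbb D^*_{n,M}$ are computed from $M$ mutually independent realizations of $\mathbf W_n$, independent of the sample. Condition (W): $\sup_n\int_0^\infty\sqrt{\mathbb P(|W_{n,1}-\overline W_n|>t)}\,dt<\infty$, $n^{-1/2}\mathbb E[\max_{1\le i\le n}|W_{n,i}-\overline W_n|]\to0$ in probability, and $n^{-1}\sum_{i=1}^n(W_{n,i}-\overline W_n)^2\to1$ in probability. *)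

theory Defs
  imports "HOL-Probability.Probability" "HOL-Combinatorics.Permutations"
begin

definition linf :: "'i set \<Rightarrow> ('i \<Rightarrow> real) set" where
  "linf I = {f. bounded (f ` I) \<and> (\<forall>i. i \<notin> I \<longrightarrow> f i = 0)}"

definition sup_dist :: "'i set \<Rightarrow> ('i \<Rightarrow> real) \<Rightarrow> ('i \<Rightarrow> real) \<Rightarrow> real" where
  "sup_dist I f g = (SUP i\<in>I. \<bar>f i - g i\<bar>)"

definition linf_open :: "'i set \<Rightarrow> ('i \<Rightarrow> real) set \<Rightarrow> bool" where
  "linf_open I S \<longleftrightarrow> S \<subseteq> linf I \<and>
     (\<forall>f\<in>S. \<exists>e>0. \<forall>g\<in>linf I. sup_dist I f g < e \<longrightarrow> g \<in> S)"

definition linf_borel :: "'i set \<Rightarrow> ('i \<Rightarrow> real) measure" where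
  "linf_borel I = sigma (linf I) {S. linf_open I S}"

definition linf_bcont :: "'i set \<Rightarrow> (('i \<Rightarrow> real) \<Rightarrow> real) \<Rightarrow> bool" where
  "linf_bcont I h \<longleftrightarrow> (\<exists>c. \<forall>f\<in>linf I. \<bar>h f\<bar> \<le> c) \<and>
     (\<forall>f\<in>linf I. \<forall>e>0. \<exists>d>0. \<forall>g\<in>linf I. sup_dist I f g < d \<longrightarrow> \<bar>h g - h f\<bar> < e)"

text \<open>Outer expectation E* T = inf { E U : U measurable, U >= T } (for bounded T).\<close>
definition outer_exp :: "'a measure \<Rightarrow> ('a \<Rightarrow> real) \<Rightarrow> real" where
  "outer_exp P T = Inf {(\<integral>\<omega>. U \<omega> \<partial>P) | U. integrable P U \<and> (\<forall>\<omega>\<in>space P. T \<omega> \<le> U \<omega>)}"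

definition centered_gaussian_process ::
  "'w measure \<Rightarrow> 't set \<Rightarrow> ('t \<Rightarrow> 'w \<Rightarrow> real) \<Rightarrow> ('t \<Rightarrow> 't \<Rightarrow> real) \<Rightarrow> bool" where
  "centered_gaussian_process N T B K \<longleftrightarrow>
     (\<forall>t\<in>T. B t \<in> borel_measurable N) \<and>
     (\<forall>F c. finite F \<longrightarrow> F \<subseteq> T \<longrightarrow>
        (let v = (\<Sum>s\<in>F. \<Sum>t\<in>F. c s * c t * K s t) in
         if v > 0 then distributed N lborel (\<lambda>\<omega>. \<Sum>t\<in>F. c t * B t \<omega>)
                        (\<lambda>x. ennreal (normal_density 0 (sqrt v) x))
         else (AE \<omega> in N. (\<Sum>t\<in>F. c t * B t \<omega>) = 0)))"

definition cube :: "(real^'p) set" where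
  "cube = {u. \<forall>k. 0 \<le> u $ k \<and> u $ k \<le> 1}"

definition vmin :: "real^'p \<Rightarrow> real^'p \<Rightarrow> real^'p" where
  "vmin u v = (\<chi> k. min (u $ k) (v $ k))"

text \<open>p_A = P(Z in A) (the sample is X 0, X 1, ...; (X 0, Z 0) has the law of (X,Z)).\<close>
definition pA :: "'a measure \<Rightarrow> (nat \<Rightarrow> 'a \<Rightarrow> real^'q) \<Rightarrow> (real^'q) set \<Rightarrow> real" where
  "pA P Z A = measure P {\<omega>\<in>space P. Z 0 \<omega> \<in> A}"

definition Fcond :: "'a measure \<Rightarrow> (nat \<Rightarrow> 'a \<Rightarrow> real^'p) \<Rightarrow> (nat \<Rightarrow> 'a \<Rightarrow> real^'q)
    \<Rightarrow> (real^'q) set \<Rightarrow> 'p \<Rightarrow> real \<Rightarrow> real" where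
  "Fcond P X Z A k t = measure P {\<omega>\<in>space P. X 0 \<omega> $ k \<le> t \<and> Z 0 \<omega> \<in> A} / pA P Z A"

definition Dpop :: "'a measure \<Rightarrow> (nat \<Rightarrow> 'a \<Rightarrow> real^'p) \<Rightarrow> (nat \<Rightarrow> 'a \<Rightarrow> real^'q)
    \<Rightarrow> (real^'q) set \<Rightarrow> real^'p \<Rightarrow> real" where
  "Dpop P X Z A u = measure P {\<omega>\<in>space P. (\<forall>k. Fcond P X Z A k (X 0 \<omega> $ k) \<le> u $ k) \<and> Z 0 \<omega> \<in> A}"

text \<open>Conditional copula C(u|A) of X given Z in A (with continuous conditional margins
  it is the conditional distribution function of U^A given Z in A).\<close>
definition Ccop :: "'a measure \<Rightarrow> (nat \<Rightarrow> 'a \<Rightarrow> real^'p) \<Rightarrow> (nat \<Rightarrow> 'a \<Rightarrow> real^'q)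
    \<Rightarrow> (real^'q) set \<Rightarrow> real^'p \<Rightarrow> real" where
  "Ccop P X Z A u = Dpop P X Z A u / pA P Z A"

definition covB :: "'a measure \<Rightarrow> (nat \<Rightarrow> 'a \<Rightarrow> real^'p) \<Rightarrow> (nat \<Rightarrow> 'a \<Rightarrow> real^'q)
    \<Rightarrow> (real^'q) set \<Rightarrow> real^'p \<Rightarrow> real^'p \<Rightarrow> real" where
  "covB P X Z A u v = pA P Z A * Ccop P X Z A (vmin u v)
                      - (pA P Z A)^2 * Ccop P X Z A u * Ccop P X Z A v"

definition Dn :: "'a measure \<Rightarrow> (nat \<Rightarrow> 'a \<Rightarrow> real^'p) \<Rightarrow> (nat \<Rightarrow> 'a \<Rightarrow> real^'q)
    \<Rightarrow> (real^'q) set \<Rightarrow> nat \<Rightarrow> real^'p \<Rightarrow> 'a \<Rightarrow> real" where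
  "Dn P X Z A n u \<omega> = (\<Sum>i<n. if (\<forall>k. Fcond P X Z A k (X i \<omega> $ k) \<le> u $ k) \<and> Z i \<omega> \<in> A
                              then 1 else 0) / real n"

definition DDn :: "'a measure \<Rightarrow> (nat \<Rightarrow> 'a \<Rightarrow> real^'p) \<Rightarrow> (nat \<Rightarrow> 'a \<Rightarrow> real^'q)
    \<Rightarrow> (real^'q) set \<Rightarrow> nat \<Rightarrow> real^'p \<Rightarrow> 'a \<Rightarrow> real" where
  "DDn P X Z A n u \<omega> = sqrt (real n) * (Dn P X Z A n u \<omega> - Dpop P X Z A u)"

definition phat :: "(nat \<Rightarrow> 'a \<Rightarrow> real^'q) \<Rightarrow> (real^'q) set \<Rightarrow> nat \<Rightarrow> 'a \<Rightarrow> real" where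
  "phat Z A n \<omega> = (\<Sum>i<n. if Z i \<omega> \<in> A then 1 else 0) / real n"

definition Femp :: "(nat \<Rightarrow> 'a \<Rightarrow> real^'p) \<Rightarrow> (nat \<Rightarrow> 'a \<Rightarrow> real^'q) \<Rightarrow> (real^'q) set
    \<Rightarrow> nat \<Rightarrow> 'p \<Rightarrow> 'a \<Rightarrow> real \<Rightarrow> real" where
  "Femp X Z A n k \<omega> t = (\<Sum>i<n. if X i \<omega> $ k \<le> t \<and> Z i \<omega> \<in> A then 1 else 0)
                         / (real n * phat Z A n \<omega>)"

text \<open>Generalized inverse F^{-1}(u) = inf {t. F t >= u}, in the extended reals
  (so that inf of an unbounded-below set is -infinity, inf of the empty set is +infinity).\<close>
definition geninv :: "(real \<Rightarrow> real) \<Rightarrow> real \<Rightarrow> ereal" where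
  "geninv F u = Inf {ereal t | t. u \<le> F t}"

definition sel :: "(nat \<Rightarrow> 'a \<Rightarrow> real^'p) \<Rightarrow> (nat \<Rightarrow> 'a \<Rightarrow> real^'q) \<Rightarrow> (real^'q) set
    \<Rightarrow> nat \<Rightarrow> real^'p \<Rightarrow> 'a \<Rightarrow> nat \<Rightarrow> bool" where
  "sel X Z A n u \<omega> i \<longleftrightarrow>
     (\<forall>k. ereal (X i \<omega> $ k) \<le> geninv (Femp X Z A n k \<omega>) (u $ k)) \<and> Z i \<omega> \<in> A"

definition Dbar :: "(nat \<Rightarrow> 'a \<Rightarrow> real^'p) \<Rightarrow> (nat \<Rightarrow> 'a \<Rightarrow> real^'q) \<Rightarrow> (real^'q) set
    \<Rightarrow> nat \<Rightarrow> real^'p \<Rightarrow> 'a \<Rightarrow> real" where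
  "Dbar X Z A n u \<omega> = (\<Sum>i<n. if sel X Z A n u \<omega> i then 1 else 0) / real n"

text \<open>Weights: W n i \<omega> is W_{n,i+1} (i < n).\<close>
definition Wbar :: "(nat \<Rightarrow> nat \<Rightarrow> 'a \<Rightarrow> real) \<Rightarrow> nat \<Rightarrow> 'a \<Rightarrow> real" where
  "Wbar W n \<omega> = (\<Sum>i<n. W n i \<omega>) / real n"

definition DDstar :: "(nat \<Rightarrow> 'a \<Rightarrow> real^'p) \<Rightarrow> (nat \<Rightarrow> 'a \<Rightarrow> real^'q) \<Rightarrow> (real^'q) set
    \<Rightarrow> (nat \<Rightarrow> nat \<Rightarrow> 'a \<Rightarrow> real) \<Rightarrow> nat \<Rightarrow> real^'p \<Rightarrow> 'a \<Rightarrow> real" where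
  "DDstar X Z A W n u \<omega> =
     (\<Sum>i<n. W n i \<omega> * (if sel X Z A n u \<omega> i then 1 else 0)) / sqrt (real n)
     - sqrt (real n) * Wbar W n \<omega> * Dbar X Z A n u \<omega>"

definition cond_W :: "'a measure \<Rightarrow> (nat \<Rightarrow> nat \<Rightarrow> 'a \<Rightarrow> real) \<Rightarrow> bool" where
  "cond_W P W \<longleftrightarrow>
     (\<exists>C::real. \<forall>n\<ge>1.
        (\<integral>\<^sup>+ t. indicator {0..} t *
            ennreal (sqrt (measure P {\<omega>\<in>space P. \<bar>W n 0 \<omega> - Wbar W n \<omega>\<bar> > t})) \<partial>lborel)
        \<le> ennreal C) \<and>
     ((\<lambda>n. \<integral>\<^sup>+ \<omega>. ennreal (Max ((\<lambda>i. \<bar>W n i \<omega> - Wbar W n \<omega>\<bar>) ` {..<n}) / sqrt (real n)) \<partial>P)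
        \<longlonglongrightarrow> 0) \<and>
     (\<forall>e>0. (\<lambda>n. measure P {\<omega>\<in>space P.
        \<bar>(\<Sum>i<n. (W n i \<omega> - Wbar W n \<omega>)^2) / real n - 1\<bar> > e}) \<longlonglongrightarrow> 0)"

text \<open>Index set: pairs (us, j) with us = (u_0,...,u_M) in ([0,1]^p)^{M+1} and j the
  component 0..M of the R^{M+1}-valued process (sup-norm on R^{M+1}).\<close>
definition Tidx :: "nat \<Rightarrow> ((nat \<Rightarrow> real^'p) \<times> nat) set" where
  "Tidx M = {(us, j). us \<in> PiE {..M} (\<lambda>_. cube) \<and> j \<le> M}"

definition Dproc :: "'a measure \<Rightarrow> (nat \<Rightarrow> 'a \<Rightarrow> real^'p) \<Rightarrow> (nat \<Rightarrow> 'a \<Rightarrow> real^'q)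
    \<Rightarrow> (real^'q) set \<Rightarrow> (nat \<Rightarrow> nat \<Rightarrow> nat \<Rightarrow> 'a \<Rightarrow> real) \<Rightarrow> nat \<Rightarrow> nat
    \<Rightarrow> 'a \<Rightarrow> (nat \<Rightarrow> real^'p) \<times> nat \<Rightarrow> real" where
  "Dproc P X Z A W M n \<omega> = (\<lambda>(us, j).
     if (us, j) \<in> Tidx M then
       (if j = 0 then DDn P X Z A n (us 0) \<omega> else DDstar X Z A (W j) n (us j) \<omega>)
     else 0)"

definition Gproc :: "nat \<Rightarrow> (nat \<Rightarrow> real^'p \<Rightarrow> 'w \<Rightarrow> real)
    \<Rightarrow> 'w \<Rightarrow> (nat \<Rightarrow> real^'p) \<times> nat \<Rightarrow> real" where
  "Gproc M B \<omega> = (\<lambda>(us, j). if (us, j) \<in> Tidx M then B j (us j) \<omega> else 0)"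

end

theory Submission
  imports Defs "HOL-Library.Discrete_Functions"
begin

text \<open>
  Bounded continuous test functions are monotone limits of Lipschitz ones, so finite-dimensional
  convergence and asymptotic equicontinuity suffice.

  Conditionally on the weights, the finite-dimensional vectors are sums of independent bounded
  terms whose characteristic functions are computed by a second-order expansion. Two independent
  centered exchangeable weight vectors are asymptotically orthogonal, and each is orthogonal to
  the constants; this is why the components of the limit are independent.

  The empirical process over a set \<open>I\<close> of indices is controlled by dyadic chaining with exponential
  moments, at a cost of order \<open>sqrt (card I)\<close>. Writing the positive and negative parts of the
  centered weights as integrals of indicators of level sets reduces the weighted process to
  unweighted ones over random index sets independent of the sample; the integral condition on
  \<open>sqrt\<close> of the tail is exactly what makes these bounds integrable. Equicontinuity then allows the
  empirical quantiles to be replaced by the true ones.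

  The Gaussian limit is obtained on the dyadic points from a Gram--Schmidt factorization of the
  covariance, and extended to continuous paths by the same chaining bound.
\<close>

section \<open>Outer expectations and the space of bounded functions\<close>

text \<open>Measurability of the bootstrap processes as random functions is never established. Every
  estimate on them is made pointwise off a measurable bad event, and they enter the outer
  expectation only through \<open>outer_exp_approx\<close>.

  \<open>DDn\<close> is treated as one more weighted process, with constant weights. After division
  by \<open>sqrt n\<close> the rows of weights have small entries and a Gram matrix close to the
  identity; these two facts alone determine the limit of the characteristic functions. Entries
  against the constant row vanish exactly, because centred weights sum to 0. For two bootstrap rows,
  exchangeability and centring force the matrix of truncated mean products to be constant
  \<open>s\<close> on the diagonal and \<open>-s / (n - 1)\<close> off it, so that its squared
  entries sum to O(n); Chebyshev's inequality then gives orthogonality.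

  Empirical quantiles enter through a deterministic fact: at almost every sample point where the
  empirical margins are uniformly close to the true ones, the selection at \<open>u\<close> is
  exactly an orthant selection at some point near \<open>u\<close>.\<close>

lemma outer_exp_approx:
  assumes Y: "integrable P Y" and R: "integrable P R"
    and le: "\<And>\<omega>. \<omega> \<in> space P \<Longrightarrow> \<bar>T \<omega> - Y \<omega>\<bar> \<le> R \<omega>"
  shows "\<bar>outer_exp P T - (\<integral>\<omega>. Y \<omega> \<partial>P)\<bar> \<le> (\<integral>\<omega>. R \<omega> \<partial>P)"
proof -
  let ?S = "{(\<integral>\<omega>. U \<omega> \<partial>P) | U. integrable P U \<and> (\<forall>\<omega>\<in>space P. T \<omega> \<le> U \<omega>)}"
  have mem: "(\<integral>\<omega>. Y \<omega> + R \<omega> \<partial>P) \<in> ?S"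
  proof -
    have "T \<omega> \<le> Y \<omega> + R \<omega>" if "\<omega> \<in> space P" for \<omega> using le[OF that] by linarith
    moreover have "integrable P (\<lambda>\<omega>. Y \<omega> + R \<omega>)" using Y R by simp
    ultimately show ?thesis by blast
  qed
  have low: "(\<integral>\<omega>. Y \<omega> \<partial>P) - (\<integral>\<omega>. R \<omega> \<partial>P) \<le> s" if s: "s \<in> ?S" for s
  proof -
    obtain U where U: "s = (\<integral>\<omega>. U \<omega> \<partial>P)" "integrable P U" "\<And>\<omega>. \<omega> \<in> space P \<Longrightarrow> T \<omega> \<le> U \<omega>"
      using s by blast
    have "(\<integral>\<omega>. Y \<omega> - R \<omega> \<partial>P) \<le> (\<integral>\<omega>. U \<omega> \<partial>P)"
      using Y R U le by (intro integral_mono) (fastforce simp: abs_le_iff)+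
    then show ?thesis using U Y R by simp
  qed
  have "Inf ?S \<le> (\<integral>\<omega>. Y \<omega> + R \<omega> \<partial>P)"
    by (rule cInf_lower[OF mem]) (rule bdd_belowI, rule low)
  moreover have "(\<integral>\<omega>. Y \<omega> \<partial>P) - (\<integral>\<omega>. R \<omega> \<partial>P) \<le> Inf ?S"
    by (rule cInf_greatest) (use mem low in blast)+
  ultimately show ?thesis
    using Y R unfolding outer_exp_def by (simp add: abs_le_iff)
qed

text \<open>Both bounds keep the real-valued infima meaningful: the constant \<open>c\<close> is an
  integrable majorant of \<open>T'\<close>, and \<open>- c\<close> bounds the integral of every
  majorant of \<open>T\<close> from below.\<close>

lemma outer_exp_mono:
  assumes "prob_space P"
    and le: "\<And>\<omega>. \<omega> \<in> space P \<Longrightarrow> T \<omega> \<le> T' \<omega>"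
    and b: "\<And>\<omega>. \<omega> \<in> space P \<Longrightarrow> - c \<le> T \<omega>" and b': "\<And>\<omega>. \<omega> \<in> space P \<Longrightarrow> T' \<omega> \<le> c"
  shows "outer_exp P T \<le> outer_exp P T'"
proof -
  interpret prob_space P by fact
  show ?thesis unfolding outer_exp_def
  proof (rule cInf_superset_mono)
    show "{(\<integral>\<omega>. U \<omega> \<partial>P) | U. integrable P U \<and> (\<forall>\<omega>\<in>space P. T' \<omega> \<le> U \<omega>)} \<noteq> {}"
      using b' by (auto intro!: exI[of _ "\<lambda>_. c"])
    show "bdd_below {(\<integral>\<omega>. U \<omega> \<partial>P) | U. integrable P U \<and> (\<forall>\<omega>\<in>space P. T \<omega> \<le> U \<omega>)}"
    proof (rule bdd_belowI)
      fix s assume "s \<in> {(\<integral>\<omega>. U \<omega> \<partial>P) | U. integrable P U \<and> (\<forall>\<omega>\<in>space P. T \<omega> \<le> U \<omega>)}"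
      then obtain U where U: "s = (\<integral>\<omega>. U \<omega> \<partial>P)" "integrable P U" "\<And>\<omega>. \<omega> \<in> space P \<Longrightarrow> T \<omega> \<le> U \<omega>"
        by auto
      have "(\<integral>\<omega>. - c \<partial>P) \<le> s"
        unfolding U(1) using U(2,3) b by (intro integral_mono) (auto intro: order_trans)
      then show "- c \<le> s" by (simp add: prob_space)
    qed
  qed (use le in \<open>auto intro: order_trans\<close>)
qed

lemma sup_dist_bdd:
  assumes "f \<in> linf I" "g \<in> linf I"
  shows "bdd_above ((\<lambda>i. \<bar>f i - g i\<bar>) ` I)"
proof -
  obtain a b where a: "\<And>i. i \<in> I \<Longrightarrow> \<bar>f i\<bar> \<le> a" and b: "\<And>i. i \<in> I \<Longrightarrow> \<bar>g i\<bar> \<le> b"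
    using assms unfolding linf_def bounded_iff by (auto simp: image_iff) blast
  show ?thesis by (rule bdd_aboveI[of _ "a + b"]) (use a b in \<open>fastforce simp: abs_le_iff\<close>)
qed

lemma sup_dist_ge: "f \<in> linf I \<Longrightarrow> g \<in> linf I \<Longrightarrow> i \<in> I \<Longrightarrow> \<bar>f i - g i\<bar> \<le> sup_dist I f g"
  unfolding sup_dist_def by (intro cSUP_upper sup_dist_bdd)

lemma sup_dist_le: "I \<noteq> {} \<Longrightarrow> (\<And>i. i \<in> I \<Longrightarrow> \<bar>f i - g i\<bar> \<le> B) \<Longrightarrow> sup_dist I f g \<le> B"
  unfolding sup_dist_def by (intro cSUP_least)

lemma sup_dist_nonneg: "I \<noteq> {} \<Longrightarrow> f \<in> linf I \<Longrightarrow> g \<in> linf I \<Longrightarrow> 0 \<le> sup_dist I f g"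
  using sup_dist_ge[of f I g] by (meson abs_ge_zero equals0I order_trans)

lemma sup_dist_refl: "I \<noteq> {} \<Longrightarrow> sup_dist I f f = 0"
  unfolding sup_dist_def by simp

lemma sup_dist_commute: "sup_dist I f g = sup_dist I g f"
  unfolding sup_dist_def by (simp add: abs_minus_commute)

lemma sup_dist_triangle:
  assumes "I \<noteq> {}" "f \<in> linf I" "g \<in> linf I" "k \<in> linf I"
  shows "sup_dist I f k \<le> sup_dist I f g + sup_dist I g k"
proof (rule sup_dist_le)
  fix i assume "i \<in> I"
  then show "\<bar>f i - k i\<bar> \<le> sup_dist I f g + sup_dist I g k"
    using sup_dist_ge[of f I g i] sup_dist_ge[of g I k i] assms by linarith
qed fact

text \<open>The Pasch--Hausdorff envelope: the largest minorant of \<open>h\<close> with Lipschitz constant \<open>k\<close>.\<close>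
definition lip_env :: "'i set \<Rightarrow> (('i \<Rightarrow> real) \<Rightarrow> real) \<Rightarrow> nat \<Rightarrow> ('i \<Rightarrow> real) \<Rightarrow> real" where
  "lip_env I h k f = (INF g\<in>linf I. h g + real k * sup_dist I f g)"

lemma linf_nonempty: "linf I \<noteq> {}"
proof -
  have "(\<lambda>_. 0) \<in> linf I" by (auto simp: linf_def bounded_iff)
  then show ?thesis by auto
qed

context
  fixes I :: "'i set" and h :: "('i \<Rightarrow> real) \<Rightarrow> real" and c :: real
  assumes I: "I \<noteq> {}" and dyadic_gauss: "\<And>f. f \<in> linf I \<Longrightarrow> \<bar>h f\<bar> \<le> c"
begin

text \<open>In this context, and in several later lemmas on test functions,
  \<open>dyadic_gauss\<close> is only the label of a uniform bound; it is unrelated to the Gaussian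
  variables defined later under that name.\<close>

lemma lip_env_term_ge: "f \<in> linf I \<Longrightarrow> g \<in> linf I \<Longrightarrow> - c \<le> h g + real k * sup_dist I f g"
  using dyadic_gauss[of g] sup_dist_nonneg[OF I, of f g] by (simp add: abs_le_iff add_increasing2)

lemma lip_env_lower:
  "f \<in> linf I \<Longrightarrow> g \<in> linf I \<Longrightarrow> lip_env I h k f \<le> h g + real k * sup_dist I f g"
  unfolding lip_env_def by (rule cINF_lower) (auto intro!: bdd_belowI[of _ "-c"] lip_env_term_ge)

lemma lip_env_greatest:
  "(\<And>g. g \<in> linf I \<Longrightarrow> b \<le> h g + real k * sup_dist I f g) \<Longrightarrow> b \<le> lip_env I h k f"
  unfolding lip_env_def by (rule cINF_greatest) (use linf_nonempty in auto)

lemma lip_env_le: "f \<in> linf I \<Longrightarrow> lip_env I h k f \<le> h f"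
  using lip_env_lower[of f f k] by (simp add: sup_dist_refl I)

lemma lip_env_bound: "f \<in> linf I \<Longrightarrow> \<bar>lip_env I h k f\<bar> \<le> c"
  using lip_env_le[of f k] dyadic_gauss[of f] lip_env_greatest[of "-c" k f] lip_env_term_ge[of f]
  by (auto simp: abs_le_iff)

lemma lip_env_lipschitz:
  assumes "f \<in> linf I" "g \<in> linf I"
  shows "\<bar>lip_env I h k f - lip_env I h k g\<bar> \<le> real k * sup_dist I f g"
proof -
  have *: "lip_env I h k f - real k * sup_dist I f g \<le> lip_env I h k g"
    if fg: "f \<in> linf I" "g \<in> linf I" for f g
  proof (rule lip_env_greatest)
    fix u assume u: "u \<in> linf I"
    have "real k * sup_dist I f u \<le> real k * (sup_dist I f g + sup_dist I g u)"
      by (intro mult_left_mono sup_dist_triangle I fg u) auto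
    then show "lip_env I h k f - real k * sup_dist I f g \<le> h u + real k * sup_dist I g u"
      using lip_env_lower[OF fg(1) u, of k] by (simp add: algebra_simps)
  qed
  from *[OF assms] *[OF assms(2,1)] show ?thesis by (simp add: sup_dist_commute abs_le_iff)
qed

text \<open>Continuity controls the competitors close to \<open>f\<close>; a competitor at distance
  at least \<open>d\<close> pays a penalty \<open>k * d\<close>, which covers the whole oscillation
  \<open>2 * c\<close> of \<open>h\<close> as soon as \<open>k\<close> is at least
  \<open>2 * c / d\<close>.\<close>

lemma lip_env_tendsto:
  assumes f: "f \<in> linf I"
    and cont: "\<And>e. e > 0 \<Longrightarrow> \<exists>d>0. \<forall>g\<in>linf I. sup_dist I f g < d \<longrightarrow> \<bar>h g - h f\<bar> < e"
  shows "(\<lambda>k. lip_env I h k f) \<longlonglongrightarrow> h f"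
proof (rule LIMSEQ_I)
  fix e :: real assume e: "e > 0"
  then obtain d where d: "d > 0" "\<And>g. g \<in> linf I \<Longrightarrow> sup_dist I f g < d \<Longrightarrow> \<bar>h g - h f\<bar> < e / 2"
    using cont[of "e/2"] by auto
  obtain k0 :: nat where k0: "2 * c / d \<le> real k0" using real_arch_simple by blast
  have "norm (lip_env I h k f - h f) < e" if k: "k \<ge> k0" for k
  proof -
    have "h f - e / 2 \<le> lip_env I h k f"
    proof (rule lip_env_greatest)
      fix g assume g: "g \<in> linf I"
      have nn: "0 \<le> real k * sup_dist I f g" using sup_dist_nonneg[OF I f g] by simp
      show "h f - e / 2 \<le> h g + real k * sup_dist I f g"
      proof (cases "sup_dist I f g < d")
        case True
        then show ?thesis using d(2)[OF g True] nn by linarith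
      next
        case False
        have "2 * c \<le> real k0 * d" using k0 d(1) by (simp add: field_simps)
        also have "\<dots> \<le> real k * sup_dist I f g" using False k d(1) by (intro mult_mono) auto
        finally show ?thesis using dyadic_gauss[OF f] dyadic_gauss[OF g] e by linarith
      qed
    qed
    then show ?thesis using lip_env_le[OF f, of k] e by simp
  qed
  then show "\<exists>k0. \<forall>k\<ge>k0. norm (lip_env I h k f - h f) < e" by blast
qed

end

definition lip_bdd :: "'i set \<Rightarrow> real \<Rightarrow> real \<Rightarrow> (('i \<Rightarrow> real) \<Rightarrow> real) \<Rightarrow> bool" where
  "lip_bdd I k c h \<longleftrightarrow> 0 \<le> k \<and> (\<forall>f\<in>linf I. \<bar>h f\<bar> \<le> c) \<and>
     (\<forall>f\<in>linf I. \<forall>g\<in>linf I. \<bar>h f - h g\<bar> \<le> k * sup_dist I f g)"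

text \<open>The outer expectation is monotone but not additive, so \<open>h\<close> is sandwiched
  between its lower envelope and the negated envelope of \<open>- h\<close>. Pointwise convergence
  of the envelopes suffices, because the limit in \<open>k\<close> is taken only under
  \<open>N\<close>, where everything is measurable and dominated convergence applies.\<close>

lemma outer_exp_tendsto_of_lipschitz:
  fixes Y :: "nat \<Rightarrow> 'a \<Rightarrow> 'i \<Rightarrow> real" and G :: "'w \<Rightarrow> 'i \<Rightarrow> real"
  assumes P: "prob_space P" and N: "prob_space N" and I: "I \<noteq> {}"
    and Y: "\<And>n \<omega>. \<omega> \<in> space P \<Longrightarrow> Y n \<omega> \<in> linf I"
    and G: "\<And>\<omega>. \<omega> \<in> space N \<Longrightarrow> G \<omega> \<in> linf I"
    and meas: "\<And>h k c. lip_bdd I k c h \<Longrightarrow> (\<lambda>\<omega>. h (G \<omega>)) \<in> borel_measurable N"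
    and conv: "\<And>h k c. lip_bdd I k c h \<Longrightarrow>
      (\<lambda>n. outer_exp P (\<lambda>\<omega>. h (Y n \<omega>))) \<longlonglongrightarrow> (\<integral>\<omega>. h (G \<omega>) \<partial>N)"
    and h: "linf_bcont I h"
  shows "(\<lambda>n. outer_exp P (\<lambda>\<omega>. h (Y n \<omega>))) \<longlonglongrightarrow> (\<integral>\<omega>. h (G \<omega>) \<partial>N)"
proof -
  interpret N: prob_space N by fact
  obtain c where c: "\<And>f. f \<in> linf I \<Longrightarrow> \<bar>h f\<bar> \<le> c" using h unfolding linf_bcont_def by blast
  have cont: "\<exists>d>0. \<forall>g\<in>linf I. sup_dist I f g < d \<longrightarrow> \<bar>h g - h f\<bar> < e" if "f \<in> linf I" "e > 0" for f e
    using h that unfolding linf_bcont_def by blast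
  define hl where "hl k = lip_env I h k" for k
  define hu where "hu k = (\<lambda>f. - lip_env I (\<lambda>g. - h g) k f)" for k
  have c': "\<bar>- h f\<bar> \<le> c" if "f \<in> linf I" for f using c[OF that] by simp
  have lip_l: "lip_bdd I (real k) c (hl k)" for k
    unfolding lip_bdd_def hl_def using lip_env_bound[of I h c] lip_env_lipschitz[of I h c] I c by auto
  have lip_u: "lip_bdd I (real k) c (hu k)" for k
    unfolding lip_bdd_def hu_def using lip_env_bound[of I "\<lambda>g. - h g" c]
      lip_env_lipschitz[of I "\<lambda>g. - h g" c] I c by (auto simp: abs_minus_commute)
  have tl: "(\<lambda>k. hl k f) \<longlonglongrightarrow> h f" if "f \<in> linf I" for f
    unfolding hl_def by (rule lip_env_tendsto[OF I c that]) (use cont that in auto)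
  have tu: "(\<lambda>k. hu k f) \<longlonglongrightarrow> h f" if "f \<in> linf I" for f
  proof -
    have "(\<lambda>k. lip_env I (\<lambda>g. - h g) k f) \<longlonglongrightarrow> - h f"
      by (rule lip_env_tendsto[OF I c' that]) (use cont[OF that] in \<open>auto simp: abs_minus_commute\<close>)
    from tendsto_minus[OF this] show ?thesis unfolding hu_def by simp
  qed
  have hl_le: "hl k f \<le> h f" if "f \<in> linf I" for k f
    unfolding hl_def using lip_env_le[of I h c f k] I c that by blast
  have hu_ge: "h f \<le> hu k f" if "f \<in> linf I" for k f
    unfolding hu_def using lip_env_le[of I "\<lambda>g. - h g" c f k] I c' that by fastforce
  have bl: "\<bar>hl k f\<bar> \<le> c" and bu: "\<bar>hu k f\<bar> \<le> c" if "f \<in> linf I" for k f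
    using lip_l[of k] lip_u[of k] that unfolding lip_bdd_def by auto
  have hm: "(\<lambda>\<omega>. h (G \<omega>)) \<in> borel_measurable N"
    by (rule borel_measurable_LIMSEQ_real[where u="\<lambda>k \<omega>. hl k (G \<omega>)"]) (use tl G meas lip_l in auto)
  have Il: "(\<lambda>k. \<integral>\<omega>. hl k (G \<omega>) \<partial>N) \<longlonglongrightarrow> (\<integral>\<omega>. h (G \<omega>) \<partial>N)"
    by (rule integral_dominated_convergence[where w="\<lambda>_. c"])
       (use hm meas lip_l tl bl G in auto)
  have Iu: "(\<lambda>k. \<integral>\<omega>. hu k (G \<omega>) \<partial>N) \<longlonglongrightarrow> (\<integral>\<omega>. h (G \<omega>) \<partial>N)"
    by (rule integral_dominated_convergence[where w="\<lambda>_. c"])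
       (use hm meas lip_u tu bu G in auto)
  show ?thesis
  proof (rule tendstoI)
    fix e :: real assume e: "e > 0"
    obtain k where k: "dist (\<integral>\<omega>. hl k (G \<omega>) \<partial>N) (\<integral>\<omega>. h (G \<omega>) \<partial>N) < e/2"
      "dist (\<integral>\<omega>. hu k (G \<omega>) \<partial>N) (\<integral>\<omega>. h (G \<omega>) \<partial>N) < e/2"
      using eventually_happens[OF eventually_conj[OF tendstoD[OF Il, of "e/2"] tendstoD[OF Iu, of "e/2"]]] e
      by auto
    have "\<forall>\<^sub>F n in sequentially. dist (outer_exp P (\<lambda>\<omega>. hl k (Y n \<omega>))) (\<integral>\<omega>. hl k (G \<omega>) \<partial>N) < e/2"
      by (rule tendstoD[OF conv[OF lip_l[of k]]]) (use e in simp)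
    moreover have "\<forall>\<^sub>F n in sequentially. dist (outer_exp P (\<lambda>\<omega>. hu k (Y n \<omega>))) (\<integral>\<omega>. hu k (G \<omega>) \<partial>N) < e/2"
      by (rule tendstoD[OF conv[OF lip_u[of k]]]) (use e in simp)
    ultimately show "\<forall>\<^sub>F n in sequentially. dist (outer_exp P (\<lambda>\<omega>. h (Y n \<omega>))) (\<integral>\<omega>. h (G \<omega>) \<partial>N) < e"
    proof eventually_elim
      case (elim n)
      have "outer_exp P (\<lambda>\<omega>. hl k (Y n \<omega>)) \<le> outer_exp P (\<lambda>\<omega>. h (Y n \<omega>))"
        by (rule outer_exp_mono[OF P, where c=c]) (use hl_le[OF Y] abs_le_D2[OF bl[OF Y]] abs_le_D1[OF c[OF Y]] in \<open>auto simp: minus_le_iff\<close>)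
      moreover have "outer_exp P (\<lambda>\<omega>. h (Y n \<omega>)) \<le> outer_exp P (\<lambda>\<omega>. hu k (Y n \<omega>))"
        by (rule outer_exp_mono[OF P, where c=c]) (use hu_ge[OF Y] abs_le_D1[OF bu[OF Y]] abs_le_D2[OF c[OF Y]] in \<open>auto simp: minus_le_iff\<close>)
      ultimately show ?case using elim k unfolding dist_real_def by linarith
    qed
  qed
qed

section \<open>Weak convergence in finite dimensions from characteristic functions\<close>

text \<open>Addition is the only closure rule, so that statements linear in the function, such as
  convergence of integrals, follow by induction from characteristic functions. Closure under
  products, which Stone-Weierstrass asks for, is derived afterwards.\<close>

inductive trig_poly :: "nat \<Rightarrow> ((nat \<Rightarrow> real) \<Rightarrow> real) \<Rightarrow> bool" for d where
  trig_base: "trig_poly d (\<lambda>x. Re (\<alpha> * cis (\<Sum>i<d. c i * x i)))"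
| trig_add: "trig_poly d f \<Longrightarrow> trig_poly d g \<Longrightarrow> trig_poly d (\<lambda>x. f x + g x)"

lemma trig_poly_const: "trig_poly d (\<lambda>_. r)"
  using trig_base[of d "complex_of_real r" "\<lambda>_. 0"] by simp

text \<open>The identity \<open>Re a * Re b = Re (a * b) / 2 + Re (a * cnj b) / 2\<close> turns a
  product of two waves into waves at the sum and the difference of their frequencies.\<close>

lemma trig_poly_mult:
  assumes "trig_poly d f" "trig_poly d g"
  shows "trig_poly d (\<lambda>x. f x * g x)"
  using assms
proof (induction arbitrary: g)
  case (trig_base \<alpha> c)
  from trig_base.prems show ?case
  proof induction
    case (trig_base \<beta> b)
    have eq: "Re (\<alpha> * cis s) * Re (\<beta> * cis t) = Re (\<alpha> * \<beta> / 2 * cis (s + t)) + Re (\<alpha> * cnj \<beta> / 2 * cis (s - t))" for s t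
      by (simp add: cos_add sin_add cos_diff sin_diff) (simp add: field_simps)
    have "(\<lambda>x. Re (\<alpha> * cis (\<Sum>i<d. c i * x i)) * Re (\<beta> * cis (\<Sum>i<d. b i * x i))) =
      (\<lambda>x. Re (\<alpha> * \<beta> / 2 * cis (\<Sum>i<d. (c i + b i) * x i)) + Re (\<alpha> * cnj \<beta> / 2 * cis (\<Sum>i<d. (c i - b i) * x i)))"
      unfolding eq by (simp add: algebra_simps sum.distrib sum_subtractf)
    then show ?case
      using trig_poly.trig_add[OF trig_poly.trig_base trig_poly.trig_base] by presburger
  next
    case (trig_add f g)
    then show ?case using trig_poly.trig_add[OF trig_add.IH] by (simp add: distrib_left)
  qed
next
  case (trig_add f g)
  then show ?case
    using trig_poly.trig_add[OF trig_add.IH(1)[OF trig_add.prems] trig_add.IH(2)[OF trig_add.prems]]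
    by (simp add: distrib_right)
qed

lemma trig_poly_compose_polynomial:
  assumes "real_polynomial_function q" "trig_poly d f"
  shows "trig_poly d (\<lambda>x. q (f x))"
  using assms
proof induction
  case (linear q)
  have "q t = q 1 * t" for t
    using linear_simps(5)[OF linear(1), of t 1] by (simp add: mult.commute)
  then have "(\<lambda>x. q (f x)) = (\<lambda>x. q 1 * f x)" by (rule ext)
  then show ?case using trig_poly_mult[OF trig_poly_const linear(2)] by presburger
qed (auto intro: trig_poly_const trig_add trig_poly_mult)

lemma trig_poly_continuous: "trig_poly d f \<Longrightarrow> continuous_on UNIV f"
proof (induction rule: trig_poly.induct)
  case (trig_base \<alpha> c)
  show ?case unfolding cis_conv_exp
    by (intro continuous_intros continuous_on_sum continuous_on_mult continuous_on_product_coordinates)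
qed (intro continuous_intros)

lemma trig_poly_bounded: "trig_poly d f \<Longrightarrow> \<exists>b. \<forall>x. \<bar>f x\<bar> \<le> b"
proof (induction rule: trig_poly.induct)
  case (trig_base \<alpha> c)
  have "\<bar>Re (\<alpha> * cis s)\<bar> \<le> cmod \<alpha>" for s
    using abs_Re_le_cmod[of "\<alpha> * cis s"] by (simp add: norm_mult)
  then show ?case by blast
next
  case (trig_add f g)
  then obtain a b where "\<And>x. \<bar>f x\<bar> \<le> a" "\<And>x. \<bar>g x\<bar> \<le> b" by blast
  then have "\<bar>f x + g x\<bar> \<le> a + b" for x using abs_triangle_ineq[of "f x" "g x"] add_mono order_trans by blast
  then show ?case by blast
qed

lemma cis_borel_measurable[measurable]: "cis \<in> borel_measurable borel"
  unfolding cis_conv_exp by (intro borel_measurable_continuous_onI continuous_intros)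

lemma trig_poly_measurable:
  assumes "trig_poly d f" "\<And>i. i < d \<Longrightarrow> (\<lambda>\<omega>. S \<omega> i) \<in> borel_measurable P"
  shows "(\<lambda>\<omega>. f (S \<omega>)) \<in> borel_measurable P"
  using assms
proof (induction rule: trig_poly.induct)
  case (trig_base \<alpha> c)
  then have [measurable]: "(\<lambda>\<omega>. \<Sum>i<d. c i * S \<omega> i) \<in> borel_measurable P" by auto
  show ?case by measurable
qed auto

lemma trig_poly_integral_tendsto:
  fixes S :: "nat \<Rightarrow> 'a \<Rightarrow> nat \<Rightarrow> real" and G :: "'w \<Rightarrow> nat \<Rightarrow> real"
  assumes P: "prob_space P" and N: "prob_space N"
    and S: "\<And>n i. i < d \<Longrightarrow> (\<lambda>\<omega>. S n \<omega> i) \<in> borel_measurable P"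
    and G: "\<And>i. i < d \<Longrightarrow> (\<lambda>\<omega>. G \<omega> i) \<in> borel_measurable N"
    and cf: "\<And>c. (\<lambda>n. \<integral>\<omega>. cis (\<Sum>i<d. c i * S n \<omega> i) \<partial>P) \<longlonglongrightarrow> (\<integral>\<omega>. cis (\<Sum>i<d. c i * G \<omega> i) \<partial>N)"
    and f: "trig_poly d f"
  shows "(\<lambda>n. \<integral>\<omega>. f (S n \<omega>) \<partial>P) \<longlonglongrightarrow> (\<integral>\<omega>. f (G \<omega>) \<partial>N)"
proof -
  interpret P: prob_space P by fact
  interpret N: prob_space N by fact
  have int: "integrable P (\<lambda>\<omega>. f (S n \<omega>)) \<and> integrable N (\<lambda>\<omega>. f (G \<omega>))" if f: "trig_poly d f" for f n
  proof -
    obtain b where b: "\<And>x. \<bar>f x\<bar> \<le> b" using trig_poly_bounded[OF f] by blast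
    show ?thesis
      using trig_poly_measurable[OF f S] trig_poly_measurable[OF f G] b
      by (auto intro!: P.integrable_const_bound[where B=b] N.integrable_const_bound[where B=b])
  qed
  show ?thesis using f
  proof (induction rule: trig_poly.induct)
    case (trig_base \<alpha> c)
    have [measurable]: "(\<lambda>\<omega>. \<Sum>i<d. c i * S n \<omega> i) \<in> borel_measurable P"
      "(\<lambda>\<omega>. \<Sum>i<d. c i * G \<omega> i) \<in> borel_measurable N" for n
      using S G by auto
    have i1: "integrable P (\<lambda>\<omega>. \<alpha> * cis (\<Sum>i<d. c i * S n \<omega> i))" for n
      by (rule P.integrable_const_bound[where B="cmod \<alpha>"]) (auto simp: norm_mult)
    have i2: "integrable N (\<lambda>\<omega>. \<alpha> * cis (\<Sum>i<d. c i * G \<omega> i))"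
      by (rule N.integrable_const_bound[where B="cmod \<alpha>"]) (auto simp: norm_mult)
    have "(\<lambda>n. Re (\<alpha> * (\<integral>\<omega>. cis (\<Sum>i<d. c i * S n \<omega> i) \<partial>P)))
       \<longlonglongrightarrow> Re (\<alpha> * (\<integral>\<omega>. cis (\<Sum>i<d. c i * G \<omega> i) \<partial>N))"
      by (intro tendsto_intros cf)
    then show ?case
      using integral_Re[OF i1] integral_Re[OF i2] by simp
  next
    case (trig_add f g)
    then show ?case using int by (auto intro!: tendsto_intros)
  qed
qed

lemma lipschitz_coords_eq:
  fixes \<phi> :: "(nat \<Rightarrow> real) \<Rightarrow> real"
  assumes lip: "\<And>x y. \<bar>\<phi> x - \<phi> y\<bar> \<le> k * (\<Sum>i<d. \<bar>x i - y i\<bar>)"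
    and eq: "\<And>i. i < d \<Longrightarrow> x i = y i"
  shows "\<phi> x = \<phi> y"
  using lip[of x y] eq by simp

lemma lipschitz_coords_continuous:
  fixes \<phi> :: "(nat \<Rightarrow> real) \<Rightarrow> real"
  assumes lip: "\<And>x y. \<bar>\<phi> x - \<phi> y\<bar> \<le> k * (\<Sum>i<d. \<bar>x i - y i\<bar>)"
  shows "continuous_on UNIV \<phi>"
  unfolding continuous_on_def
proof
  fix x :: "nat \<Rightarrow> real"
  have c: "((\<lambda>y. y i) \<longlongrightarrow> x i) (at x)" for i
    using continuous_on_product_coordinates[of i] unfolding continuous_on_def by auto
  have "((\<lambda>y. k * (\<Sum>i<d. \<bar>y i - x i\<bar>)) \<longlongrightarrow> k * (\<Sum>i<d. \<bar>x i - x i\<bar>)) (at x)"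
    by (intro tendsto_intros c)
  then have "((\<lambda>y. \<phi> y - \<phi> x) \<longlongrightarrow> 0) (at x)"
    by (intro Lim_null_comparison[of "\<lambda>y. \<phi> y - \<phi> x" "\<lambda>y. k * (\<Sum>i<d. \<bar>y i - x i\<bar>)"]) (auto simp: lip)
  then show "(\<phi> \<longlongrightarrow> \<phi> x) (at x within UNIV)" using LIM_zero_cancel by blast
qed

lemma lipschitz_coords_measurable:
  fixes \<phi> :: "(nat \<Rightarrow> real) \<Rightarrow> real"
  assumes lip: "\<And>x y. \<bar>\<phi> x - \<phi> y\<bar> \<le> k * (\<Sum>i<d. \<bar>x i - y i\<bar>)"
    and G: "\<And>i. i < d \<Longrightarrow> (\<lambda>\<omega>. G \<omega> i) \<in> borel_measurable N"
  shows "(\<lambda>\<omega>. \<phi> (G \<omega>)) \<in> borel_measurable N"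
proof -
  \<comment> \<open>Only the first \<open>d\<close> coordinates of \<open>G\<close> are known to be
    measurable; the others are replaced by 0, a change to which \<phi> is blind.\<close>
  define H where "H = (\<lambda>\<omega> i. if i < d then G \<omega> i else 0)"
  have "H \<in> borel_measurable N"
  proof (rule measurable_coordinatewise_then_product)
    fix i show "(\<lambda>\<omega>. H \<omega> i) \<in> borel_measurable N"
      using G[of i] by (cases "i < d") (auto simp: H_def)
  qed
  moreover have "\<phi> \<in> borel_measurable borel"
    by (intro borel_measurable_continuous_onI lipschitz_coords_continuous[OF lip])
  ultimately have "(\<lambda>\<omega>. \<phi> (H \<omega>)) \<in> borel_measurable N" by measurable
  moreover have "\<phi> (H \<omega>) = \<phi> (G \<omega>)" for \<omega>
    by (rule lipschitz_coords_eq[OF lip]) (simp add: H_def)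
  ultimately show ?thesis by simp
qed

text \<open>Composing with a polynomial approximation of the clipping function keeps the approximant
  bounded outside the compact box on which it is close to \<open>\<phi>\<close>.\<close>
lemma trig_poly_approx:
  fixes \<phi> :: "(nat \<Rightarrow> real) \<Rightarrow> real"
  assumes lip: "\<And>x y. \<bar>\<phi> x - \<phi> y\<bar> \<le> k * (\<Sum>i<d. \<bar>x i - y i\<bar>)"
    and dyadic_gauss: "\<And>x. \<bar>\<phi> x\<bar> \<le> c" and e: "0 < e" and R: "0 < R"
  shows "\<exists>T. trig_poly d T \<and> (\<forall>x. \<bar>T x\<bar> \<le> c + e) \<and>
    (\<forall>x. (\<forall>i<d. \<bar>x i\<bar> \<le> R) \<longrightarrow> \<bar>\<phi> x - T x\<bar> \<le> e)"
proof -
  \<comment> \<open>Coordinates from \<open>d\<close> on are pinned to 0. This makes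
    \<open>K\<close> compact in the product topology of the full function space, and lets functions
    of the first \<open>d\<close> coordinates separate its points.\<close>
  define J :: "nat \<Rightarrow> real set" where "J i = (if i < d then {-R..R} else {0})" for i
  define K where "K = Pi\<^sub>E UNIV J"
  have "compactin (product_topology (\<lambda>i. euclidean) UNIV) K"
    unfolding K_def compactin_PiE by (auto simp: J_def)
  then have cK: "compact K" by (simp add: euclidean_product_topology)
  have sep: "\<exists>f. trig_poly d f \<and> f x \<noteq> f y" if xy: "x \<in> K" "y \<in> K" "x \<noteq> y" for x y
  proof -
    obtain i where i: "x i \<noteq> y i" using xy(3) by auto
    have xyJ: "x i \<in> J i" "y i \<in> J i" using xy(1,2) unfolding K_def by (auto simp: PiE_iff)
    have id: "i < d" using xyJ i unfolding J_def by (cases "i < d") auto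
    have b: "\<bar>x i\<bar> \<le> R" "\<bar>y i\<bar> \<le> R" using xyJ id unfolding J_def by auto
    \<comment> \<open>\<open>- \<i> * cis s\<close> has real part \<open>sin s\<close>, and on
      \<open>K\<close> the argument \<open>x i / R\<close> lies in \<open>[-1, 1]\<close>, where the
      sine is injective.\<close>
    define f where "f = (\<lambda>x. Re ((- \<i>) * cis (\<Sum>j<d. (if j = i then 1 / R else 0) * x j)))"
    have f: "trig_poly d f" unfolding f_def by (rule trig_base)
    have val: "f z = sin (z i / R)" for z
    proof -
      have "(\<Sum>j<d. (if j = i then 1 / R else 0) * z j) = (\<Sum>j<d. if j = i then z j / R else 0)"
        by (intro sum.cong) auto
      also have "\<dots> = z i / R" using id by simp
      finally show ?thesis unfolding f_def by simp
    qed
    have "\<bar>x i / R\<bar> \<le> 1" "\<bar>y i / R\<bar> \<le> 1" using b R by (auto simp: abs_divide)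
    then have bR: "\<bar>x i / R\<bar> \<le> pi / 2" "\<bar>y i / R\<bar> \<le> pi / 2"
      using pi_gt3 by linarith+
    have "f x \<noteq> f y"
    proof
      assume "f x = f y"
      then have "sin (x i / R) = sin (y i / R)" unfolding val .
      then have "x i / R = y i / R"
        by (rule sin_inj_pi[rotated 4]) (use bR[unfolded abs_le_iff] in linarith)+
      then show False using i R by simp
    qed
    then show ?thesis using f by (intro exI[of _ f] conjI)
  qed
  have "\<exists>g. trig_poly d g \<and> (\<forall>x\<in>K. \<bar>\<phi> x - g x\<bar> < e / 2)"
  proof (rule Stone_Weierstrass_HOL[where P="trig_poly d" and S=K and f=\<phi> and e="e / 2", OF cK])
    show "continuous_on K \<phi>"
      by (rule continuous_on_subset[OF lipschitz_coords_continuous[OF lip]]) simp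
    show "continuous_on K f" if "trig_poly d f" for f
      by (rule continuous_on_subset[OF trig_poly_continuous[OF that]]) simp
    show "trig_poly d (\<lambda>x. r)" for r by (rule trig_poly_const)
    show "trig_poly d (\<lambda>x. f x + g x)" if "trig_poly d f \<and> trig_poly d g" for f g
      using that trig_add by blast
    show "trig_poly d (\<lambda>x. f x * g x)" if "trig_poly d f \<and> trig_poly d g" for f g
      using that trig_poly_mult by blast
    show "\<exists>f. trig_poly d f \<and> f x \<noteq> f y" if "x \<in> K \<and> y \<in> K \<and> x \<noteq> y" for x y
      using that sep by blast
    show "0 < e / 2" using e by simp
  qed
  then obtain T where T: "trig_poly d T" and Tc: "\<And>x. x \<in> K \<Longrightarrow> \<bar>\<phi> x - T x\<bar> < e / 2" by blast
  obtain b where b: "\<And>x. \<bar>T x\<bar> \<le> b" using trig_poly_bounded[OF T] by blast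
  define clip where "clip t = max (- c) (min c t)" for t :: real
  have c0: "0 \<le> c" using dyadic_gauss[of "\<lambda>_. 0"] by linarith
  have clip_bd: "\<bar>clip t\<bar> \<le> c" for t using c0 by (auto simp: clip_def abs_le_iff)
  have clip_close: "\<bar>s - clip t\<bar> \<le> \<bar>s - t\<bar>" if "\<bar>s\<bar> \<le> c" for s t
    using that unfolding clip_def by (cases "t \<le> c"; cases "- c \<le> t") (simp_all add: abs_le_iff)
  have "continuous_on {-b..b} clip" unfolding clip_def by (intro continuous_intros)
  then obtain q where q: "real_polynomial_function q" "\<And>t. t \<in> {-b..b} \<Longrightarrow> \<bar>clip t - q t\<bar> < e / 2"
    using Stone_Weierstrass_real_polynomial_function[of "{-b..b}" clip "e/2"] e by auto
  have qT: "\<bar>clip (T x) - q (T x)\<bar> < e / 2" for x using q(2)[of "T x"] b[of x] by (auto simp: abs_le_iff)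
  show ?thesis
  proof (intro exI conjI allI impI)
    show "trig_poly d (\<lambda>x. q (T x))" by (rule trig_poly_compose_polynomial[OF q(1) T])
    show "\<bar>q (T x)\<bar> \<le> c + e" for x
      using qT[of x] clip_bd[of "T x"] e by linarith
    fix x :: "nat \<Rightarrow> real" assume x: "\<forall>i<d. \<bar>x i\<bar> \<le> R"
    define y where "y i = (if i < d then x i else 0)" for i
    have yK: "y \<in> K" using x by (auto simp: K_def J_def y_def PiE_iff abs_le_iff minus_le_iff)
    have "\<phi> x = \<phi> y" by (rule lipschitz_coords_eq[OF lip]) (simp add: y_def)
    moreover have "T x = T y" using T
    proof (induction rule: trig_poly.induct)
      case (trig_base \<alpha> c)
      have "(\<Sum>i<d. c i * x i) = (\<Sum>i<d. c i * y i)" by (intro sum.cong) (auto simp: y_def)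
      then show ?case by simp
    qed auto
    moreover have "\<bar>\<phi> y - clip (T y)\<bar> \<le> \<bar>\<phi> y - T y\<bar>"
      by (rule clip_close[OF dyadic_gauss])
    ultimately have *: "\<bar>\<phi> x - clip (T x)\<bar> < e / 2" using Tc[OF yK] by simp
    show "\<bar>\<phi> x - q (T x)\<bar> \<le> e" using * qT[of x] by linarith
  qed
qed

lemma (in prob_space) integral_diff_le_off_event:
  fixes f g :: "'a \<Rightarrow> real"
  assumes f: "f \<in> borel_measurable M" "\<And>\<omega>. \<omega> \<in> space M \<Longrightarrow> \<bar>f \<omega>\<bar> \<le> a"
    and g: "g \<in> borel_measurable M" "\<And>\<omega>. \<omega> \<in> space M \<Longrightarrow> \<bar>g \<omega>\<bar> \<le> b"
    and A: "A \<in> sets M"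
    and off: "\<And>\<omega>. \<omega> \<in> space M \<Longrightarrow> \<omega> \<notin> A \<Longrightarrow> \<bar>f \<omega> - g \<omega>\<bar> \<le> e" and e: "0 \<le> e"
  shows "\<bar>(\<integral>\<omega>. f \<omega> \<partial>M) - (\<integral>\<omega>. g \<omega> \<partial>M)\<bar> \<le> e + (a + b) * prob A"
proof -
  have i: "integrable M f" "integrable M g"
    by (rule integrable_const_bound[where B=a], use f in auto)
       (rule integrable_const_bound[where B=b], use g in auto)
  have "\<bar>(\<integral>\<omega>. f \<omega> \<partial>M) - (\<integral>\<omega>. g \<omega> \<partial>M)\<bar> = \<bar>\<integral>\<omega>. f \<omega> - g \<omega> \<partial>M\<bar>" using i by simp
  also have "\<dots> \<le> (\<integral>\<omega>. \<bar>f \<omega> - g \<omega>\<bar> \<partial>M)" by (rule integral_abs_bound)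
  also have "\<dots> \<le> (\<integral>\<omega>. e + (a + b) * indicator A \<omega> \<partial>M)"
  proof (rule integral_mono)
    show "integrable M (\<lambda>\<omega>. e + (a + b) * indicator A \<omega>)" using A by (auto simp: emeasure_eq_measure)
    show "\<bar>f \<omega> - g \<omega>\<bar> \<le> e + (a + b) * indicator A \<omega>" if "\<omega> \<in> space M" for \<omega>
      using off[OF that] f(2)[OF that] g(2)[OF that] e by (cases "\<omega> \<in> A") auto
  qed (use i in auto)
  also have "\<dots> = e + (a + b) * prob A" using A by (simp add: prob_space emeasure_eq_measure)
  finally show ?thesis .
qed

lemma (in prob_space) tight_coords:
  fixes G :: "'a \<Rightarrow> nat \<Rightarrow> real"
  assumes G[measurable]: "\<And>i. i < d \<Longrightarrow> (\<lambda>\<omega>. G \<omega> i) \<in> borel_measurable M" and e: "0 < e"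
  shows "\<exists>R0>0. \<forall>R\<ge>R0. prob {\<omega>\<in>space M. \<exists>i<d. \<bar>G \<omega> i\<bar> > R} < e"
proof -
  define E where "E n = {\<omega>\<in>space M. \<exists>i<d. \<bar>G \<omega> i\<bar> > real n}" for n
  have Em: "E n \<in> sets M" for n unfolding E_def by measurable
  have "(\<lambda>n. prob (E n)) \<longlonglongrightarrow> prob (\<Inter>n. E n)"
    by (rule finite_Lim_measure_decseq) (use Em in \<open>auto simp: decseq_def E_def intro: le_less_trans of_nat_mono\<close>)
  moreover have "(\<Inter>n. E n) = {}"
  proof (intro equals0I)
    fix \<omega> assume w: "\<omega> \<in> (\<Inter>n. E n)"
    obtain n where n: "(\<Sum>i<d. \<bar>G \<omega> i\<bar>) \<le> real n" using real_arch_simple by blast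
    obtain i where i: "i < d" "\<bar>G \<omega> i\<bar> > real n" using w unfolding E_def by auto
    have "\<bar>G \<omega> i\<bar> \<le> (\<Sum>i<d. \<bar>G \<omega> i\<bar>)" using i by (intro member_le_sum) auto
    then show False using i n by simp
  qed
  ultimately have "(\<lambda>n. prob (E n)) \<longlonglongrightarrow> 0" by simp
  then have "\<forall>\<^sub>F n in sequentially. prob (E n) < e" using e by (rule order_tendstoD(2))
  then obtain n0 where n0: "prob (E (Suc n0)) < e" unfolding eventually_sequentially using le_SucI by blast
  show ?thesis
  proof (intro exI[of _ "real (Suc n0)"] conjI allI impI)
    fix R assume R: "real (Suc n0) \<le> R"
    have "prob {\<omega>\<in>space M. \<exists>i<d. \<bar>G \<omega> i\<bar> > R} \<le> prob (E (Suc n0))"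
      by (intro finite_measure_mono Em) (use R in \<open>auto simp: E_def\<close>)
    then show "prob {\<omega>\<in>space M. \<exists>i<d. \<bar>G \<omega> i\<bar> > R} < e" using n0 by linarith
  qed simp
qed

lemma (in prob_space) integral_trig_approx:
  fixes H :: "'a \<Rightarrow> nat \<Rightarrow> real"
  assumes lip: "\<And>x y. \<bar>\<phi> x - \<phi> y\<bar> \<le> k * (\<Sum>i<d. \<bar>x i - y i\<bar>)"
    and dyadic_gauss: "\<And>x. \<bar>\<phi> x\<bar> \<le> c"
    and T: "trig_poly d T" "\<And>x. \<bar>T x\<bar> \<le> c + e"
      "\<And>x. (\<And>i. i < d \<Longrightarrow> \<bar>x i\<bar> \<le> R) \<Longrightarrow> \<bar>\<phi> x - T x\<bar> \<le> e"
    and e: "0 < e" "e \<le> 1"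
    and H[measurable]: "\<And>i. i < d \<Longrightarrow> (\<lambda>\<omega>. H \<omega> i) \<in> borel_measurable M"
    and p: "prob {\<omega>\<in>space M. \<exists>i<d. \<bar>H \<omega> i\<bar> > R} \<le> e"
  shows "\<bar>(\<integral>\<omega>. \<phi> (H \<omega>) \<partial>M) - (\<integral>\<omega>. T (H \<omega>) \<partial>M)\<bar> \<le> e + (2 * c + 1) * e"
proof -
  let ?A = "{\<omega>\<in>space M. \<exists>i<d. \<bar>H \<omega> i\<bar> > R}"
  have c0: "0 \<le> c" using dyadic_gauss[of "\<lambda>_. 0"] by linarith
  have "\<bar>(\<integral>\<omega>. \<phi> (H \<omega>) \<partial>M) - (\<integral>\<omega>. T (H \<omega>) \<partial>M)\<bar> \<le> e + (c + (c + e)) * prob ?A"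
  proof (rule integral_diff_le_off_event)
    show "(\<lambda>\<omega>. \<phi> (H \<omega>)) \<in> borel_measurable M" by (rule lipschitz_coords_measurable[OF lip H])
    show "(\<lambda>\<omega>. T (H \<omega>)) \<in> borel_measurable M" by (rule trig_poly_measurable[OF T(1) H])
    show "?A \<in> sets M" by measurable
    show "\<bar>\<phi> (H \<omega>) - T (H \<omega>)\<bar> \<le> e" if "\<omega> \<in> space M" "\<omega> \<notin> ?A" for \<omega>
          proof (rule T(3))
      have "\<not> (\<exists>i<d. \<bar>H \<omega> i\<bar> > R)" using that by simp
      then show "\<bar>H \<omega> i\<bar> \<le> R" if "i < d" for i using that not_less by blast
    qed
  qed (use dyadic_gauss T(2) e in auto)
  also have "\<dots> \<le> e + (2 * c + 1) * e"
    using p e c0 by (intro add_left_mono mult_mono) auto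
  finally show ?thesis .
qed

text \<open>A multivariate continuity theorem for bounded Lipschitz test functions. On a box
  carrying most of both laws the test function is uniformly close to a trigonometric polynomial; the
  polynomial stays bounded elsewhere, so the complement of the box costs only its small probability.
  Tightness is a hypothesis because the chaining majorant supplies it
  (\<open>orth_proc_tight\<close>).\<close>

lemma integral_tendsto_of_char_tendsto:
  fixes S :: "nat \<Rightarrow> 'a \<Rightarrow> nat \<Rightarrow> real" and G :: "'w \<Rightarrow> nat \<Rightarrow> real"
  assumes P: "prob_space P" and N: "prob_space N"
    and S: "\<And>n i. i < d \<Longrightarrow> (\<lambda>\<omega>. S n \<omega> i) \<in> borel_measurable P"
    and G: "\<And>i. i < d \<Longrightarrow> (\<lambda>\<omega>. G \<omega> i) \<in> borel_measurable N"
    and cf: "\<And>c. (\<lambda>n. \<integral>\<omega>. cis (\<Sum>i<d. c i * S n \<omega> i) \<partial>P) \<longlonglongrightarrow> (\<integral>\<omega>. cis (\<Sum>i<d. c i * G \<omega> i) \<partial>N)"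
    and tight: "\<And>e. 0 < e \<Longrightarrow> \<exists>R. \<forall>\<^sub>F n in sequentially. measure P {\<omega>\<in>space P. \<exists>i<d. \<bar>S n \<omega> i\<bar> > R} \<le> e"
    and lip: "\<And>x y. \<bar>\<phi> x - \<phi> y\<bar> \<le> k * (\<Sum>i<d. \<bar>x i - y i\<bar>)"
    and dyadic_gauss: "\<And>x. \<bar>\<phi> x\<bar> \<le> c"
  shows "(\<lambda>n. \<integral>\<omega>. \<phi> (S n \<omega>) \<partial>P) \<longlonglongrightarrow> (\<integral>\<omega>. \<phi> (G \<omega>) \<partial>N)"
proof (rule tendstoI)
  fix \<epsilon> :: real assume \<epsilon>: "\<epsilon> > 0"
  interpret P: prob_space P by fact
  interpret N: prob_space N by fact
  note S[measurable] G[measurable]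
  have c0: "0 \<le> c" using dyadic_gauss[of "\<lambda>_. 0"] by linarith
  \<comment> \<open>Three errors of at most \<open>e + (2 * c + 1) * e\<close>, that is
    \<open>(2 * c + 2) * e\<close>, are added at the end; dividing by \<open>2 * c + 3\<close> makes
    their sum strictly smaller than \<epsilon>.\<close>
  define e where "e = min 1 (\<epsilon> / (3 * (2 * c + 3)))"
  have e: "0 < e" "e \<le> 1" using \<epsilon> c0 by (auto simp: e_def)
  have "3 * (2 * c + 3) * e \<le> 3 * (2 * c + 3) * (\<epsilon> / (3 * (2 * c + 3)))"
    using c0 unfolding e_def by (intro mult_left_mono) auto
  also have "\<dots> = \<epsilon>" using c0 by simp
  finally have "3 * (2 * c + 3) * e \<le> \<epsilon>" .
  then have e\<epsilon>: "3 * (e + (2 * c + 1) * e) < \<epsilon>" using e by (simp add: algebra_simps)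
  obtain R1 where R1: "\<And>R. R \<ge> R1 \<Longrightarrow> N.prob {\<omega>\<in>space N. \<exists>i<d. \<bar>G \<omega> i\<bar> > R} < e"
    using N.tight_coords[of d G e] G e by auto
  obtain R2 where R2: "\<forall>\<^sub>F n in sequentially. P.prob {\<omega>\<in>space P. \<exists>i<d. \<bar>S n \<omega> i\<bar> > R2} \<le> e"
    using tight e(1) by blast
  define R where "R = max 1 (max R1 R2)"
  obtain T where T: "trig_poly d T" "\<And>x. \<bar>T x\<bar> \<le> c + e"
    "\<And>x. (\<And>i. i < d \<Longrightarrow> \<bar>x i\<bar> \<le> R) \<Longrightarrow> \<bar>\<phi> x - T x\<bar> \<le> e"
    using trig_poly_approx[OF lip dyadic_gauss e(1), of R] unfolding R_def by (auto simp: less_max_iff_disj)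
  have bG: "\<bar>(\<integral>\<omega>. \<phi> (G \<omega>) \<partial>N) - (\<integral>\<omega>. T (G \<omega>) \<partial>N)\<bar> \<le> e + (2 * c + 1) * e"
  proof (rule N.integral_trig_approx[where R=R, OF lip dyadic_gauss T(1,2) T(3) e G])
    show "N.prob {\<omega>\<in>space N. \<exists>i<d. \<bar>G \<omega> i\<bar> > R} \<le> e" by (rule less_imp_le[OF R1]) (simp add: R_def)
  qed auto
  have tT: "(\<lambda>n. \<integral>\<omega>. T (S n \<omega>) \<partial>P) \<longlonglongrightarrow> (\<integral>\<omega>. T (G \<omega>) \<partial>N)"
    by (rule trig_poly_integral_tendsto[OF P N S G cf T(1)])
  have pos: "0 < e + (2 * c + 1) * e" using e c0 by (simp add: add_pos_nonneg)
  from tendstoD[OF tT pos] R2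
  show "\<forall>\<^sub>F n in sequentially. dist (\<integral>\<omega>. \<phi> (S n \<omega>) \<partial>P) (\<integral>\<omega>. \<phi> (G \<omega>) \<partial>N) < \<epsilon>"
  proof eventually_elim
    case (elim n)
    have "P.prob {\<omega>\<in>space P. \<exists>i<d. \<bar>S n \<omega> i\<bar> > R} \<le> P.prob {\<omega>\<in>space P. \<exists>i<d. \<bar>S n \<omega> i\<bar> > R2}"
      by (intro P.finite_measure_mono) (auto simp: R_def)
    then have p: "P.prob {\<omega>\<in>space P. \<exists>i<d. \<bar>S n \<omega> i\<bar> > R} \<le> e" using elim by linarith
    have "\<bar>(\<integral>\<omega>. \<phi> (S n \<omega>) \<partial>P) - (\<integral>\<omega>. T (S n \<omega>) \<partial>P)\<bar> \<le> e + (2 * c + 1) * e"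
      by (rule P.integral_trig_approx[where R=R, OF lip dyadic_gauss T(1,2) T(3) e S]) (use p in auto)
    moreover have "\<bar>x - z\<bar> < \<epsilon>" if "\<bar>x - y\<bar> \<le> r" "\<bar>y - w\<bar> < r" "\<bar>z - w\<bar> \<le> r" "3 * r < \<epsilon>" for x y z w r :: real
      using that by linarith
    ultimately show ?case using elim(1) bG e\<epsilon> unfolding dist_real_def by blast
  qed
qed

section \<open>A maximal inequality and dyadic chaining\<close>

text \<open>From \<open>y \<le> exp y\<close> with \<open>y = lam * |X e| - c\<close>, the maximum
  is at most \<open>c / lam\<close> plus \<open>exp (- c) / lam\<close> times the sum of all
  exponentials. The choice \<open>c = ln (2 * card E) + \<kappa>\<close> makes the expectation of
  the second term at most \<open>1 / lam\<close>.\<close>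

lemma (in prob_space) nn_integral_Max_abs_le:
  fixes X :: "'e \<Rightarrow> 'a \<Rightarrow> real"
  assumes E: "finite E" "E \<noteq> {}" and lam: "0 < lam" and \<kappa>: "0 \<le> \<kappa>"
    and X[measurable]: "\<And>e. e \<in> E \<Longrightarrow> X e \<in> borel_measurable M"
    and up: "\<And>e. e \<in> E \<Longrightarrow> (\<integral>\<^sup>+\<omega>. ennreal (exp (lam * X e \<omega>)) \<partial>M) \<le> ennreal (exp \<kappa>)"
    and dn: "\<And>e. e \<in> E \<Longrightarrow> (\<integral>\<^sup>+\<omega>. ennreal (exp (- lam * X e \<omega>)) \<partial>M) \<le> ennreal (exp \<kappa>)"
  shows "(\<integral>\<^sup>+\<omega>. ennreal (Max ((\<lambda>e. \<bar>X e \<omega>\<bar>) ` E)) \<partial>M) \<le> ennreal ((ln (2 * real (card E)) + \<kappa> + 1) / lam)"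
proof -
  define c where "c = ln (2 * real (card E)) + \<kappa>"
  have cE: "1 \<le> real (card E)" using E by (simp add: Suc_leI card_gt_0_iff)
  have c0: "0 \<le> c" unfolding c_def using cE \<kappa> by simp
  have pt: "Max ((\<lambda>e. \<bar>X e \<omega>\<bar>) ` E) \<le> c / lam + exp (- c) / lam * (\<Sum>e\<in>E. exp (lam * X e \<omega>) + exp (- lam * X e \<omega>))" for \<omega>
  proof -
    have "\<bar>X e \<omega>\<bar> \<le> c / lam + exp (- c) / lam * (\<Sum>e\<in>E. exp (lam * X e \<omega>) + exp (- lam * X e \<omega>))" if e: "e \<in> E" for e
    proof -
      have "lam * \<bar>X e \<omega>\<bar> - c \<le> exp (lam * \<bar>X e \<omega>\<bar> - c)" using exp_ge_add_one_self[of "lam * \<bar>X e \<omega>\<bar> - c"] by linarith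
      also have "\<dots> = exp (- c) * exp (lam * \<bar>X e \<omega>\<bar>)" by (simp add: exp_diff exp_minus field_simps)
      also have "exp (lam * \<bar>X e \<omega>\<bar>) \<le> exp (lam * X e \<omega>) + exp (- lam * X e \<omega>)" by (simp add: abs_if)
      also have "\<dots> \<le> (\<Sum>e\<in>E. exp (lam * X e \<omega>) + exp (- lam * X e \<omega>))"
        using E e by (intro member_le_sum[of e E "\<lambda>e. exp (lam * X e \<omega>) + exp (- lam * X e \<omega>)"]) (auto intro: add_nonneg_nonneg)
      finally have "lam * \<bar>X e \<omega>\<bar> \<le> c + exp (- c) * (\<Sum>e\<in>E. exp (lam * X e \<omega>) + exp (- lam * X e \<omega>))" by simp
      then show ?thesis using lam by (simp add: field_simps)
    qed
    then show ?thesis using E by (subst Max_le_iff) auto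
  qed
  have "(\<integral>\<^sup>+\<omega>. ennreal (Max ((\<lambda>e. \<bar>X e \<omega>\<bar>) ` E)) \<partial>M)
      \<le> (\<integral>\<^sup>+\<omega>. ennreal (c / lam) + ennreal (exp (- c) / lam) * (\<Sum>e\<in>E. ennreal (exp (lam * X e \<omega>)) + ennreal (exp (- lam * X e \<omega>))) \<partial>M)"
  proof (rule nn_integral_mono)
    fix \<omega>
    have "ennreal (Max ((\<lambda>e. \<bar>X e \<omega>\<bar>) ` E)) \<le> ennreal (c / lam + exp (- c) / lam * (\<Sum>e\<in>E. exp (lam * X e \<omega>) + exp (- lam * X e \<omega>)))"
      by (rule ennreal_leI[OF pt])
    also have "\<dots> = ennreal (c / lam) + ennreal (exp (- c) / lam) * (\<Sum>e\<in>E. ennreal (exp (lam * X e \<omega>)) + ennreal (exp (- lam * X e \<omega>)))"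
    proof -
      have "(\<Sum>e\<in>E. ennreal (exp (lam * X e \<omega>)) + ennreal (exp (- lam * X e \<omega>)))
          = (\<Sum>e\<in>E. ennreal (exp (lam * X e \<omega>) + exp (- lam * X e \<omega>)))"
        by (intro sum.cong refl ennreal_plus[symmetric]) auto
      also have "\<dots> = ennreal (\<Sum>e\<in>E. exp (lam * X e \<omega>) + exp (- lam * X e \<omega>))"
        by (intro sum_ennreal) (auto intro: add_nonneg_nonneg)
      finally show ?thesis
        using c0 lam by (subst ennreal_plus; (subst ennreal_mult)?)
          (auto intro!: sum_nonneg add_nonneg_nonneg mult_nonneg_nonneg divide_nonneg_nonneg)
    qed
    finally show "ennreal (Max ((\<lambda>e. \<bar>X e \<omega>\<bar>) ` E)) \<le> ennreal (c / lam) + ennreal (exp (- c) / lam) * (\<Sum>e\<in>E. ennreal (exp (lam * X e \<omega>)) + ennreal (exp (- lam * X e \<omega>)))" .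
  qed
  also have "\<dots> = ennreal (c / lam) + ennreal (exp (- c) / lam) * (\<Sum>e\<in>E. (\<integral>\<^sup>+\<omega>. ennreal (exp (lam * X e \<omega>)) \<partial>M) + (\<integral>\<^sup>+\<omega>. ennreal (exp (- lam * X e \<omega>)) \<partial>M))"
    by (simp add: nn_integral_add nn_integral_cmult nn_integral_sum emeasure_space_1)
  also have "\<dots> \<le> ennreal (c / lam) + ennreal (exp (- c) / lam) * (\<Sum>e\<in>E. ennreal (exp \<kappa>) + ennreal (exp \<kappa>))"
    using up dn by (intro add_left_mono mult_left_mono sum_mono add_mono) auto
  also have "\<dots> = ennreal (c / lam + exp (- c) / lam * (\<Sum>e\<in>E. exp \<kappa> + exp \<kappa>))"
  proof -
    have "(\<Sum>e\<in>E. ennreal (exp \<kappa>) + ennreal (exp \<kappa>)) = ennreal (\<Sum>e\<in>E. exp \<kappa> + exp \<kappa>)"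
      by (subst sum_ennreal[symmetric]) (simp_all flip: ennreal_plus)
    then show ?thesis
      using c0 lam by (subst ennreal_plus; (subst ennreal_mult)?)
        (auto intro!: sum_nonneg add_nonneg_nonneg mult_nonneg_nonneg divide_nonneg_nonneg)
  qed
  also have "c / lam + exp (- c) / lam * (\<Sum>e\<in>E. exp \<kappa> + exp \<kappa>) = (c + 1) / lam"
  proof -
    have "exp (- c) * (\<Sum>e\<in>E. exp \<kappa> + exp \<kappa>) = 1"
    proof -
      have "exp c = (\<Sum>e\<in>E. exp \<kappa> + exp \<kappa>)" using cE by (simp add: c_def exp_add)
      then show ?thesis by (metis exp_minus_inverse mult.commute)
    qed
    then show ?thesis using lam by (simp add: field_simps)
  qed
  finally show ?thesis by (simp add: c_def)
qed

section \<open>Dyadic grids, links of the chain and their entropy\<close>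

definition dfloor :: "nat \<Rightarrow> real^'p \<Rightarrow> real^'p" where
  "dfloor l u = (\<chi> k. real_of_int \<lfloor>2^l * u $ k\<rfloor> / 2^l)"

definition dceil :: "nat \<Rightarrow> real^'p \<Rightarrow> real^'p" where
  "dceil l u = (\<chi> k. real_of_int \<lceil>2^l * u $ k\<rceil> / 2^l)"

definition dgrid :: "nat \<Rightarrow> (real^'p) set" where
  "dgrid l = {u \<in> cube. \<forall>k. 2^l * u $ k \<in> \<int>}"

text \<open>The links are pairs comparable in every coordinate, so that the increment of an orthant
  indicator along a link is again an indicator. Degenerate pairs \<open>(a, a)\<close> are included,
  which keeps the set nonempty.\<close>

definition dpairs :: "nat \<Rightarrow> ((real^'p) \<times> (real^'p)) set" where
  "dpairs l = {(a, b). a \<in> dgrid l \<and> b \<in> dgrid l \<and> (\<forall>k. a $ k \<le> b $ k \<and> b $ k \<le> a $ k + 1 / 2^l)}"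

lemma dgrid_finite_card:
  "finite (dgrid l :: (real^'p) set) \<and> card (dgrid l :: (real^'p) set) \<le> (2^l + 1) ^ CARD('p)"
proof -
  define g where "g f = (\<chi> k. real (f k) / 2^l)" for f :: "'p \<Rightarrow> nat"
  let ?F = "Pi\<^sub>E (UNIV :: 'p set) (\<lambda>_. {0..2^l :: nat})"
  have sub: "(dgrid l :: (real^'p) set) \<subseteq> g ` ?F"
  proof
    fix u :: "real^'p" assume u: "u \<in> dgrid l"
    define f where "f k = nat \<lfloor>2^l * u $ k\<rfloor>" for k
    have fk: "real (f k) = 2^l * u $ k" for k
    proof -
      have "2^l * u $ k \<in> \<int>" "0 \<le> 2^l * u $ k" using u by (auto simp: dgrid_def cube_def)
      then show ?thesis unfolding f_def by (auto elim!: Ints_cases)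
    qed
    have "f k \<le> 2^l" for k
    proof -
      have "real (f k) \<le> 2^l" unfolding fk using u by (auto simp: dgrid_def cube_def mult_le_cancel_left1)
      then show ?thesis by (metis of_nat_le_iff of_nat_numeral of_nat_power)
    qed
    moreover have "u = g f" by (simp add: g_def fk vec_eq_iff)
    ultimately show "u \<in> g ` ?F" by (auto simp: PiE_iff)
  qed
  have "finite ?F" by (intro finite_PiE) auto
  moreover have "card ?F = (2^l + 1) ^ CARD('p)" by (simp add: card_PiE)
  ultimately show ?thesis
    using sub card_image_le[of ?F g] card_mono[OF finite_imageI sub] finite_subset[OF sub finite_imageI] by fastforce
qed

lemma dgrid_finite: "finite (dgrid l)"
  using dgrid_finite_card by blast

lemma dpairs_subset: "dpairs l \<subseteq> dgrid l \<times> dgrid l"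
  by (auto simp: dpairs_def)

lemma dpairs_finite: "finite (dpairs l)"
  by (rule finite_subset[OF dpairs_subset finite_SigmaI[OF dgrid_finite dgrid_finite]])

lemma dgrid_zero: "0 \<in> dgrid l"
  by (simp add: dgrid_def cube_def)

lemma dpairs_nonempty: "dpairs l \<noteq> {}"
  using dgrid_zero[of l] by (auto simp: dpairs_def intro!: exI[of _ 0])

lemma dgrid_cube: "u \<in> dgrid l \<Longrightarrow> u \<in> cube"
  by (simp add: dgrid_def)

lemma dgrid_Suc: "u \<in> dgrid l \<Longrightarrow> u \<in> dgrid (Suc l)"
proof -
  assume u: "u \<in> dgrid l"
  have "2 * (2^l * u $ k) \<in> \<int>" for k using u by (intro Ints_mult[of 2 "2^l * u $ k"]) (auto simp: dgrid_def)
  then show ?thesis using u by (simp add: dgrid_def mult.assoc)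
qed

text \<open>Dominates the logarithm of the number of pairs at level \<open>l\<close>, which is what the maximal inequality
  charges for a maximum over them.\<close>
definition entropy_bound :: "'p::finite itself \<Rightarrow> nat \<Rightarrow> real" where
  "entropy_bound _ l = (4 * real CARD('p) + 2) * real (Suc l)"

text \<open>The left side is the numerator of the maximal inequality when the exponential moments
  are at most \<open>exp p\<close>, where \<open>p\<close> is the dimension. The logarithm is at
  most \<open>2 * p * (l + 1) + 1\<close>, and the remaining \<open>p + 2\<close> is absorbed by
  \<open>(2 * p + 2) * (l + 1)\<close>.\<close>

lemma entropy_bound_ge: "ln (2 * real (card (dpairs l :: ((real^'p) \<times> (real^'p)) set))) + real CARD('p) + 1 \<le> entropy_bound TYPE('p) l"
proof -
  let ?p = "real CARD('p)"
  have "card (dpairs l :: ((real^'p) \<times> (real^'p)) set) \<le> card (dgrid l \<times> dgrid l :: ((real^'p) \<times> (real^'p)) set)"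
    by (intro card_mono dpairs_subset finite_SigmaI dgrid_finite)
  also have "\<dots> \<le> (2^l + 1) ^ CARD('p) * (2^l + 1) ^ CARD('p)"
    unfolding card_cartesian_product using dgrid_finite_card[where 'p='p, of l] by (intro mult_mono) auto
  also have "\<dots> \<le> (2 ^ Suc l) ^ CARD('p) * (2 ^ Suc l) ^ CARD('p)"
    by (intro mult_mono power_mono) auto
  also have "\<dots> = 2 ^ (2 * CARD('p) * Suc l)" by (simp flip: power_mult power_add add: algebra_simps)
  finally have "real (card (dpairs l :: ((real^'p) \<times> (real^'p)) set)) \<le> 2 ^ (2 * CARD('p) * Suc l)"
    by (metis of_nat_le_iff of_nat_numeral of_nat_power)
  then have "2 * real (card (dpairs l :: ((real^'p) \<times> (real^'p)) set)) \<le> 2 ^ (2 * CARD('p) * Suc l + 1)" by simp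
  moreover have "0 < card (dpairs l :: ((real^'p) \<times> (real^'p)) set)"
    using dpairs_nonempty[of l] dpairs_finite[of l] by (simp add: card_gt_0_iff)
  ultimately have "ln (2 * real (card (dpairs l :: ((real^'p) \<times> (real^'p)) set))) \<le> ln (2 ^ (2 * CARD('p) * Suc l + 1))"
    by (intro ln_mono) auto
  also have "\<dots> = real (2 * CARD('p) * Suc l + 1) * ln 2" by (simp only: ln_realpow)
  also have "\<dots> \<le> real (2 * CARD('p) * Suc l + 1) * 1"
    using ln_le_minus_one[of 2] by (intro mult_left_mono) auto
  finally have "ln (2 * real (card (dpairs l :: ((real^'p) \<times> (real^'p)) set))) \<le> 2 * ?p * real (Suc l) + 1" by (simp add: algebra_simps)
  moreover have "(2 * ?p + 2) * 1 \<le> (2 * ?p + 2) * real (Suc l)" by (rule mult_left_mono) auto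
  moreover have "entropy_bound TYPE('p) l = 2 * ?p * real (Suc l) + (2 * ?p + 2) * real (Suc l)"
    by (simp add: entropy_bound_def algebra_simps)
  moreover have "0 \<le> ?p" by simp
  ultimately show ?thesis by argo
qed

text \<open>The factor 4 is that of \<open>Psi\<close>: two chains, and one further link at each of
  the two ends.\<close>

definition entropy_tail :: "'p::finite itself \<Rightarrow> nat \<Rightarrow> real" where
  "entropy_tail t m = 4 * (\<Sum>l. entropy_bound t (l + m) / sqrt (2 ^ (l + m)))"

lemma entropy_bound_nonneg: "0 \<le> entropy_bound t l"
  by (simp add: entropy_bound_def)

lemma entropy_bound_summable: "summable (\<lambda>l. entropy_bound (t :: 'p::finite itself) l / sqrt (2 ^ l))"
proof -
  \<comment> \<open>\<open>diffs (\<lambda>_. 1)\<close> has the coefficients \<open>n + 1\<close>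
    of the differentiated geometric series, evaluated at \<open>1 / sqrt 2\<close>, inside the unit
    disc.\<close>
  have "summable (\<lambda>n. diffs (\<lambda>_. 1) n * (1 / sqrt 2) ^ n :: real)"
    by (rule termdiff_converges[of _ 1]) (auto simp: summable_geometric)
  then have "summable (\<lambda>n. (4 * real CARD('p) + 2) * (real (Suc n) * (1 / sqrt 2) ^ n))"
    by (intro summable_mult) (simp add: diffs_def)
  moreover have "(4 * real CARD('p) + 2) * (real (Suc n) * (1 / sqrt 2) ^ n) = entropy_bound t n / sqrt (2 ^ n)" for n
    by (simp add: entropy_bound_def real_sqrt_power power_divide)
  ultimately show ?thesis by (simp only:)
qed

lemma entropy_tail_nonneg: "0 \<le> entropy_tail t m"
  unfolding entropy_tail_def using entropy_bound_summable[of t] entropy_bound_nonneg[of t]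
  by (intro mult_nonneg_nonneg suminf_nonneg) (auto simp: summable_iff_shift[of "\<lambda>l. entropy_bound t l / sqrt (2 ^ l)" m])

lemma entropy_tail_tendsto: "entropy_tail t \<longlonglongrightarrow> 0"
proof -
  let ?g = "\<lambda>l. entropy_bound t l / sqrt (2 ^ l)"
  have "(\<lambda>m. \<Sum>l. ?g (l + m)) \<longlonglongrightarrow> 0"
  proof -
    have "(\<lambda>m. (\<Sum>l. ?g l) - (\<Sum>l<m. ?g l)) \<longlonglongrightarrow> (\<Sum>l. ?g l) - (\<Sum>l. ?g l)"
      by (intro tendsto_intros summable_LIMSEQ entropy_bound_summable)
    then show ?thesis using suminf_minus_initial_segment[OF entropy_bound_summable[of t]] by simp
  qed
  from tendsto_mult[OF tendsto_const[of 4] this] show ?thesis unfolding entropy_tail_def[abs_def] by simp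
qed

lemma entropy_bound_sum_le: "4 * (\<Sum>l\<in>{m..L}. entropy_bound t l / sqrt (2 ^ l)) \<le> entropy_tail t m"
proof -
  let ?g = "\<lambda>l. entropy_bound t l / sqrt (2 ^ l)"
  have "(\<Sum>l\<in>{m..L}. ?g l) \<le> (\<Sum>l\<in>{0 + m..L + m}. ?g l)"
    using entropy_bound_nonneg[of t] by (intro sum_mono2) auto
  also have "\<dots> = (\<Sum>l\<in>{0..L}. ?g (l + m))" by (rule sum.shift_bounds_cl_nat_ivl)
  also have "\<dots> \<le> (\<Sum>l. ?g (l + m))"
    using entropy_bound_summable[of t] entropy_bound_nonneg[of t]
    by (intro sum_le_suminf) (auto simp: summable_iff_shift[of ?g m])
  finally show ?thesis unfolding entropy_tail_def by simp
qed

lemma dfloor_le: "dfloor l u $ k \<le> u $ k" and le_dfloor: "u $ k \<le> dfloor l u $ k + 1 / 2 ^ l"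
proof -
  have "real_of_int \<lfloor>2^l * u $ k\<rfloor> \<le> 2^l * u $ k" by simp
  then show "dfloor l u $ k \<le> u $ k" by (simp add: dfloor_def divide_le_eq mult.commute)
  have "2^l * u $ k \<le> real_of_int \<lfloor>2^l * u $ k\<rfloor> + 1" by linarith
  then show "u $ k \<le> dfloor l u $ k + 1 / 2 ^ l" by (simp add: dfloor_def field_simps)
qed

lemma le_dceil: "u $ k \<le> dceil l u $ k"
  using le_of_int_ceiling[of "2^l * u $ k"] by (simp add: dceil_def field_simps)

lemma dfloor_grid: "u \<in> cube \<Longrightarrow> dfloor l u \<in> dgrid l"
  unfolding dgrid_def cube_def
proof safe
  fix k assume u: "\<forall>k. 0 \<le> u $ k \<and> u $ k \<le> 1"
  show "0 \<le> dfloor l u $ k" using u by (simp add: dfloor_def)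
  show "dfloor l u $ k \<le> 1" using dfloor_le[of l u k] u by (meson order_trans)
  show "2 ^ l * dfloor l u $ k \<in> \<int>" by (simp add: dfloor_def)
qed

lemma dceil_grid: "u \<in> cube \<Longrightarrow> dceil l u \<in> dgrid l"
  unfolding dgrid_def cube_def
proof safe
  fix k assume u: "\<forall>k. 0 \<le> u $ k \<and> u $ k \<le> 1"
  show "0 \<le> dceil l u $ k" using le_dceil[of u k l] u by (meson order_trans)
  have "\<lceil>2 ^ l * u $ k\<rceil> \<le> 2 ^ l" using u by (simp add: ceiling_le_iff mult_left_le)
  then have "real_of_int \<lceil>2 ^ l * u $ k\<rceil> \<le> real_of_int (2 ^ l)" unfolding of_int_le_iff .
  then show "dceil l u $ k \<le> 1" by (simp add: dceil_def)
  show "2 ^ l * dceil l u $ k \<in> \<int>" by (simp add: dceil_def)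
qed

lemma dfloor_dceil_pair: "u \<in> cube \<Longrightarrow> (dfloor l u, dceil l u) \<in> dpairs l"
proof -
  assume u: "u \<in> cube"
  have "dceil l u $ k \<le> dfloor l u $ k + 1 / 2^l" for k
  proof -
    have "\<lceil>2^l * u $ k\<rceil> \<le> \<lfloor>2^l * u $ k\<rfloor> + 1" by (simp add: ceiling_le_iff less_imp_le)
    then have "real_of_int \<lceil>2^l * u $ k\<rceil> \<le> real_of_int \<lfloor>2^l * u $ k\<rfloor> + 1"
      by (metis of_int_1 of_int_add of_int_le_iff)
    then show ?thesis by (simp add: dceil_def dfloor_def field_simps)
  qed
  then show ?thesis using dfloor_grid[OF u] dceil_grid[OF u] order_trans[OF dfloor_le[of l u] le_dceil[of u _ l]]
    by (auto simp: dpairs_def)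
qed

lemma dfloor_step: "u \<in> cube \<Longrightarrow> (dfloor l u, dfloor (Suc l) u) \<in> dpairs (Suc l)"
proof -
  assume u: "u \<in> cube"
  have "dfloor l u $ k \<le> dfloor (Suc l) u $ k \<and> dfloor (Suc l) u $ k \<le> dfloor l u $ k + 1 / 2 ^ Suc l" for k
  proof -
    define x where "x = 2 ^ l * u $ k"
    have "2 * \<lfloor>x\<rfloor> \<le> \<lfloor>2 * x\<rfloor>" "\<lfloor>2 * x\<rfloor> \<le> 2 * \<lfloor>x\<rfloor> + 1" using floor_correct[of x] by (linarith, linarith)
    then have "real_of_int (2 * \<lfloor>x\<rfloor>) \<le> real_of_int \<lfloor>2 * x\<rfloor>" "real_of_int \<lfloor>2 * x\<rfloor> \<le> real_of_int (2 * \<lfloor>x\<rfloor> + 1)"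
      unfolding of_int_le_iff by auto
    then show ?thesis by (simp add: dfloor_def x_def field_simps)
  qed
  then show ?thesis using dfloor_grid[OF u] dgrid_Suc by (auto simp: dpairs_def)
qed

text \<open>The dyadic floors of two nearby points need not be comparable. Their componentwise
  minimum is a grid point below both and within one cell of each, so it can serve as a common
  link.\<close>

lemma dfloor_near_pair:
  assumes u: "u \<in> cube" "v \<in> cube" and near: "\<And>k. \<bar>u $ k - v $ k\<bar> \<le> 1 / 2 ^ l"
  shows "(vmin (dfloor l u) (dfloor l v), dfloor l u) \<in> dpairs l"
proof -
  have "dfloor l u $ k \<le> dfloor l v $ k + 1 / 2^l" for k
  proof -
    have "2 ^ l * u $ k \<le> 2 ^ l * v $ k + 1" using near[of k] by (auto simp: abs_le_iff field_simps)
    then have "\<lfloor>2 ^ l * u $ k\<rfloor> \<le> \<lfloor>2 ^ l * v $ k\<rfloor> + 1"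
      using floor_mono[of "2 ^ l * u $ k" "2 ^ l * v $ k + 1"] by simp
    then have "real_of_int \<lfloor>2 ^ l * u $ k\<rfloor> \<le> real_of_int \<lfloor>2 ^ l * v $ k\<rfloor> + 1"
      by (metis of_int_1 of_int_add of_int_le_iff)
    then show ?thesis by (simp add: dfloor_def field_simps)
  qed
  moreover have "vmin (dfloor l u) (dfloor l v) \<in> dgrid l"
    using dfloor_grid[OF u(1), of l] dfloor_grid[OF u(2), of l] by (auto simp: dgrid_def cube_def vmin_def min_def)
  ultimately show ?thesis
    using dfloor_grid[OF u(1), of l] by (auto simp: dpairs_def vmin_def min_def)
qed

lemma vmin_commute: "vmin u v = vmin v u"
  by (simp add: vmin_def min.commute)

lemma dyadic_chain:
  fixes f :: "real^'p \<Rightarrow> real"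
  assumes M: "\<And>l a b. m < l \<Longrightarrow> l \<le> L \<Longrightarrow> (a, b) \<in> dpairs l \<Longrightarrow> \<bar>f b - f a\<bar> \<le> Mx l"
    and u: "u \<in> cube" and mL: "m \<le> L"
  shows "\<bar>f (dfloor L u) - f (dfloor m u)\<bar> \<le> (\<Sum>l\<in>{m<..L}. Mx l)"
  using mL M
proof (induction L rule: dec_induct)
  case base
  then show ?case by simp
next
  case (step n)
  have "\<bar>f (dfloor n u) - f (dfloor m u)\<bar> \<le> (\<Sum>l\<in>{m<..n}. Mx l)" using step by simp
  moreover have "\<bar>f (dfloor (Suc n) u) - f (dfloor n u)\<bar> \<le> Mx (Suc n)"
    using step.prems[of "Suc n"] step.hyps dfloor_step[OF u, of n] by simp
  moreover have "{m<..Suc n} = insert (Suc n) {m<..n}" using step.hyps by auto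
  ultimately show ?case by simp
qed

text \<open>The path runs from the level-\<open>L\<close> floor of \<open>u\<close> to its
  level-\<open>m\<close> floor, across the common lower neighbour, and back up to \<open>v\<close>.
  Each half uses one link of every level from \<open>m\<close> to \<open>L\<close>.\<close>

lemma dyadic_modulus:
  fixes f :: "real^'p \<Rightarrow> real"
  assumes M: "\<And>l a b. m \<le> l \<Longrightarrow> l \<le> L \<Longrightarrow> (a, b) \<in> dpairs l \<Longrightarrow> \<bar>f b - f a\<bar> \<le> Mx l"
    and u: "u \<in> cube" "v \<in> cube" and near: "\<And>k. \<bar>u $ k - v $ k\<bar> \<le> 1 / 2 ^ m" and mL: "m \<le> L"
  shows "\<bar>f (dfloor L u) - f (dfloor L v)\<bar> \<le> 2 * (\<Sum>l\<in>{m..L}. Mx l)"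
proof -
  let ?w = "vmin (dfloor m u) (dfloor m v)"
  have near': "\<bar>v $ k - u $ k\<bar> \<le> 1 / 2 ^ m" for k using near[of k] by (simp add: abs_minus_commute)
  have "\<bar>f (dfloor m u) - f ?w\<bar> \<le> Mx m" by (rule M) (use mL dfloor_near_pair[OF u near] in auto)
  moreover have "\<bar>f (dfloor m v) - f ?w\<bar> \<le> Mx m"
    by (rule M) (use mL dfloor_near_pair[OF u(2,1) near'] in \<open>auto simp: vmin_commute\<close>)
  moreover have "\<bar>f (dfloor L u) - f (dfloor m u)\<bar> \<le> (\<Sum>l\<in>{m<..L}. Mx l)"
    by (rule dyadic_chain) (use M u mL in auto)
  moreover have "\<bar>f (dfloor L v) - f (dfloor m v)\<bar> \<le> (\<Sum>l\<in>{m<..L}. Mx l)"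
    by (rule dyadic_chain) (use M u mL in auto)
  moreover have "(\<Sum>l\<in>{m..L}. Mx l) = Mx m + (\<Sum>l\<in>{m<..L}. Mx l)"
    using mL by (simp add: sum.head)
  ultimately show ?thesis by linarith
qed

section \<open>The empirical process of orthant indicators\<close>

lemma exp_le_quadratic:
  fixes x :: real assumes "\<bar>x\<bar> \<le> 1" shows "exp x \<le> 1 + x + x\<^sup>2"
proof (cases "0 \<le> x")
  case True
  then show ?thesis using exp_bound[of x] assms by simp
next
  case False
  define y where "y = - x"
  have y: "0 \<le> y" "x = - y" using False by (auto simp: y_def)
  have ge: "1 + y + y\<^sup>2 / 2 \<le> exp y" using exp_lower_Taylor_quadratic[OF y(1)] by simp
  \<comment> \<open>It suffices that \<open>1 - y + y\<^sup>2\<close> dominates the reciprocal of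
    the Taylor lower bound of \<open>exp y\<close>; the product of the two has nonnegative terms
    beyond 1.\<close>
  have "(1 + y + y\<^sup>2 / 2) * (1 - y + y\<^sup>2) = 1 + y\<^sup>2 / 2 + y ^ 3 / 2 + y ^ 4 / 2"
    by (simp add: power2_eq_square power3_eq_cube power4_eq_xxxx field_simps)
  also have "\<dots> \<ge> 1" using y by simp
  finally have "1 / (1 + y + y\<^sup>2 / 2) \<le> 1 - y + y\<^sup>2"
    using y by (simp add: divide_le_eq add_pos_nonneg mult.commute)
  moreover have "exp (- y) \<le> 1 / (1 + y + y\<^sup>2 / 2)"
    using ge y by (simp add: exp_minus divide_simps add_pos_nonneg)
  ultimately show ?thesis using y by simp
qed

lemma prod_mono_ennreal:
  fixes g h :: "'i \<Rightarrow> ennreal"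
  assumes "\<And>i. i \<in> I \<Longrightarrow> g i \<le> h i"
  shows "prod g I \<le> prod h I"
  using assms by (induction I rule: infinite_finite_induct) (auto intro!: mult_mono)

text \<open>This isolates what chaining uses. Independence is stated for increments, since
  exponential moments are taken of increments; \<open>D_incr\<close> bounds the mass added along a
  level-\<open>l\<close> link by \<open>CARD('p) / 2 ^ l\<close>.\<close>

locale iid_orthants = prob_space M for M :: "'a measure" +
  fixes f :: "nat \<Rightarrow> real^'p \<Rightarrow> 'a \<Rightarrow> real" and D :: "real^'p \<Rightarrow> real"
  assumes f01: "f i u \<omega> \<in> {0, 1}"
    and f_mono: "(\<And>k. u $ k \<le> v $ k) \<Longrightarrow> f i u \<omega> \<le> f i v \<omega>"
    and f_min: "f i u \<omega> * f i v \<omega> = f i (vmin u v) \<omega>"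
    and f_meas[measurable]: "f i u \<in> borel_measurable M"
    and f_indep: "indep_vars (\<lambda>_. borel) (\<lambda>i \<omega>. f i b \<omega> - f i a \<omega>) UNIV"
    and f_exp: "expectation (f i u) = D u"
    and D_incr: "a \<in> cube \<Longrightarrow> b \<in> cube \<Longrightarrow> (\<And>k. a $ k \<le> b $ k) \<Longrightarrow> D b - D a \<le> (\<Sum>k\<in>UNIV. b $ k - a $ k)"
begin

lemma f_bound: "0 \<le> f i u \<omega>" "f i u \<omega> \<le> 1"
  using f01[of i u \<omega>] by auto

lemma f_integrable: "integrable M (f i u)"
  by (rule integrable_const_bound[where B=1]) (use f_bound in auto)

lemma D_bound: "0 \<le> D u" "D u \<le> 1"
proof -
  have "0 \<le> expectation (f 0 u)" using f_bound by (intro Bochner_Integration.integral_nonneg) auto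
  then show "0 \<le> D u" using f_exp by simp
  have "expectation (f 0 u) \<le> expectation (\<lambda>_. 1)" using f_bound f_integrable by (intro integral_mono) auto
  then show "D u \<le> 1" using f_exp by (simp add: prob_space)
qed

lemma D_mono: "(\<And>k. u $ k \<le> v $ k) \<Longrightarrow> D u \<le> D v"
  using integral_mono[OF f_integrable[of 0 u] f_integrable[of 0 v]] f_mono[of u v 0] f_exp by simp

lemma D_pair:
  assumes "(a, b) \<in> dpairs l" shows "D b - D a \<le> real CARD('p) / 2 ^ l" "0 \<le> D b - D a"
proof -
  have "D b - D a \<le> (\<Sum>k\<in>UNIV. b $ k - a $ k)"
    using assms by (intro D_incr) (auto simp: dpairs_def dgrid_def)
  also have "\<dots> \<le> (\<Sum>k\<in>(UNIV :: 'p set). 1 / 2 ^ l)"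
    using assms by (intro sum_mono) (auto simp: dpairs_def algebra_simps)
  finally show "D b - D a \<le> real CARD('p) / 2 ^ l" by simp
  show "0 \<le> D b - D a" using assms D_mono[of a b] by (auto simp: dpairs_def)
qed

definition T :: "nat set \<Rightarrow> real^'p \<Rightarrow> 'a \<Rightarrow> real" where
  "T I u \<omega> = (\<Sum>i\<in>I. f i u \<omega> - D u)"

definition level_max :: "nat set \<Rightarrow> nat \<Rightarrow> 'a \<Rightarrow> real" where
  "level_max I l \<omega> = Max ((\<lambda>e. \<bar>T I (snd e) \<omega> - T I (fst e) \<omega>\<bar>) ` dpairs l)"

text \<open>Chaining stops at the level where a cell has mass about \<open>1 / card I\<close>; below it the monotonicity of
  the orthant indicators costs only a constant.\<close>
definition Psi :: "nat set \<Rightarrow> nat \<Rightarrow> 'a \<Rightarrow> real" where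
  "Psi I m \<omega> = (if card I < 2 ^ m then 2 * 2 ^ m else 4 * (\<Sum>l\<in>{m..floor_log (card I)}. level_max I l \<omega>) + 4 * real CARD('p))"

lemma T_measurable[measurable]: "T I u \<in> borel_measurable M"
  unfolding T_def by measurable

lemma level_max_ge: "(a, b) \<in> dpairs l \<Longrightarrow> \<bar>T I b \<omega> - T I a \<omega>\<bar> \<le> level_max I l \<omega>"
  unfolding level_max_def by (rule Max_ge) (force intro: finite_imageI dpairs_finite)+

lemma level_max_nonneg: "0 \<le> level_max I l \<omega>"
proof -
  obtain a b :: "real^'p" where "(a, b) \<in> dpairs l" using dpairs_nonempty by (metis ex_in_conv surj_pair)
  then show ?thesis using level_max_ge[of a b l I \<omega>] by linarith
qed

lemma level_max_measurable[measurable]: "level_max I l \<in> borel_measurable M"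
  unfolding level_max_def by (intro borel_measurable_Max dpairs_finite) measurable

lemma Psi_measurable[measurable]: "Psi I m \<in> borel_measurable M"
  unfolding Psi_def by measurable

lemma Psi_nonneg: "0 \<le> Psi I m \<omega>"
  unfolding Psi_def using level_max_nonneg by (auto intro!: add_nonneg_nonneg sum_nonneg)

text \<open>Both the count of indicators and its mean are monotone in \<open>u\<close>, so they are
  trapped between their values at the dyadic floor and ceiling. What is lost beyond one link is the
  mean increment over that cell.\<close>

lemma T_sandwich:
  assumes u: "u \<in> cube" and I: "finite I"
  shows "\<bar>T I u \<omega> - T I (dfloor L u) \<omega>\<bar> \<le> level_max I L \<omega> + real (card I) * real CARD('p) / 2 ^ L"
proof -
  let ?a = "dfloor L u" and ?b = "dceil L u" and ?F = "\<lambda>u. \<Sum>i\<in>I. f i u \<omega>"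
  have T: "T I v \<omega> = ?F v - real (card I) * D v" for v by (simp add: T_def sum_subtractf)
  have ab: "(?a, ?b) \<in> dpairs L" by (rule dfloor_dceil_pair[OF u])
  have F: "?F ?a \<le> ?F u" "?F u \<le> ?F ?b"
    by (intro sum_mono f_mono dfloor_le le_dceil)+
  have "D ?a \<le> D u" "D u \<le> D ?b" by (intro D_mono dfloor_le le_dceil)+
  then have G: "real (card I) * D ?a \<le> real (card I) * D u" "real (card I) * D u \<le> real (card I) * D ?b"
    by (auto intro: mult_left_mono)
  have H: "real (card I) * D ?b - real (card I) * D ?a \<le> real (card I) * real CARD('p) / 2 ^ L"
    using mult_left_mono[OF D_pair(1)[OF ab], of "real (card I)"] by (simp add: algebra_simps)
  have "\<bar>T I ?b \<omega> - T I ?a \<omega>\<bar> \<le> level_max I L \<omega>" by (rule level_max_ge[OF ab])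
  then show ?thesis unfolding T using F G H by linarith
qed

lemma T_modulus_le_Psi:
  assumes I: "finite I" and u: "u \<in> cube" "v \<in> cube" and near: "\<And>k. \<bar>u $ k - v $ k\<bar> \<le> 1 / 2 ^ m"
  shows "\<bar>T I u \<omega> - T I v \<omega>\<bar> \<le> Psi I m \<omega>"
proof (cases "card I < 2 ^ m")
  case True
  have "\<bar>T I u \<omega> - T I v \<omega>\<bar> = \<bar>\<Sum>i\<in>I. (f i u \<omega> - D u) - (f i v \<omega> - D v)\<bar>"
    by (simp add: T_def sum_subtractf)
  also have "\<dots> \<le> (\<Sum>i\<in>I. \<bar>(f i u \<omega> - D u) - (f i v \<omega> - D v)\<bar>)" by (rule sum_abs)
  also have "\<dots> \<le> (\<Sum>i\<in>I. 2)"
  proof (rule sum_mono)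
    fix i show "\<bar>(f i u \<omega> - D u) - (f i v \<omega> - D v)\<bar> \<le> 2"
      using f_bound[of i u \<omega>] f_bound[of i v \<omega>] D_bound[of u] D_bound[of v] by linarith
  qed
  also have "\<dots> = 2 * real (card I)" by simp
  also have "\<dots> \<le> 2 * 2 ^ m" using True by (metis less_imp_le mult_le_cancel_left_pos of_nat_le_iff of_nat_numeral of_nat_power zero_less_numeral)
  finally show ?thesis using True by (simp add: Psi_def)
next
  case False
  let ?L = "floor_log (card I)"
  let ?S = "\<Sum>l\<in>{m..?L}. level_max I l \<omega>"
  have pos: "0 < card I" using False by (metis gr0I not_less zero_le zero_less_numeral zero_less_power)
  have L1: "2 ^ ?L \<le> card I" and L2: "card I < 2 * 2 ^ ?L"
    using floor_log_exp2_le[OF pos] floor_log_exp2_gt[of "card I"] by auto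
  have mL: "m \<le> ?L"
  proof (rule ccontr)
    assume "\<not> m \<le> ?L"
    then have "2 ^ Suc ?L \<le> (2 ^ m :: nat)" by (intro power_increasing) auto
    then show False using L2 False by simp
  qed
  have "\<bar>T I (dfloor ?L u) \<omega> - T I (dfloor ?L v) \<omega>\<bar> \<le> 2 * ?S"
    by (rule dyadic_modulus[where f="\<lambda>u. T I u \<omega>" and Mx="\<lambda>l. level_max I l \<omega>", OF _ u near mL]) (rule level_max_ge)
  moreover have "\<bar>T I u \<omega> - T I (dfloor ?L u) \<omega>\<bar> \<le> level_max I ?L \<omega> + real (card I) * real CARD('p) / 2 ^ ?L"
    "\<bar>T I v \<omega> - T I (dfloor ?L v) \<omega>\<bar> \<le> level_max I ?L \<omega> + real (card I) * real CARD('p) / 2 ^ ?L"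
    by (rule T_sandwich[OF u(1) I], rule T_sandwich[OF u(2) I])
  moreover have "level_max I ?L \<omega> \<le> ?S" using mL level_max_nonneg by (intro member_le_sum) auto
  \<comment> \<open>The stopping level satisfies \<open>2 ^ ?L \<le> card I < 2 * 2 ^ ?L\<close>, so
    the mean number of points in a cell is bounded; the two ends together give the summand
    \<open>4 * CARD('p)\<close> of \<open>Psi\<close>.\<close>
  moreover have "real (card I) * real CARD('p) / 2 ^ ?L \<le> 2 * real CARD('p)"
  proof -
    have "real (card I) \<le> 2 * 2 ^ ?L" using of_nat_mono[OF less_imp_le[OF L2], where 'a=real] by simp
    then have "real (card I) * real CARD('p) \<le> 2 * 2 ^ ?L * real CARD('p)" by (intro mult_right_mono) auto
    then show ?thesis by (simp add: divide_le_eq algebra_simps)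
  qed
  ultimately have "\<bar>T I u \<omega> - T I v \<omega>\<bar> \<le> 4 * ?S + 4 * real CARD('p)" by linarith
  then show ?thesis using False by (simp add: Psi_def)
qed

text \<open>Along a link the increment is a \<open>{0, 1}\<close> variable of mean \<open>d\<close>,
  hence equals its own square and has variance \<open>d - d\<^sup>2\<close>. The quadratic bound of
  the exponential on \<open>[-1, 1]\<close> turns this variance into the exponent.\<close>

lemma exp_moment_single:
  assumes ab: "(a, b) \<in> dpairs l" and \<theta>: "\<bar>\<theta>\<bar> \<le> 1"
  shows "(\<integral>\<^sup>+\<omega>. ennreal (exp (\<theta> * ((f i b \<omega> - D b) - (f i a \<omega> - D a)))) \<partial>M) \<le> ennreal (exp (\<theta>\<^sup>2 * (real CARD('p) / 2 ^ l)))"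
proof -
  define g where "g \<omega> = f i b \<omega> - f i a \<omega>" for \<omega>
  define d where "d = D b - D a"
  have g01: "g \<omega> \<in> {0, 1}" for \<omega>
    using f01[of i b \<omega>] f01[of i a \<omega>] f_mono[of a b i \<omega>] ab by (auto simp: g_def dpairs_def)
  then have gsq: "(g \<omega>)\<^sup>2 = g \<omega>" for \<omega> by (smt (verit) empty_iff insert_iff one_power2 zero_power2)
  have gi: "integrable M g" unfolding g_def using f_integrable by auto
  have gE: "expectation g = d" unfolding g_def d_def using f_integrable f_exp by simp
  have d: "0 \<le> d" "d \<le> real CARD('p) / 2 ^ l" "d \<le> 1"
    unfolding d_def using D_pair[OF ab] D_bound[of a] D_bound[of b] by auto
  have Y: "(f i b \<omega> - D b) - (f i a \<omega> - D a) = g \<omega> - d" for \<omega> by (simp add: g_def d_def)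
  have pt: "exp (\<theta> * (g \<omega> - d)) \<le> 1 + \<theta> * (g \<omega> - d) + \<theta>\<^sup>2 * (g \<omega> - 2 * d * g \<omega> + d\<^sup>2)" for \<omega>
  proof -
    have "\<bar>g \<omega> - d\<bar> \<le> 1" using g01[of \<omega>] d by auto
    then have "\<bar>\<theta> * (g \<omega> - d)\<bar> \<le> 1" using \<theta> mult_mono[of "\<bar>\<theta>\<bar>" 1 "\<bar>g \<omega> - d\<bar>" 1] by (simp add: abs_mult)
    moreover have "(\<theta> * (g \<omega> - d))\<^sup>2 = \<theta>\<^sup>2 * (g \<omega> - 2 * d * g \<omega> + d\<^sup>2)"
      using gsq[of \<omega>] by (simp add: power_mult_distrib power2_diff)
    ultimately show ?thesis using exp_le_quadratic[of "\<theta> * (g \<omega> - d)"] by simp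
  qed
  have [measurable]: "g \<in> borel_measurable M" using gi by auto
  have "(\<integral>\<^sup>+\<omega>. ennreal (exp (\<theta> * (g \<omega> - d))) \<partial>M) \<le> (\<integral>\<^sup>+\<omega>. ennreal (1 + \<theta> * (g \<omega> - d) + \<theta>\<^sup>2 * (g \<omega> - 2 * d * g \<omega> + d\<^sup>2)) \<partial>M)"
    by (intro nn_integral_mono ennreal_leI pt)
  also have "\<dots> = ennreal (expectation (\<lambda>\<omega>. 1 + \<theta> * (g \<omega> - d) + \<theta>\<^sup>2 * (g \<omega> - 2 * d * g \<omega> + d\<^sup>2)))"
    using gi order_trans[OF _ pt] by (intro nn_integral_eq_integral) (auto intro!: AE_I2)
  also have "expectation (\<lambda>\<omega>. 1 + \<theta> * (g \<omega> - d) + \<theta>\<^sup>2 * (g \<omega> - 2 * d * g \<omega> + d\<^sup>2)) = 1 + \<theta>\<^sup>2 * (d - d\<^sup>2)"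
    using gi gE by (simp add: prob_space power2_eq_square)
  also have "\<dots> \<le> 1 + \<theta>\<^sup>2 * (real CARD('p) / 2 ^ l)" using d by (intro add_left_mono mult_left_mono) (auto intro: order_trans[of _ d])
  also have "\<dots> \<le> exp (\<theta>\<^sup>2 * (real CARD('p) / 2 ^ l))" by (rule exp_ge_add_one_self)
  finally show ?thesis unfolding Y by (simp add: ennreal_leI)
qed

lemma exp_moment_T:
  assumes I: "finite I" and ab: "(a, b) \<in> dpairs l" and \<theta>: "\<bar>\<theta>\<bar> \<le> 1"
  shows "(\<integral>\<^sup>+\<omega>. ennreal (exp (\<theta> * (T I b \<omega> - T I a \<omega>))) \<partial>M) \<le> ennreal (exp (real (card I) * \<theta>\<^sup>2 * (real CARD('p) / 2 ^ l)))"
proof -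
  let ?Y = "\<lambda>i \<omega>. (f i b \<omega> - D b) - (f i a \<omega> - D a)"
  have ind: "indep_vars (\<lambda>_. borel) (\<lambda>i \<omega>. ennreal (exp (\<theta> * ?Y i \<omega>))) I"
  proof -
    have "indep_vars (\<lambda>_. borel) (\<lambda>i \<omega>. (\<lambda>x. ennreal (exp (\<theta> * (x - (D b - D a))))) (f i b \<omega> - f i a \<omega>)) I"
      by (rule indep_vars_compose2[OF indep_vars_subset[OF f_indep]]) auto
    then show ?thesis by (simp add: algebra_simps)
  qed
  have "exp (\<theta> * (T I b \<omega> - T I a \<omega>)) = (\<Prod>i\<in>I. exp (\<theta> * ?Y i \<omega>))" for \<omega>
    using I by (simp add: T_def sum_subtractf[symmetric] sum_distrib_left exp_sum)
  then have "(\<integral>\<^sup>+\<omega>. ennreal (exp (\<theta> * (T I b \<omega> - T I a \<omega>))) \<partial>M) = (\<integral>\<^sup>+\<omega>. (\<Prod>i\<in>I. ennreal (exp (\<theta> * ?Y i \<omega>))) \<partial>M)"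
    by (simp add: prod_ennreal)
  also have "\<dots> = (\<Prod>i\<in>I. \<integral>\<^sup>+\<omega>. ennreal (exp (\<theta> * ?Y i \<omega>)) \<partial>M)"
    by (rule indep_vars_nn_integral[OF I ind]) simp
  also have "\<dots> \<le> (\<Prod>i\<in>I. ennreal (exp (\<theta>\<^sup>2 * (real CARD('p) / 2 ^ l))))"
    by (intro prod_mono_ennreal exp_moment_single[OF ab \<theta>])
  also have "\<dots> = ennreal (exp (real (card I) * \<theta>\<^sup>2 * (real CARD('p) / 2 ^ l)))"
    by (simp add: ennreal_power exp_of_nat_mult[symmetric] mult.assoc)
  finally show ?thesis .
qed

text \<open>The choice \<open>lam = sqrt (2 ^ l / card I)\<close> makes the exponent
  \<open>card I * lam\<^sup>2 * CARD('p) / 2 ^ l\<close> equal to \<open>CARD('p)\<close> at every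
  level. The hypothesis on \<open>l\<close> says exactly \<open>lam \<le> 1\<close>, the range of
  the quadratic bound; this is why the chain cannot continue below cells of mass about
  \<open>1 / card I\<close>.\<close>

lemma level_max_expectation:
  assumes I: "finite I" and l: "2 ^ l \<le> card I"
  shows "(\<integral>\<^sup>+\<omega>. ennreal (level_max I l \<omega>) \<partial>M) \<le> ennreal (sqrt (real (card I)) * (entropy_bound TYPE('p) l / sqrt (2 ^ l)))"
proof -
  let ?k = "real (card I)"
  define lam where "lam = sqrt (2 ^ l) / sqrt ?k"
  have lk: "2 ^ l \<le> ?k" using l by (metis of_nat_le_iff of_nat_numeral of_nat_power)
  have k: "0 < ?k" using lk by (smt (verit) zero_less_power)
  have lam: "0 < lam" "lam \<le> 1" using k lk by (auto simp: lam_def divide_le_eq)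
  have e: "?k * lam\<^sup>2 * (real CARD('p) / 2 ^ l) = real CARD('p)" using k by (simp add: lam_def power_divide)
  have up: "(\<integral>\<^sup>+\<omega>. ennreal (exp (lam * (T I (snd e) \<omega> - T I (fst e) \<omega>))) \<partial>M) \<le> ennreal (exp (real CARD('p)))"
    and dn: "(\<integral>\<^sup>+\<omega>. ennreal (exp (- lam * (T I (snd e) \<omega> - T I (fst e) \<omega>))) \<partial>M) \<le> ennreal (exp (real CARD('p)))"
    if "e \<in> dpairs l" for e
    using exp_moment_T[OF I, of "fst e" "snd e" l lam] exp_moment_T[OF I, of "fst e" "snd e" l "- lam"] that lam e
    by auto
  have "(\<integral>\<^sup>+\<omega>. ennreal (level_max I l \<omega>) \<partial>M) \<le> ennreal ((ln (2 * real (card (dpairs l :: ((real^'p) \<times> (real^'p)) set))) + real CARD('p) + 1) / lam)"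
    unfolding level_max_def
    by (rule nn_integral_Max_abs_le[OF dpairs_finite dpairs_nonempty lam(1) _ _ up dn]) auto
  also have "\<dots> \<le> ennreal (entropy_bound TYPE('p) l / lam)"
    using lam by (intro ennreal_leI divide_right_mono entropy_bound_ge) auto
  also have "entropy_bound TYPE('p) l / lam = sqrt ?k * (entropy_bound TYPE('p) l / sqrt (2 ^ l))" by (simp add: lam_def)
  finally show ?thesis .
qed

text \<open>For fixed \<open>m\<close> the additive constant becomes negligible after division by
  \<open>sqrt (card I)\<close>, while the leading coefficient is small for large \<open>m\<close>.
  Hence \<open>m\<close> is chosen first and the sample size afterwards.\<close>

lemma Psi_expectation:
  assumes I: "finite I"
  shows "(\<integral>\<^sup>+\<omega>. ennreal (Psi I m \<omega>) \<partial>M) \<le> ennreal (entropy_tail TYPE('p) m * sqrt (real (card I)) + (4 * real CARD('p) + 2 * 2 ^ m))"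
proof (cases "card I < 2 ^ m")
  case True
  then have "(\<integral>\<^sup>+\<omega>. ennreal (Psi I m \<omega>) \<partial>M) = ennreal (2 * 2 ^ m)" by (simp add: Psi_def emeasure_space_1)
  then show ?thesis using entropy_tail_nonneg[of "TYPE('p)" m] by (auto intro!: ennreal_leI add_increasing)
next
  case False
  let ?L = "floor_log (card I)"
  have pos: "0 < card I" using False by (metis gr0I not_less zero_le zero_less_numeral zero_less_power)
  have ll: "2 ^ l \<le> card I" if "l \<in> {m..?L}" for l
    using that by (intro le_trans[OF power_increasing[of l ?L "2::nat"] floor_log_exp2_le[OF pos]]) auto
  have kn: "0 \<le> sqrt (real (card I)) * (entropy_bound TYPE('p) l / sqrt (2 ^ l))" for l
    using entropy_bound_nonneg[of "TYPE('p)" l] by simp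
  have "(\<integral>\<^sup>+\<omega>. ennreal (Psi I m \<omega>) \<partial>M) = (\<integral>\<^sup>+\<omega>. ennreal 4 * (\<Sum>l\<in>{m..?L}. ennreal (level_max I l \<omega>)) + ennreal (4 * real CARD('p)) \<partial>M)"
    using False level_max_nonneg by (intro nn_integral_cong) (simp add: Psi_def ennreal_mult sum_nonneg del: sum_ennreal add: sum_ennreal[symmetric])
  also have "\<dots> = ennreal 4 * (\<Sum>l\<in>{m..?L}. \<integral>\<^sup>+\<omega>. ennreal (level_max I l \<omega>) \<partial>M) + ennreal (4 * real CARD('p))"
    by (simp add: nn_integral_add nn_integral_cmult nn_integral_sum emeasure_space_1)
  also have "\<dots> \<le> ennreal 4 * (\<Sum>l\<in>{m..?L}. ennreal (sqrt (real (card I)) * (entropy_bound TYPE('p) l / sqrt (2 ^ l)))) + ennreal (4 * real CARD('p))"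
    by (intro add_right_mono mult_left_mono sum_mono level_max_expectation[OF I ll]) auto
  also have "\<dots> = ennreal (4 * (\<Sum>l\<in>{m..?L}. sqrt (real (card I)) * (entropy_bound TYPE('p) l / sqrt (2 ^ l))) + 4 * real CARD('p))"
  proof -
    have s0: "0 \<le> (\<Sum>l\<in>{m..?L}. sqrt (real (card I)) * (entropy_bound TYPE('p) l / sqrt (2 ^ l)))" by (intro sum_nonneg kn)
    then have "ennreal (4 * (\<Sum>l\<in>{m..?L}. sqrt (real (card I)) * (entropy_bound TYPE('p) l / sqrt (2 ^ l))) + 4 * real CARD('p))
      = ennreal 4 * ennreal (\<Sum>l\<in>{m..?L}. sqrt (real (card I)) * (entropy_bound TYPE('p) l / sqrt (2 ^ l))) + ennreal (4 * real CARD('p))"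
      by (subst ennreal_plus, linarith, simp, subst ennreal_mult, auto)
    then show ?thesis by (simp only: sum_ennreal[OF kn])
  qed
  also have "\<dots> \<le> ennreal (entropy_tail TYPE('p) m * sqrt (real (card I)) + (4 * real CARD('p) + 2 * 2 ^ m))"
  proof (rule ennreal_leI)
    have "4 * (\<Sum>l\<in>{m..?L}. sqrt (real (card I)) * (entropy_bound TYPE('p) l / sqrt (2 ^ l)))
        = sqrt (real (card I)) * (4 * (\<Sum>l\<in>{m..?L}. entropy_bound TYPE('p) l / sqrt (2 ^ l)))"
      by (simp add: sum_distrib_left algebra_simps)
    also have "\<dots> \<le> sqrt (real (card I)) * entropy_tail TYPE('p) m" by (intro mult_left_mono entropy_bound_sum_le) simp
    finally show "4 * (\<Sum>l\<in>{m..?L}. sqrt (real (card I)) * (entropy_bound TYPE('p) l / sqrt (2 ^ l))) + 4 * real CARD('p)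
      \<le> entropy_tail TYPE('p) m * sqrt (real (card I)) + (4 * real CARD('p) + 2 * 2 ^ m)" by (simp add: mult.commute add_increasing2)
  qed
  finally show ?thesis .
qed

end

section \<open>A multiplier inequality\<close>

text \<open>Jensen's inequality for the square root, in the form that the variance of the square
  root of the count is nonnegative.\<close>

lemma (in prob_space) nn_integral_sqrt_card_le:
  fixes n :: nat
  assumes E[measurable]: "\<And>i. i < n \<Longrightarrow> E i \<in> sets M" and q: "\<And>i. i < n \<Longrightarrow> prob (E i) \<le> q" and q0: "0 \<le> q"
  shows "(\<integral>\<^sup>+\<omega>. ennreal (sqrt (real (card {i. i < n \<and> \<omega> \<in> E i}))) \<partial>M) \<le> ennreal (sqrt (real n * q))"
proof -
  let ?c = "\<lambda>\<omega>. \<Sum>i<n. indicator (E i) \<omega> :: real"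
  have c: "real (card {i. i < n \<and> \<omega> \<in> E i}) = ?c \<omega>" for \<omega>
  proof -
    have "?c \<omega> = (\<Sum>i\<in>{i. i < n \<and> \<omega> \<in> E i}. 1)"
      by (rule sum.mono_neutral_cong_right) (auto simp: indicator_def)
    then show ?thesis by simp
  qed
  have [measurable]: "?c \<in> borel_measurable M" by (rule borel_measurable_sum) auto
  have cn: "0 \<le> ?c \<omega>" "?c \<omega> \<le> real n" for \<omega>
    by (auto intro: sum_nonneg) (use sum_bounded_above[of "{..<n}" "\<lambda>i. indicator (E i) \<omega> :: real" 1] in \<open>auto simp: indicator_def\<close>)
  have i1: "integrable M (\<lambda>\<omega>. sqrt (?c \<omega>))"
    by (rule integrable_const_bound[where B="sqrt (real n)"]) (use cn in auto)
  have i2: "integrable M ?c"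
    by (rule integrable_const_bound[where B="real n"]) (use cn in auto)
  have "(expectation (\<lambda>\<omega>. sqrt (?c \<omega>)))\<^sup>2 \<le> expectation (\<lambda>\<omega>. (sqrt (?c \<omega>))\<^sup>2)"
    using variance_eq[of "\<lambda>\<omega>. sqrt (?c \<omega>)"] variance_positive[of "\<lambda>\<omega>. sqrt (?c \<omega>)"] i1 i2 cn by simp
  also have "\<dots> = (\<Sum>i<n. prob (E i))" using cn E
    by (simp add: Bochner_Integration.integral_sum integrable_indicator_iff emeasure_eq_measure)
  also have "\<dots> \<le> (\<Sum>i<n. q)" by (intro sum_mono q) auto
  finally have "expectation (\<lambda>\<omega>. sqrt (?c \<omega>)) \<le> sqrt (real n * q)" by (simp add: real_le_rsqrt)
  moreover have "(\<integral>\<^sup>+\<omega>. ennreal (sqrt (?c \<omega>)) \<partial>M) = ennreal (expectation (\<lambda>\<omega>. sqrt (?c \<omega>)))"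
    by (rule nn_integral_eq_integral[OF i1]) (use cn in auto)
  ultimately show ?thesis unfolding c by (simp add: ennreal_leI)
qed

lemma (in prob_space) nn_integral_layer_cake:
  assumes X[measurable]: "X \<in> borel_measurable M"
  shows "(\<integral>\<^sup>+t. indicator {0..} t * emeasure M {\<omega>\<in>space M. t < X \<omega>} \<partial>lborel) = (\<integral>\<^sup>+\<omega>. ennreal (X \<omega>) \<partial>M)"
proof -
  interpret pair_sigma_finite lborel M ..
  have "(\<integral>\<^sup>+t. indicator {0..} t * emeasure M {\<omega>\<in>space M. t < X \<omega>} \<partial>lborel)
      = (\<integral>\<^sup>+t. \<integral>\<^sup>+\<omega>. indicator {0..} t * indicator {0<..} (X \<omega> - t) \<partial>M \<partial>lborel)"
  proof (rule nn_integral_cong)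
    fix t :: real
    have "(\<integral>\<^sup>+\<omega>. indicator {0..} t * indicator {0<..} (X \<omega> - t) \<partial>M) = indicator {0..} t * (\<integral>\<^sup>+\<omega>. indicator {0<..} (X \<omega> - t) \<partial>M)"
      by (rule nn_integral_cmult) measurable
    also have "(\<integral>\<^sup>+\<omega>. indicator {0<..} (X \<omega> - t) \<partial>M) = (\<integral>\<^sup>+\<omega>. indicator {\<omega>\<in>space M. t < X \<omega>} \<omega> \<partial>M)"
      by (rule nn_integral_cong) (auto simp: indicator_def)
    also have "\<dots> = emeasure M {\<omega>\<in>space M. t < X \<omega>}" by (rule nn_integral_indicator) measurable
    finally show "indicator {0..} t * emeasure M {\<omega>\<in>space M. t < X \<omega>} = (\<integral>\<^sup>+\<omega>. indicator {0..} t * indicator {0<..} (X \<omega> - t) \<partial>M)" by simp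
  qed
  also have "\<dots> = (\<integral>\<^sup>+\<omega>. \<integral>\<^sup>+t. indicator {0..} t * indicator {0<..} (X \<omega> - t) \<partial>lborel \<partial>M)"
    by (rule Fubini'[symmetric]) measurable
  also have "\<dots> = (\<integral>\<^sup>+\<omega>. ennreal (X \<omega>) \<partial>M)"
  proof (rule nn_integral_cong)
    fix \<omega>
    have "(\<integral>\<^sup>+t. indicator {0..} t * indicator {0<..} (X \<omega> - t) \<partial>lborel) = (\<integral>\<^sup>+t. indicator {0..<X \<omega>} t \<partial>lborel)"
      by (rule nn_integral_cong) (auto simp: indicator_def)
    also have "\<dots> = emeasure lborel {0..<X \<omega>}" by (rule nn_integral_indicator) simp
    also have "\<dots> = ennreal (X \<omega>)"
      by (cases "0 \<le> X \<omega>") (auto simp: ennreal_neg)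
    finally show "(\<integral>\<^sup>+t. indicator {0..} t * indicator {0<..} (X \<omega> - t) \<partial>lborel) = ennreal (X \<omega>)" .
  qed
  finally show ?thesis .
qed

context iid_orthants
begin

definition level_set :: "nat \<Rightarrow> (nat \<Rightarrow> 'a \<Rightarrow> real) \<Rightarrow> real \<Rightarrow> 'a \<Rightarrow> nat set" where
  "level_set n \<xi> t \<omega> = {i. i < n \<and> t < \<xi> i \<omega>}"

text \<open>Layer cake: a nonnegative multiplier is the integral over \<open>t\<close> of the indicator of \<open>t < \<xi> i\<close>, so the
  weighted sum is an integral of unweighted sums over the level sets.\<close>
definition mult_maj :: "nat \<Rightarrow> (nat \<Rightarrow> 'a \<Rightarrow> real) \<Rightarrow> nat \<Rightarrow> 'a \<Rightarrow> ennreal" where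
  "mult_maj n \<xi> m \<omega> = (\<integral>\<^sup>+t. indicator {0..} t *
     (\<Sum>J\<in>Pow {..<n} - {{}}. ennreal (Psi J m \<omega>) * indicator {\<omega>. level_set n \<xi> t \<omega> = J} \<omega>) \<partial>lborel)"

text \<open>Splitting by the value \<open>J\<close> of the level set replaces \<open>Psi\<close> at
  a random set by finitely many fixed ones, to which independence applies one at a time. The empty
  set is left out because \<open>Psi {} m\<close> is \<open>2 * 2 ^ m\<close>, not 0, and would make
  the integral over all \<open>t\<close> infinite.\<close>

lemma level_set_sum:
  fixes g :: "nat set \<Rightarrow> ennreal"
  shows "(\<Sum>J\<in>Pow {..<n} - {{}}. g J * indicator {\<omega>. level_set n \<xi> t \<omega> = J} \<omega>) = (if level_set n \<xi> t \<omega> = {} then 0 else g (level_set n \<xi> t \<omega>))"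
proof -
  have "(\<Sum>J\<in>Pow {..<n} - {{}}. g J * indicator {\<omega>. level_set n \<xi> t \<omega> = J} \<omega>)
      = (\<Sum>J\<in>Pow {..<n} - {{}}. if J = level_set n \<xi> t \<omega> then g J else 0)"
    by (rule sum.cong) (auto simp: indicator_def)
  also have "\<dots> = (if level_set n \<xi> t \<omega> \<in> Pow {..<n} - {{}} then g (level_set n \<xi> t \<omega>) else 0)"
    by (rule sum.delta) auto
  finally show ?thesis by (auto simp: level_set_def)
qed

lemma mult_maj_ge:
  assumes \<xi>: "\<And>i. i < n \<Longrightarrow> 0 \<le> \<xi> i \<omega>"
    and u: "u \<in> cube" "v \<in> cube" and near: "\<And>k. \<bar>u $ k - v $ k\<bar> \<le> 1 / 2 ^ m"
  shows "ennreal \<bar>\<Sum>i<n. \<xi> i \<omega> * ((f i u \<omega> - D u) - (f i v \<omega> - D v))\<bar> \<le> mult_maj n \<xi> m \<omega>"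
proof -
  define d where "d i = (f i u \<omega> - D u) - (f i v \<omega> - D v)" for i
  let ?g = "\<lambda>t. \<Sum>i<n. indicator {0..<\<xi> i \<omega>} t * d i"
  have int: "integrable lborel (\<lambda>t. indicator {0..<\<xi> i \<omega>} t * d i)" if "i < n" for i
    by (intro integrable_mult_left) (simp add: integrable_indicator_iff \<xi> that)
  have "(\<integral>t. ?g t \<partial>lborel) = (\<Sum>i<n. \<xi> i \<omega> * d i)"
    using int \<xi> by (subst Bochner_Integration.integral_sum) (auto simp: integrable_indicator_iff)
  then have "ennreal \<bar>\<Sum>i<n. \<xi> i \<omega> * d i\<bar> \<le> (\<integral>\<^sup>+t. ennreal (norm (?g t)) \<partial>lborel)"
  proof -
    assume eq: "(\<integral>t. ?g t \<partial>lborel) = (\<Sum>i<n. \<xi> i \<omega> * d i)"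
    have "integrable lborel ?g" using int by (intro Bochner_Integration.integrable_sum) auto
    from integral_norm_bound_ennreal[OF this] show ?thesis by (simp only: eq real_norm_def)
  qed
  also have "\<dots> \<le> mult_maj n \<xi> m \<omega>"
    unfolding mult_maj_def
  proof (rule nn_integral_mono)
    fix t :: real
    have "?g t = (if 0 \<le> t then \<Sum>i\<in>level_set n \<xi> t \<omega>. d i else 0)"
      by (auto simp: level_set_def indicator_def intro!: sum.neutral sum.mono_neutral_cong_right)
    moreover have "(\<Sum>i\<in>level_set n \<xi> t \<omega>. d i) = T (level_set n \<xi> t \<omega>) u \<omega> - T (level_set n \<xi> t \<omega>) v \<omega>"
      by (simp add: T_def d_def sum_subtractf)
    moreover have "\<bar>T (level_set n \<xi> t \<omega>) u \<omega> - T (level_set n \<xi> t \<omega>) v \<omega>\<bar> \<le> Psi (level_set n \<xi> t \<omega>) m \<omega>"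
      by (rule T_modulus_le_Psi[OF _ u near]) (simp add: level_set_def)
    ultimately have "norm (?g t) \<le> (if 0 \<le> t \<and> level_set n \<xi> t \<omega> \<noteq> {} then Psi (level_set n \<xi> t \<omega>) m \<omega> else 0)"
      by (auto simp: T_def)
    then have "ennreal (norm (?g t)) \<le> ennreal (if 0 \<le> t \<and> level_set n \<xi> t \<omega> \<noteq> {} then Psi (level_set n \<xi> t \<omega>) m \<omega> else 0)"
      by (rule ennreal_leI)
    then show "ennreal (norm (?g t)) \<le> indicator {0..} t * (\<Sum>J\<in>Pow {..<n} - {{}}. ennreal (Psi J m \<omega>) * indicator {\<omega>. level_set n \<xi> t \<omega> = J} \<omega>)"
      unfolding level_set_sum by (auto simp: indicator_def split: if_splits)
  qed
  finally show ?thesis unfolding d_def .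
qed

context
  fixes n :: nat and \<xi> :: "nat \<Rightarrow> 'a \<Rightarrow> real"
  assumes \<xi>_meas[measurable]: "\<And>i. i < n \<Longrightarrow> \<xi> i \<in> borel_measurable M"
begin

lemma level_set_pred_measurable: "Measurable.pred (lborel \<Otimes>\<^sub>M M) (\<lambda>(t, \<omega>). level_set n \<xi> t \<omega> = J)"
proof (cases "J \<subseteq> {..<n}")
  case True
  have "(\<lambda>(t, \<omega>). level_set n \<xi> t \<omega> = J) = (\<lambda>(t, \<omega>). \<forall>i<n. (t < \<xi> i \<omega>) = (i \<in> J))"
    using True by (auto simp: level_set_def fun_eq_iff set_eq_iff)
  moreover have "Measurable.pred (lborel \<Otimes>\<^sub>M M) (\<lambda>(t, \<omega>). \<forall>i<n. (t < \<xi> i \<omega>) = (i \<in> J))"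
    unfolding split_beta' by measurable
  ultimately show ?thesis by simp
next
  case False
  then have "(\<lambda>(t, \<omega>). level_set n \<xi> t \<omega> = J) = (\<lambda>_. False)" by (auto simp: level_set_def fun_eq_iff)
  then show ?thesis by simp
qed

lemma level_set_set_measurable[measurable]: "{\<omega>\<in>space M. level_set n \<xi> t \<omega> = J} \<in> sets M"
proof -
  have "(\<lambda>\<omega>. (t, \<omega>)) \<in> measurable M (lborel \<Otimes>\<^sub>M M)" by measurable
  from measurable_compose[OF this level_set_pred_measurable[of J]]
  have "Measurable.pred M (\<lambda>\<omega>. level_set n \<xi> t \<omega> = J)" by simp
  then show ?thesis by measurable
qed

lemma level_set_indicator_measurable:
  "(\<lambda>(t, \<omega>). indicator {\<omega>. level_set n \<xi> t \<omega> = J} \<omega> :: ennreal) \<in> borel_measurable (lborel \<Otimes>\<^sub>M M)"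
proof -
  have "(\<lambda>(t, \<omega>). indicator {\<omega>. level_set n \<xi> t \<omega> = J} \<omega> :: ennreal) = (\<lambda>x. if (case x of (t, \<omega>) \<Rightarrow> level_set n \<xi> t \<omega> = J) then 1 else 0)"
    by (auto simp: fun_eq_iff indicator_def)
  then show ?thesis using level_set_pred_measurable[of J] by simp
qed

lemma mult_maj_integrand_measurable:
  "(\<lambda>(t, \<omega>). indicator {0..} t * (\<Sum>J\<in>Pow {..<n} - {{}}. ennreal (Psi J m \<omega>) * indicator {\<omega>. level_set n \<xi> t \<omega> = J} \<omega>))
     \<in> borel_measurable (lborel \<Otimes>\<^sub>M M)"
proof -
  have "(\<lambda>x. indicator {\<omega>. level_set n \<xi> (fst x) \<omega> = J} (snd x) :: ennreal) \<in> borel_measurable (lborel \<Otimes>\<^sub>M M)" for J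
    using level_set_indicator_measurable[of J] by (simp add: split_beta')
  then have "(\<lambda>x. ennreal (Psi J m (snd x)) * indicator {\<omega>. level_set n \<xi> (fst x) \<omega> = J} (snd x)) \<in> borel_measurable (lborel \<Otimes>\<^sub>M M)" for J
    by (rule borel_measurable_times_ennreal[rotated]) measurable
  then have "(\<lambda>x. \<Sum>J\<in>Pow {..<n} - {{}}. ennreal (Psi J m (snd x)) * indicator {\<omega>. level_set n \<xi> (fst x) \<omega> = J} (snd x)) \<in> borel_measurable (lborel \<Otimes>\<^sub>M M)"
    by (rule borel_measurable_sum)
  then show ?thesis unfolding split_beta' by (rule borel_measurable_times_ennreal[rotated]) measurable
qed

lemma mult_maj_measurable: "mult_maj n \<xi> m \<in> borel_measurable M"
proof -
  interpret pair_sigma_finite lborel M ..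
  have "(\<lambda>(\<omega>, t). indicator {0..} t * (\<Sum>J\<in>Pow {..<n} - {{}}. ennreal (Psi J m \<omega>) * indicator {\<omega>. level_set n \<xi> t \<omega> = J} \<omega>))
     \<in> borel_measurable (M \<Otimes>\<^sub>M lborel)"
    using measurable_pair_swap[OF mult_maj_integrand_measurable[of m]] by (simp add: split_beta')
  then show ?thesis unfolding mult_maj_def[abs_def] using lborel.borel_measurable_nn_integral by blast
qed

text \<open>\<open>X\<close> dominates the individual multipliers and \<open>Y\<close> all of them
  at once. The leading term of \<open>Psi_expectation\<close> meets the mean square root of the size
  of the level set, at most \<open>sqrt (n * q t)\<close>. Its constant term counts only while the
  level set is nonempty, which forces \<open>t < Y\<close>, so integration over \<open>t\<close>
  yields the mean of \<open>Y\<close>.\<close>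

lemma mult_maj_expectation:
  assumes ind: "\<And>t J. J \<subseteq> {..<n} \<Longrightarrow> (\<integral>\<^sup>+\<omega>. ennreal (Psi J m \<omega>) * indicator {\<omega>. level_set n \<xi> t \<omega> = J} \<omega> \<partial>M)
      = emeasure M {\<omega>\<in>space M. level_set n \<xi> t \<omega> = J} * (\<integral>\<^sup>+\<omega>. ennreal (Psi J m \<omega>) \<partial>M)"
    and X: "\<And>i. i < n \<Longrightarrow> X i \<in> borel_measurable M" "\<And>i \<omega>. i < n \<Longrightarrow> \<xi> i \<omega> \<le> X i \<omega>"
    and q: "\<And>i t. i < n \<Longrightarrow> prob {\<omega>\<in>space M. t < X i \<omega>} \<le> q t" "\<And>t. 0 \<le> q t" "q \<in> borel_measurable borel"
    and Y: "Y \<in> borel_measurable M" "\<And>i \<omega>. i < n \<Longrightarrow> X i \<omega> \<le> Y \<omega>"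
  shows "(\<integral>\<^sup>+\<omega>. mult_maj n \<xi> m \<omega> \<partial>M) \<le>
    ennreal (entropy_tail TYPE('p) m * sqrt (real n)) * (\<integral>\<^sup>+t. indicator {0..} t * ennreal (sqrt (q t)) \<partial>lborel)
    + ennreal (4 * real CARD('p) + 2 * 2 ^ m) * (\<integral>\<^sup>+\<omega>. ennreal (Y \<omega>) \<partial>M)"
proof -
  note X(1)[measurable] Y(1)[measurable] q(3)[measurable]
  have mY: "(\<lambda>t. emeasure M {\<omega>\<in>space M. t < Y \<omega>}) \<in> borel_measurable lborel"
  proof -
    have "{x\<in>space (lborel \<Otimes>\<^sub>M M). fst x < Y (snd x)} \<in> sets (lborel \<Otimes>\<^sub>M M)" by measurable
    from measurable_emeasure_Pair[OF this] show ?thesis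
      by (simp add: space_pair_measure vimage_def)
  qed
  interpret pair_sigma_finite lborel M ..
  let ?\<tau> = "entropy_tail TYPE('p) m" and ?c = "4 * real CARD('p) + 2 * 2 ^ m :: real"
  have t0: "0 \<le> ?\<tau>" by (rule entropy_tail_nonneg)
  have inner: "(\<integral>\<^sup>+\<omega>. (\<Sum>J\<in>Pow {..<n} - {{}}. ennreal (Psi J m \<omega>) * indicator {\<omega>. level_set n \<xi> t \<omega> = J} \<omega>) \<partial>M)
      \<le> ennreal (?\<tau> * sqrt (real n)) * ennreal (sqrt (q t)) + ennreal ?c * emeasure M {\<omega>\<in>space M. t < Y \<omega>}" for t
  proof -
    have m1: "(\<lambda>\<omega>. indicator {\<omega>. level_set n \<xi> t \<omega> = J} \<omega> :: ennreal) \<in> borel_measurable M" for J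
    proof -
      have "(\<lambda>\<omega>. (t, \<omega>)) \<in> measurable M (lborel \<Otimes>\<^sub>M M)" by measurable
      from measurable_compose[OF this level_set_indicator_measurable[of J]] show ?thesis by simp
    qed
    have em: "(\<integral>\<^sup>+\<omega>. indicator {\<omega>. level_set n \<xi> t \<omega> = J} \<omega> \<partial>M) = emeasure M {\<omega>\<in>space M. level_set n \<xi> t \<omega> = J}" for J
    proof -
      have "(\<integral>\<^sup>+\<omega>. indicator {\<omega>. level_set n \<xi> t \<omega> = J} \<omega> \<partial>M) = (\<integral>\<^sup>+\<omega>. indicator {\<omega>\<in>space M. level_set n \<xi> t \<omega> = J} \<omega> \<partial>M)"
        by (rule nn_integral_cong) (auto simp: indicator_def)
      then show ?thesis using nn_integral_indicator[OF level_set_set_measurable[of t J]] by simp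
    qed
    define g where "g J = ennreal ?\<tau> * ennreal (sqrt (real (card J))) + ennreal ?c" for J :: "nat set"
    have "(\<integral>\<^sup>+\<omega>. (\<Sum>J\<in>Pow {..<n} - {{}}. ennreal (Psi J m \<omega>) * indicator {\<omega>. level_set n \<xi> t \<omega> = J} \<omega>) \<partial>M)
        = (\<Sum>J\<in>Pow {..<n} - {{}}. \<integral>\<^sup>+\<omega>. ennreal (Psi J m \<omega>) * indicator {\<omega>. level_set n \<xi> t \<omega> = J} \<omega> \<partial>M)"
      by (rule nn_integral_sum) (use m1 in measurable)
    also have "\<dots> = (\<Sum>J\<in>Pow {..<n} - {{}}. emeasure M {\<omega>\<in>space M. level_set n \<xi> t \<omega> = J} * (\<integral>\<^sup>+\<omega>. ennreal (Psi J m \<omega>) \<partial>M))"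
      by (intro sum.cong refl ind) auto
    also have "\<dots> \<le> (\<Sum>J\<in>Pow {..<n} - {{}}. emeasure M {\<omega>\<in>space M. level_set n \<xi> t \<omega> = J} * g J)"
    proof (intro sum_mono mult_left_mono)
      fix J :: "nat set" assume "J \<in> Pow {..<n} - {{}}"
      then have "finite J" using finite_subset by auto
      then have "(\<integral>\<^sup>+\<omega>. ennreal (Psi J m \<omega>) \<partial>M) \<le> ennreal (?\<tau> * sqrt (real (card J)) + ?c)" by (rule Psi_expectation)
      then show "(\<integral>\<^sup>+\<omega>. ennreal (Psi J m \<omega>) \<partial>M) \<le> g J" using t0 by (simp add: g_def ennreal_plus ennreal_mult)
    qed simp
    also have "\<dots> = (\<integral>\<^sup>+\<omega>. (\<Sum>J\<in>Pow {..<n} - {{}}. g J * indicator {\<omega>. level_set n \<xi> t \<omega> = J} \<omega>) \<partial>M)"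
      using m1 by (subst nn_integral_sum) (auto simp: nn_integral_cmult em mult.commute)
    also have "\<dots> = (\<integral>\<^sup>+\<omega>. (if level_set n \<xi> t \<omega> = {} then 0 else g (level_set n \<xi> t \<omega>)) \<partial>M)"
      unfolding level_set_sum ..
    also have "\<dots> \<le> (\<integral>\<^sup>+\<omega>. ennreal ?\<tau> * ennreal (sqrt (real (card {i. i < n \<and> \<omega> \<in> {\<omega>\<in>space M. t < X i \<omega>}}))) + ennreal ?c * indicator {\<omega>\<in>space M. t < Y \<omega>} \<omega> \<partial>M)"
    proof (rule nn_integral_mono)
      fix \<omega> assume w: "\<omega> \<in> space M"
      have sub: "level_set n \<xi> t \<omega> \<subseteq> {i. i < n \<and> \<omega> \<in> {\<omega>\<in>space M. t < X i \<omega>}}"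
        using X(2) w by (auto simp: level_set_def intro: less_le_trans)
      have "card (level_set n \<xi> t \<omega>) \<le> card {i. i < n \<and> \<omega> \<in> {\<omega>\<in>space M. t < X i \<omega>}}"
        by (rule card_mono[OF _ sub]) simp
      moreover have "t < Y \<omega>" if "level_set n \<xi> t \<omega> \<noteq> {}"
        using that X(2)[of _ \<omega>] Y(2)[of _ \<omega>] unfolding level_set_def by (auto intro: less_le_trans order_trans)
      ultimately show "(if level_set n \<xi> t \<omega> = {} then 0 else g (level_set n \<xi> t \<omega>)) \<le> ennreal ?\<tau> * ennreal (sqrt (real (card {i. i < n \<and> \<omega> \<in> {\<omega>\<in>space M. t < X i \<omega>}}))) + ennreal ?c * indicator {\<omega>\<in>space M. t < Y \<omega>} \<omega>"
        using w by (auto simp: g_def intro!: add_mono mult_left_mono ennreal_leI)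
    qed
    also have "\<dots> = ennreal ?\<tau> * (\<integral>\<^sup>+\<omega>. ennreal (sqrt (real (card {i. i < n \<and> \<omega> \<in> {\<omega>\<in>space M. t < X i \<omega>}}))) \<partial>M) + ennreal ?c * emeasure M {\<omega>\<in>space M. t < Y \<omega>}"
    proof -
      have [measurable]: "(\<lambda>\<omega>. real (card {i. i < n \<and> \<omega> \<in> {\<omega>\<in>space M. t < X i \<omega>}})) \<in> borel_measurable M"
      proof -
        have "(\<lambda>\<omega>. \<Sum>i<n. indicator {\<omega>\<in>space M. t < X i \<omega>} \<omega> :: real) \<in> borel_measurable M"
          by (rule borel_measurable_sum) measurable
        moreover have "(\<Sum>i<n. indicator {\<omega>\<in>space M. t < X i \<omega>} \<omega> :: real) = real (card {i. i < n \<and> \<omega> \<in> {\<omega>\<in>space M. t < X i \<omega>}})" for \<omega>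
        proof -
          have "(\<Sum>i<n. indicator {\<omega>\<in>space M. t < X i \<omega>} \<omega> :: real) = (\<Sum>i\<in>{i. i < n \<and> \<omega> \<in> {\<omega>\<in>space M. t < X i \<omega>}}. 1)"
            by (rule sum.mono_neutral_cong_right) (auto simp: indicator_def)
          then show ?thesis by simp
        qed
        ultimately show ?thesis by simp
      qed
      show ?thesis by (subst nn_integral_add, measurable) (simp add: nn_integral_cmult)
    qed
    also have "\<dots> \<le> ennreal ?\<tau> * ennreal (sqrt (real n * q t)) + ennreal ?c * emeasure M {\<omega>\<in>space M. t < Y \<omega>}"
      by (intro add_right_mono mult_left_mono nn_integral_sqrt_card_le q) auto
    also have "ennreal ?\<tau> * ennreal (sqrt (real n * q t)) = ennreal (?\<tau> * sqrt (real n)) * ennreal (sqrt (q t))"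
      using t0 q(2) by (simp add: real_sqrt_mult ennreal_mult mult.assoc)
    finally show ?thesis .
  qed
  have "(\<integral>\<^sup>+\<omega>. mult_maj n \<xi> m \<omega> \<partial>M) = (\<integral>\<^sup>+t. \<integral>\<^sup>+\<omega>. indicator {0..} t *
     (\<Sum>J\<in>Pow {..<n} - {{}}. ennreal (Psi J m \<omega>) * indicator {\<omega>. level_set n \<xi> t \<omega> = J} \<omega>) \<partial>M \<partial>lborel)"
    unfolding mult_maj_def by (rule Fubini'[OF mult_maj_integrand_measurable])
  also have "\<dots> \<le> (\<integral>\<^sup>+t. ennreal (?\<tau> * sqrt (real n)) * (indicator {0..} t * ennreal (sqrt (q t))) + ennreal ?c * (indicator {0..} t * emeasure M {\<omega>\<in>space M. t < Y \<omega>}) \<partial>lborel)"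
  proof (rule nn_integral_mono)
    fix t :: real
    show "(\<integral>\<^sup>+\<omega>. indicator {0..} t * (\<Sum>J\<in>Pow {..<n} - {{}}. ennreal (Psi J m \<omega>) * indicator {\<omega>. level_set n \<xi> t \<omega> = J} \<omega>) \<partial>M)
      \<le> ennreal (?\<tau> * sqrt (real n)) * (indicator {0..} t * ennreal (sqrt (q t))) + ennreal ?c * (indicator {0..} t * emeasure M {\<omega>\<in>space M. t < Y \<omega>})"
      using inner[of t] by (cases "0 \<le> t") auto
  qed
  also have "\<dots> = ennreal (?\<tau> * sqrt (real n)) * (\<integral>\<^sup>+t. indicator {0..} t * ennreal (sqrt (q t)) \<partial>lborel)
    + ennreal ?c * (\<integral>\<^sup>+t. indicator {0..} t * emeasure M {\<omega>\<in>space M. t < Y \<omega>} \<partial>lborel)"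
    using mY by (subst nn_integral_add) (auto simp: nn_integral_cmult)
  finally show ?thesis unfolding nn_integral_layer_cake[OF Y(1)] .
qed

end

end

section \<open>Construction of the Gaussian limit\<close>

definition bdd_meas :: "'a measure \<Rightarrow> ('a \<Rightarrow> real) \<Rightarrow> bool" where
  "bdd_meas M h \<longleftrightarrow> h \<in> borel_measurable M \<and> (\<exists>b. \<forall>x. \<bar>h x\<bar> \<le> b)"

lemma bdd_meas_const: "bdd_meas M (\<lambda>_. c)" by (auto simp: bdd_meas_def)

lemma bdd_meas_add: assumes "bdd_meas M g" "bdd_meas M h" shows "bdd_meas M (\<lambda>x. g x + h x)"
proof -
  obtain a b where "\<And>x. \<bar>g x\<bar> \<le> a" "\<And>x. \<bar>h x\<bar> \<le> b" using assms unfolding bdd_meas_def by blast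
  then have "\<bar>g x + h x\<bar> \<le> a + b" for x using abs_triangle_ineq add_mono order_trans by blast
  then show ?thesis using assms unfolding bdd_meas_def by auto
qed

lemma bdd_meas_mult: assumes "bdd_meas M g" "bdd_meas M h" shows "bdd_meas M (\<lambda>x. g x * h x)"
proof -
  obtain a b where ab: "\<And>x. \<bar>g x\<bar> \<le> a" "\<And>x. \<bar>h x\<bar> \<le> b" using assms unfolding bdd_meas_def by blast
  have "\<bar>g x * h x\<bar> \<le> a * b" for x
    using mult_mono[OF ab(1)[of x] ab(2)[of x] order_trans[OF abs_ge_zero ab(1)[of x]] abs_ge_zero] by (simp add: abs_mult)
  then show ?thesis using assms unfolding bdd_meas_def by auto
qed

lemma bdd_meas_sum: "(\<And>k. k \<in> K \<Longrightarrow> bdd_meas M (h k)) \<Longrightarrow> bdd_meas M (\<lambda>x. \<Sum>k\<in>K. h k x)"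
  by (induction K rule: infinite_finite_induct) (auto intro: bdd_meas_const bdd_meas_add)

lemma bdd_meas_diff: "bdd_meas M g \<Longrightarrow> bdd_meas M h \<Longrightarrow> bdd_meas M (\<lambda>x. g x - h x)"
  using bdd_meas_add[of M g "\<lambda>x. - 1 * h x"] bdd_meas_mult[OF bdd_meas_const[of M "- 1"], of h] by simp

lemma (in prob_space) bdd_meas_integrable:
  assumes "bdd_meas M h" shows "integrable M h"
proof -
  obtain b where "\<And>x. \<bar>h x\<bar> \<le> b" and m: "h \<in> borel_measurable M" using assms unfolding bdd_meas_def by blast
  then show ?thesis by (intro integrable_const_bound[where B=b]) auto
qed

context prob_space
begin

text \<open>Gram--Schmidt; a vanishing remainder gives the zero function, because \<open>x / 0 = 0\<close>.\<close>
function gram_schmidt :: "(nat \<Rightarrow> 'a \<Rightarrow> real) \<Rightarrow> nat \<Rightarrow> 'a \<Rightarrow> real" where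
  "gram_schmidt g n = (let r = (\<lambda>x. g n x - (\<Sum>k<n. expectation (\<lambda>y. g n y * gram_schmidt g k y) * gram_schmidt g k x))
     in (\<lambda>x. r x / sqrt (expectation (\<lambda>y. (r y)\<^sup>2))))"
  by auto
termination by (relation "Wellfounded.measure snd") auto

declare gram_schmidt.simps[simp del]

definition gs_residual :: "(nat \<Rightarrow> 'a \<Rightarrow> real) \<Rightarrow> nat \<Rightarrow> 'a \<Rightarrow> real" where
  "gs_residual g n x = g n x - (\<Sum>k<n. expectation (\<lambda>y. g n y * gram_schmidt g k y) * gram_schmidt g k x)"

lemma gram_schmidt_eq: "gram_schmidt g n x = gs_residual g n x / sqrt (expectation (\<lambda>y. (gs_residual g n y)\<^sup>2))"
  unfolding gram_schmidt.simps[of g n] Let_def gs_residual_def ..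

context
  fixes g :: "nat \<Rightarrow> 'a \<Rightarrow> real"
  assumes g: "\<And>n. bdd_meas M (g n)"
begin

lemma gram_schmidt_bdd_meas: "bdd_meas M (gram_schmidt g n)"
proof (induction n rule: less_induct)
  case (less n)
  have r: "bdd_meas M (gs_residual g n)"
    unfolding gs_residual_def[abs_def] by (intro bdd_meas_diff g bdd_meas_sum bdd_meas_mult bdd_meas_const less) auto
  have "gram_schmidt g n = (\<lambda>x. (1 / sqrt (expectation (\<lambda>y. (gs_residual g n y)\<^sup>2))) * gs_residual g n x)"
    by (simp add: fun_eq_iff gram_schmidt_eq)
  then show ?case using bdd_meas_mult[OF bdd_meas_const r] by presburger
qed

lemma gs_residual_bdd_meas: "bdd_meas M (gs_residual g n)"
  unfolding gs_residual_def[abs_def] by (intro bdd_meas_diff g bdd_meas_sum bdd_meas_mult bdd_meas_const gram_schmidt_bdd_meas)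

lemma int_mult: "bdd_meas M h \<Longrightarrow> bdd_meas M k \<Longrightarrow> integrable M (\<lambda>x. h x * k x)"
  by (intro bdd_meas_integrable bdd_meas_mult)

text \<open>In the degenerate case the vector vanishes at every point, not merely almost everywhere,
  because the division is by 0.\<close>

lemma gram_schmidt_unit: "expectation (\<lambda>x. gram_schmidt g n x * gram_schmidt g n x) = 1 \<or> (\<forall>x. gram_schmidt g n x = 0)"
proof (cases "expectation (\<lambda>y. (gs_residual g n y)\<^sup>2) = 0")
  case True
  then show ?thesis by (simp add: gram_schmidt_eq)
next
  case False
  have "0 \<le> expectation (\<lambda>y. (gs_residual g n y)\<^sup>2)" by (intro Bochner_Integration.integral_nonneg) auto
  then have pos: "0 < expectation (\<lambda>y. (gs_residual g n y)\<^sup>2)" using False by linarith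
  have "gram_schmidt g n x * gram_schmidt g n x = (gs_residual g n x)\<^sup>2 / expectation (\<lambda>y. (gs_residual g n y)\<^sup>2)" for x
    using pos by (simp add: gram_schmidt_eq power2_eq_square)
  then show ?thesis using pos by simp
qed

lemma gram_schmidt_orth: "j < n \<Longrightarrow> expectation (\<lambda>x. gram_schmidt g n x * gram_schmidt g j x) = 0"
proof (induction n arbitrary: j rule: less_induct)
  case (less n)
  note prem = less.prems and IH = less.IH
  have kj: "expectation (\<lambda>x. gram_schmidt g k x * gram_schmidt g j x) = (if k = j then expectation (\<lambda>x. gram_schmidt g j x * gram_schmidt g j x) else 0)" if "k < n" for k
  proof (cases k j rule: linorder_cases)
    case less
    then have "expectation (\<lambda>x. gram_schmidt g j x * gram_schmidt g k x) = 0" using IH[of j k] prem by blast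
    then show ?thesis using less by (simp add: mult.commute)
  next
    case greater
    then show ?thesis using IH[of k j] that by simp
  qed simp
  have "expectation (\<lambda>x. gs_residual g n x * gram_schmidt g j x)
      = expectation (\<lambda>x. g n x * gram_schmidt g j x - (\<Sum>k<n. expectation (\<lambda>y. g n y * gram_schmidt g k y) * (gram_schmidt g k x * gram_schmidt g j x)))"
    by (intro Bochner_Integration.integral_cong refl) (simp add: gs_residual_def left_diff_distrib sum_distrib_right mult.assoc)
  also have "\<dots> = expectation (\<lambda>x. g n x * gram_schmidt g j x) - (\<Sum>k<n. expectation (\<lambda>y. g n y * gram_schmidt g k y) * expectation (\<lambda>x. gram_schmidt g k x * gram_schmidt g j x))"
    using int_mult[OF g gram_schmidt_bdd_meas] int_mult[OF gram_schmidt_bdd_meas gram_schmidt_bdd_meas] by (subst Bochner_Integration.integral_diff) (auto simp: Bochner_Integration.integral_sum)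
  also have "(\<Sum>k<n. expectation (\<lambda>y. g n y * gram_schmidt g k y) * expectation (\<lambda>x. gram_schmidt g k x * gram_schmidt g j x))
      = (\<Sum>k<n. if k = j then expectation (\<lambda>y. g n y * gram_schmidt g j y) * expectation (\<lambda>x. gram_schmidt g j x * gram_schmidt g j x) else 0)"
    by (intro sum.cong refl, subst kj) auto
  also have "\<dots> = expectation (\<lambda>y. g n y * gram_schmidt g j y) * expectation (\<lambda>x. gram_schmidt g j x * gram_schmidt g j x)"
    using less.prems by simp
  finally have "expectation (\<lambda>x. gs_residual g n x * gram_schmidt g j x) = 0"
    using gram_schmidt_unit[of j] by auto
  moreover have "gram_schmidt g n x * gram_schmidt g j x = gs_residual g n x * gram_schmidt g j x / sqrt (expectation (\<lambda>y. (gs_residual g n y)\<^sup>2))" for x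
    by (simp add: gram_schmidt_eq[of g n])
  ultimately show ?case by simp
qed

definition gs_coeff :: "nat \<Rightarrow> nat \<Rightarrow> real" where
  "gs_coeff i k = (if k \<le> i then expectation (\<lambda>x. g i x * gram_schmidt g k x) else 0)"

lemma gram_schmidt_gram: "expectation (\<lambda>x. gram_schmidt g k x * gram_schmidt g l x) = (if k = l then expectation (\<lambda>x. gram_schmidt g k x * gram_schmidt g k x) else 0)"
  using gram_schmidt_orth[of k l] gram_schmidt_orth[of l k] by (auto simp: mult.commute linorder_neq_iff)

lemma gs_coeff_diag: "gs_coeff i i = sqrt (expectation (\<lambda>y. (gs_residual g i y)\<^sup>2))"
proof -
  let ?s = "sqrt (expectation (\<lambda>y. (gs_residual g i y)\<^sup>2))"
  have gi: "g i x = gs_residual g i x + (\<Sum>k<i. gs_coeff i k * gram_schmidt g k x)" for x by (simp add: gs_residual_def gs_coeff_def)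
  have "gs_coeff i i = expectation (\<lambda>x. g i x * gram_schmidt g i x)" by (simp add: gs_coeff_def)
  also have "\<dots> = expectation (\<lambda>x. gs_residual g i x * gram_schmidt g i x + (\<Sum>k<i. gs_coeff i k * (gram_schmidt g k x * gram_schmidt g i x)))"
    by (simp add: gi distrib_right sum_distrib_right mult.assoc)
  also have "\<dots> = expectation (\<lambda>x. gs_residual g i x * gram_schmidt g i x) + (\<Sum>k<i. gs_coeff i k * expectation (\<lambda>x. gram_schmidt g k x * gram_schmidt g i x))"
    using int_mult[OF gs_residual_bdd_meas gram_schmidt_bdd_meas] int_mult[OF gram_schmidt_bdd_meas gram_schmidt_bdd_meas]
    by (subst Bochner_Integration.integral_add) (auto simp: Bochner_Integration.integral_sum)
  also have "(\<Sum>k<i. gs_coeff i k * expectation (\<lambda>x. gram_schmidt g k x * gram_schmidt g i x)) = 0"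
    by (intro sum.neutral) (auto simp: gram_schmidt_gram)
  also have "expectation (\<lambda>x. gs_residual g i x * gram_schmidt g i x) = expectation (\<lambda>y. (gs_residual g i y)\<^sup>2) / ?s"
    by (simp add: gram_schmidt_eq power2_eq_square)
  also have "\<dots> = ?s" by (simp add: real_div_sqrt Bochner_Integration.integral_nonneg)
  finally show ?thesis by simp
qed

text \<open>Only an almost sure identity: when the residual has zero second moment the normalized
  vector is identically 0, while the residual itself is only almost surely 0.\<close>

lemma gram_schmidt_expand: assumes "i < n" shows "AE x in M. g i x = (\<Sum>k<n. gs_coeff i k * gram_schmidt g k x)"
proof -
  have "AE x in M. gs_residual g i x = gs_coeff i i * gram_schmidt g i x"
  proof (cases "expectation (\<lambda>y. (gs_residual g i y)\<^sup>2) = 0")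
    case True
    have "integrable M (\<lambda>y. (gs_residual g i y)\<^sup>2)" unfolding power2_eq_square by (rule int_mult[OF gs_residual_bdd_meas gs_residual_bdd_meas])
    then have "AE x in M. (gs_residual g i x)\<^sup>2 = 0" using True integral_nonneg_eq_0_iff_AE[of M "\<lambda>y. (gs_residual g i y)\<^sup>2"] by auto
    then show ?thesis using True by (auto simp: gs_coeff_diag)
  next
    case False
    then show ?thesis unfolding gs_coeff_diag by (simp add: gram_schmidt_eq)
  qed
  moreover have "g i x = gs_residual g i x + (\<Sum>k<i. gs_coeff i k * gram_schmidt g k x)" for x by (simp add: gs_residual_def gs_coeff_def)
  moreover have "(\<Sum>k<n. gs_coeff i k * gram_schmidt g k x) = gs_coeff i i * gram_schmidt g i x + (\<Sum>k<i. gs_coeff i k * gram_schmidt g k x)" for x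
  proof -
    have "(\<Sum>k<n. gs_coeff i k * gram_schmidt g k x) = (\<Sum>k<Suc i. gs_coeff i k * gram_schmidt g k x)"
      using assms by (intro sum.mono_neutral_right) (auto simp: gs_coeff_def)
    then show ?thesis by simp
  qed
  ultimately show ?thesis by auto
qed

text \<open>This is the Cholesky factorization. In a degenerate direction \<open>k\<close> the
  normalized vector has second moment 0 instead of 1, but there the coefficients vanish as well, so
  the formula is unaffected.\<close>

lemma gs_coeff_cov:
  assumes "i < n" "j < n"
  shows "expectation (\<lambda>x. g i x * g j x) = (\<Sum>k<n. gs_coeff i k * gs_coeff j k)"
proof -
  have unit: "gs_coeff j k * expectation (\<lambda>x. gram_schmidt g k x * gram_schmidt g k x) = gs_coeff j k" for k
    using gram_schmidt_unit[of k] by (auto simp: gs_coeff_def)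
  have b: "bdd_meas M (\<lambda>x. \<Sum>k<n. gs_coeff i k * gram_schmidt g k x)" for i by (intro bdd_meas_sum bdd_meas_mult bdd_meas_const gram_schmidt_bdd_meas)
  have "expectation (\<lambda>x. g i x * g j x) = expectation (\<lambda>x. (\<Sum>k<n. gs_coeff i k * gram_schmidt g k x) * (\<Sum>l<n. gs_coeff j l * gram_schmidt g l x))"
  proof (rule integral_cong_AE)
    show "AE x in M. g i x * g j x = (\<Sum>k<n. gs_coeff i k * gram_schmidt g k x) * (\<Sum>l<n. gs_coeff j l * gram_schmidt g l x)"
      using gram_schmidt_expand[OF assms(1)] gram_schmidt_expand[OF assms(2)] by eventually_elim simp
  qed (use int_mult[OF g g] int_mult[OF b b] in auto)
  also have "\<dots> = expectation (\<lambda>x. \<Sum>k<n. \<Sum>l<n. gs_coeff i k * gs_coeff j l * (gram_schmidt g k x * gram_schmidt g l x))"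
    by (simp add: sum_product mult_ac)
  also have "\<dots> = (\<Sum>k<n. \<Sum>l<n. gs_coeff i k * gs_coeff j l * expectation (\<lambda>x. gram_schmidt g k x * gram_schmidt g l x))"
  proof -
    have i: "integrable M (\<lambda>x. gs_coeff i k * gs_coeff j l * (gram_schmidt g k x * gram_schmidt g l x))" for k l
      by (intro integrable_mult_right int_mult gram_schmidt_bdd_meas)
    show ?thesis
      by (subst Bochner_Integration.integral_sum, intro Bochner_Integration.integrable_sum i,
          subst Bochner_Integration.integral_sum, rule i) simp
  qed
  also have "\<dots> = (\<Sum>k<n. \<Sum>l<n. if k = l then gs_coeff i k * gs_coeff j k else 0)"
    by (intro sum.cong refl, subst gram_schmidt_gram) (auto simp: mult.assoc unit)
  also have "\<dots> = (\<Sum>k<n. gs_coeff i k * gs_coeff j k)" by simp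
  finally show ?thesis .
qed

end

text \<open>A single infinite lower triangular matrix serves all \<open>n\<close> at once, so that
  the Gaussian variables built from it at all dyadic points are jointly consistent.\<close>

lemma exists_factorization:
  fixes g :: "nat \<Rightarrow> 'a \<Rightarrow> real"
  assumes "\<And>n. bdd_meas M (g n)"
  shows "\<exists>a. (\<forall>i k. i < k \<longrightarrow> a i k = 0) \<and>
    (\<forall>i j n. i < n \<longrightarrow> j < n \<longrightarrow> expectation (\<lambda>x. g i x * g j x) = (\<Sum>k<n. a i k * a j k))"
proof (intro exI conjI allI impI)
  show "gs_coeff g i k = 0" if "i < k" for i k using that by (simp add: gs_coeff_def[OF assms])
  show "expectation (\<lambda>x. g i x * g j x) = (\<Sum>k<n. gs_coeff g i k * gs_coeff g j k)" if "i < n" "j < n" for i j n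
    by (rule gs_coeff_cov[OF assms that])
qed

end

section \<open>Independent standard normals as coordinates of a product space\<close>

lemma indep_vars_PiM_coords:
  assumes "\<And>i. prob_space (M i)"
  shows "prob_space.indep_vars (PiM UNIV M) M (\<lambda>i \<omega>. \<omega> i) UNIV"
proof -
  interpret P: prob_space "PiM UNIV M" by (rule prob_space_PiM) (use assms in auto)
  have "distr (PiM UNIV M) (PiM UNIV M) (\<lambda>x. \<lambda>i\<in>UNIV. x i) = distr (PiM UNIV M) (PiM UNIV M) (\<lambda>x. x)"
    by (rule distr_cong) auto
  also have "\<dots> = PiM UNIV M" by (rule distr_id)
  also have "\<dots> = PiM UNIV (\<lambda>i. distr (PiM UNIV M) (M i) (\<lambda>\<omega>. \<omega> i))"
    by (rule PiM_cong) (auto simp: distr_PiM_component assms)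
  finally show ?thesis by (subst P.indep_vars_iff_distr_eq_PiM) auto
qed

lemma std_normal_mgf: "(\<integral>\<^sup>+x. ennreal (exp (\<alpha> * x)) \<partial>std_normal_distribution) = ennreal (exp (\<alpha>\<^sup>2 / 2))"
proof -
  have "(\<integral>\<^sup>+x. ennreal (exp (\<alpha> * x)) \<partial>std_normal_distribution) = (\<integral>\<^sup>+x. ennreal (std_normal_density x) * ennreal (exp (\<alpha> * x)) \<partial>lborel)"
    by (rule nn_integral_density) auto
  \<comment> \<open>Translation by \<alpha> completes the square.\<close>
  also have "\<dots> = (\<integral>\<^sup>+x. ennreal (std_normal_density (\<alpha> + 1 * x)) * ennreal (exp (\<alpha> * (\<alpha> + 1 * x))) \<partial>lborel)"
    by (subst nn_integral_real_affine[where c=1 and t=\<alpha>]) auto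
  also have "\<dots> = (\<integral>\<^sup>+x. ennreal (exp (\<alpha>\<^sup>2 / 2)) * ennreal (std_normal_density x) \<partial>lborel)"
  proof (rule nn_integral_cong)
    fix x :: real
    have "exp (- (\<alpha> + x)\<^sup>2 / 2) * exp (\<alpha> * (\<alpha> + x)) = exp (\<alpha>\<^sup>2 / 2) * exp (- x\<^sup>2 / 2)"
      unfolding exp_add[symmetric] by (rule arg_cong[where f=exp]) (simp add: power2_eq_square field_simps)
    then have "std_normal_density (\<alpha> + 1 * x) * exp (\<alpha> * (\<alpha> + 1 * x)) = exp (\<alpha>\<^sup>2 / 2) * std_normal_density x"
      by (simp add: std_normal_density_def)
    then show "ennreal (std_normal_density (\<alpha> + 1 * x)) * ennreal (exp (\<alpha> * (\<alpha> + 1 * x))) = ennreal (exp (\<alpha>\<^sup>2 / 2)) * ennreal (std_normal_density x)"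
      by (simp flip: ennreal_mult)
  qed
  also have "\<dots> = ennreal (exp (\<alpha>\<^sup>2 / 2)) * (\<integral>\<^sup>+x. ennreal (std_normal_density x) \<partial>lborel)"
    by (rule nn_integral_cmult) auto
  also have "(\<integral>\<^sup>+x. ennreal (std_normal_density x) \<partial>lborel) = emeasure std_normal_distribution (space std_normal_distribution)"
    by (simp add: emeasure_density)
  also have "\<dots> = 1" by (rule prob_space.emeasure_space_1[OF real_dist_normal_dist[unfolded real_distribution_def, THEN conjunct1]])
  finally show ?thesis by simp
qed

lemma std_normal_char: "(\<integral>x. cis (\<alpha> * x) \<partial>std_normal_distribution) = complex_of_real (exp (- (\<alpha>\<^sup>2) / 2))"
  using fun_cong[OF char_std_normal_distribution, of \<alpha>] by (simp add: char_def cis_conv_exp)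

locale gaussian_sequence =
  fixes \<iota> :: "nat \<Rightarrow> 's"
  assumes inj: "inj \<iota>"
begin

abbreviation N0 :: "('s \<Rightarrow> real) measure" where "N0 \<equiv> PiM UNIV (\<lambda>_. std_normal_distribution)"

sublocale N0: prob_space N0
  by (rule prob_space_PiM) (rule real_dist_normal_dist[unfolded real_distribution_def, THEN conjunct1])

lemma indep: "N0.indep_vars (\<lambda>_. borel) (\<lambda>i \<omega>. \<omega> i) UNIV"
proof -
  have "N0.indep_vars (\<lambda>_. std_normal_distribution) (\<lambda>i \<omega>. \<omega> i) UNIV"
    by (rule indep_vars_PiM_coords) (rule real_dist_normal_dist[unfolded real_distribution_def, THEN conjunct1])
  then show ?thesis
    using N0.indep_vars_compose2[of "\<lambda>_. std_normal_distribution" "\<lambda>i \<omega>. \<omega> i" UNIV "\<lambda>_ x. x" "\<lambda>_. borel"] by simp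
qed

lemma coord_meas[measurable]: "(\<lambda>\<omega>. \<omega> (\<iota> k)) \<in> borel_measurable N0"
proof -
  have "(\<lambda>\<omega>. \<omega> (\<iota> k)) \<in> measurable N0 std_normal_distribution" by (rule measurable_component_singleton) simp
  then show ?thesis by (simp cong: measurable_cong_sets)
qed

lemma coord_distr: "distr N0 borel (\<lambda>\<omega>. \<omega> (\<iota> k)) = std_normal_distribution"
proof -
  have "distr N0 std_normal_distribution (\<lambda>\<omega>. \<omega> (\<iota> k)) = std_normal_distribution"
    by (rule distr_PiM_component) (auto intro: real_dist_normal_dist[unfolded real_distribution_def, THEN conjunct1])
  then show ?thesis by (simp cong: distr_cong)
qed

lemma mgf_sum: "(\<integral>\<^sup>+\<omega>. ennreal (exp (\<Sum>k<n. \<alpha> k * \<omega> (\<iota> k))) \<partial>N0) = ennreal (exp ((\<Sum>k<n. (\<alpha> k)\<^sup>2) / 2))"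
proof -
  have ind: "N0.indep_vars (\<lambda>_. borel) (\<lambda>s \<omega>. ennreal (exp (\<alpha> (inv \<iota> s) * \<omega> s))) (\<iota> ` {..<n})"
    by (rule N0.indep_vars_compose2[OF N0.indep_vars_subset[OF indep]]) auto
  have re: "inj_on \<iota> {..<n}" by (rule inj_on_subset[OF inj]) simp
  have "(\<integral>\<^sup>+\<omega>. ennreal (exp (\<Sum>k<n. \<alpha> k * \<omega> (\<iota> k))) \<partial>N0) = (\<integral>\<^sup>+\<omega>. (\<Prod>k<n. ennreal (exp (\<alpha> k * \<omega> (\<iota> k)))) \<partial>N0)"
    by (simp add: exp_sum prod_ennreal)
  also have "\<dots> = (\<Prod>k<n. \<integral>\<^sup>+\<omega>. ennreal (exp (\<alpha> k * \<omega> (\<iota> k))) \<partial>N0)"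
    using N0.indep_vars_nn_integral[OF _ ind] by (simp add: prod.reindex[OF re] inv_f_f[OF inj])
  also have "\<dots> = (\<Prod>k<n. ennreal (exp ((\<alpha> k)\<^sup>2 / 2)))"
  proof (rule prod.cong)
    fix k
    have "(\<integral>\<^sup>+\<omega>. ennreal (exp (\<alpha> k * \<omega> (\<iota> k))) \<partial>N0) = (\<integral>\<^sup>+x. ennreal (exp (\<alpha> k * x)) \<partial>distr N0 borel (\<lambda>\<omega>. \<omega> (\<iota> k)))"
      by (rule nn_integral_distr[symmetric]) auto
    then show "(\<integral>\<^sup>+\<omega>. ennreal (exp (\<alpha> k * \<omega> (\<iota> k))) \<partial>N0) = ennreal (exp ((\<alpha> k)\<^sup>2 / 2))"
      unfolding coord_distr std_normal_mgf .
  qed simp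
  also have "\<dots> = ennreal (exp ((\<Sum>k<n. (\<alpha> k)\<^sup>2) / 2))"
    by (simp add: prod_ennreal exp_sum[symmetric] sum_divide_distrib)
  finally show ?thesis .
qed

lemma char_sum: "(\<integral>\<omega>. cis (\<Sum>k<n. \<alpha> k * \<omega> (\<iota> k)) \<partial>N0) = complex_of_real (exp (- (\<Sum>k<n. (\<alpha> k)\<^sup>2) / 2))"
proof -
  have ind: "N0.indep_vars (\<lambda>_. borel) (\<lambda>s \<omega>. cis (\<alpha> (inv \<iota> s) * \<omega> s)) (\<iota> ` {..<n})"
    by (rule N0.indep_vars_compose2[OF N0.indep_vars_subset[OF indep]]) auto
  have re: "inj_on \<iota> {..<n}" by (rule inj_on_subset[OF inj]) simp
  have int: "integrable N0 (\<lambda>\<omega>. cis (\<alpha> (inv \<iota> s) * \<omega> s))" if "s \<in> \<iota> ` {..<n}" for s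
    using that by (intro N0.integrable_const_bound[where B=1]) auto
  have "(\<integral>\<omega>. cis (\<Sum>k<n. \<alpha> k * \<omega> (\<iota> k)) \<partial>N0) = (\<integral>\<omega>. (\<Prod>k<n. cis (\<alpha> k * \<omega> (\<iota> k))) \<partial>N0)"
    by (simp add: cis_conv_exp exp_sum sum_distrib_left)
  also have "\<dots> = (\<Prod>k<n. \<integral>\<omega>. cis (\<alpha> k * \<omega> (\<iota> k)) \<partial>N0)"
    using N0.indep_vars_lebesgue_integral[OF _ ind int] by (simp add: prod.reindex[OF re] inv_f_f[OF inj])
  also have "\<dots> = (\<Prod>k<n. complex_of_real (exp (- ((\<alpha> k)\<^sup>2) / 2)))"
  proof (rule prod.cong)
    fix k
    have "(\<integral>\<omega>. cis (\<alpha> k * \<omega> (\<iota> k)) \<partial>N0) = (\<integral>x. cis (\<alpha> k * x) \<partial>distr N0 borel (\<lambda>\<omega>. \<omega> (\<iota> k)))"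
      by (rule integral_distr[symmetric]) auto
    then show "(\<integral>\<omega>. cis (\<alpha> k * \<omega> (\<iota> k)) \<partial>N0) = complex_of_real (exp (- ((\<alpha> k)\<^sup>2) / 2))"
      unfolding coord_distr std_normal_char .
  qed simp
  also have "\<dots> = complex_of_real (exp (- (\<Sum>k<n. (\<alpha> k)\<^sup>2) / 2))"
  proof -
    have "(\<Prod>k<n. exp (- ((\<alpha> k)\<^sup>2) / 2)) = exp (\<Sum>k<n. - ((\<alpha> k)\<^sup>2) / 2)" by (simp add: exp_sum)
    also have "(\<Sum>k<n. - ((\<alpha> k)\<^sup>2) / 2) = - (\<Sum>k<n. (\<alpha> k)\<^sup>2) / 2" by (simp add: sum_negf sum_divide_distrib)
    finally show ?thesis by (simp flip: of_real_prod)
  qed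
  finally show ?thesis .
qed

end

text \<open>The sample space of the limit is fixed as a power of \<open>real^'p \<Rightarrow> real\<close>, so the sequence of standard
  normals is read off at countably many coordinates.\<close>
definition cpt :: "nat \<Rightarrow> real^'p" where "cpt k = (\<chi> _. real k)"

interpretation GS: gaussian_sequence "cpt :: nat \<Rightarrow> real^'p"
  by standard (auto simp: inj_def cpt_def vec_eq_iff)

section \<open>The Gaussian process on dyadic points and its continuous extension\<close>

context iid_orthants
begin

definition Kc :: "real^'p \<Rightarrow> real^'p \<Rightarrow> real" where "Kc u v = D (vmin u v) - D u * D v"

lemma cov_eq: "expectation (\<lambda>\<omega>. (f i u \<omega> - D u) * (f i v \<omega> - D v)) = Kc u v"
proof -
  have "(f i u \<omega> - D u) * (f i v \<omega> - D v) = f i (vmin u v) \<omega> - D v * f i u \<omega> - D u * f i v \<omega> + D u * D v" for \<omega>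
    using f_min[of i u \<omega> v] by (simp add: algebra_simps)
  then show ?thesis using f_integrable by (simp add: f_exp Kc_def prob_space)
qed

abbreviation dy :: "(real^'p) set" where "dy \<equiv> (\<Union>l. dgrid l)"
definition un :: "nat \<Rightarrow> real^'p" where "un n = from_nat_into dy n"
definition ix :: "real^'p \<Rightarrow> nat" where "ix u = to_nat_on dy u"

lemma un_ix: "u \<in> dy \<Longrightarrow> un (ix u) = u"
  unfolding un_def ix_def by (rule from_nat_into_to_nat_on) (auto intro: countable_finite dgrid_finite)

definition coef :: "nat \<Rightarrow> nat \<Rightarrow> real" where
  "coef = (SOME a. (\<forall>i k. i < k \<longrightarrow> a i k = 0) \<and>
     (\<forall>i j n. i < n \<longrightarrow> j < n \<longrightarrow> expectation (\<lambda>x. (f 0 (un i) x - D (un i)) * (f 0 (un j) x - D (un j))) = (\<Sum>k<n. a i k * a j k)))"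

lemma coef: "i < k \<Longrightarrow> coef i k = 0" "i < n \<Longrightarrow> j < n \<Longrightarrow> Kc (un i) (un j) = (\<Sum>k<n. coef i k * coef j k)"
proof -
  have "bdd_meas M (\<lambda>x. f 0 (un n) x - D (un n))" for n
    by (intro bdd_meas_diff bdd_meas_const) (use f_bound in \<open>auto simp: bdd_meas_def intro!: exI[of _ 1]\<close>)
  from someI_ex[OF exists_factorization[of "\<lambda>n x. f 0 (un n) x - D (un n)", OF this]]
  have c: "(\<forall>i k. i < k \<longrightarrow> coef i k = 0) \<and> (\<forall>i j n. i < n \<longrightarrow> j < n \<longrightarrow> Kc (un i) (un j) = (\<Sum>k<n. coef i k * coef j k))"
    unfolding coef_def cov_eq .
  show "coef i k = 0" if "i < k" using c that by simp
  show "Kc (un i) (un j) = (\<Sum>k<n. coef i k * coef j k)" if "i < n" "j < n" using c that by simp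
qed

text \<open>The triangular form makes this a finite sum, which may be extended to any larger upper
  index; finitely many points can therefore be written over the same normals.\<close>

definition dyadic_gauss :: "real^'p \<Rightarrow> (real^'p \<Rightarrow> real) \<Rightarrow> real" where
  "dyadic_gauss u \<omega> = (\<Sum>k<Suc (ix u). coef (ix u) k * \<omega> (cpt k))"

abbreviation N0 :: "(real^'p \<Rightarrow> real) measure" where "N0 \<equiv> PiM UNIV (\<lambda>_. std_normal_distribution)"

lemma dyadic_gauss_measurable[measurable]: "dyadic_gauss u \<in> borel_measurable N0"
  unfolding dyadic_gauss_def by measurable

text \<open>The points are indexed by a map \<open>w\<close> that need not be injective: later,
  distinct points of the cube may share a dyadic floor, and an increment is the case of two indices
  with coefficients of opposite sign.\<close>

lemma dyadic_gauss_comb: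
  fixes w :: "'s \<Rightarrow> real^'p"
  assumes F: "finite F" and w: "\<And>s. s \<in> F \<Longrightarrow> w s \<in> dy"
  shows "\<exists>n \<alpha>. (\<forall>\<omega>. (\<Sum>s\<in>F. c s * dyadic_gauss (w s) \<omega>) = (\<Sum>k<n. \<alpha> k * \<omega> (cpt k))) \<and>
     (\<Sum>k<n. (\<alpha> k)\<^sup>2) = (\<Sum>s\<in>F. \<Sum>t\<in>F. c s * c t * Kc (w s) (w t))"
proof -
  obtain n where n: "\<And>s. s \<in> F \<Longrightarrow> ix (w s) < n"
    using finite_nat_bounded[of "(\<lambda>s. ix (w s)) ` F"] F by auto
  define \<alpha> where "\<alpha> k = (\<Sum>s\<in>F. c s * coef (ix (w s)) k)" for k
  have bdn: "dyadic_gauss (w s) \<omega> = (\<Sum>k<n. coef (ix (w s)) k * \<omega> (cpt k))" if "s \<in> F" for s \<omega>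
    unfolding dyadic_gauss_def using n[OF that] by (intro sum.mono_neutral_left) (auto simp: coef(1))
  have "(\<Sum>s\<in>F. c s * dyadic_gauss (w s) \<omega>) = (\<Sum>k<n. \<alpha> k * \<omega> (cpt k))" for \<omega>
  proof -
    have "(\<Sum>s\<in>F. c s * dyadic_gauss (w s) \<omega>) = (\<Sum>s\<in>F. \<Sum>k<n. c s * coef (ix (w s)) k * \<omega> (cpt k))"
      by (intro sum.cong refl) (simp add: bdn sum_distrib_left mult.assoc)
    also have "\<dots> = (\<Sum>k<n. \<Sum>s\<in>F. c s * coef (ix (w s)) k * \<omega> (cpt k))" by (rule sum.swap)
    finally show ?thesis by (simp add: \<alpha>_def sum_distrib_right)
  qed
  moreover have "(\<Sum>k<n. (\<alpha> k)\<^sup>2) = (\<Sum>s\<in>F. \<Sum>t\<in>F. c s * c t * Kc (w s) (w t))"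
  proof -
    have "(\<Sum>s\<in>F. \<Sum>t\<in>F. c s * c t * Kc (w s) (w t)) = (\<Sum>s\<in>F. \<Sum>t\<in>F. \<Sum>k<n. (c s * coef (ix (w s)) k) * (c t * coef (ix (w t)) k))"
    proof (intro sum.cong refl)
      fix s t assume st: "s \<in> F" "t \<in> F"
      have "Kc (w s) (w t) = (\<Sum>k<n. coef (ix (w s)) k * coef (ix (w t)) k)"
        using coef(2)[OF n[OF st(1)] n[OF st(2)]] un_ix w st by simp
      then show "c s * c t * Kc (w s) (w t) = (\<Sum>k<n. (c s * coef (ix (w s)) k) * (c t * coef (ix (w t)) k))"
        by (simp add: sum_distrib_left mult_ac)
    qed
    also have "\<dots> = (\<Sum>s\<in>F. \<Sum>k<n. \<Sum>t\<in>F. (c s * coef (ix (w s)) k) * (c t * coef (ix (w t)) k))"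
      by (intro sum.cong refl sum.swap)
    also have "\<dots> = (\<Sum>k<n. \<Sum>s\<in>F. \<Sum>t\<in>F. (c s * coef (ix (w s)) k) * (c t * coef (ix (w t)) k))" by (rule sum.swap)
    also have "\<dots> = (\<Sum>k<n. (\<alpha> k)\<^sup>2)" by (simp add: \<alpha>_def power2_eq_square sum_product)
    finally show ?thesis by simp
  qed
  ultimately show ?thesis by blast
qed

lemma dyadic_gauss_char:
  fixes w :: "'s \<Rightarrow> real^'p"
  assumes "finite F" "\<And>s. s \<in> F \<Longrightarrow> w s \<in> dy"
  shows "(\<integral>\<omega>. cis (\<Sum>s\<in>F. c s * dyadic_gauss (w s) \<omega>) \<partial>N0) = complex_of_real (exp (- (\<Sum>s\<in>F. \<Sum>t\<in>F. c s * c t * Kc (w s) (w t)) / 2))"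
proof -
  obtain n \<alpha> where "\<And>\<omega>. (\<Sum>s\<in>F. c s * dyadic_gauss (w s) \<omega>) = (\<Sum>k<n. \<alpha> k * \<omega> (cpt k))"
    "(\<Sum>k<n. (\<alpha> k)\<^sup>2) = (\<Sum>s\<in>F. \<Sum>t\<in>F. c s * c t * Kc (w s) (w t))"
    using dyadic_gauss_comb[of F w c] assms by blast
  then show ?thesis using GS.char_sum[where n=n and \<alpha>=\<alpha>] by simp
qed

lemma dyadic_gauss_mgf:
  assumes "a \<in> dy" "b \<in> dy"
  shows "(\<integral>\<^sup>+\<omega>. ennreal (exp (\<theta> * (dyadic_gauss b \<omega> - dyadic_gauss a \<omega>))) \<partial>N0) = ennreal (exp (\<theta>\<^sup>2 * (Kc b b + Kc a a - Kc a b - Kc b a) / 2))"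
proof -
  \<comment> \<open>The two-element index type is \<open>bool\<close>, so the case
    \<open>a = b\<close> requires no separate treatment.\<close>
  let ?c = "\<lambda>s. if s then \<theta> else - \<theta>" and ?w = "\<lambda>s. if s then b else a"
  obtain n \<alpha> where e: "\<And>\<omega>. (\<Sum>s\<in>UNIV. ?c s * dyadic_gauss (?w s) \<omega>) = (\<Sum>k<n. \<alpha> k * \<omega> (cpt k))"
    "(\<Sum>k<n. (\<alpha> k)\<^sup>2) = (\<Sum>s\<in>UNIV. \<Sum>t\<in>UNIV. ?c s * ?c t * Kc (?w s) (?w t))"
  proof -
    have "?w s \<in> dy" for s using assms by (cases s) simp_all
    then have "\<exists>n \<alpha>. (\<forall>\<omega>. (\<Sum>s\<in>UNIV. ?c s * dyadic_gauss (?w s) \<omega>) = (\<Sum>k<n. \<alpha> k * \<omega> (cpt k))) \<and>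
      (\<Sum>k<n. (\<alpha> k)\<^sup>2) = (\<Sum>s\<in>UNIV. \<Sum>t\<in>UNIV. ?c s * ?c t * Kc (?w s) (?w t))"
      by (intro dyadic_gauss_comb) simp_all
    then show ?thesis using that by blast
  qed
  have "(\<Sum>s\<in>UNIV. ?c s * dyadic_gauss (?w s) \<omega>) = \<theta> * (dyadic_gauss b \<omega> - dyadic_gauss a \<omega>)" for \<omega> by (simp add: UNIV_bool algebra_simps)
  moreover have "(\<Sum>s\<in>UNIV. \<Sum>t\<in>UNIV. ?c s * ?c t * Kc (?w s) (?w t)) = \<theta>\<^sup>2 * (Kc b b + Kc a a - Kc a b - Kc b a)"
    by (simp add: UNIV_bool power2_eq_square algebra_simps)
  ultimately have e1: "(\<Sum>k<n. \<alpha> k * \<omega> (cpt k)) = \<theta> * (dyadic_gauss b \<omega> - dyadic_gauss a \<omega>)"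
    and e2: "(\<Sum>k<n. (\<alpha> k)\<^sup>2) = \<theta>\<^sup>2 * (Kc b b + Kc a a - Kc a b - Kc b a)" for \<omega>
    using e by metis+
  have "(\<integral>\<^sup>+\<omega>. ennreal (exp (\<Sum>k<n. \<alpha> k * \<omega> (cpt k))) \<partial>N0) = ennreal (exp ((\<Sum>k<n. (\<alpha> k)\<^sup>2) / 2))"
    by (rule GS.mgf_sum)
  then show ?thesis unfolding e1 e2 .
qed

text \<open>For \<open>a \<le> b\<close> the variance of the increment is
  \<open>d - d\<^sup>2\<close> with \<open>d = D b - D a\<close>, just as for the orthant
  indicators.\<close>

lemma Kc_pair:
  assumes ab: "(a, b) \<in> dpairs l" shows "Kc b b + Kc a a - Kc a b - Kc b a \<le> real CARD('p) / 2 ^ l"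
proof -
  have v: "vmin a b = a" "vmin b a = a" "vmin a a = a" "vmin b b = b"
    using ab by (auto simp: vmin_def dpairs_def vec_eq_iff min_def intro: antisym)
  have "Kc b b + Kc a a - Kc a b - Kc b a = (D b - D a) - (D b - D a)\<^sup>2"
    by (simp add: Kc_def v power2_eq_square algebra_simps)
  then show ?thesis using D_pair(1)[OF ab] zero_le_power2[of "D b - D a"] by linarith
qed

definition gauss_max :: "nat \<Rightarrow> (real^'p \<Rightarrow> real) \<Rightarrow> real" where
  "gauss_max l \<omega> = Max ((\<lambda>e. \<bar>dyadic_gauss (snd e) \<omega> - dyadic_gauss (fst e) \<omega>\<bar>) ` dpairs l)"

lemma gauss_max_ge: "(a, b) \<in> dpairs l \<Longrightarrow> \<bar>dyadic_gauss b \<omega> - dyadic_gauss a \<omega>\<bar> \<le> gauss_max l \<omega>"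
  unfolding gauss_max_def by (rule Max_ge) (force intro: finite_imageI dpairs_finite)+

lemma gauss_max_nonneg: "0 \<le> gauss_max l \<omega>"
proof -
  obtain a b :: "real^'p" where "(a, b) \<in> dpairs l" using dpairs_nonempty by (metis ex_in_conv surj_pair)
  then show ?thesis using gauss_max_ge[of a b l \<omega>] by linarith
qed

lemma gauss_max_measurable[measurable]: "gauss_max l \<in> borel_measurable N0"
  unfolding gauss_max_def by (intro borel_measurable_Max dpairs_finite) measurable

text \<open>The same maximal inequality with \<open>lam = sqrt (2 ^ l)\<close>. The Gaussian
  exponential moment holds for every parameter, so there is no largest admissible level and the
  chain can run through all of them.\<close>

lemma gauss_max_expectation: "(\<integral>\<^sup>+\<omega>. ennreal (gauss_max l \<omega>) \<partial>N0) \<le> ennreal (entropy_bound TYPE('p) l / sqrt (2 ^ l))"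
proof -
  have mgf: "(\<integral>\<^sup>+\<omega>. ennreal (exp (\<theta> * (dyadic_gauss (snd e) \<omega> - dyadic_gauss (fst e) \<omega>))) \<partial>N0) \<le> ennreal (exp (real CARD('p)))"
    if e: "e \<in> dpairs l" and \<theta>: "\<theta>\<^sup>2 = 2 ^ l" for e \<theta>
  proof -
    obtain a b where ab: "e = (a, b)" by (cases e)
    have "a \<in> dy" "b \<in> dy" using e ab by (auto simp: dpairs_def)
    moreover have "\<theta>\<^sup>2 * (Kc b b + Kc a a - Kc a b - Kc b a) / 2 \<le> real CARD('p)"
    proof -
      have "\<theta>\<^sup>2 * (Kc b b + Kc a a - Kc a b - Kc b a) \<le> 2 ^ l * (real CARD('p) / 2 ^ l)"
        unfolding \<theta> using Kc_pair[of a b l] e ab by (intro mult_left_mono) auto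
      then show ?thesis by simp
    qed
    ultimately show ?thesis using dyadic_gauss_mgf[of a b \<theta>] ab by (simp add: ennreal_leI)
  qed
  have "(\<integral>\<^sup>+\<omega>. ennreal (gauss_max l \<omega>) \<partial>N0) \<le> ennreal ((ln (2 * real (card (dpairs l :: ((real^'p) \<times> (real^'p)) set))) + real CARD('p) + 1) / sqrt (2 ^ l))"
    unfolding gauss_max_def
    by (rule GS.N0.nn_integral_Max_abs_le[OF dpairs_finite dpairs_nonempty _ _ _ mgf mgf]) auto
  also have "\<dots> \<le> ennreal (entropy_bound TYPE('p) l / sqrt (2 ^ l))"
    by (intro ennreal_leI divide_right_mono entropy_bound_ge) auto
  finally show ?thesis .
qed

definition Good :: "(real^'p \<Rightarrow> real) set" where
  "Good = {\<omega>\<in>space N0. (\<Sum>l. ennreal (gauss_max l \<omega>)) < \<infinity>}"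

lemma Good_measurable[measurable]: "Good \<in> sets N0"
  unfolding Good_def by measurable

text \<open>The link maxima have summable expectations, so their sum has finite expectation and is
  almost surely finite.\<close>

lemma Good_AE: "AE \<omega> in N0. \<omega> \<in> Good"
proof -
  have k0: "0 \<le> entropy_bound TYPE('p) l / sqrt (2 ^ l)" for l using entropy_bound_nonneg[of "TYPE('p)" l] by simp
  have "(\<integral>\<^sup>+\<omega>. (\<Sum>l. ennreal (gauss_max l \<omega>)) \<partial>N0) = (\<Sum>l. \<integral>\<^sup>+\<omega>. ennreal (gauss_max l \<omega>) \<partial>N0)"
    by (rule nn_integral_suminf) measurable
  also have "\<dots> \<le> (\<Sum>l. ennreal (entropy_bound TYPE('p) l / sqrt (2 ^ l)))"
    by (intro suminf_le gauss_max_expectation) auto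
  also have "\<dots> = ennreal (\<Sum>l. entropy_bound TYPE('p) l / sqrt (2 ^ l))"
    by (rule suminf_ennreal2[OF k0 entropy_bound_summable])
  finally have "(\<integral>\<^sup>+\<omega>. (\<Sum>l. ennreal (gauss_max l \<omega>)) \<partial>N0) \<noteq> \<infinity>" by (auto simp: top_unique)
  from nn_integral_PInf_AE[OF _ this] have "AE \<omega> in N0. (\<Sum>l. ennreal (gauss_max l \<omega>)) \<noteq> \<infinity>" by simp
  then show ?thesis using AE_space by eventually_elim (auto simp: Good_def less_top)
qed

lemma Good_summable: "\<omega> \<in> Good \<Longrightarrow> summable (\<lambda>l. gauss_max l \<omega>)"
  by (rule summable_suminf_not_top[OF gauss_max_nonneg]) (auto simp: Good_def)

text \<open>Off the good event the path is set to 0, so that uniform continuity and boundedness on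
  the cube hold for every \<omega> and not only almost surely.\<close>

definition gauss_path :: "real^'p \<Rightarrow> (real^'p \<Rightarrow> real) \<Rightarrow> real" where
  "gauss_path u \<omega> = (if \<omega> \<in> Good then lim (\<lambda>m. dyadic_gauss (dfloor m u) \<omega>) else 0)"

lemma gauss_path_tendsto:
  assumes w: "\<omega> \<in> Good" and u: "u \<in> cube"
  shows "(\<lambda>m. dyadic_gauss (dfloor m u) \<omega>) \<longlonglongrightarrow> gauss_path u \<omega>"
proof -
  let ?S = "\<lambda>n. \<Sum>l<n. gauss_max l \<omega>"
  have cS: "Cauchy ?S" using Good_summable[OF w] by (simp add: Cauchy_convergent_iff summable_iff_convergent)
  have step: "\<bar>dyadic_gauss (dfloor L u) \<omega> - dyadic_gauss (dfloor m u) \<omega>\<bar> \<le> ?S (Suc L) - ?S (Suc m)" if mL: "m \<le> L" for m L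
  proof -
    have "\<bar>dyadic_gauss (dfloor L u) \<omega> - dyadic_gauss (dfloor m u) \<omega>\<bar> \<le> (\<Sum>l\<in>{m<..L}. gauss_max l \<omega>)"
      by (rule dyadic_chain[where f="\<lambda>u. dyadic_gauss u \<omega>" and Mx="\<lambda>l. gauss_max l \<omega>", OF _ u mL]) (rule gauss_max_ge)
    also have "\<dots> = ?S (Suc L) - ?S (Suc m)"
    proof -
      have "?S (Suc L) = sum (\<lambda>l. gauss_max l \<omega>) ({..<Suc m} \<union> {m<..L})"
        by (rule sum.cong) (use mL in auto)
      also have "\<dots> = ?S (Suc m) + (\<Sum>l\<in>{m<..L}. gauss_max l \<omega>)" by (rule sum.union_disjoint) auto
      finally show ?thesis by linarith
    qed
    finally show ?thesis .
  qed
  have "Cauchy (\<lambda>m. dyadic_gauss (dfloor m u) \<omega>)"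
  proof (rule CauchyI)
    fix e :: real assume "0 < e"
    then obtain K where K: "\<And>m n. m \<ge> K \<Longrightarrow> n \<ge> K \<Longrightarrow> norm (?S m - ?S n) < e" using CauchyD[OF cS] by blast
    have less: "\<bar>dyadic_gauss (dfloor n u) \<omega> - dyadic_gauss (dfloor m u) \<omega>\<bar> < e" if mn: "K \<le> m" "m \<le> n" for m n
    proof -
      have "\<bar>dyadic_gauss (dfloor n u) \<omega> - dyadic_gauss (dfloor m u) \<omega>\<bar> \<le> ?S (Suc n) - ?S (Suc m)" using step[of m n] mn by simp
      also have "\<dots> < e" using K[of "Suc n" "Suc m"] mn by (auto simp: abs_less_iff simp del: sum.lessThan_Suc)
      finally show ?thesis .
    qed
    show "\<exists>M. \<forall>m\<ge>M. \<forall>n\<ge>M. norm (dyadic_gauss (dfloor m u) \<omega> - dyadic_gauss (dfloor n u) \<omega>) < e"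
    proof (intro exI[of _ K] allI impI)
      fix m n assume "K \<le> m" "K \<le> n"
      then show "norm (dyadic_gauss (dfloor m u) \<omega> - dyadic_gauss (dfloor n u) \<omega>) < e"
        using less[of m n] less[of n m] by (cases "m \<le> n") (auto simp: abs_minus_commute)
    qed
  qed
  then show ?thesis using w by (simp add: gauss_path_def Cauchy_convergent_iff convergent_LIMSEQ_iff)
qed

lemma gauss_path_modulus:
  assumes w: "\<omega> \<in> Good" and u: "u \<in> cube" "v \<in> cube" and near: "\<And>k. \<bar>u $ k - v $ k\<bar> \<le> 1 / 2 ^ m"
  shows "\<bar>gauss_path u \<omega> - gauss_path v \<omega>\<bar> \<le> 2 * (\<Sum>l. gauss_max (l + m) \<omega>)"
proof (rule LIMSEQ_le_const2)
  show "(\<lambda>L. \<bar>dyadic_gauss (dfloor L u) \<omega> - dyadic_gauss (dfloor L v) \<omega>\<bar>) \<longlonglongrightarrow> \<bar>gauss_path u \<omega> - gauss_path v \<omega>\<bar>"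
    by (intro tendsto_intros gauss_path_tendsto w u)
  show "\<exists>K. \<forall>L\<ge>K. \<bar>dyadic_gauss (dfloor L u) \<omega> - dyadic_gauss (dfloor L v) \<omega>\<bar> \<le> 2 * (\<Sum>l. gauss_max (l + m) \<omega>)"
  proof (intro exI[of _ m] allI impI)
    fix L assume mL: "m \<le> L"
    have "\<bar>dyadic_gauss (dfloor L u) \<omega> - dyadic_gauss (dfloor L v) \<omega>\<bar> \<le> 2 * (\<Sum>l\<in>{m..L}. gauss_max l \<omega>)"
      by (rule dyadic_modulus[where f="\<lambda>u. dyadic_gauss u \<omega>" and Mx="\<lambda>l. gauss_max l \<omega>", OF _ u near mL]) (rule gauss_max_ge)
    also have "(\<Sum>l\<in>{m..L}. gauss_max l \<omega>) \<le> (\<Sum>l\<in>{0 + m..L + m}. gauss_max l \<omega>)"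
      using gauss_max_nonneg by (intro sum_mono2) auto
    also have "\<dots> = (\<Sum>l\<in>{0..L}. gauss_max (l + m) \<omega>)" by (rule sum.shift_bounds_cl_nat_ivl)
    also have "\<dots> \<le> (\<Sum>l. gauss_max (l + m) \<omega>)"
      using Good_summable[OF w] gauss_max_nonneg
      by (intro sum_le_suminf) (auto simp: summable_iff_shift[of "\<lambda>l. gauss_max l \<omega>" m])
    finally show "\<bar>dyadic_gauss (dfloor L u) \<omega> - dyadic_gauss (dfloor L v) \<omega>\<bar> \<le> 2 * (\<Sum>l. gauss_max (l + m) \<omega>)" by simp
  qed
qed

lemma gauss_path_unif_cont:
  assumes e: "0 < e"
  shows "\<exists>m. \<forall>u\<in>cube. \<forall>v\<in>cube. (\<forall>k. \<bar>u $ k - v $ k\<bar> \<le> 1 / 2 ^ m) \<longrightarrow> \<bar>gauss_path u \<omega> - gauss_path v \<omega>\<bar> \<le> e"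
proof (cases "\<omega> \<in> Good")
  case True
  have "(\<lambda>m. (\<Sum>l. gauss_max l \<omega>) - (\<Sum>l<m. gauss_max l \<omega>)) \<longlonglongrightarrow> (\<Sum>l. gauss_max l \<omega>) - (\<Sum>l. gauss_max l \<omega>)"
    by (intro tendsto_intros summable_LIMSEQ Good_summable True)
  then have "(\<lambda>m. \<Sum>l. gauss_max (l + m) \<omega>) \<longlonglongrightarrow> 0"
    using suminf_minus_initial_segment[OF Good_summable[OF True]] by simp
  then have "\<forall>\<^sub>F m in sequentially. (\<Sum>l. gauss_max (l + m) \<omega>) < e / 2" using e by (intro order_tendstoD(2)) auto
  then obtain m where m: "(\<Sum>l. gauss_max (l + m) \<omega>) < e / 2" unfolding eventually_sequentially by blast
  show ?thesis
  proof (intro exI[of _ m] ballI impI)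
    fix u v :: "real^'p" assume uv: "u \<in> cube" "v \<in> cube" "\<forall>k. \<bar>u $ k - v $ k\<bar> \<le> 1 / 2 ^ m"
    have "\<bar>gauss_path u \<omega> - gauss_path v \<omega>\<bar> \<le> 2 * (\<Sum>l. gauss_max (l + m) \<omega>)" by (rule gauss_path_modulus[OF True uv(1,2)]) (use uv(3) in blast)
    then show "\<bar>gauss_path u \<omega> - gauss_path v \<omega>\<bar> \<le> e" using m by linarith
  qed
next
  case False
  then show ?thesis using e by (simp add: gauss_path_def)
qed

lemma gauss_path_measurable[measurable]:
  assumes u: "u \<in> cube" shows "gauss_path u \<in> borel_measurable N0"
proof (rule borel_measurable_LIMSEQ_real)
  show "(\<lambda>m. if \<omega> \<in> Good then dyadic_gauss (dfloor m u) \<omega> else 0) \<longlonglongrightarrow> gauss_path u \<omega>" for \<omega>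
    using gauss_path_tendsto[OF _ u, of \<omega>] by (cases "\<omega> \<in> Good") (auto simp: gauss_path_def)
  show "(\<lambda>\<omega>. if \<omega> \<in> Good then dyadic_gauss (dfloor m u) \<omega> else 0) \<in> borel_measurable N0" for m by measurable
qed

lemma D_close:
  assumes "a \<in> cube" "b \<in> cube" "\<And>k. a $ k \<le> b $ k" "\<And>k. b $ k \<le> a $ k + 1 / 2 ^ m"
  shows "\<bar>D a - D b\<bar> \<le> real CARD('p) / 2 ^ m"
proof -
  have "D b - D a \<le> (\<Sum>k\<in>UNIV. b $ k - a $ k)" by (rule D_incr) (use assms in auto)
  also have "\<dots> \<le> (\<Sum>k\<in>(UNIV :: 'p set). 1 / 2 ^ m)" using assms(4) by (intro sum_mono) (simp add: algebra_simps)
  finally show ?thesis using D_mono[of a b] assms(3) by simp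
qed

lemma D_tendsto:
  assumes "\<And>m. a m \<in> cube" "b \<in> cube" "\<And>m k. a m $ k \<le> b $ k" "\<And>m k. b $ k \<le> a m $ k + 1 / 2 ^ m"
  shows "(\<lambda>m. D (a m)) \<longlonglongrightarrow> D b"
proof -
  have "(\<lambda>m. real CARD('p) * (1 / 2) ^ m) \<longlonglongrightarrow> real CARD('p) * 0"
    by (intro tendsto_intros LIMSEQ_realpow_zero) auto
  then have z: "(\<lambda>m. real CARD('p) / 2 ^ m) \<longlonglongrightarrow> 0" by (simp add: power_divide)
  have "(\<lambda>m. D (a m) - D b) \<longlonglongrightarrow> 0"
  proof (rule Lim_null_comparison[OF _ z], rule always_eventually, rule allI)
    show "norm (D (a m) - D b) \<le> real CARD('p) / 2 ^ m" for m
      unfolding real_norm_def by (rule D_close[OF assms])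
  qed
  then show ?thesis by (rule LIM_zero_cancel)
qed

lemma Kc_tendsto:
  assumes u: "u \<in> cube" "v \<in> cube" shows "(\<lambda>m. Kc (dfloor m u) (dfloor m v)) \<longlonglongrightarrow> Kc u v"
  unfolding Kc_def
proof (intro tendsto_intros D_tendsto)
  show "vmin (dfloor m u) (dfloor m v) \<in> cube" for m
    using dgrid_cube[OF dfloor_grid[OF u(1), of m]] dgrid_cube[OF dfloor_grid[OF u(2), of m]] by (auto simp: cube_def vmin_def min_def)
  show "vmin (dfloor m u) (dfloor m v) $ k \<le> vmin u v $ k" for m k
    using dfloor_le[of m u k] dfloor_le[of m v k] by (auto simp: vmin_def intro: min.mono)
  show "vmin u v $ k \<le> vmin (dfloor m u) (dfloor m v) $ k + 1 / 2 ^ m" for m k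
    using le_dfloor[of u k m] le_dfloor[of v k m] by (auto simp: vmin_def min_def)
  show "vmin u v \<in> cube" using u by (auto simp: cube_def vmin_def min_def)
qed (use u dfloor_le le_dfloor dgrid_cube[OF dfloor_grid] in auto)

lemma gauss_path_char:
  assumes F: "finite F" "F \<subseteq> cube"
  shows "(\<integral>\<omega>. cis (\<Sum>u\<in>F. c u * gauss_path u \<omega>) \<partial>N0) = complex_of_real (exp (- (\<Sum>u\<in>F. \<Sum>v\<in>F. c u * c v * Kc u v) / 2))"
proof (rule LIMSEQ_unique)
  have [measurable]: "gauss_path u \<in> borel_measurable N0" if "u \<in> F" for u using gauss_path_measurable that F by auto
  show "(\<lambda>m. \<integral>\<omega>. cis (\<Sum>u\<in>F. c u * dyadic_gauss (dfloor m u) \<omega>) \<partial>N0) \<longlonglongrightarrow> (\<integral>\<omega>. cis (\<Sum>u\<in>F. c u * gauss_path u \<omega>) \<partial>N0)"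
  proof (rule integral_dominated_convergence[where w="\<lambda>_. 1"])
    show "AE \<omega> in N0. (\<lambda>m. cis (\<Sum>u\<in>F. c u * dyadic_gauss (dfloor m u) \<omega>)) \<longlonglongrightarrow> cis (\<Sum>u\<in>F. c u * gauss_path u \<omega>)"
      using Good_AE
    proof eventually_elim
      case (elim \<omega>)
      show ?case unfolding cis_conv_exp
        by (intro tendsto_intros gauss_path_tendsto elim) (use F in auto)
    qed
  qed auto
  have "(\<integral>\<omega>. cis (\<Sum>u\<in>F. c u * dyadic_gauss (dfloor m u) \<omega>) \<partial>N0) = complex_of_real (exp (- (\<Sum>u\<in>F. \<Sum>v\<in>F. c u * c v * Kc (dfloor m u) (dfloor m v)) / 2))" for m
    by (rule dyadic_gauss_char[OF F(1)]) (use F dfloor_grid in blast)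
  moreover have "(\<lambda>m. complex_of_real (exp (- (\<Sum>u\<in>F. \<Sum>v\<in>F. c u * c v * Kc (dfloor m u) (dfloor m v)) / 2)))
      \<longlonglongrightarrow> complex_of_real (exp (- (\<Sum>u\<in>F. \<Sum>v\<in>F. c u * c v * Kc u v) / 2))"
    by (intro tendsto_intros Kc_tendsto) (use F in auto)
  ultimately show "(\<lambda>m. \<integral>\<omega>. cis (\<Sum>u\<in>F. c u * dyadic_gauss (dfloor m u) \<omega>) \<partial>N0)
      \<longlonglongrightarrow> complex_of_real (exp (- (\<Sum>u\<in>F. \<Sum>v\<in>F. c u * c v * Kc u v) / 2))" by simp
qed

end

section \<open>Generalized inverses of empirical distribution functions\<close>

text \<open>The infimum is attained at a data point, the smallest one whose empirical level reaches
  \<open>u\<close>. Below it the empirical function is constant between data points, so it cannot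
  reach \<open>u\<close> earlier; \<open>0 < u\<close> excludes the stretch to the left of all
  data.\<close>

lemma geninv_empirical:
  fixes x :: "nat \<Rightarrow> real" and z :: "nat \<Rightarrow> bool" and n :: nat
  defines "c \<equiv> (\<Sum>i<n. if z i then 1 else 0 :: real)"
  defines "F \<equiv> (\<lambda>t. (\<Sum>i<n. if x i \<le> t \<and> z i then 1 else 0) / c)"
  assumes c: "0 < c" and u: "0 < u" "u \<le> 1"
  shows "\<exists>y. geninv F u = ereal y \<and> u \<le> F y \<and> (\<forall>t<y. F t < u)"
proof -
  define S where "S = {y \<in> x ` {i. i < n \<and> z i}. u \<le> F y}"
  have fin: "finite (x ` {i. i < n \<and> z i})" by simp
  have ne: "x ` {i. i < n \<and> z i} \<noteq> {}"
  proof
    assume "x ` {i. i < n \<and> z i} = {}"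
    then have "c = 0" unfolding c_def by (intro sum.neutral) auto
    then show False using c by simp
  qed
  have Fmax: "F (Max (x ` {i. i < n \<and> z i})) = 1"
  proof -
    have "(\<Sum>i<n. if x i \<le> Max (x ` {i. i < n \<and> z i}) \<and> z i then 1 else 0 :: real) = c"
      unfolding c_def by (intro sum.cong refl) auto
    then show ?thesis unfolding F_def using c by simp
  qed
  have "S \<noteq> {}" using Fmax u(2) Max_in[OF fin ne] unfolding S_def by auto
  moreover have "finite S" unfolding S_def by simp
  ultimately have y: "Min S \<in> S" and ymin: "\<And>s. s \<in> S \<Longrightarrow> Min S \<le> s" by auto
  have low: "F t < u" if t: "t < Min S" for t
  proof (rule ccontr)
    assume "\<not> F t < u"
    then have Ft: "u \<le> F t" by simp
    \<comment> \<open>If level \<open>u\<close> were reached at \<open>t\<close>, it would already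
      be reached at the largest counted data point not exceeding \<open>t\<close>, contradicting
      minimality.\<close>
    define R where "R = {y \<in> x ` {i. i < n \<and> z i}. y \<le> t}"
    have Rne: "R \<noteq> {}"
    proof
      assume "R = {}"
      then have "F t = 0" unfolding F_def R_def by (auto intro!: sum.neutral)
      then show False using Ft u(1) by simp
    qed
    have Rfin: "finite R" unfolding R_def by simp
    have R: "Max R \<in> R" using Rfin Rne by simp
    have "(\<Sum>i<n. if x i \<le> t \<and> z i then 1 else 0 :: real) = (\<Sum>i<n. if x i \<le> Max R \<and> z i then 1 else 0)"
    proof (intro sum.cong refl if_cong)
      fix i assume i: "i \<in> {..<n}"
      have "x i \<le> Max R" if "x i \<le> t" "z i"
      proof -
        have "x i \<in> R" using i that by (auto simp: R_def)
        then show ?thesis by (rule Max_ge[OF Rfin])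
      qed
      moreover have "Max R \<le> t" using R by (simp add: R_def)
      ultimately show "(x i \<le> t \<and> z i) = (x i \<le> Max R \<and> z i)" by auto
    qed
    then have "u \<le> F (Max R)" using Ft unfolding F_def by simp
    then have "Max R \<in> S" using R unfolding S_def R_def by auto
    then have "Min S \<le> Max R" by (rule ymin)
    then show False using R t unfolding R_def by auto
  qed
  have "geninv F u = ereal (Min S)"
    unfolding geninv_def
  proof (rule antisym)
    show "Inf {ereal t |t. u \<le> F t} \<le> ereal (Min S)" using y by (intro Inf_lower) (auto simp: S_def)
    show "ereal (Min S) \<le> Inf {ereal t |t. u \<le> F t}"
      using low by (intro Inf_greatest) (auto simp: not_less[symmetric])
  qed
  then show ?thesis using y low by (intro exI[of _ "Min S"]) (auto simp: S_def)
qed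

text \<open>Applied at \<open>u = 0\<close>, where the quantile \<open>- \<infinity>\<close> selects
  no observation at all.\<close>

lemma geninv_nonpos:
  assumes "\<And>t. u \<le> F t" shows "geninv F u = - \<infinity>"
proof -
  have "Inf {ereal t |t. u \<le> F t} \<le> ereal r" for r
    by (intro Inf_lower) (use assms in auto)
  then show ?thesis unfolding geninv_def by (simp add: ereal_bot)
qed

section \<open>The sampling model\<close>

locale sampling_model = prob_space P for P :: "'a measure" +
  fixes X :: "nat \<Rightarrow> 'a \<Rightarrow> real^'p" and Z :: "nat \<Rightarrow> 'a \<Rightarrow> real^'q" and A :: "(real^'q) set"
  assumes X_meas[measurable]: "\<And>i. X i \<in> borel_measurable P"
    and Z_meas[measurable]: "\<And>i. Z i \<in> borel_measurable P"
    and iid_indep: "indep_vars (\<lambda>_. borel) (\<lambda>i \<omega>. (X i \<omega>, Z i \<omega>)) UNIV"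
    and iid_distr: "\<And>i. distr P borel (\<lambda>\<omega>. (X i \<omega>, Z i \<omega>)) = distr P borel (\<lambda>\<omega>. (X 0 \<omega>, Z 0 \<omega>))"
    and A[measurable]: "A \<in> sets borel"
    and pA_pos: "pA P Z A > 0"
    and margins_cont: "\<And>k. continuous_on UNIV (Fcond P X Z A k)"
begin

abbreviation Fc :: "'p \<Rightarrow> real \<Rightarrow> real" where "Fc \<equiv> Fcond P X Z A"
abbreviation V :: "nat \<Rightarrow> 'a \<Rightarrow> (real^'p) \<times> (real^'q)" where "V i \<omega> \<equiv> (X i \<omega>, Z i \<omega>)"

definition phi :: "real^'p \<Rightarrow> (real^'p) \<times> (real^'q) \<Rightarrow> real" where
  "phi u x = (if (\<forall>k. Fc k (fst x $ k) \<le> u $ k) \<and> snd x \<in> A then 1 else 0)"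

definition ff :: "nat \<Rightarrow> real^'p \<Rightarrow> 'a \<Rightarrow> real" where "ff i u \<omega> = phi u (V i \<omega>)"

lemma Fc_measurable[measurable]: "Fc k \<in> borel_measurable borel"
  by (rule borel_measurable_continuous_onI[OF margins_cont])

lemma nth_measurable[measurable]: "(\<lambda>x :: real^'n. x $ k) \<in> borel_measurable borel"
  by (intro borel_measurable_continuous_onI continuous_intros)

lemma V_measurable[measurable]: "V i \<in> borel_measurable P"
  by measurable

lemma phi_measurable[measurable]: "phi u \<in> borel_measurable borel"
proof -
  have "phi u \<in> borel_measurable (borel \<Otimes>\<^sub>M borel)" unfolding phi_def by measurable
  then show ?thesis by (simp add: borel_prod)
qed

lemma ff_measurable[measurable]: "ff i u \<in> borel_measurable P"
  unfolding ff_def by measurable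

lemma V_transfer:
  assumes Q: "Measurable.pred borel Q"
  shows "prob {\<omega>\<in>space P. Q (V i \<omega>)} = prob {\<omega>\<in>space P. Q (V 0 \<omega>)}"
proof -
  have "prob {\<omega>\<in>space P. Q (V i \<omega>)} = measure (distr P borel (V i)) {x\<in>space borel. Q x}" for i
    using Q by (subst measure_distr) (auto intro!: arg_cong[where f=prob])
  then show ?thesis using iid_distr[of i] by simp
qed

lemma Fc_def': "pA P Z A * Fc k t = prob {\<omega>\<in>space P. X 0 \<omega> $ k \<le> t \<and> Z 0 \<omega> \<in> A}"
  using pA_pos by (simp add: Fcond_def)

lemma ZA_set: "{\<omega>\<in>space P. Z 0 \<omega> \<in> A} \<in> sets P" by measurable

section \<open>Uniformity of the transformed conditional margins\<close>

definition \<mu> :: "'p \<Rightarrow> real measure" where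
  "\<mu> k = distr (uniform_measure P {\<omega>\<in>space P. Z 0 \<omega> \<in> A}) borel (\<lambda>\<omega>. X 0 \<omega> $ k)"

lemma \<mu>_real_distribution: "real_distribution (\<mu> k)"
proof -
  have "prob_space (uniform_measure P {\<omega>\<in>space P. Z 0 \<omega> \<in> A})"
    using pA_pos ZA_set by (intro prob_space_uniform_measure) (auto simp: pA_def emeasure_eq_measure)
  then show ?thesis unfolding \<mu>_def
    by (intro prob_space.real_distribution_distr) measurable
qed

lemma Fc_cdf: "Fc k = cdf (\<mu> k)"
proof
  fix t
  let ?E = "{\<omega>\<in>space P. Z 0 \<omega> \<in> A}"
  have "cdf (\<mu> k) t = measure (uniform_measure P ?E) {\<omega>\<in>space P. X 0 \<omega> $ k \<le> t}"
    unfolding cdf_def \<mu>_def by (subst measure_distr) (auto intro!: arg_cong[where f="measure _"])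
  also have "\<dots> = prob (?E \<inter> {\<omega>\<in>space P. X 0 \<omega> $ k \<le> t}) / prob ?E"
    using pA_pos by (intro measure_uniform_measure) (auto simp: pA_def emeasure_eq_measure)
  also have "?E \<inter> {\<omega>\<in>space P. X 0 \<omega> $ k \<le> t} = {\<omega>\<in>space P. X 0 \<omega> $ k \<le> t \<and> Z 0 \<omega> \<in> A}" by auto
  finally show "Fc k t = cdf (\<mu> k) t" by (simp add: Fcond_def pA_def)
qed

lemma Fc_mono: "s \<le> t \<Longrightarrow> Fc k s \<le> Fc k t"
proof -
  interpret m: real_distribution "\<mu> k" by (rule \<mu>_real_distribution)
  show "s \<le> t \<Longrightarrow> Fc k s \<le> Fc k t" unfolding Fc_cdf by (rule m.cdf_nondecreasing)
qed

lemma Fc_bounds: "0 \<le> Fc k t" "Fc k t \<le> 1"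
proof -
  interpret m: real_distribution "\<mu> k" by (rule \<mu>_real_distribution)
  show "0 \<le> Fc k t" "Fc k t \<le> 1" unfolding Fc_cdf using m.cdf_nonneg m.cdf_bounded_prob by auto
qed

text \<open>The probability integral transform. By monotonicity and continuity the set where
  \<open>Fc k\<close> is at most \<open>t\<close> is a closed half line, whose end point has level
  exactly \<open>t\<close>; flat stretches of the margin are absorbed by taking the
  supremum.\<close>

lemma uniform_interior:
  assumes t: "0 < t" "t < 1"
  shows "prob {\<omega>\<in>space P. Fc k (X 0 \<omega> $ k) \<le> t \<and> Z 0 \<omega> \<in> A} = pA P Z A * t"
proof -
  interpret m: real_distribution "\<mu> k" by (rule \<mu>_real_distribution)
  have top: "(Fc k \<longlongrightarrow> 1) at_top" and bot: "(Fc k \<longlongrightarrow> 0) at_bot"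
    unfolding Fc_cdf using m.cdf_lim_at_top_prob m.cdf_lim_at_bot by auto
  obtain b where b: "t < Fc k b" using eventually_happens[OF order_tendstoD(1)[OF top t(2)]] by auto
  obtain a where a: "Fc k a < t" using eventually_happens[OF order_tendstoD(2)[OF bot t(1)]] by auto
  define S where "S = {x. Fc k x \<le> t}"
  have Sb: "bdd_above S"
  proof (rule bdd_aboveI)
    fix x assume "x \<in> S"
    then show "x \<le> b" using b Fc_mono[of b x k] unfolding S_def by (cases "x \<le> b") auto
  qed
  have Sc: "closed S" unfolding S_def
    by (rule closed_Collect_le[OF margins_cont continuous_on_const])
  have Sne: "S \<noteq> {}" using a unfolding S_def by (auto intro: less_imp_le)
  have xS: "Sup S \<in> S" by (rule closed_contains_Sup[OF Sne Sb Sc])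
  have iff: "Fc k y \<le> t \<longleftrightarrow> y \<le> Sup S" for y
    using xS cSup_upper[OF _ Sb, of y] Fc_mono[of y "Sup S" k] by (auto simp: S_def)
  have "Fc k (Sup S) = t"
  proof (rule antisym)
    show "Fc k (Sup S) \<le> t" using xS by (simp add: S_def)
    have "((\<lambda>y. Fc k y) \<longlongrightarrow> Fc k (Sup S)) (at_right (Sup S))"
      using margins_cont[of k] by (auto simp: continuous_on_def intro: tendsto_within_subset)
    moreover have "\<forall>\<^sub>F y in at_right (Sup S). t \<le> Fc k y"
      unfolding eventually_at_right_field using iff by (auto intro!: exI[of _ "Sup S + 1"] simp: not_le[symmetric] less_imp_le)
    ultimately show "t \<le> Fc k (Sup S)"
      by (intro tendsto_lowerbound) (auto simp: trivial_limit_at_right_real)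
  qed
  then show ?thesis unfolding iff using Fc_def'[of k "Sup S"] by simp
qed

text \<open>At \<open>t = 1\<close> the margin condition always holds; \<open>t = 0\<close> is
  reached by letting an interior level decrease to 0.\<close>

lemma uniform_margin:
  assumes t: "0 \<le> t" "t \<le> 1"
  shows "prob {\<omega>\<in>space P. Fc k (X i \<omega> $ k) \<le> t \<and> Z i \<omega> \<in> A} = pA P Z A * t"
proof -
  have tr: "prob {\<omega>\<in>space P. Fc k (X i \<omega> $ k) \<le> t \<and> Z i \<omega> \<in> A} = prob {\<omega>\<in>space P. Fc k (X 0 \<omega> $ k) \<le> t \<and> Z 0 \<omega> \<in> A}"
  proof -
    have "Measurable.pred (borel \<Otimes>\<^sub>M borel) (\<lambda>x :: (real^'p) \<times> (real^'q). Fc k (fst x $ k) \<le> t \<and> snd x \<in> A)" by measurable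
    then have "Measurable.pred borel (\<lambda>x :: (real^'p) \<times> (real^'q). Fc k (fst x $ k) \<le> t \<and> snd x \<in> A)" by (simp add: borel_prod)
    from V_transfer[OF this, of i] show ?thesis by simp
  qed
  consider "0 < t" "t < 1" | "t = 1" | "t = 0" using t by linarith
  then have "prob {\<omega>\<in>space P. Fc k (X 0 \<omega> $ k) \<le> t \<and> Z 0 \<omega> \<in> A} = pA P Z A * t"
  proof cases
    case 1 then show ?thesis by (rule uniform_interior)
  next
    case 2 then show ?thesis using Fc_bounds by (simp add: pA_def)
  next
    case 3
    have "prob {\<omega>\<in>space P. Fc k (X 0 \<omega> $ k) \<le> t \<and> Z 0 \<omega> \<in> A} \<le> 0"
    proof (rule field_le_epsilon)
      fix e :: real assume e: "0 < e"
      define s where "s = min (1/2) e"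
      have s: "0 < s" "s < 1" using e by (auto simp: s_def)
      have "prob {\<omega>\<in>space P. Fc k (X 0 \<omega> $ k) \<le> t \<and> Z 0 \<omega> \<in> A} \<le> prob {\<omega>\<in>space P. Fc k (X 0 \<omega> $ k) \<le> s \<and> Z 0 \<omega> \<in> A}"
        using s 3 by (intro finite_measure_mono) auto
      also have "\<dots> = pA P Z A * s" by (rule uniform_interior[OF s])
      also have "\<dots> \<le> 1 * e" using s prob_le_1 by (intro mult_mono) (auto simp: pA_def s_def)
      finally show "prob {\<omega>\<in>space P. Fc k (X 0 \<omega> $ k) \<le> t \<and> Z 0 \<omega> \<in> A} \<le> 0 + e" by simp
    qed
    then show ?thesis using 3 measure_nonneg[of P] by (simp add: antisym)
  qed
  then show ?thesis using tr by simp
qed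

lemma pA_le_1: "pA P Z A \<le> 1" unfolding pA_def by (rule prob_le_1)

lemma Dpop_prob: "Dpop P X Z A u = prob {\<omega>\<in>space P. (\<forall>k. Fc k (X 0 \<omega> $ k) \<le> u $ k) \<and> Z 0 \<omega> \<in> A}"
  by (simp add: Dpop_def)

lemma ff_expectation: "expectation (ff i u) = Dpop P X Z A u"
proof -
  have "expectation (ff i u) = (\<integral>x. phi u x \<partial>distr P borel (V i))"
    unfolding ff_def by (rule integral_distr[symmetric]) measurable
  also have "\<dots> = (\<integral>x. phi u x \<partial>distr P borel (V 0))" using iid_distr[of i] by simp
  also have "\<dots> = expectation (ff 0 u)" unfolding ff_def by (rule integral_distr) measurable
  also have "\<dots> = expectation (indicator {\<omega>\<in>space P. (\<forall>k. Fc k (X 0 \<omega> $ k) \<le> u $ k) \<and> Z 0 \<omega> \<in> A})"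
    by (intro Bochner_Integration.integral_cong) (auto simp: ff_def phi_def indicator_def)
  also have "\<dots> = Dpop P X Z A u" by (simp add: Dpop_def)
  finally show ?thesis .
qed

text \<open>Passing from \<open>a\<close> to \<open>b\<close> adds at most one strip per coordinate.
  A strip has probability \<open>pA * (b $ k - a $ k)\<close>, and the factor \<open>pA\<close> is
  at most 1.\<close>

lemma Dpop_incr:
  assumes ab: "a \<in> cube" "b \<in> cube" "\<And>k. a $ k \<le> b $ k"
  shows "Dpop P X Z A b - Dpop P X Z A a \<le> (\<Sum>k\<in>UNIV. b $ k - a $ k)"
proof -
  let ?S = "\<lambda>u. {\<omega>\<in>space P. (\<forall>k. Fc k (X 0 \<omega> $ k) \<le> u $ k) \<and> Z 0 \<omega> \<in> A}"
  let ?B = "\<lambda>k t. {\<omega>\<in>space P. Fc k (X 0 \<omega> $ k) \<le> t \<and> Z 0 \<omega> \<in> A}"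
  have "prob (?S b) \<le> prob (?S a \<union> (\<Union>k\<in>UNIV. ?B k (b $ k) - ?B k (a $ k)))"
    by (intro finite_measure_mono) auto
  also have "\<dots> \<le> prob (?S a) + prob (\<Union>k\<in>UNIV. ?B k (b $ k) - ?B k (a $ k))"
    by (rule measure_Un_le) auto
  also have "prob (\<Union>k\<in>UNIV. ?B k (b $ k) - ?B k (a $ k)) \<le> (\<Sum>k\<in>UNIV. prob (?B k (b $ k) - ?B k (a $ k)))"
    by (rule measure_UNION_le) auto
  also have "\<dots> \<le> (\<Sum>k\<in>UNIV. b $ k - a $ k)"
  proof (rule sum_mono)
    fix k
    have "prob (?B k (b $ k) - ?B k (a $ k)) = prob (?B k (b $ k)) - prob (?B k (a $ k))"
      using ab(3)[of k] by (intro finite_measure_Diff) auto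
    also have "\<dots> = pA P Z A * (b $ k - a $ k)"
      using ab by (simp add: uniform_margin cube_def algebra_simps)
    also have "\<dots> \<le> b $ k - a $ k" using mult_right_mono[OF pA_le_1, of "b $ k - a $ k"] ab(3)[of k] by simp
    finally show "prob (?B k (b $ k) - ?B k (a $ k)) \<le> b $ k - a $ k" .
  qed
  finally show ?thesis unfolding Dpop_prob by simp
qed

sublocale orth: iid_orthants P ff "Dpop P X Z A"
proof
  show "ff i u \<omega> \<in> {0, 1}" for i u \<omega> by (simp add: ff_def phi_def)
  show "ff i u \<omega> \<le> ff i v \<omega>" if "\<And>k. u $ k \<le> v $ k" for u v i \<omega>
    using that by (auto simp: ff_def phi_def intro: order_trans)
  show "ff i u \<omega> * ff i v \<omega> = ff i (vmin u v) \<omega>" for i u v \<omega>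
    by (auto simp: ff_def phi_def vmin_def)
  show "indep_vars (\<lambda>_. borel) (\<lambda>i \<omega>. ff i b \<omega> - ff i a \<omega>) UNIV" for a b
    unfolding ff_def
    using indep_vars_compose2[OF iid_indep, of "\<lambda>_ x. phi b x - phi a x" "\<lambda>_. borel"] by simp
qed (auto simp: ff_expectation intro: Dpop_incr)

text \<open>Where \<open>Fc k\<close> is flat, comparing transformed values does not compare the
  observations. Almost surely no observation with \<open>Z\<close> in \<open>A\<close> lies strictly
  right of a point of its own level; testing rationals only keeps this a countable family of null
  events. Positivity settles the points of the cube with a zero coordinate.\<close>

definition regular :: "'a \<Rightarrow> bool" where
  "regular \<omega> \<longleftrightarrow> (\<forall>i k. Z i \<omega> \<in> A \<longrightarrow> 0 < Fc k (X i \<omega> $ k) \<and> (\<forall>q\<in>\<rat>. q < X i \<omega> $ k \<longrightarrow> Fc k q < Fc k (X i \<omega> $ k)))"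

lemma regular_AE: "AE \<omega> in P. regular \<omega>"
proof -
  have 1: "AE \<omega> in P. Z i \<omega> \<in> A \<longrightarrow> 0 < Fc k (X i \<omega> $ k)" for i k
  proof -
    have "prob {\<omega>\<in>space P. Fc k (X i \<omega> $ k) \<le> 0 \<and> Z i \<omega> \<in> A} = 0" using uniform_margin[of 0 k i] by simp
    then have "AE \<omega> in P. \<not> (Fc k (X i \<omega> $ k) \<le> 0 \<and> Z i \<omega> \<in> A)"
      by (subst (asm) prob_eq_0) (auto elim!: eventually_mono)
    then show ?thesis by eventually_elim auto
  qed
  have 2: "AE \<omega> in P. Z i \<omega> \<in> A \<longrightarrow> q < X i \<omega> $ k \<longrightarrow> Fc k q < Fc k (X i \<omega> $ k)" for i k q
  proof -
    \<comment> \<open>\<open>?R\<close> is contained in \<open>?S\<close> by monotonicity, and both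
      have probability \<open>pA * Fc k q\<close>: one by the definition of the margin, the other by
      uniformity. Their difference is therefore null.\<close>
    let ?S = "{\<omega>\<in>space P. Fc k (X i \<omega> $ k) \<le> Fc k q \<and> Z i \<omega> \<in> A}" and ?R = "{\<omega>\<in>space P. X i \<omega> $ k \<le> q \<and> Z i \<omega> \<in> A}"
    have "prob ?R = prob {\<omega>\<in>space P. X 0 \<omega> $ k \<le> q \<and> Z 0 \<omega> \<in> A}"
    proof -
      have "Measurable.pred (borel \<Otimes>\<^sub>M borel) (\<lambda>x :: (real^'p) \<times> (real^'q). fst x $ k \<le> q \<and> snd x \<in> A)" by measurable
      then have "Measurable.pred borel (\<lambda>x :: (real^'p) \<times> (real^'q). fst x $ k \<le> q \<and> snd x \<in> A)" by (simp add: borel_prod)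
      from V_transfer[OF this, of i] show ?thesis by simp
    qed
    also have "\<dots> = pA P Z A * Fc k q" by (simp add: Fc_def')
    also have "\<dots> = prob ?S" using uniform_margin[of "Fc k q" k i] Fc_bounds by simp
    finally have "prob (?S - ?R) = 0" using Fc_mono[of _ q k] by (subst finite_measure_Diff) auto
    then have "AE \<omega> in P. \<omega> \<notin> ?S - ?R" by (subst (asm) prob_eq_0) auto
    then show ?thesis using AE_space by eventually_elim auto
  qed
  have "AE \<omega> in P. \<forall>i k. Z i \<omega> \<in> A \<longrightarrow> 0 < Fc k (X i \<omega> $ k)" unfolding AE_all_countable using 1 by blast
  moreover have "AE \<omega> in P. \<forall>i k. \<forall>q\<in>\<rat>. Z i \<omega> \<in> A \<longrightarrow> q < X i \<omega> $ k \<longrightarrow> Fc k q < Fc k (X i \<omega> $ k)"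
    unfolding AE_all_countable AE_ball_countable[OF countable_rat] using 2 by blast
  ultimately show ?thesis unfolding regular_def by eventually_elim blast
qed

lemma regular_iff:
  assumes r: "regular \<omega>" and Z: "Z i \<omega> \<in> A"
  shows "X i \<omega> $ k \<le> x \<longleftrightarrow> Fc k (X i \<omega> $ k) \<le> Fc k x"
proof
  show "X i \<omega> $ k \<le> x \<Longrightarrow> Fc k (X i \<omega> $ k) \<le> Fc k x" by (rule Fc_mono)
  assume le: "Fc k (X i \<omega> $ k) \<le> Fc k x"
  show "X i \<omega> $ k \<le> x"
  proof (rule ccontr)
    assume "\<not> X i \<omega> $ k \<le> x"
    then obtain q where q: "q \<in> \<rat>" "x < q" "q < X i \<omega> $ k" using Rats_dense_in_real[of x "X i \<omega> $ k"] by auto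
    have "Fc k q < Fc k (X i \<omega> $ k)" using r Z q unfolding regular_def by blast
    then show False using le Fc_mono[of x q k] q by linarith
  qed
qed

lemma ff_zero: "regular \<omega> \<Longrightarrow> ff i 0 \<omega> = 0"
  by (auto simp: ff_def phi_def regular_def not_le)

lemma Dpop_zero: "Dpop P X Z A 0 = 0"
proof -
  have "expectation (ff 0 0) = expectation (\<lambda>_. 0)"
    using regular_AE by (intro integral_cong_AE) (auto elim!: eventually_mono simp: ff_zero)
  then show ?thesis using ff_expectation[of 0 0] by simp
qed

text \<open>At 0 the centred sum vanishes on regular sample points, and every point of the cube is
  within \<open>1 / 2 ^ 0\<close> of 0 in each coordinate. So \<open>Psi\<close> at scale 0 bounds
  the process itself and not only its increments.\<close>

lemma Dn_close:
  assumes r: "regular \<omega>" and n: "0 < n" and u: "u \<in> cube" and s: "orth.Psi {..<n} 0 \<omega> \<le> s * real n"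
  shows "\<bar>(\<Sum>i<n. ff i u \<omega>) / real n - Dpop P X Z A u\<bar> \<le> s"
proof -
  have "\<bar>orth.T {..<n} u \<omega> - orth.T {..<n} 0 \<omega>\<bar> \<le> orth.Psi {..<n} 0 \<omega>"
    by (rule orth.T_modulus_le_Psi) (use u in \<open>auto simp: cube_def\<close>)
  moreover have "orth.T {..<n} 0 \<omega> = 0" by (simp add: orth.T_def ff_zero[OF r] Dpop_zero)
  moreover have "orth.T {..<n} u \<omega> = real n * ((\<Sum>i<n. ff i u \<omega>) / real n - Dpop P X Z A u)"
    using n by (simp add: orth.T_def sum_subtractf right_diff_distrib)
  ultimately have "real n * \<bar>(\<Sum>i<n. ff i u \<omega>) / real n - Dpop P X Z A u\<bar> \<le> real n * s"
    using s by (simp add: abs_mult mult.commute)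
  then show ?thesis using n by simp
qed

text \<open>Denominator and numerator of the empirical margin are values of the empirical process at
  the all-ones vector and at the vector with \<open>Fc k t\<close> in coordinate \<open>k\<close>
  and 1 elsewhere. Each contributes half of \<open>\<delta> * pA\<close>, and division by
  \<open>pA\<close> leaves \<delta>.\<close>

lemma Femp_close:
  assumes r: "regular \<omega>" and n: "0 < n" and \<delta>: "0 < \<delta>" "\<delta> \<le> 1"
    and s: "orth.Psi {..<n} 0 \<omega> \<le> (\<delta> * pA P Z A / 2) * real n"
  shows "0 < phat Z A n \<omega>" "\<bar>Femp X Z A n k \<omega> t - Fc k t\<bar> \<le> \<delta>"
proof -
  let ?p = "pA P Z A" and ?ph = "phat Z A n \<omega>" and ?e = "\<delta> * pA P Z A / 2"
  have ff1: "ff i 1 \<omega> = (if Z i \<omega> \<in> A then 1 else 0)" for i using Fc_bounds by (simp add: ff_def phi_def)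
  have D1: "Dpop P X Z A 1 = ?p" using Fc_bounds by (simp add: Dpop_def pA_def)
  have c1: "\<bar>?ph - ?p\<bar> \<le> ?e"
    using Dn_close[OF r n, of 1 ?e] s by (simp add: D1 ff1 phat_def cube_def)
  have "?e < ?p" using \<delta> pA_pos mult_right_mono[OF \<delta>(2), of ?p] by simp
  then show ph: "0 < ?ph" using c1 by linarith
  define v :: "real^'p" where "v = (\<chi> k'. if k' = k then Fc k t else 1)"
  have vc: "v \<in> cube" using Fc_bounds by (auto simp: v_def cube_def)
  have ffv: "ff i v \<omega> = (if X i \<omega> $ k \<le> t \<and> Z i \<omega> \<in> A then 1 else 0)" for i
    using regular_iff[OF r, of i k t] Fc_bounds(2) by (auto simp: ff_def phi_def v_def)
  have Dv: "Dpop P X Z A v = ?p * Fc k t"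
  proof -
    have "Dpop P X Z A v = prob {\<omega>\<in>space P. Fc k (X 0 \<omega> $ k) \<le> Fc k t \<and> Z 0 \<omega> \<in> A}"
      unfolding Dpop_prob using Fc_bounds(2) by (intro arg_cong[where f=prob]) (auto simp: v_def dest: spec[of _ k])
    then show ?thesis using uniform_margin[of "Fc k t" k 0] Fc_bounds by simp
  qed
  let ?F = "Femp X Z A n k \<omega> t"
  have phF: "?ph * ?F = (\<Sum>i<n. ff i v \<omega>) / real n" using ph n by (simp add: Femp_def ffv)
  have c2: "\<bar>?ph * ?F - ?p * Fc k t\<bar> \<le> ?e" unfolding phF Dv[symmetric] by (rule Dn_close[OF r n vc s])
  have F0: "0 \<le> ?F" unfolding Femp_def using ph by (intro divide_nonneg_nonneg sum_nonneg) auto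
  have F1: "?F \<le> 1"
  proof -
    have "(\<Sum>i<n. if X i \<omega> $ k \<le> t \<and> Z i \<omega> \<in> A then 1 else 0) \<le> (\<Sum>i<n. if Z i \<omega> \<in> A then 1 else 0 :: real)"
      by (intro sum_mono) auto
    also have "\<dots> = real n * ?ph" using n by (simp add: phat_def)
    finally show ?thesis unfolding Femp_def using ph n by (simp add: divide_le_eq)
  qed
  \<comment> \<open>The error of the quotient is split so that the random denominator multiplies a
    quantity bounded by 1 and no lower bound on it is required.\<close>
  have "?p * \<bar>?F - Fc k t\<bar> = \<bar>(?ph * ?F - ?p * Fc k t) - (?ph - ?p) * ?F\<bar>"
    using pA_pos by (simp add: abs_mult[symmetric] algebra_simps abs_mult_pos')
  also have "\<dots> \<le> \<bar>?ph * ?F - ?p * Fc k t\<bar> + \<bar>?ph - ?p\<bar> * ?F" using F0 by (simp add: abs_mult abs_triangle_ineq4 order_trans[OF abs_triangle_ineq4])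
  also have "\<dots> \<le> ?e + ?e * 1" using c1 c2 F0 F1 \<delta> pA_pos by (intro add_mono mult_mono) auto
  also have "\<dots> = ?p * \<delta>" by simp
  finally show "\<bar>?F - Fc k t\<bar> \<le> \<delta>" using pA_pos by simp
qed

text \<open>Selecting by empirical quantiles is selecting by a nearby point in the scale of the true
  conditional margins.\<close>
lemma sel_eq_ff:
  assumes r: "regular \<omega>" and n: "0 < n" and \<delta>: "0 < \<delta>" "\<delta> \<le> 1" and u: "u \<in> cube"
    and s: "orth.Psi {..<n} 0 \<omega> \<le> (\<delta> * pA P Z A / 2) * real n"
  shows "\<exists>v\<in>cube. (\<forall>k. \<bar>v $ k - u $ k\<bar> \<le> \<delta>) \<and> (\<forall>i. (if sel X Z A n u \<omega> i then 1 else 0) = ff i v \<omega>)"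
proof -
  note close = Femp_close[OF r n \<delta> s]
  have Femp_eq: "Femp X Z A n k \<omega> = (\<lambda>t. (\<Sum>i<n. if X i \<omega> $ k \<le> t \<and> Z i \<omega> \<in> A then 1 else 0) / (\<Sum>i<n. if Z i \<omega> \<in> A then 1 else 0))" for k
    using n by (simp add: Femp_def phat_def fun_eq_iff)
  have cpos: "0 < (\<Sum>i<n. if Z i \<omega> \<in> A then 1 else 0 :: real)"
    using close(1) n by (simp add: phat_def zero_less_divide_iff)
  have ex: "\<exists>y. 0 < u $ k \<longrightarrow> geninv (Femp X Z A n k \<omega>) (u $ k) = ereal y \<and> u $ k \<le> Femp X Z A n k \<omega> y \<and> (\<forall>t<y. Femp X Z A n k \<omega> t < u $ k)" for k
  proof (cases "0 < u $ k")
    case True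
    have "u $ k \<le> 1" using u by (simp add: cube_def)
    from geninv_empirical[OF cpos True this, of "\<lambda>i. X i \<omega> $ k"] show ?thesis unfolding Femp_eq by blast
  qed simp
  then obtain y where y: "\<And>k. 0 < u $ k \<Longrightarrow> geninv (Femp X Z A n k \<omega>) (u $ k) = ereal (y k)"
    "\<And>k. 0 < u $ k \<Longrightarrow> u $ k \<le> Femp X Z A n k \<omega> (y k)" "\<And>k t. 0 < u $ k \<Longrightarrow> t < y k \<Longrightarrow> Femp X Z A n k \<omega> t < u $ k"
    by metis
  \<comment> \<open>The shifted point consists of the true levels of the empirical quantiles. A zero
    coordinate of \<open>u\<close> stays zero: its quantile is \<open>- \<infinity>\<close>, and
    regular observations in \<open>A\<close> have positive level.\<close>
  define v :: "real^'p" where "v = (\<chi> k. if 0 < u $ k then Fc k (y k) else 0)"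
  have u0: "u $ k = 0" if "\<not> 0 < u $ k" for k using that u by (auto simp: cube_def not_less intro: antisym)
  have "v \<in> cube" using Fc_bounds by (auto simp: v_def cube_def)
  moreover have "\<bar>v $ k - u $ k\<bar> \<le> \<delta>" for k
  proof (cases "0 < u $ k")
    case True
    have "u $ k - \<delta> \<le> Fc k (y k)" using close(2)[of k "y k"] y(2)[OF True] by linarith
    moreover have "Fc k (y k) \<le> u $ k + \<delta>"
    proof -
      \<comment> \<open>The empirical margin may jump past \<open>u $ k\<close> at
        \<open>y k\<close>. The upper bound is therefore taken from arguments to the left, where the
        empirical level is below \<open>u $ k\<close>, and passed to \<open>y k\<close> by
        continuity of \<open>Fc k\<close>.\<close>
      have "((\<lambda>t. Fc k t) \<longlongrightarrow> Fc k (y k)) (at_left (y k))"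
        using margins_cont[of k] by (auto simp: continuous_on_def intro: tendsto_within_subset)
      moreover have "\<forall>\<^sub>F t in at_left (y k). Fc k t \<le> u $ k + \<delta>"
        unfolding eventually_at_left_field
      proof (intro exI[of _ "y k - 1"] conjI allI impI)
        fix t assume "t < y k"
        then show "Fc k t \<le> u $ k + \<delta>" using y(3)[OF True, of t] close(2)[of k t] by linarith
      qed simp
      ultimately show ?thesis by (intro tendsto_upperbound) (auto simp: trivial_limit_at_left_real)
    qed
    ultimately show ?thesis using True by (simp add: v_def abs_le_iff)
  next
    case False
    then show ?thesis using u0[OF False] \<delta> by (simp add: v_def)
  qed
  moreover have "(if sel X Z A n u \<omega> i then 1 else 0) = ff i v \<omega>" for i
  proof (cases "Z i \<omega> \<in> A")
    case True
    have "ereal (X i \<omega> $ k) \<le> geninv (Femp X Z A n k \<omega>) (u $ k) \<longleftrightarrow> Fc k (X i \<omega> $ k) \<le> v $ k" for k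
    proof (cases "0 < u $ k")
      case uk: True
      then show ?thesis using regular_iff[OF r True, of k "y k"] y(1)[OF uk] by (simp add: v_def)
    next
      case uk: False
      have "geninv (Femp X Z A n k \<omega>) (u $ k) = - \<infinity>"
        unfolding u0[OF uk] Femp_eq using cpos by (intro geninv_nonpos divide_nonneg_nonneg sum_nonneg) auto
      moreover have "0 < Fc k (X i \<omega> $ k)" using r True unfolding regular_def by blast
      ultimately show ?thesis using uk by (simp add: v_def)
    qed
    then show ?thesis using True by (simp add: sel_def ff_def phi_def)
  next
    case False
    then show ?thesis by (simp add: sel_def ff_def phi_def)
  qed
  ultimately show ?thesis by blast
qed

end

section \<open>Characteristic functions of weighted sums\<close>

text \<open>Independence of two random elements whose values may lie in different types.\<close>
definition (in prob_space) indep2 :: "'b measure \<Rightarrow> ('a \<Rightarrow> 'b) \<Rightarrow> 'c measure \<Rightarrow> ('a \<Rightarrow> 'c) \<Rightarrow> bool" where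
  "indep2 S X R Y \<longleftrightarrow> X \<in> measurable M S \<and> Y \<in> measurable M R \<and>
     (\<forall>A\<in>sets S. \<forall>B\<in>sets R. prob ((X -` A \<inter> space M) \<inter> (Y -` B \<inter> space M)) = prob (X -` A \<inter> space M) * prob (Y -` B \<inter> space M))"

lemma (in prob_space) indep2_distr:
  assumes "indep2 S X R Y"
  shows "distr M S X \<Otimes>\<^sub>M distr M R Y = distr M (S \<Otimes>\<^sub>M R) (\<lambda>x. (X x, Y x))"
proof -
  have [measurable]: "X \<in> measurable M S" "Y \<in> measurable M R" using assms unfolding indep2_def by auto
  interpret X: prob_space "distr M S X" by (rule prob_space_distr) measurable
  interpret Y: prob_space "distr M R Y" by (rule prob_space_distr) measurable
  show ?thesis
  proof (rule pair_measure_eqI)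
    fix A B assume AB: "A \<in> sets (distr M S X)" "B \<in> sets (distr M R Y)"
    then have [measurable]: "A \<in> sets S" "B \<in> sets R" by auto
    have "emeasure (distr M (S \<Otimes>\<^sub>M R) (\<lambda>x. (X x, Y x))) (A \<times> B) = emeasure M ((\<lambda>x. (X x, Y x)) -` (A \<times> B) \<inter> space M)"
      by (rule emeasure_distr) measurable
    also have "(\<lambda>x. (X x, Y x)) -` (A \<times> B) \<inter> space M = (X -` A \<inter> space M) \<inter> (Y -` B \<inter> space M)" by auto
    also have "emeasure M \<dots> = ennreal (prob (X -` A \<inter> space M) * prob (Y -` B \<inter> space M))"
      using assms AB unfolding indep2_def by (simp add: emeasure_eq_measure)
    also have "\<dots> = emeasure (distr M S X) A * emeasure (distr M R Y) B"
      by (simp add: emeasure_distr emeasure_eq_measure ennreal_mult)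
    finally show "emeasure (distr M S X) A * emeasure (distr M R Y) B = emeasure (distr M (S \<Otimes>\<^sub>M R) (\<lambda>x. (X x, Y x))) (A \<times> B)" by simp
  qed (auto intro: X.sigma_finite_measure_axioms Y.sigma_finite_measure_axioms)
qed

lemma (in prob_space) nn_integral_indep_mult:
  assumes ind: "indep2 S X R Y" and f[measurable]: "f \<in> borel_measurable S" and g[measurable]: "g \<in> borel_measurable R"
  shows "(\<integral>\<^sup>+x. f (X x) * g (Y x) \<partial>M) = (\<integral>\<^sup>+x. f (X x) \<partial>M) * (\<integral>\<^sup>+x. g (Y x) \<partial>M)"
proof -
  have [measurable]: "X \<in> measurable M S" "Y \<in> measurable M R" using ind unfolding indep2_def by auto
  note eq = indep2_distr[OF ind]
  interpret X: prob_space "distr M S X" by (rule prob_space_distr) measurable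
  interpret Y: prob_space "distr M R Y" by (rule prob_space_distr) measurable
  have "(\<integral>\<^sup>+x. f (X x) * g (Y x) \<partial>M) = (\<integral>\<^sup>+z. f (fst z) * g (snd z) \<partial>distr M (S \<Otimes>\<^sub>M R) (\<lambda>x. (X x, Y x)))"
    by (subst nn_integral_distr) auto
  also have "\<dots> = (\<integral>\<^sup>+x. \<integral>\<^sup>+y. f x * g y \<partial>distr M R Y \<partial>distr M S X)"
    unfolding eq[symmetric] by (subst Y.nn_integral_fst[symmetric]) auto
  also have "\<dots> = (\<integral>\<^sup>+x. f x \<partial>distr M S X) * (\<integral>\<^sup>+y. g y \<partial>distr M R Y)"
    by (simp add: nn_integral_cmult nn_integral_multc)
  finally show ?thesis by (simp add: nn_integral_distr)
qed

lemma (in prob_space) integral_indep_pair: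
  fixes F :: "'b \<Rightarrow> 'c \<Rightarrow> 'd::{banach, second_countable_topology}"
  assumes ind: "indep2 S X R Y" and F[measurable]: "case_prod F \<in> borel_measurable (S \<Otimes>\<^sub>M R)"
    and b: "\<And>x y. norm (F x y) \<le> b"
  shows "expectation (\<lambda>x. F (X x) (Y x)) = expectation (\<lambda>x. \<integral>v. F v (Y x) \<partial>distr M S X)"
proof -
  have [measurable]: "X \<in> measurable M S" "Y \<in> measurable M R" using ind unfolding indep2_def by auto
  interpret X: prob_space "distr M S X" by (rule prob_space_distr) measurable
  interpret Y: prob_space "distr M R Y" by (rule prob_space_distr) measurable
  interpret XY: pair_prob_space "distr M S X" "distr M R Y" ..
  have int: "integrable (distr M S X \<Otimes>\<^sub>M distr M R Y) (case_prod F)"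
  proof (rule XY.integrable_const_bound[where B=b])
    show "case_prod F \<in> borel_measurable (distr M S X \<Otimes>\<^sub>M distr M R Y)" by measurable
  qed (use b in \<open>auto simp: split_beta'\<close>)
  have m: "(\<lambda>y. \<integral>v. F v y \<partial>distr M S X) \<in> borel_measurable R"
  proof -
    have "(\<lambda>(y, v). F v y) \<in> borel_measurable (R \<Otimes>\<^sub>M distr M S X)" by measurable
    from X.borel_measurable_lebesgue_integral[OF this] show ?thesis by simp
  qed
  have "expectation (\<lambda>x. F (X x) (Y x)) = (\<integral>z. case_prod F z \<partial>distr M (S \<Otimes>\<^sub>M R) (\<lambda>x. (X x, Y x)))"
    by (subst integral_distr) auto
  also have "\<dots> = (\<integral>y. (\<integral>v. F v y \<partial>distr M S X) \<partial>distr M R Y)"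
    unfolding indep2_distr[OF ind, symmetric] by (rule XY.integral_snd[OF int, symmetric])
  also have "\<dots> = expectation (\<lambda>x. \<integral>v. F v (Y x) \<partial>distr M S X)" by (rule integral_distr) (use m in auto)
  finally show ?thesis .
qed

lemma (in prob_space) integral_indep_mult:
  fixes f :: "'b \<Rightarrow> real" and g :: "'c \<Rightarrow> real"
  assumes ind: "indep2 S X R Y" and f[measurable]: "f \<in> borel_measurable S" and g[measurable]: "g \<in> borel_measurable R"
    and b: "\<And>x. \<bar>f x\<bar> \<le> b" "\<And>y. \<bar>g y\<bar> \<le> b"
  shows "expectation (\<lambda>x. f (X x) * g (Y x)) = expectation (\<lambda>x. f (X x)) * expectation (\<lambda>x. g (Y x))"
proof -
  have [measurable]: "X \<in> measurable M S" using ind unfolding indep2_def by auto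
  have "\<bar>f x * g y\<bar> \<le> b * b" for x y
    using mult_mono[OF b(1)[of x] b(2)[of y]] order_trans[OF abs_ge_zero b(1)] by (simp add: abs_mult)
  then have "expectation (\<lambda>x. f (X x) * g (Y x)) = expectation (\<lambda>x. \<integral>v. f v * g (Y x) \<partial>distr M S X)"
    by (intro integral_indep_pair[OF ind, where b="b * b"]) auto
  then show ?thesis by (simp add: integral_distr)
qed

text \<open>Both the characteristic function and \<open>exp (- s / 2)\<close> are compared with
  \<open>1 - s / 2\<close>, each at cost \<open>b * s\<close>: the third absolute moment is at most
  \<open>b * s\<close>, and \<open>s \<le> b\<^sup>2 \<le> b\<close>.\<close>

lemma (in prob_space) char_bounded_variable:
  fixes Y :: "'a \<Rightarrow> real"
  assumes Y[measurable]: "Y \<in> borel_measurable M" and b: "\<And>x. \<bar>Y x\<bar> \<le> b" "b \<le> 1" and E: "expectation Y = 0"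
  defines "s \<equiv> expectation (\<lambda>x. (Y x)\<^sup>2)"
  shows "cmod (expectation (\<lambda>x. cis (Y x)) - complex_of_real (exp (- s / 2))) \<le> 2 * b * s" "0 \<le> s"
proof -
  have b0: "0 \<le> b" using order_trans[OF abs_ge_zero b(1)] .
  have iY: "integrable M Y" by (rule integrable_const_bound[where B=b]) (use b in auto)
  have sq: "(Y x)\<^sup>2 \<le> b\<^sup>2" for x using power_mono[OF b(1)[of x] abs_ge_zero, of 2] by simp
  have iY2: "integrable M (\<lambda>x. (Y x)\<^sup>2)" by (rule integrable_const_bound[where B="b\<^sup>2"]) (use sq in auto)
  show s0: "0 \<le> s" unfolding s_def by (rule Bochner_Integration.integral_nonneg) auto
  have sb: "s \<le> b\<^sup>2"
    using integral_mono[OF iY2, of "\<lambda>_. b\<^sup>2"] sq by (simp add: s_def prob_space)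
  also have "\<dots> \<le> b" using b0 b(2) mult_right_mono[of b 1 b] by (simp add: power2_eq_square)
  finally have sb1: "s \<le> b" .
  have ch: "char (distr M borel Y) 1 = expectation (\<lambda>x. cis (Y x))"
    unfolding char_def by (subst integral_distr) (auto simp: cis_conv_exp)
  have "cmod (char (distr M borel Y) 1 - (1 - 1\<^sup>2 * s / 2)) \<le> (1\<^sup>2 / 6) * expectation (\<lambda>x. min (6 * (Y x)\<^sup>2) (\<bar>1\<bar> * \<bar>Y x\<bar> ^ 3))"
    by (rule char_approx3'[OF Y iY iY2 E _ refl]) (simp add: E s_def)
  also have "\<dots> \<le> expectation (\<lambda>x. b * (Y x)\<^sup>2)"
  proof -
    have pt: "min (6 * (Y x)\<^sup>2) (\<bar>1\<bar> * \<bar>Y x\<bar> ^ 3) \<le> b * (Y x)\<^sup>2" for x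
    proof -
      have "\<bar>Y x\<bar> ^ 3 = \<bar>Y x\<bar> * (Y x)\<^sup>2" by (simp add: power3_eq_cube power2_eq_square abs_mult_self_eq mult.assoc)
      also have "\<dots> \<le> b * (Y x)\<^sup>2" using b(1) by (intro mult_right_mono) auto
      finally show ?thesis by simp
    qed
    have nn: "0 \<le> expectation (\<lambda>x. min (6 * (Y x)\<^sup>2) (\<bar>1\<bar> * \<bar>Y x\<bar> ^ 3))"
      by (rule Bochner_Integration.integral_nonneg) auto
    have "expectation (\<lambda>x. min (6 * (Y x)\<^sup>2) (\<bar>1\<bar> * \<bar>Y x\<bar> ^ 3)) \<le> expectation (\<lambda>x. b * (Y x)\<^sup>2)"
    proof (rule integral_mono)
      show "integrable M (\<lambda>x. min (6 * (Y x)\<^sup>2) (\<bar>1\<bar> * \<bar>Y x\<bar> ^ 3))"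
        by (rule integrable_const_bound[where B="b * b\<^sup>2"])
           (use pt order_trans[OF pt mult_left_mono[OF sq b0]] in \<open>auto simp: abs_of_nonneg\<close>)
    qed (use pt iY2 in auto)
    then show ?thesis using nn unfolding power_one by linarith
  qed
  also have "\<dots> = b * s" by (simp add: s_def)
  finally have 1: "cmod (expectation (\<lambda>x. cis (Y x)) - (1 - s / 2)) \<le> b * s" unfolding ch by simp
  have 2: "\<bar>exp (- s / 2) - (1 - s / 2)\<bar> \<le> b * s"
  proof -
    have "1 - s / 2 \<le> exp (- s / 2)" using exp_ge_add_one_self[of "- s / 2"] by simp
    moreover have "exp (- s / 2) \<le> 1 + (- s / 2) + (- s / 2)\<^sup>2"
      by (rule exp_le_quadratic) (use s0 sb1 b(2) in auto)
    moreover have "(- s / 2)\<^sup>2 \<le> b * s"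
    proof -
      have "(- s / 2)\<^sup>2 = s * s / 4" by (simp add: power2_eq_square)
      also have "\<dots> \<le> b * s" using mult_right_mono[OF sb1 s0] mult_nonneg_nonneg[OF s0 s0] by linarith
      finally show ?thesis .
    qed
    ultimately show ?thesis by linarith
  qed
  have "cmod (expectation (\<lambda>x. cis (Y x)) - complex_of_real (exp (- s / 2)))
      \<le> cmod (expectation (\<lambda>x. cis (Y x)) - (1 - s / 2)) + cmod (complex_of_real (1 - s / 2) - complex_of_real (exp (- s / 2)))"
    using norm_triangle_ineq[of "expectation (\<lambda>x. cis (Y x)) - (1 - s / 2)" "complex_of_real (1 - s / 2) - complex_of_real (exp (- s / 2))"] by simp
  also have "cmod (complex_of_real (1 - s / 2) - complex_of_real (exp (- s / 2))) \<le> b * s"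
    using 2 unfolding of_real_diff[symmetric] norm_of_real by (simp add: abs_minus_commute)
  finally show "cmod (expectation (\<lambda>x. cis (Y x)) - complex_of_real (exp (- s / 2))) \<le> 2 * b * s" using 1 by simp
qed

lemma exp_neg_lipschitz:
  fixes x y :: real assumes "0 \<le> x" "0 \<le> y" shows "\<bar>exp (- x) - exp (- y)\<bar> \<le> \<bar>x - y\<bar>"
proof -
  have *: "exp (- x) - exp (- y) \<le> y - x" if "0 \<le> x" "x \<le> y" for x y :: real
  proof -
    have "exp (- x) - exp (- y) = exp (- x) * (1 - exp (x - y))" by (simp add: right_diff_distrib flip: exp_add)
    also have "\<dots> \<le> 1 * (y - x)"
    proof (rule mult_mono)
      show "1 - exp (x - y) \<le> y - x" using exp_ge_add_one_self[of "x - y"] by linarith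
    qed (use that in auto)
    finally show ?thesis by simp
  qed
  show ?thesis using *[of x y] *[of y x] assms by (cases "x \<le> y") auto
qed

text \<open>The central limit theorem for fixed coefficients. The variances of the factors add up to
  the sum over \<open>j, l\<close> of the Gram entry of rows \<open>j, l\<close> times
  \<open>E (g j * g l)\<close>. Since the Gram matrix is nearly the identity, covariances between
  different \<open>g j\<close> and \<open>g l\<close> drop out and only the second moments remain.
  With \<open>C = (K + 1) * B\<close>, replacing the factors costs \<open>4 * C ^ 3 * e\<close> and
  replacing the total variance at most \<open>C ^ 3 * e\<close>.\<close>

lemma (in prob_space) char_weighted_product:
  fixes g :: "nat \<Rightarrow> 'a \<Rightarrow> real" and \<theta> :: "nat \<Rightarrow> nat \<Rightarrow> real"
  assumes g[measurable]: "\<And>j. j \<le> K \<Longrightarrow> g j \<in> borel_measurable M"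
    and gb: "\<And>j x. j \<le> K \<Longrightarrow> \<bar>g j x\<bar> \<le> B" and B: "1 \<le> B"
    and gE: "\<And>j. j \<le> K \<Longrightarrow> expectation (g j) = 0"
    and e: "0 \<le> e" "real (Suc K) * B * e \<le> 1"
    and \<theta>: "\<And>j i. j \<le> K \<Longrightarrow> i < n \<Longrightarrow> \<bar>\<theta> j i\<bar> \<le> e"
    and A: "\<And>j l. j \<le> K \<Longrightarrow> l \<le> K \<Longrightarrow> \<bar>(\<Sum>i<n. \<theta> j i * \<theta> l i) - (if j = l then 1 else 0)\<bar> \<le> e"
  shows "cmod ((\<Prod>i<n. expectation (\<lambda>x. cis (\<Sum>j\<le>K. \<theta> j i * g j x))) - complex_of_real (exp (- (\<Sum>j\<le>K. expectation (\<lambda>x. (g j x)\<^sup>2)) / 2)))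
    \<le> 5 * (real (Suc K) * B) ^ 3 * e"
proof -
  let ?C = "real (Suc K) * B"
  have C: "1 \<le> ?C" using B mult_mono[of 1 "real (Suc K)" 1 B] by simp
  define b where "b = ?C * e"
  define Y where "Y i x = (\<Sum>j\<le>K. \<theta> j i * g j x)" for i x
  define s where "s i = expectation (\<lambda>x. (Y i x)\<^sup>2)" for i
  define G where "G j l = expectation (\<lambda>x. g j x * g l x)" for j l
  define A' where "A' j l = (\<Sum>i<n. \<theta> j i * \<theta> l i)" for j l
  define v where "v = (\<Sum>j\<le>K. expectation (\<lambda>x. (g j x)\<^sup>2))"
  have e1: "e \<le> 1" using e C mult_right_mono[OF C e(1)] by simp
  have Ym[measurable]: "Y i \<in> borel_measurable M" for i unfolding Y_def by (rule borel_measurable_sum) auto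
  have Yb: "\<bar>Y i x\<bar> \<le> b" if "i < n" for i x
  proof -
    have "\<bar>Y i x\<bar> \<le> (\<Sum>j\<le>K. \<bar>\<theta> j i * g j x\<bar>)" unfolding Y_def by (rule sum_abs)
    also have "\<dots> \<le> (\<Sum>j\<le>K. e * B)"
      using \<theta> gb that e by (intro sum_mono) (auto simp: abs_mult intro!: mult_mono)
    finally show ?thesis by (simp add: b_def mult_ac)
  qed
  have gi: "integrable M (g j)" if "j \<le> K" for j
    by (rule integrable_const_bound[where B=B]) (use gb that in auto)
  have ggb: "\<bar>g j x * g l x\<bar> \<le> B\<^sup>2" if "j \<le> K" "l \<le> K" for j l x
    using mult_mono[OF gb[OF that(1), of x] gb[OF that(2), of x]] B by (simp add: abs_mult power2_eq_square)
  have ggi: "integrable M (\<lambda>x. g j x * g l x)" if "j \<le> K" "l \<le> K" for j l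
    by (rule integrable_const_bound[where B="B\<^sup>2"]) (use ggb that in auto)
  have Gb: "\<bar>G j l\<bar> \<le> B\<^sup>2" if "j \<le> K" "l \<le> K" for j l
  proof -
    have "\<bar>G j l\<bar> \<le> expectation (\<lambda>x. \<bar>g j x * g l x\<bar>)" unfolding G_def by (rule integral_abs_bound)
    also have "\<dots> \<le> expectation (\<lambda>_. B\<^sup>2)" using ggi ggb that by (intro integral_mono) auto
    finally show ?thesis by (simp add: prob_space)
  qed
  have YE: "expectation (Y i) = 0" for i
    unfolding Y_def using gi gE by (subst Bochner_Integration.integral_sum) auto
  have s_eq: "s i = (\<Sum>j\<le>K. \<Sum>l\<le>K. \<theta> j i * \<theta> l i * G j l)" for i
  proof -
    have "(Y i x)\<^sup>2 = (\<Sum>j\<le>K. \<Sum>l\<le>K. \<theta> j i * \<theta> l i * (g j x * g l x))" for x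
      by (simp add: Y_def power2_eq_square sum_product mult_ac)
    then have "s i = expectation (\<lambda>x. \<Sum>j\<le>K. \<Sum>l\<le>K. \<theta> j i * \<theta> l i * (g j x * g l x))" by (simp only: s_def)
    also have "\<dots> = (\<Sum>j\<le>K. expectation (\<lambda>x. \<Sum>l\<le>K. \<theta> j i * \<theta> l i * (g j x * g l x)))"
      by (intro Bochner_Integration.integral_sum Bochner_Integration.integrable_sum integrable_mult_right ggi) auto
    also have "\<dots> = (\<Sum>j\<le>K. \<Sum>l\<le>K. expectation (\<lambda>x. \<theta> j i * \<theta> l i * (g j x * g l x)))"
      by (intro sum.cong refl Bochner_Integration.integral_sum integrable_mult_right ggi) auto
    finally show ?thesis by (simp add: G_def)
  qed
  have sum_s: "(\<Sum>i<n. s i) = (\<Sum>j\<le>K. \<Sum>l\<le>K. A' j l * G j l)"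
  proof -
    have "(\<Sum>i<n. s i) = (\<Sum>j\<le>K. \<Sum>i<n. \<Sum>l\<le>K. \<theta> j i * \<theta> l i * G j l)" unfolding s_eq by (rule sum.swap)
    also have "\<dots> = (\<Sum>j\<le>K. \<Sum>l\<le>K. \<Sum>i<n. \<theta> j i * \<theta> l i * G j l)" by (intro sum.cong refl sum.swap)
    finally show ?thesis by (simp add: A'_def sum_distrib_right)
  qed
  have v_eq: "v = (\<Sum>j\<le>K. \<Sum>l\<le>K. (if j = l then 1 else 0) * G j l)"
  proof -
    have "(\<Sum>l\<le>K. (if j = l then 1 else 0) * G j l) = G j j" if "j \<le> K" for j
    proof -
      have "(\<Sum>l\<le>K. (if j = l then 1 else 0) * G j l) = (\<Sum>l\<le>K. if l = j then G j j else 0)" by (intro sum.cong) auto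
      then show ?thesis using that by simp
    qed
    then show ?thesis unfolding v_def G_def by (simp add: power2_eq_square)
  qed
  have dv: "\<bar>(\<Sum>i<n. s i) - v\<bar> \<le> ?C\<^sup>2 * e"
  proof -
    have "(\<Sum>i<n. s i) - v = (\<Sum>j\<le>K. \<Sum>l\<le>K. (A' j l - (if j = l then 1 else 0)) * G j l)"
      unfolding sum_s v_eq by (simp add: sum_subtractf left_diff_distrib)
    also have "\<bar>\<dots>\<bar> \<le> (\<Sum>j\<le>K. \<Sum>l\<le>K. \<bar>(A' j l - (if j = l then 1 else 0)) * G j l\<bar>)"
      by (rule order_trans[OF sum_abs]) (intro sum_mono sum_abs)
    also have "\<dots> \<le> (\<Sum>j\<le>K. \<Sum>l\<le>K. e * B\<^sup>2)"
    proof (intro sum_mono)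
      fix j l assume "j \<in> {..K}" "l \<in> {..K}"
      then show "\<bar>(A' j l - (if j = l then 1 else 0)) * G j l\<bar> \<le> e * B\<^sup>2"
        using A[of j l] Gb[of j l] e unfolding A'_def abs_mult by (intro mult_mono) auto
    qed
    also have "\<dots> = ?C\<^sup>2 * e" by (simp add: power2_eq_square mult_ac)
    finally show ?thesis .
  qed
  have v0: "0 \<le> v" unfolding v_def by (intro sum_nonneg Bochner_Integration.integral_nonneg) auto
  have vb: "v \<le> ?C\<^sup>2"
  proof -
    have "v \<le> (\<Sum>j\<le>K. B\<^sup>2)" unfolding v_def
      using Gb by (intro sum_mono) (auto simp: G_def power2_eq_square abs_le_iff)
    also have "\<dots> = real (Suc K) * B\<^sup>2" by simp
    also have "\<dots> \<le> real (Suc K) * real (Suc K) * B\<^sup>2" by (intro mult_right_mono) auto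
    finally show ?thesis by (simp add: power2_eq_square mult_ac)
  qed
  have sn: "0 \<le> s i" for i unfolding s_def by (rule Bochner_Integration.integral_nonneg) auto
  have b1: "b \<le> 1" using e by (simp add: b_def)
  have ss: "(\<Sum>i<n. s i) \<le> 2 * ?C\<^sup>2"
    using dv vb mult_left_mono[OF e1, of "?C\<^sup>2"] by (auto simp: abs_le_iff)
  have "cmod ((\<Prod>i<n. expectation (\<lambda>x. cis (Y i x))) - (\<Prod>i<n. complex_of_real (exp (- s i / 2))))
     \<le> (\<Sum>i<n. cmod (expectation (\<lambda>x. cis (Y i x)) - complex_of_real (exp (- s i / 2))))"
  proof (rule norm_prod_diff)
    fix i
    have "cmod (expectation (\<lambda>x. cis (Y i x))) \<le> expectation (\<lambda>x. cmod (cis (Y i x)))" by (rule integral_norm_bound)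
    then show "cmod (expectation (\<lambda>x. cis (Y i x))) \<le> 1" by (simp add: prob_space)
    show "cmod (complex_of_real (exp (- s i / 2))) \<le> 1" using sn[of i] by simp
  qed
  also have "\<dots> \<le> (\<Sum>i<n. 2 * b * s i)"
    unfolding s_def by (intro sum_mono char_bounded_variable) (use Yb b1 YE in auto)
  also have "\<dots> = 2 * b * (\<Sum>i<n. s i)" by (simp add: sum_distrib_left)
  also have "\<dots> \<le> 2 * b * (2 * ?C\<^sup>2)" using ss e C by (intro mult_left_mono) (auto simp: b_def)
  also have "\<dots> = 4 * ?C ^ 3 * e" by (simp add: b_def power2_eq_square power3_eq_cube)
  finally have 1: "cmod ((\<Prod>i<n. expectation (\<lambda>x. cis (Y i x))) - (\<Prod>i<n. complex_of_real (exp (- s i / 2)))) \<le> 4 * ?C ^ 3 * e" .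
  have p: "(\<Prod>i<n. complex_of_real (exp (- s i / 2))) = complex_of_real (exp (- (\<Sum>i<n. s i) / 2))"
  proof -
    have "(\<Prod>i<n. exp (- s i / 2)) = exp (\<Sum>i<n. - s i / 2)" by (simp add: exp_sum)
    also have "(\<Sum>i<n. - s i / 2) = - (\<Sum>i<n. s i) / 2" by (simp add: sum_negf sum_divide_distrib)
    finally show ?thesis by (simp flip: of_real_prod)
  qed
  have "\<bar>exp (- ((\<Sum>i<n. s i) / 2)) - exp (- (v / 2))\<bar> \<le> \<bar>(\<Sum>i<n. s i) / 2 - v / 2\<bar>"
    by (rule exp_neg_lipschitz) (use v0 sn in \<open>auto intro: sum_nonneg\<close>)
  also have "\<dots> \<le> ?C\<^sup>2 * e" using dv by (simp add: diff_divide_distrib[symmetric] abs_divide)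
  also have "\<dots> \<le> ?C ^ 3 * e" using C e by (intro mult_right_mono power_increasing) auto
  finally have 2: "cmod (complex_of_real (exp (- (\<Sum>i<n. s i) / 2)) - complex_of_real (exp (- v / 2))) \<le> ?C ^ 3 * e"
    unfolding of_real_diff[symmetric] norm_of_real by simp
  have "cmod ((\<Prod>i<n. expectation (\<lambda>x. cis (Y i x))) - complex_of_real (exp (- v / 2))) \<le> 4 * ?C ^ 3 * e + ?C ^ 3 * e"
    using norm_diff_triangle_le[OF 1[unfolded p] 2] .
  then show ?thesis unfolding Y_def v_def by (simp add: mult_ac)
qed

section \<open>Exchangeable weights\<close>

locale bootstrap_model = sampling_model P X Z A
  for P :: "'a measure" and X :: "nat \<Rightarrow> 'a \<Rightarrow> real^'p" and Z :: "nat \<Rightarrow> 'a \<Rightarrow> real^'q" and A +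
  fixes W :: "nat \<Rightarrow> nat \<Rightarrow> nat \<Rightarrow> 'a \<Rightarrow> real" and K :: nat
  assumes W_meas[measurable]: "\<And>j n i. W j n i \<in> borel_measurable P"
    and W_exch: "\<And>n \<pi>. \<pi> permutes {..<n} \<Longrightarrow>
        distr P (PiM {..<n} (\<lambda>_. borel)) (\<lambda>\<omega>. \<lambda>i\<in>{..<n}. W 1 n (\<pi> i) \<omega>)
      = distr P (PiM {..<n} (\<lambda>_. borel)) (\<lambda>\<omega>. \<lambda>i\<in>{..<n}. W 1 n i \<omega>)"
    and W_copies: "\<And>j n. j \<in> {1..K} \<Longrightarrow>
        distr P (PiM {..<n} (\<lambda>_. borel)) (\<lambda>\<omega>. \<lambda>i\<in>{..<n}. W j n i \<omega>)
      = distr P (PiM {..<n} (\<lambda>_. borel)) (\<lambda>\<omega>. \<lambda>i\<in>{..<n}. W 1 n i \<omega>)"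
    and W_indep: "\<And>n. indep_sets
        (\<lambda>c. case c of
               None \<Rightarrow> {(\<lambda>\<omega>. \<lambda>i. (X i \<omega>, Z i \<omega>)) -` S \<inter> space P | S. S \<in> sets (PiM UNIV (\<lambda>_. borel))}
             | Some j \<Rightarrow> {(\<lambda>\<omega>. \<lambda>i\<in>{..<n}. W j n i \<omega>) -` S \<inter> space P | S. S \<in> sets (PiM {..<n} (\<lambda>_. borel))})
        (insert None (Some ` {1..K}))"
    and condW: "cond_W P (W 1)"
begin

abbreviation WV :: "nat \<Rightarrow> nat \<Rightarrow> 'a \<Rightarrow> nat \<Rightarrow> real" where "WV j n \<omega> \<equiv> (\<lambda>i\<in>{..<n}. W j n i \<omega>)"
abbreviation Vs :: "'a \<Rightarrow> nat \<Rightarrow> (real^'p) \<times> (real^'q)" where "Vs \<omega> \<equiv> (\<lambda>i. (X i \<omega>, Z i \<omega>))"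

definition src :: "nat \<Rightarrow> nat option \<Rightarrow> 'a set set" where
  "src n c = (case c of
       None \<Rightarrow> {Vs -` S \<inter> space P | S. S \<in> sets (PiM UNIV (\<lambda>_. borel))}
     | Some j \<Rightarrow> {WV j n -` S \<inter> space P | S. S \<in> sets (PiM {..<n} (\<lambda>_. borel))})"

lemma WV_measurable[measurable]: "WV j n \<in> measurable P (PiM {..<n} (\<lambda>_. borel))"
  by (rule measurable_restrict) measurable

lemma Vs_measurable[measurable]: "Vs \<in> measurable P (PiM UNIV (\<lambda>_. borel))"
  by (rule measurable_PiM_single') auto

lemma src_vimage: "src n None = sets (vimage_algebra (space P) Vs (PiM UNIV (\<lambda>_. borel)))"
  "src n (Some j) = sets (vimage_algebra (space P) (WV j n) (PiM {..<n} (\<lambda>_. borel)))"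
proof -
  have "Vs \<in> space P \<rightarrow> space (PiM UNIV (\<lambda>_. borel))" "WV j n \<in> space P \<rightarrow> space (PiM {..<n} (\<lambda>_. borel))"
    by (auto simp: space_PiM)
  then show "src n None = sets (vimage_algebra (space P) Vs (PiM UNIV (\<lambda>_. borel)))"
    "src n (Some j) = sets (vimage_algebra (space P) (WV j n) (PiM {..<n} (\<lambda>_. borel)))"
    by (auto simp: src_def sets_vimage_algebra2)
qed

lemma src_Int_stable: "Int_stable (src n c)"
  by (cases c) (auto simp: src_vimage Int_stable_def)

text \<open>Independence between whole groups of sources is what allows the sample to be separated
  from all \<open>K\<close> weight vectors at once; two single sources are the other case.\<close>

lemma src_group_indep:
  assumes GH: "G \<inter> H = {}" "G \<subseteq> insert None (Some ` {1..K})" "H \<subseteq> insert None (Some ` {1..K})"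
  shows "indep_set (sigma_sets (space P) (\<Union>c\<in>G. src n c)) (sigma_sets (space P) (\<Union>c\<in>H. src n c))"
proof -
  have i: "indep_sets (src n) (insert None (Some ` {1..K}))"
    using W_indep[of n] unfolding src_def[abs_def] .
  have "indep_sets (\<lambda>b. sigma_sets (space P) (\<Union>c\<in>(if b then G else H). src n c)) UNIV"
  proof (rule indep_sets_collect_sigma)
    show "indep_sets (src n) (\<Union>b\<in>UNIV. if b then G else H)"
      by (rule indep_sets_mono_index[OF _ i]) (use GH in \<open>auto split: if_splits\<close>)
    show "disjoint_family_on (\<lambda>b. if b then G else H) UNIV"
      using GH(1) by (auto simp: disjoint_family_on_def)
  qed (rule src_Int_stable)
  then show ?thesis unfolding indep_set_def
    by (rule indep_sets_cong[THEN iffD1, rotated -1]) (auto split: bool.split)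
qed

lemma indep2_of_groups:
  assumes GH: "G \<inter> H = {}" "G \<subseteq> insert None (Some ` {1..K})" "H \<subseteq> insert None (Some ` {1..K})"
    and X': "X' \<in> measurable (sigma (space P) (\<Union>c\<in>G. src n c)) S" "X' \<in> measurable P S"
    and Y': "Y' \<in> measurable (sigma (space P) (\<Union>c\<in>H. src n c)) R" "Y' \<in> measurable P R"
  shows "indep2 S X' R Y'"
  unfolding indep2_def
proof (intro conjI ballI X'(2) Y'(2))
  fix A B assume AB: "A \<in> sets S" "B \<in> sets R"
  have sub: "(\<Union>c\<in>G. src n c) \<subseteq> Pow (space P)" for G by (auto simp: src_def split: option.splits)
  have "X' -` A \<inter> space P \<in> sigma_sets (space P) (\<Union>c\<in>G. src n c)"
    using measurable_sets[OF X'(1) AB(1)] sub by (simp add: space_measure_of sets_measure_of)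
  moreover have "Y' -` B \<inter> space P \<in> sigma_sets (space P) (\<Union>c\<in>H. src n c)"
    using measurable_sets[OF Y'(1) AB(2)] sub by (simp add: space_measure_of sets_measure_of)
  ultimately show "prob ((X' -` A \<inter> space P) \<inter> (Y' -` B \<inter> space P)) = prob (X' -` A \<inter> space P) * prob (Y' -` B \<inter> space P)"
    using indep_setD[OF src_group_indep[OF GH, of n]] by blast
qed

lemma sigma_src_measurable:
  assumes "c \<in> G" and f: "f \<in> measurable (vimage_algebra (space P) g R) S" and src: "src n c = sets (vimage_algebra (space P) g R)"
  shows "f \<in> measurable (sigma (space P) (\<Union>c\<in>G. src n c)) S"
proof -
  have sub: "(\<Union>c\<in>G. src n c) \<subseteq> Pow (space P)" by (auto simp: src_def split: option.splits)
  have "sets (vimage_algebra (space P) g R) \<subseteq> sets (sigma (space P) (\<Union>c\<in>G. src n c))"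
    using assms(1) sub unfolding src[symmetric] by (auto simp: sets_measure_of)
  moreover have "space (sigma (space P) (\<Union>c\<in>G. src n c)) = space (vimage_algebra (space P) g R)"
    using sub by (simp add: space_measure_of)
  ultimately show ?thesis using f unfolding measurable_def by auto
qed

lemma Vs_sigma: "None \<in> G \<Longrightarrow> Vs \<in> measurable (sigma (space P) (\<Union>c\<in>G. src n c)) (PiM UNIV (\<lambda>_. borel))"
  by (rule sigma_src_measurable[OF _ measurable_vimage_algebra1 src_vimage(1)]) (auto simp: space_PiM)

lemma WV_sigma: "Some j \<in> G \<Longrightarrow> WV j n \<in> measurable (sigma (space P) (\<Union>c\<in>G. src n c)) (PiM {..<n} (\<lambda>_. borel))"
  by (rule sigma_src_measurable[OF _ measurable_vimage_algebra1 src_vimage(2)]) (auto simp: space_PiM)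

lemma indep_WV_WV:
  assumes "j \<in> {1..K}" "l \<in> {1..K}" "j \<noteq> l"
  shows "indep2 (PiM {..<n} (\<lambda>_. borel)) (WV j n) (PiM {..<n} (\<lambda>_. borel)) (WV l n)"
  by (rule indep2_of_groups[where G="{Some j}" and H="{Some l}" and n=n, OF _ _ _ WV_sigma _ WV_sigma]) (use assms in auto)

lemma indep_Vs_WV:
  assumes "j \<in> {1..K}"
  shows "indep2 (PiM UNIV (\<lambda>_. borel)) Vs (PiM {..<n} (\<lambda>_. borel)) (WV j n)"
  by (rule indep2_of_groups[where G="{None}" and H="{Some j}" and n=n, OF _ _ _ Vs_sigma _ WV_sigma]) (use assms in auto)

text \<open>All bootstrap weights as one array, so that conditioning on them is Fubini's theorem for
  two independent random elements.\<close>

definition WA :: "nat \<Rightarrow> 'a \<Rightarrow> nat \<times> nat \<Rightarrow> real" where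
  "WA n \<omega> = (\<lambda>(j, i)\<in>{1..K} \<times> {..<n}. W j n i \<omega>)"

abbreviation Vn :: "nat \<Rightarrow> 'a \<Rightarrow> nat \<Rightarrow> (real^'p) \<times> (real^'q)" where "Vn n \<omega> \<equiv> (\<lambda>i\<in>{..<n}. (X i \<omega>, Z i \<omega>))"

lemma indep_Vn_WA: "indep2 (PiM {..<n} (\<lambda>_. borel)) (Vn n) (PiM ({1..K} \<times> {..<n}) (\<lambda>_. borel)) (WA n)"
proof (rule indep2_of_groups[of "{None}" "Some ` {1..K}"])
  have comp: "Vn n \<in> measurable Q (PiM {..<n} (\<lambda>_. borel))" if Q: "Vs \<in> measurable Q (PiM UNIV (\<lambda>_. borel))" for Q
  proof (rule measurable_restrict)
    fix i :: nat
    have "(\<lambda>x. x i) \<in> measurable (PiM UNIV (\<lambda>_. borel)) (borel :: ((real^'p) \<times> (real^'q)) measure)"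
      by (rule measurable_component_singleton) simp
    from measurable_compose[OF Q this] show "V i \<in> borel_measurable Q" by simp
  qed
  show "Vn n \<in> measurable (sigma (space P) (\<Union>c\<in>{None}. src n c)) (PiM {..<n} (\<lambda>_. borel))" by (rule comp[OF Vs_sigma]) simp
  show "Vn n \<in> measurable P (PiM {..<n} (\<lambda>_. borel))" by (rule comp) measurable
  have comp': "WA n \<in> measurable Q (PiM ({1..K} \<times> {..<n}) (\<lambda>_. borel))"
    if Q: "\<And>j. j \<in> {1..K} \<Longrightarrow> WV j n \<in> measurable Q (PiM {..<n} (\<lambda>_. borel))" for Q
    unfolding WA_def
  proof (rule measurable_restrict, clarify)
    fix j i assume ji: "j \<in> {1..K}" "i < n"
    have "(\<lambda>x. x i) \<in> measurable (PiM {..<n} (\<lambda>_. borel)) (borel :: real measure)"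
      by (rule measurable_component_singleton) (use ji in simp)
    from measurable_compose[OF Q[OF ji(1)] this] show "W j n i \<in> borel_measurable Q" using ji by simp
  qed
  show "WA n \<in> measurable (sigma (space P) (\<Union>c\<in>Some ` {1..K}. src n c)) (PiM ({1..K} \<times> {..<n}) (\<lambda>_. borel))"
    by (rule comp'[OF WV_sigma]) auto
  show "WA n \<in> measurable P (PiM ({1..K} \<times> {..<n}) (\<lambda>_. borel))" by (rule comp') measurable
qed auto

section \<open>Centred weights: their laws, tails and cross products\<close>

definition wt :: "nat \<Rightarrow> nat \<Rightarrow> nat \<Rightarrow> 'a \<Rightarrow> real" where
  "wt j n i \<omega> = W j n i \<omega> - Wbar (W j) n \<omega>"

text \<open>Centring as a map on weight vectors: the laws in \<open>W_exch\<close> and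
  \<open>W_copies\<close> concern the raw vectors, and facts on centred weights are transported
  through this map.\<close>

definition cw :: "nat \<Rightarrow> nat \<Rightarrow> (nat \<Rightarrow> real) \<Rightarrow> real" where
  "cw n i x = x i - (\<Sum>i<n. x i) / real n"

lemma wt_cw: "i < n \<Longrightarrow> wt j n i \<omega> = cw n i (WV j n \<omega>)"
  by (simp add: wt_def cw_def Wbar_def)

lemma Wbar_measurable[measurable]: "Wbar (W j) n \<in> borel_measurable P"
  unfolding Wbar_def[abs_def] by measurable

lemma wt_measurable[measurable]: "wt j n i \<in> borel_measurable P"
  unfolding wt_def[abs_def] by measurable

lemma cw_measurable[measurable]: "i < n \<Longrightarrow> cw n i \<in> borel_measurable (PiM {..<n} (\<lambda>_. borel))"
  unfolding cw_def[abs_def] by measurable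

lemma wt_sum: "(\<Sum>i<n. wt j n i \<omega>) = 0"
  by (cases "n = 0") (simp_all add: wt_def Wbar_def sum_subtractf)

lemma cw_sum: "(\<Sum>i<n. cw n i x) = 0"
  by (cases "n = 0") (simp_all add: cw_def sum_subtractf)

lemma WV_law_nn:
  assumes "j \<in> {1..K}" "g \<in> borel_measurable (PiM {..<n} (\<lambda>_. borel))"
  shows "(\<integral>\<^sup>+\<omega>. g (WV j n \<omega>) \<partial>P) = (\<integral>\<^sup>+\<omega>. g (WV 1 n \<omega>) \<partial>P)"
  using nn_integral_distr[OF WV_measurable[of j n], of g] nn_integral_distr[OF WV_measurable[of 1 n], of g] assms W_copies[OF assms(1), of n] by simp

lemma WV_law_exp:
  fixes g :: "(nat \<Rightarrow> real) \<Rightarrow> real"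
  assumes "j \<in> {1..K}" "g \<in> borel_measurable (PiM {..<n} (\<lambda>_. borel))"
  shows "expectation (\<lambda>\<omega>. g (WV j n \<omega>)) = expectation (\<lambda>\<omega>. g (WV 1 n \<omega>))"
  using integral_distr[OF WV_measurable[of j n], of g] integral_distr[OF WV_measurable[of 1 n], of g] assms W_copies[OF assms(1), of n] by simp

lemma WV_law_prob:
  assumes "j \<in> {1..K}" and Q: "Measurable.pred (PiM {..<n} (\<lambda>_. borel)) Q"
  shows "prob {\<omega>\<in>space P. Q (WV j n \<omega>)} = prob {\<omega>\<in>space P. Q (WV 1 n \<omega>)}"
proof -
  have "prob {\<omega>\<in>space P. Q (WV j n \<omega>)} = measure (distr P (PiM {..<n} (\<lambda>_. borel)) (WV j n)) {x\<in>space (PiM {..<n} (\<lambda>_. borel)). Q x}" for j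
    using Q by (subst measure_distr) (auto intro!: arg_cong[where f=prob] simp: space_PiM)
  then show ?thesis using W_copies[OF assms(1), of n] by simp
qed

lemma cw_perm:
  assumes \<pi>: "\<pi> permutes {..<n}" and i: "i < n"
  shows "cw n i (\<lambda>i\<in>{..<n}. W 1 n (\<pi> i) \<omega>) = cw n (\<pi> i) (WV 1 n \<omega>)"
proof -
  have pi: "\<pi> i < n" using permutes_in_image[OF \<pi>, of i] i by simp
  have "(\<Sum>i<n. W 1 n (\<pi> i) \<omega>) = (\<Sum>i<n. W 1 n i \<omega>)" using sum.permute[OF \<pi>, of "\<lambda>i. W 1 n i \<omega>"] by (simp add: comp_def)
  then show ?thesis using i pi by (simp add: cw_def)
qed

lemma WV_exch_law:
  assumes \<pi>: "\<pi> permutes {..<n}" and Q: "Measurable.pred (PiM {..<n} (\<lambda>_. borel)) Q"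
  shows "prob {\<omega>\<in>space P. Q (\<lambda>i\<in>{..<n}. W 1 n (\<pi> i) \<omega>)} = prob {\<omega>\<in>space P. Q (WV 1 n \<omega>)}"
proof -
  have m: "(\<lambda>\<omega>. \<lambda>i\<in>{..<n}. W 1 n (\<pi> i) \<omega>) \<in> measurable P (PiM {..<n} (\<lambda>_. borel))" by (rule measurable_restrict) measurable
  have "prob {\<omega>\<in>space P. Q (f \<omega>)} = measure (distr P (PiM {..<n} (\<lambda>_. borel)) f) {x\<in>space (PiM {..<n} (\<lambda>_. borel)). Q x}"
    if f: "f \<in> measurable P (PiM {..<n} (\<lambda>_. borel))" for f
    using Q f measurable_space[OF f] by (subst measure_distr) (auto intro!: arg_cong[where f=prob])
  from this[OF m] this[OF WV_measurable[of 1 n]] show ?thesis using W_exch[OF \<pi>] by simp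
qed

definition tailq :: "nat \<Rightarrow> real \<Rightarrow> real" where
  "tailq n t = prob {\<omega>\<in>space P. \<bar>W 1 n 0 \<omega> - Wbar (W 1) n \<omega>\<bar> > t}"

text \<open>The condition on the weights speaks of row 1 and index 0. Equality in law of the rows
  moves row \<open>j\<close> to row 1, and the transposition of 0 and \<open>i\<close> moves the
  index.\<close>

lemma wt_tail:
  assumes j: "j \<in> {1..K}" and i: "i < n"
  shows "prob {\<omega>\<in>space P. t < \<bar>wt j n i \<omega>\<bar>} = tailq n t"
proof -
  have n: "0 < n" using i by simp
  have \<pi>: "Transposition.transpose 0 i permutes {..<n}" by (rule permutes_swap_id) (use i in auto)
  have Q: "Measurable.pred (PiM {..<n} (\<lambda>_. borel)) (\<lambda>x. t < \<bar>cw n i x\<bar>)" using i by measurable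
  have Q0: "Measurable.pred (PiM {..<n} (\<lambda>_. borel)) (\<lambda>x. t < \<bar>cw n 0 x\<bar>)" using n by measurable
  have "prob {\<omega>\<in>space P. t < \<bar>wt j n i \<omega>\<bar>} = prob {\<omega>\<in>space P. t < \<bar>cw n i (WV 1 n \<omega>)\<bar>}"
    using WV_law_prob[OF j Q] by (simp add: wt_cw[OF i])
  also have "\<dots> = prob {\<omega>\<in>space P. t < \<bar>cw n 0 (\<lambda>i'\<in>{..<n}. W 1 n (Transposition.transpose 0 i i') \<omega>)\<bar>}"
    using cw_perm[OF \<pi> n] by simp
  also have "\<dots> = prob {\<omega>\<in>space P. t < \<bar>cw n 0 (WV 1 n \<omega>)\<bar>}" by (rule WV_exch_law[OF \<pi> Q0])
  finally show ?thesis unfolding tailq_def using wt_cw[OF n, of 1] by (simp add: wt_def)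
qed

definition wmax :: "nat \<Rightarrow> nat \<Rightarrow> 'a \<Rightarrow> real" where
  "wmax j n \<omega> = Max ((\<lambda>i. \<bar>wt j n i \<omega>\<bar>) ` {..<n})"

lemma wmax_measurable[measurable]: "wmax j n \<in> borel_measurable P"
  unfolding wmax_def[abs_def] by (intro borel_measurable_Max) auto

lemma wmax_ge: "i < n \<Longrightarrow> \<bar>wt j n i \<omega>\<bar> \<le> wmax j n \<omega>"
  unfolding wmax_def by (intro Max_ge) auto

lemma wmax_tendsto:
  assumes j: "j \<in> {1..K}"
  shows "(\<lambda>n. \<integral>\<^sup>+\<omega>. ennreal (wmax j n \<omega> / sqrt (real n)) \<partial>P) \<longlonglongrightarrow> 0"
proof -
  have "(\<integral>\<^sup>+\<omega>. ennreal (wmax j n \<omega> / sqrt (real n)) \<partial>P)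
      = (\<integral>\<^sup>+\<omega>. ennreal (Max ((\<lambda>i. \<bar>W 1 n i \<omega> - Wbar (W 1) n \<omega>\<bar>) ` {..<n}) / sqrt (real n)) \<partial>P)" for n
  proof -
    let ?g = "\<lambda>x. ennreal (Max ((\<lambda>i. \<bar>cw n i x\<bar>) ` {..<n}) / sqrt (real n))"
    have [measurable]: "(\<lambda>x. Max ((\<lambda>i. \<bar>cw n i x\<bar>) ` {..<n})) \<in> borel_measurable (PiM {..<n} (\<lambda>_. borel))"
      by (intro borel_measurable_Max) auto
    have eq: "wmax j n \<omega> = Max ((\<lambda>i. \<bar>cw n i (WV j n \<omega>)\<bar>) ` {..<n})" for j \<omega>
      unfolding wmax_def by (intro arg_cong[where f=Max] image_cong) (auto simp: wt_cw)
    have "(\<integral>\<^sup>+\<omega>. ?g (WV j n \<omega>) \<partial>P) = (\<integral>\<^sup>+\<omega>. ?g (WV 1 n \<omega>) \<partial>P)" by (rule WV_law_nn[OF j]) measurable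
    then have "(\<integral>\<^sup>+\<omega>. ennreal (wmax j n \<omega> / sqrt (real n)) \<partial>P) = (\<integral>\<^sup>+\<omega>. ennreal (wmax 1 n \<omega> / sqrt (real n)) \<partial>P)" unfolding eq .
    then show ?thesis unfolding wmax_def wt_def .
  qed
  then show ?thesis using condW unfolding cond_W_def by simp
qed

lemma wt_square_tendsto:
  assumes j: "j \<in> {1..K}" and e: "0 < e"
  shows "(\<lambda>n. prob {\<omega>\<in>space P. \<bar>(\<Sum>i<n. (wt j n i \<omega>)\<^sup>2) / real n - 1\<bar> > e}) \<longlonglongrightarrow> 0"
proof -
  have "prob {\<omega>\<in>space P. \<bar>(\<Sum>i<n. (wt j n i \<omega>)\<^sup>2) / real n - 1\<bar> > e}
      = prob {\<omega>\<in>space P. \<bar>(\<Sum>i<n. (W 1 n i \<omega> - Wbar (W 1) n \<omega>)\<^sup>2) / real n - 1\<bar> > e}" for n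
  proof -
    let ?Q = "\<lambda>x. e < \<bar>(\<Sum>i<n. (cw n i x)\<^sup>2) / real n - 1\<bar>"
    have [measurable]: "(\<lambda>x. \<Sum>i<n. (cw n i x)\<^sup>2) \<in> borel_measurable (PiM {..<n} (\<lambda>_. borel))"
      by (rule borel_measurable_sum) auto
    have Q: "Measurable.pred (PiM {..<n} (\<lambda>_. borel)) ?Q" by measurable
    have eq: "(\<Sum>i<n. (wt j n i \<omega>)\<^sup>2) = (\<Sum>i<n. (cw n i (WV j n \<omega>))\<^sup>2)" for j \<omega>
      by (intro sum.cong) (auto simp: wt_cw)
    have "prob {\<omega>\<in>space P. \<bar>(\<Sum>i<n. (wt j n i \<omega>)\<^sup>2) / real n - 1\<bar> > e} = prob {\<omega>\<in>space P. \<bar>(\<Sum>i<n. (wt 1 n i \<omega>)\<^sup>2) / real n - 1\<bar> > e}"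
      unfolding eq by (rule WV_law_prob[OF j Q])
    then show ?thesis unfolding wt_def .
  qed
  then show ?thesis using condW e unfolding cond_W_def by simp
qed

text \<open>The truncation to a permutation-invariant event replaces second moments of the weights.\<close>
definition trunc_prod :: "nat \<Rightarrow> nat \<Rightarrow> nat \<Rightarrow> (nat \<Rightarrow> real) \<Rightarrow> real" where
  "trunc_prod n i k x = (if i < n \<and> k < n \<and> (\<Sum>i<n. (cw n i x)\<^sup>2) \<le> 2 * real n then cw n i x * cw n k x else 0)"

lemma trunc_prod_measurable[measurable]: "trunc_prod n i k \<in> borel_measurable (PiM {..<n} (\<lambda>_. borel))"
proof (cases "i < n \<and> k < n")
  case True
  have [measurable]: "(\<lambda>x. \<Sum>i<n. (cw n i x)\<^sup>2) \<in> borel_measurable (PiM {..<n} (\<lambda>_. borel))" by (rule borel_measurable_sum) auto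
  show ?thesis unfolding trunc_prod_def[abs_def] using True by simp
next
  case False
  then have "trunc_prod n i k = (\<lambda>_. 0)" by (auto simp: trunc_prod_def fun_eq_iff)
  then show ?thesis by simp
qed

lemma trunc_prod_bound: "\<bar>trunc_prod n i k x\<bar> \<le> 2 * real n"
proof (cases "i < n \<and> k < n \<and> (\<Sum>i<n. (cw n i x)\<^sup>2) \<le> 2 * real n")
  case True
  have sq: "(cw n i x)\<^sup>2 \<le> 2 * real n" if "i < n" for i
    using member_le_sum[of i "{..<n}" "\<lambda>i. (cw n i x)\<^sup>2"] that True by auto
  have "2 * \<bar>cw n i x * cw n k x\<bar> \<le> (cw n i x)\<^sup>2 + (cw n k x)\<^sup>2"
    using sum_squares_bound[of "\<bar>cw n i x\<bar>" "\<bar>cw n k x\<bar>"] by (simp add: abs_mult)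
  then show ?thesis using sq[of i] sq[of k] True by (simp add: trunc_prod_def)
qed (auto simp: trunc_prod_def)

definition trunc_mean :: "nat \<Rightarrow> nat \<Rightarrow> nat \<Rightarrow> real" where "trunc_mean n i k = expectation (\<lambda>\<omega>. trunc_prod n i k (WV 1 n \<omega>))"

lemma trunc_prod_integrable: "integrable P (\<lambda>\<omega>. trunc_prod n i k (WV j n \<omega>))"
  by (rule integrable_const_bound[where B="2 * real n"]) (use trunc_prod_bound in auto)

text \<open>The sample mean and the truncation event are symmetric functions of the vector, so
  permuting the weights only permutes the two indices of the product.\<close>

lemma trunc_mean_perm:
  assumes \<pi>: "\<pi> permutes {..<n}" and ik: "i < n" "k < n"
  shows "trunc_mean n (\<pi> i) (\<pi> k) = trunc_mean n i k"
proof -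
  have m: "(\<lambda>\<omega>. \<lambda>i\<in>{..<n}. W 1 n (\<pi> i) \<omega>) \<in> measurable P (PiM {..<n} (\<lambda>_. borel))" by (rule measurable_restrict) measurable
  have pik: "\<pi> i < n" "\<pi> k < n" using permutes_in_image[OF \<pi>] ik by auto
  have "trunc_prod n i k (\<lambda>i\<in>{..<n}. W 1 n (\<pi> i) \<omega>) = trunc_prod n (\<pi> i) (\<pi> k) (WV 1 n \<omega>)" for \<omega>
  proof -
    have "(\<Sum>i<n. (cw n i (\<lambda>i\<in>{..<n}. W 1 n (\<pi> i) \<omega>))\<^sup>2) = (\<Sum>i<n. (cw n (\<pi> i) (WV 1 n \<omega>))\<^sup>2)"
      by (intro sum.cong refl) (simp only: cw_perm[OF \<pi>] lessThan_iff)
    also have "\<dots> = (\<Sum>i<n. (cw n i (WV 1 n \<omega>))\<^sup>2)"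
      using sum.permute[OF \<pi>, of "\<lambda>i. (cw n i (WV 1 n \<omega>))\<^sup>2"] by (simp add: comp_def)
    finally show ?thesis using ik pik by (simp only: trunc_prod_def cw_perm[OF \<pi>])
  qed
  then have "trunc_mean n (\<pi> i) (\<pi> k) = expectation (\<lambda>\<omega>. trunc_prod n i k (\<lambda>i\<in>{..<n}. W 1 n (\<pi> i) \<omega>))" by (simp add: trunc_mean_def)
  also have "\<dots> = expectation (\<lambda>\<omega>. trunc_prod n i k (WV 1 n \<omega>))"
    using integral_distr[OF m trunc_prod_measurable[of n i k]] integral_distr[OF WV_measurable[of 1 n] trunc_prod_measurable[of n i k]] W_exch[OF \<pi>] by simp
  finally show ?thesis by (simp add: trunc_mean_def)
qed

lemma trunc_mean_values:
  assumes n: "2 \<le> n"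
  shows "i < n \<Longrightarrow> trunc_mean n i i = trunc_mean n 0 0"
    and "i < n \<Longrightarrow> k < n \<Longrightarrow> i \<noteq> k \<Longrightarrow> trunc_mean n i k = trunc_mean n 0 1"
proof -
  have t: "Transposition.transpose a b permutes {..<n}" if "a < n" "b < n" for a b by (rule permutes_swap_id) (use that in auto)
  show "trunc_mean n i i = trunc_mean n 0 0" if "i < n" using trunc_mean_perm[OF t[of 0 i], of 0 0] that n by simp
  show "trunc_mean n i k = trunc_mean n 0 1" if ik: "i < n" "k < n" "i \<noteq> k"
  proof -
    \<comment> \<open>After 0 has been moved to \<open>i\<close>, index 1 sits at \<open>b\<close>,
      which is 0 if \<open>i = 1\<close> and 1 otherwise. The second transposition takes
      \<open>b\<close> to \<open>k\<close> and fixes \<open>i\<close>, since \<open>b\<close> and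
      \<open>k\<close> both differ from \<open>i\<close>.\<close>
    define b where "b = Transposition.transpose 0 i 1"
    have b: "b < n" "b \<noteq> i" using ik n unfolding b_def by (auto simp: Transposition.transpose_def)
    have c: "(Transposition.transpose b k \<circ> Transposition.transpose 0 i) permutes {..<n}" by (rule permutes_compose[OF t t]) (use ik b n in auto)
    have "(Transposition.transpose b k \<circ> Transposition.transpose 0 i) 0 = i" using b ik by (simp add: Transposition.transpose_def)
    moreover have "(Transposition.transpose b k \<circ> Transposition.transpose 0 i) 1 = k" unfolding comp_def b_def[symmetric] by simp
    ultimately show ?thesis using trunc_mean_perm[OF c, of 0 1] n by simp
  qed
qed

text \<open>By exchangeability the diagonal entries all equal \<open>s\<close> and the others all
  equal \<open>c\<close>. Rows of products of centred weights sum to 0, so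
  \<open>(n - 1) * c = - s\<close>, and truncation gives \<open>0 \<le> s \<le> 2\<close>. Each row
  then contributes \<open>s\<^sup>2 + (n - 1) * c\<^sup>2\<close>, where both terms are at most
  4.\<close>

lemma trunc_mean_sum_squares:
  assumes n: "2 \<le> n"
  shows "(\<Sum>i<n. \<Sum>k<n. (trunc_mean n i k)\<^sup>2) \<le> 12 * real n"
proof -
  define s c where "s = trunc_mean n 0 0" and "c = trunc_mean n 0 1"
  have row: "(\<Sum>k<n. h (trunc_mean n i k)) = h s + (real n - 1) * h c" if i: "i < n" for i and h :: "real \<Rightarrow> real"
  proof -
    have "(\<Sum>k<n. h (trunc_mean n i k)) = h (trunc_mean n i i) + (\<Sum>k\<in>{..<n} - {i}. h (trunc_mean n i k))" using i by (subst sum.remove) auto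
    also have "(\<Sum>k\<in>{..<n} - {i}. h (trunc_mean n i k)) = (\<Sum>k\<in>{..<n} - {i}. h c)"
      by (intro sum.cong refl) (auto simp: c_def trunc_mean_values(2)[OF n i])
    also have "\<dots> = (real n - 1) * h c" using i by (simp add: of_nat_diff)
    finally show ?thesis using trunc_mean_values(1)[OF n i] by (simp add: s_def)
  qed
  have z: "(\<Sum>k<n. trunc_prod n 0 k x) = 0" for x
  proof -
    have "(\<Sum>k<n. trunc_prod n 0 k x) = (\<Sum>k<n. if 0 < n \<and> (\<Sum>i<n. (cw n i x)\<^sup>2) \<le> 2 * real n then cw n 0 x * cw n k x else 0)"
      by (intro sum.cong) (auto simp: trunc_prod_def)
    also have "\<dots> = (if 0 < n \<and> (\<Sum>i<n. (cw n i x)\<^sup>2) \<le> 2 * real n then cw n 0 x * (\<Sum>k<n. cw n k x) else 0)" by (simp add: sum_distrib_left)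
    finally show ?thesis by (simp add: cw_sum)
  qed
  have "s + (real n - 1) * c = (\<Sum>k<n. trunc_mean n 0 k)" by (rule row[of 0 "\<lambda>x. x", symmetric]) (use n in simp)
  also have "\<dots> = expectation (\<lambda>\<omega>. \<Sum>k<n. trunc_prod n 0 k (WV 1 n \<omega>))"
    unfolding trunc_mean_def by (rule Bochner_Integration.integral_sum[symmetric]) (rule trunc_prod_integrable)
  finally have sc: "(real n - 1) * c = - s" unfolding z by simp
  have "(\<Sum>i<n. trunc_mean n i i) = (\<Sum>i<n. s)" unfolding s_def by (intro sum.cong refl trunc_mean_values(1)[OF n]) simp
  then have "real n * s = (\<Sum>i<n. trunc_mean n i i)" by simp
  also have "\<dots> = expectation (\<lambda>\<omega>. \<Sum>i<n. trunc_prod n i i (WV 1 n \<omega>))"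
    unfolding trunc_mean_def by (rule Bochner_Integration.integral_sum[symmetric]) (rule trunc_prod_integrable)
  finally have ns: "real n * s = expectation (\<lambda>\<omega>. \<Sum>i<n. trunc_prod n i i (WV 1 n \<omega>))" .
  have diag: "0 \<le> (\<Sum>i<n. trunc_prod n i i x)" "(\<Sum>i<n. trunc_prod n i i x) \<le> 2 * real n" for x
  proof -
    have "(\<Sum>i<n. trunc_prod n i i x) = (\<Sum>i<n. if (\<Sum>i<n. (cw n i x)\<^sup>2) \<le> 2 * real n then (cw n i x)\<^sup>2 else 0)"
      by (intro sum.cong) (auto simp: trunc_prod_def power2_eq_square)
    also have "\<dots> = (if (\<Sum>i<n. (cw n i x)\<^sup>2) \<le> 2 * real n then \<Sum>i<n. (cw n i x)\<^sup>2 else 0)" by simp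
    finally show "0 \<le> (\<Sum>i<n. trunc_prod n i i x)" "(\<Sum>i<n. trunc_prod n i i x) \<le> 2 * real n" by (auto intro: sum_nonneg)
  qed
  have "0 \<le> real n * s" unfolding ns using diag by (intro Bochner_Integration.integral_nonneg) auto
  then have s0: "0 \<le> s" using n by (simp add: zero_le_mult_iff)
  have "real n * s \<le> expectation (\<lambda>_. 2 * real n)" unfolding ns
    by (rule integral_mono) (use diag trunc_prod_integrable in \<open>auto intro!: Bochner_Integration.integrable_sum\<close>)
  then have s2: "s \<le> 2" using n by (simp add: prob_space)
  have ss: "s\<^sup>2 \<le> 4" using power_mono[OF s2 s0, of 2] by simp
  have cc: "(real n - 1) * c\<^sup>2 \<le> 4"
  proof -
    have "(real n - 1) * c\<^sup>2 \<le> (real n - 1)\<^sup>2 * c\<^sup>2"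
      using n by (intro mult_right_mono) (auto simp: power2_eq_square mult_le_cancel_left1)
    also have "\<dots> = s\<^sup>2" using sc by (metis power2_minus power_mult_distrib)
    finally show ?thesis using ss by linarith
  qed
  have "(\<Sum>i<n. \<Sum>k<n. (trunc_mean n i k)\<^sup>2) = (\<Sum>i<n. s\<^sup>2 + (real n - 1) * c\<^sup>2)"
    by (intro sum.cong refl) (auto intro: row[of _ "\<lambda>x. x\<^sup>2"])
  also have "\<dots> \<le> (\<Sum>i<n. 12)" using ss cc by (intro sum_mono) auto
  finally show ?thesis by simp
qed

text \<open>Chebyshev's inequality. When both vectors satisfy the truncation bound, \<open>Y\<close>
  is the square of the cross product; otherwise it is 0. Independence of the two rows factorizes its
  mean into squares of the common \<open>trunc_mean\<close>, of total order \<open>n\<close>, which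
  is compared with \<open>(e * n)\<^sup>2\<close>. The truncation fails with vanishing probability
  by \<open>wt_square_tendsto\<close> at tolerance 1.\<close>

lemma cross_tendsto:
  assumes jl: "j \<in> {1..K}" "l \<in> {1..K}" "j \<noteq> l" and e: "0 < e"
  shows "(\<lambda>n. prob {\<omega>\<in>space P. \<bar>(\<Sum>i<n. wt j n i \<omega> * wt l n i \<omega>) / real n\<bar> > e}) \<longlonglongrightarrow> 0"
proof -
  let ?S = "\<lambda>j n. {\<omega>\<in>space P. \<bar>(\<Sum>i<n. (wt j n i \<omega>)\<^sup>2) / real n - 1\<bar> > 1}"
  let ?C = "\<lambda>n. {\<omega>\<in>space P. \<bar>(\<Sum>i<n. wt j n i \<omega> * wt l n i \<omega>) / real n\<bar> > e}"
  have bound: "prob (?C n) \<le> prob (?S j n) + prob (?S l n) + 12 / e\<^sup>2 * (1 / real n)" if n: "2 \<le> n" for n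
  proof -
    define Y where "Y \<omega> = (\<Sum>i<n. \<Sum>k<n. trunc_prod n i k (WV j n \<omega>) * trunc_prod n i k (WV l n \<omega>))" for \<omega>
    have [measurable]: "Y \<in> borel_measurable P" unfolding Y_def by measurable
    have i2: "integrable P (\<lambda>\<omega>. trunc_prod n i k (WV j n \<omega>) * trunc_prod n i k (WV l n \<omega>))" for i k
    proof (rule integrable_const_bound[where B="2 * real n * (2 * real n)"])
      show "AE x in P. norm (trunc_prod n i k (WV j n x) * trunc_prod n i k (WV l n x)) \<le> 2 * real n * (2 * real n)"
      proof (rule AE_I2)
        fix x
        have "\<bar>trunc_prod n i k (WV j n x)\<bar> * \<bar>trunc_prod n i k (WV l n x)\<bar> \<le> 2 * real n * (2 * real n)"
          by (intro mult_mono trunc_prod_bound) auto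
        then show "norm (trunc_prod n i k (WV j n x) * trunc_prod n i k (WV l n x)) \<le> 2 * real n * (2 * real n)"
          by (simp only: abs_mult real_norm_def)
      qed
    qed measurable
    have "expectation Y = (\<Sum>i<n. \<Sum>k<n. expectation (\<lambda>\<omega>. trunc_prod n i k (WV j n \<omega>) * trunc_prod n i k (WV l n \<omega>)))"
      unfolding Y_def by (subst Bochner_Integration.integral_sum, intro Bochner_Integration.integrable_sum i2,
          subst Bochner_Integration.integral_sum, rule i2) simp
    also have "\<dots> = (\<Sum>i<n. \<Sum>k<n. trunc_mean n i k * trunc_mean n i k)"
      by (intro sum.cong refl, subst integral_indep_mult[OF indep_WV_WV[OF jl], where b="2 * real n"])
         (auto simp: trunc_prod_bound WV_law_exp[OF jl(1)] WV_law_exp[OF jl(2)] trunc_mean_def)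
    finally have EY: "expectation Y \<le> 12 * real n" using trunc_mean_sum_squares[OF n] by (simp add: power2_eq_square)
    have iY: "integrable P Y" unfolding Y_def by (intro Bochner_Integration.integrable_sum i2)
    have tr: "trunc_prod n i k (WV j n \<omega>) = wt j n i \<omega> * wt j n k \<omega>" if "i < n" "k < n" "(\<Sum>i<n. (wt j n i \<omega>)\<^sup>2) \<le> 2 * real n" for i k j \<omega>
    proof -
      have "(\<Sum>i<n. (wt j n i \<omega>)\<^sup>2) = (\<Sum>i<n. (cw n i (WV j n \<omega>))\<^sup>2)" by (intro sum.cong) (auto simp: wt_cw)
      then show ?thesis using that by (simp add: trunc_prod_def wt_cw)
    qed
    have Yeq: "Y \<omega> = (\<Sum>i<n. wt j n i \<omega> * wt l n i \<omega>)\<^sup>2"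
      if "(\<Sum>i<n. (wt j n i \<omega>)\<^sup>2) \<le> 2 * real n" "(\<Sum>i<n. (wt l n i \<omega>)\<^sup>2) \<le> 2 * real n" for \<omega>
    proof -
      have "Y \<omega> = (\<Sum>i<n. \<Sum>k<n. (wt j n i \<omega> * wt l n i \<omega>) * (wt j n k \<omega> * wt l n k \<omega>))"
        unfolding Y_def using that by (intro sum.cong refl) (simp add: tr)
      then show ?thesis by (simp add: power2_eq_square sum_product)
    qed
    have Ynn: "0 \<le> Y \<omega>" for \<omega>
    proof (cases "(\<Sum>i<n. (wt j n i \<omega>)\<^sup>2) \<le> 2 * real n \<and> (\<Sum>i<n. (wt l n i \<omega>)\<^sup>2) \<le> 2 * real n")
      case False
      have z: "trunc_prod n i k (WV j n \<omega>) = 0" if "\<not> (\<Sum>i<n. (wt j n i \<omega>)\<^sup>2) \<le> 2 * real n" for i k j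
      proof -
        have "(\<Sum>i<n. (wt j n i \<omega>)\<^sup>2) = (\<Sum>i<n. (cw n i (WV j n \<omega>))\<^sup>2)" by (intro sum.cong) (auto simp: wt_cw)
        then show ?thesis using that by (simp add: trunc_prod_def)
      qed
      then have "Y \<omega> = 0" unfolding Y_def using False z by (intro sum.neutral ballI) auto
      then show ?thesis by simp
    qed (simp add: Yeq)
    have sub: "?C n \<subseteq> ?S j n \<union> ?S l n \<union> {\<omega>\<in>space P. (e * real n)\<^sup>2 \<le> Y \<omega>}"
    proof
      fix \<omega> assume w: "\<omega> \<in> ?C n"
      show "\<omega> \<in> ?S j n \<union> ?S l n \<union> {\<omega>\<in>space P. (e * real n)\<^sup>2 \<le> Y \<omega>}"
      proof (cases "\<omega> \<in> ?S j n \<or> \<omega> \<in> ?S l n")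
        case False
        then have "(\<Sum>i<n. (wt j n i \<omega>)\<^sup>2) / real n \<le> 2" "(\<Sum>i<n. (wt l n i \<omega>)\<^sup>2) / real n \<le> 2" using w by (auto simp: not_less abs_le_iff)
        then have "Y \<omega> = (\<Sum>i<n. wt j n i \<omega> * wt l n i \<omega>)\<^sup>2" using n by (intro Yeq) (auto simp: field_simps)
        moreover have "e * real n \<le> \<bar>\<Sum>i<n. wt j n i \<omega> * wt l n i \<omega>\<bar>" using w n by (auto simp: abs_divide field_simps)
        ultimately show ?thesis using w e power_mono[of "e * real n" "\<bar>\<Sum>i<n. wt j n i \<omega> * wt l n i \<omega>\<bar>" 2] by auto
      qed auto
    qed
    have "prob (?C n) \<le> prob (?S j n \<union> ?S l n \<union> {\<omega>\<in>space P. (e * real n)\<^sup>2 \<le> Y \<omega>})" by (intro finite_measure_mono sub) measurable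
    also have "\<dots> \<le> prob (?S j n \<union> ?S l n) + prob {\<omega>\<in>space P. (e * real n)\<^sup>2 \<le> Y \<omega>}" by (rule measure_Un_le) measurable
    also have "prob (?S j n \<union> ?S l n) \<le> prob (?S j n) + prob (?S l n)" by (rule measure_Un_le) measurable
    also have "prob {\<omega>\<in>space P. (e * real n)\<^sup>2 \<le> Y \<omega>} \<le> expectation Y / (e * real n)\<^sup>2"
      by (rule integral_Markov_inequality_measure[OF iY, where A="{}", simplified]) (use Ynn e n in auto)
    also have "\<dots> \<le> 12 * real n / (e * real n)\<^sup>2" using EY by (intro divide_right_mono) auto
    also have "\<dots> = 12 / e\<^sup>2 * (1 / real n)" using n e by (simp add: power2_eq_square field_simps)
    finally show ?thesis by simp
  qed
  have "(\<lambda>n. prob (?S j n) + prob (?S l n) + 12 / e\<^sup>2 * (1 / real n)) \<longlonglongrightarrow> 0 + 0 + 12 / e\<^sup>2 * 0"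
    by (intro tendsto_intros wt_square_tendsto jl lim_1_over_n) auto
  then have lim: "(\<lambda>n. prob (?S j n) + prob (?S l n) + 12 / e\<^sup>2 * (1 / real n)) \<longlonglongrightarrow> 0" by simp
  show ?thesis
    by (rule tendsto_sandwich[OF _ eventually_sequentiallyI[of 2, OF bound] tendsto_const lim]) auto
qed

end

section \<open>Finite-dimensional limits and moduli of the bootstrap processes\<close>

lemma (in prob_space) markov_ennreal:
  assumes [measurable]: "Y \<in> borel_measurable M" and c: "0 < c" and b: "0 \<le> b" and i: "(\<integral>\<^sup>+\<omega>. Y \<omega> \<partial>M) \<le> ennreal b"
  shows "prob {\<omega>\<in>space M. ennreal c < Y \<omega>} \<le> b / c"
proof -
  have "ennreal c * emeasure M {\<omega>\<in>space M. ennreal c < Y \<omega>} = (\<integral>\<^sup>+\<omega>. ennreal c * indicator {\<omega>\<in>space M. ennreal c < Y \<omega>} \<omega> \<partial>M)"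
    by (simp add: nn_integral_cmult)
  also have "\<dots> \<le> (\<integral>\<^sup>+\<omega>. Y \<omega> \<partial>M)" by (intro nn_integral_mono) (auto simp: indicator_def)
  finally have "ennreal (c * prob {\<omega>\<in>space M. ennreal c < Y \<omega>}) \<le> ennreal b"
    using i c by (simp add: emeasure_eq_measure ennreal_mult)
  then have "c * prob {\<omega>\<in>space M. ennreal c < Y \<omega>} \<le> b" using b by (simp add: ennreal_le_iff)
  then show ?thesis using c by (simp add: field_simps)
qed

lemma (in prob_space) markov_tendsto:
  assumes m: "\<And>n. Y n \<in> borel_measurable M" and c: "0 < c" and i: "(\<lambda>n. \<integral>\<^sup>+\<omega>. Y n \<omega> \<partial>M) \<longlonglongrightarrow> 0"
  shows "(\<lambda>n. prob {\<omega>\<in>space M. ennreal c < Y n \<omega>}) \<longlonglongrightarrow> 0"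
proof (rule tendstoI)
  fix e :: real assume e: "0 < e"
  have "\<forall>\<^sub>F n in sequentially. (\<integral>\<^sup>+\<omega>. Y n \<omega> \<partial>M) < ennreal (c * e / 2)"
    using i by (rule order_tendstoD(2)) (use c e in simp)
  then show "\<forall>\<^sub>F n in sequentially. dist (prob {\<omega>\<in>space M. ennreal c < Y n \<omega>}) 0 < e"
  proof eventually_elim
    case (elim n)
    have "prob {\<omega>\<in>space M. ennreal c < Y n \<omega>} \<le> (c * e / 2) / c"
      by (rule markov_ennreal[OF m c]) (use elim c e in auto)
    also have "\<dots> < e" using c e by simp
    finally show ?case by simp
  qed
qed

lemma inv_sqrt_tendsto: "(\<lambda>n. 1 / sqrt (real n)) \<longlonglongrightarrow> 0"
  by (rule real_tendsto_divide_at_top[OF tendsto_const filterlim_compose[OF sqrt_at_top filterlim_real_sequentially]])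

context bootstrap_model
begin

abbreviation DD :: "real^'p \<Rightarrow> real" where "DD \<equiv> Dpop P X Z A"

definition weighted_proc :: "nat \<Rightarrow> nat \<Rightarrow> real^'p \<Rightarrow> 'a \<Rightarrow> real" where
  "weighted_proc j n u \<omega> = (\<Sum>i<n. wt j n i \<omega> * ff i u \<omega>) / sqrt (real n)"

text \<open>The processes with the empirical quantiles replaced by the true conditional margins.\<close>
definition orth_proc :: "nat \<Rightarrow> nat \<Rightarrow> real^'p \<Rightarrow> 'a \<Rightarrow> real" where
  "orth_proc j n u \<omega> = (if j = 0 then DDn P X Z A n u \<omega> else weighted_proc j n u \<omega>)"

lemma DDn_T: "DDn P X Z A n u \<omega> = orth.T {..<n} u \<omega> / sqrt (real n)"
proof (cases "n = 0")
  case False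
  have "sqrt (real n) * (S / real n - d) = (S - real n * d) / sqrt (real n)" for S d
    using False by (simp add: field_simps real_sqrt_mult_self)
  then show ?thesis unfolding DDn_def Dn_def orth.T_def
    by (simp add: sum_subtractf ff_def phi_def)
qed (simp add: DDn_def orth.T_def)

text \<open>Centred weights sum to 0, so the indicators may be centred without changing the
  process.\<close>

lemma weighted_proc_centered: "weighted_proc j n u \<omega> = (\<Sum>i<n. wt j n i \<omega> * (ff i u \<omega> - DD u)) / sqrt (real n)"
proof -
  have "(\<Sum>i<n. wt j n i \<omega> * (ff i u \<omega> - DD u)) = (\<Sum>i<n. wt j n i \<omega> * ff i u \<omega>) - (\<Sum>i<n. wt j n i \<omega>) * DD u"
    by (simp add: right_diff_distrib sum_subtractf sum_distrib_right)
  then show ?thesis by (simp add: weighted_proc_def wt_sum)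
qed

lemma orth_proc_measurable[measurable]: "orth_proc j n u \<in> borel_measurable P"
  unfolding orth_proc_def[abs_def] DDn_T weighted_proc_def by measurable

text \<open>Row 0 is the constant \<open>1 / sqrt n\<close>, which gives \<open>DDn\<close> the same
  linear form as the bootstrap processes.\<close>

definition proc_weight :: "nat \<Rightarrow> nat \<Rightarrow> nat \<Rightarrow> (nat \<times> nat \<Rightarrow> real) \<Rightarrow> real" where
  "proc_weight j n i w = (if j = 0 then 1 / sqrt (real n) else (w (j, i) - (\<Sum>i<n. w (j, i)) / real n) / sqrt (real n))"

lemma proc_weight_WA: "j \<le> K \<Longrightarrow> i < n \<Longrightarrow> proc_weight j n i (WA n \<omega>) = (if j = 0 then 1 / sqrt (real n) else wt j n i \<omega> / sqrt (real n))"
  by (simp add: proc_weight_def WA_def wt_def Wbar_def)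

lemma proc_weight_measurable: "j \<le> K \<Longrightarrow> i < n \<Longrightarrow> proc_weight j n i \<in> borel_measurable (PiM ({1..K} \<times> {..<n}) (\<lambda>_. borel))"
proof (cases "j = 0")
  case False
  assume ji: "j \<le> K" "i < n"
  have [measurable]: "(\<lambda>w. w (j, i)) \<in> borel_measurable (PiM ({1..K} \<times> {..<n}) (\<lambda>_. borel))" if "i < n" for i
    by (rule measurable_component_singleton) (use ji that False in auto)
  show ?thesis unfolding proc_weight_def[abs_def] using False ji by simp
qed (simp add: proc_weight_def[abs_def])

abbreviation Qv :: "((real^'p) \<times> (real^'q)) measure" where "Qv \<equiv> distr P borel (V 0)"

lemma Vn_distr: "0 < n \<Longrightarrow> distr P (PiM {..<n} (\<lambda>_. borel)) (Vn n) = PiM {..<n} (\<lambda>_. Qv)"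
proof -
  assume n: "0 < n"
  have "indep_vars (\<lambda>_. borel) V {..<n}" by (rule indep_vars_subset[OF iid_indep]) simp
  then have "distr P (PiM {..<n} (\<lambda>_. borel)) (Vn n) = PiM {..<n} (\<lambda>i. distr P borel (V i))"
    by (subst (asm) indep_vars_iff_distr_eq_PiM') (use n in auto)
  also have "\<dots> = PiM {..<n} (\<lambda>_. Qv)" by (rule PiM_cong) (auto intro: iid_distr)
  finally show ?thesis .
qed

text \<open>With the weight array frozen, the sample has a product law and the characteristic
  function factorizes over observations.\<close>

lemma char_fubini:
  fixes g :: "nat \<Rightarrow> (real^'p) \<times> (real^'q) \<Rightarrow> real"
  assumes g[measurable]: "\<And>j. j \<le> K \<Longrightarrow> g j \<in> borel_measurable borel" and n: "0 < n"
  shows "expectation (\<lambda>\<omega>. cis (\<Sum>i<n. \<Sum>j\<le>K. proc_weight j n i (WA n \<omega>) * g j (V i \<omega>)))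
    = expectation (\<lambda>\<omega>. \<Prod>i<n. \<integral>x. cis (\<Sum>j\<le>K. proc_weight j n i (WA n \<omega>) * g j x) \<partial>Qv)"
proof -
  let ?F = "\<lambda>v w. \<Prod>i<n. cis (\<Sum>j\<le>K. proc_weight j n i w * g j (v i))"
  let ?MV = "PiM {..<n} (\<lambda>_. borel) :: (nat \<Rightarrow> (real^'p) \<times> (real^'q)) measure"
  let ?MW = "PiM ({1..K} \<times> {..<n}) (\<lambda>_. borel) :: (nat \<times> nat \<Rightarrow> real) measure"
  interpret Q: prob_space Qv by (rule prob_space_distr) measurable
  interpret PQ: product_prob_space "\<lambda>_::nat. Qv" ..
  have m: "(\<lambda>z. proc_weight j n i (snd z) * g j (fst z i)) \<in> borel_measurable (?MV \<Otimes>\<^sub>M ?MW)" if ji: "j \<le> K" "i < n" for j i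
  proof -
    have "(\<lambda>z. fst z i) \<in> measurable (?MV \<Otimes>\<^sub>M ?MW) borel"
      using measurable_compose[OF measurable_fst measurable_component_singleton[of i "{..<n}" "\<lambda>_. borel"]] ji by simp
    from measurable_compose[OF this g[OF ji(1)]] measurable_compose[OF measurable_snd proc_weight_measurable[OF ji]]
    show ?thesis by (intro borel_measurable_times) auto
  qed
  have cisprod: "cis (\<Sum>i<n. h i) = (\<Prod>i<n. cis (h i))" for h :: "nat \<Rightarrow> real"
    by (simp add: cis_conv_exp exp_sum sum_distrib_left)
  have Fm: "case_prod ?F \<in> borel_measurable (?MV \<Otimes>\<^sub>M ?MW)"
  proof -
    have "(\<lambda>z. \<Sum>i<n. \<Sum>j\<le>K. proc_weight j n i (snd z) * g j (fst z i)) \<in> borel_measurable (?MV \<Otimes>\<^sub>M ?MW)"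
      by (intro borel_measurable_sum m) auto
    from measurable_compose[OF this cis_borel_measurable] show ?thesis by (simp add: cisprod split_beta')
  qed
  have "expectation (\<lambda>\<omega>. cis (\<Sum>i<n. \<Sum>j\<le>K. proc_weight j n i (WA n \<omega>) * g j (V i \<omega>))) = expectation (\<lambda>\<omega>. ?F (Vn n \<omega>) (WA n \<omega>))"
    unfolding cisprod by (intro Bochner_Integration.integral_cong prod.cong refl) auto
  also have "\<dots> = expectation (\<lambda>\<omega>. \<integral>v. ?F v (WA n \<omega>) \<partial>distr P ?MV (Vn n))"
    by (rule integral_indep_pair[OF indep_Vn_WA Fm, where b=1]) (simp add: prod_norm[symmetric])
  also have "\<dots> = expectation (\<lambda>\<omega>. \<Prod>i<n. \<integral>x. cis (\<Sum>j\<le>K. proc_weight j n i (WA n \<omega>) * g j x) \<partial>Qv)"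
    unfolding Vn_distr[OF n]
  proof (intro Bochner_Integration.integral_cong refl PQ.product_integral_prod)
    fix \<omega> and i :: nat
    show "integrable Qv (\<lambda>x. cis (\<Sum>j\<le>K. proc_weight j n i (WA n \<omega>) * g j x))"
    proof (rule Q.integrable_const_bound[where B=1])
      have "(\<lambda>x. \<Sum>j\<le>K. proc_weight j n i (WA n \<omega>) * g j x) \<in> borel_measurable Qv" by (rule borel_measurable_sum) auto
      from measurable_compose[OF this cis_borel_measurable]
      show "(\<lambda>x. cis (\<Sum>j\<le>K. proc_weight j n i (WA n \<omega>) * g j x)) \<in> borel_measurable Qv" .
    qed simp
  qed simp
  finally show ?thesis .
qed

text \<open>Off this event the scaled weight rows satisfy the hypotheses of
  \<open>char_weighted_product\<close> once \<open>n\<close> is large: entries at most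
  \<open>e\<close>, and a Gram matrix within \<open>e\<close> of the identity.\<close>

definition bad_weights :: "real \<Rightarrow> nat \<Rightarrow> 'a set" where
  "bad_weights e n = (\<Union>j\<in>{1..K}. {\<omega>\<in>space P. ennreal e < ennreal (wmax j n \<omega> / sqrt (real n))}
     \<union> {\<omega>\<in>space P. \<bar>(\<Sum>i<n. (wt j n i \<omega>)\<^sup>2) / real n - 1\<bar> > e}
     \<union> (\<Union>l\<in>{1..K} - {j}. {\<omega>\<in>space P. \<bar>(\<Sum>i<n. wt j n i \<omega> * wt l n i \<omega>) / real n\<bar> > e}))"

lemma bad_weights_measurable[measurable]: "bad_weights e n \<in> sets P"
  unfolding bad_weights_def by (intro sets.finite_UN sets.Un) auto

lemma bad_weights_tendsto:
  assumes e: "0 < e" shows "(\<lambda>n. prob (bad_weights e n)) \<longlonglongrightarrow> 0"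
proof -
  let ?A = "\<lambda>j n. {\<omega>\<in>space P. ennreal e < ennreal (wmax j n \<omega> / sqrt (real n))}"
  let ?B = "\<lambda>j n. {\<omega>\<in>space P. \<bar>(\<Sum>i<n. (wt j n i \<omega>)\<^sup>2) / real n - 1\<bar> > e}"
  let ?C = "\<lambda>j l n. {\<omega>\<in>space P. \<bar>(\<Sum>i<n. wt j n i \<omega> * wt l n i \<omega>) / real n\<bar> > e}"
  have le: "prob (bad_weights e n) \<le> (\<Sum>j\<in>{1..K}. prob (?A j n) + prob (?B j n) + (\<Sum>l\<in>{1..K} - {j}. prob (?C j l n)))" for n
  proof -
    have "prob (bad_weights e n) \<le> (\<Sum>j\<in>{1..K}. prob (?A j n \<union> ?B j n \<union> (\<Union>l\<in>{1..K} - {j}. ?C j l n)))"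
      unfolding bad_weights_def by (rule measure_UNION_le) auto
    also have "\<dots> \<le> (\<Sum>j\<in>{1..K}. prob (?A j n) + prob (?B j n) + (\<Sum>l\<in>{1..K} - {j}. prob (?C j l n)))"
    proof (rule sum_mono)
      fix j
      have "prob (?A j n \<union> ?B j n \<union> (\<Union>l\<in>{1..K} - {j}. ?C j l n)) \<le> prob (?A j n \<union> ?B j n) + prob (\<Union>l\<in>{1..K} - {j}. ?C j l n)"
        by (rule measure_Un_le) auto
      also have "prob (?A j n \<union> ?B j n) \<le> prob (?A j n) + prob (?B j n)" by (rule measure_Un_le) auto
      also have "prob (\<Union>l\<in>{1..K} - {j}. ?C j l n) \<le> (\<Sum>l\<in>{1..K} - {j}. prob (?C j l n))" by (rule measure_UNION_le) auto
      finally show "prob (?A j n \<union> ?B j n \<union> (\<Union>l\<in>{1..K} - {j}. ?C j l n)) \<le> prob (?A j n) + prob (?B j n) + (\<Sum>l\<in>{1..K} - {j}. prob (?C j l n))" by simp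
    qed
    finally show ?thesis .
  qed
  have "(\<lambda>n. \<Sum>j\<in>{1..K}. prob (?A j n) + prob (?B j n) + (\<Sum>l\<in>{1..K} - {j}. prob (?C j l n))) \<longlonglongrightarrow> (\<Sum>j\<in>{1..K}. 0 + 0 + (\<Sum>l\<in>{1..K} - {j}. 0))"
  proof (rule tendsto_sum)
    fix j assume j: "j \<in> {1..K}"
    have a: "(\<lambda>n. prob (?A j n)) \<longlonglongrightarrow> 0"
      by (rule markov_tendsto[where Y="\<lambda>n \<omega>. ennreal (wmax j n \<omega> / sqrt (real n))", OF _ e wmax_tendsto[OF j]]) measurable
    have b: "(\<lambda>n. prob (?B j n)) \<longlonglongrightarrow> 0" by (rule wt_square_tendsto[OF j e])
    have c: "(\<lambda>n. \<Sum>l\<in>{1..K} - {j}. prob (?C j l n)) \<longlonglongrightarrow> (\<Sum>l\<in>{1..K} - {j}. 0)"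
    proof (rule tendsto_sum)
      fix l assume "l \<in> {1..K} - {j}"
      then show "(\<lambda>n. prob (?C j l n)) \<longlonglongrightarrow> 0" using j e by (intro cross_tendsto) auto
    qed
    show "(\<lambda>n. prob (?A j n) + prob (?B j n) + (\<Sum>l\<in>{1..K} - {j}. prob (?C j l n))) \<longlonglongrightarrow> 0 + 0 + (\<Sum>l\<in>{1..K} - {j}. 0)"
      by (rule tendsto_add[OF tendsto_add[OF a b] c])
  qed
  then have lim: "(\<lambda>n. \<Sum>j\<in>{1..K}. prob (?A j n) + prob (?B j n) + (\<Sum>l\<in>{1..K} - {j}. prob (?C j l n))) \<longlonglongrightarrow> 0" by simp
  show ?thesis
    by (rule tendsto_sandwich[OF _ always_eventually[OF allI[OF le]] tendsto_const lim]) simp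
qed

lemma fidi_char:
  fixes c :: "nat \<Rightarrow> real^'p \<Rightarrow> real"
  assumes F: "finite F"
  shows "(\<lambda>n. expectation (\<lambda>\<omega>. cis (\<Sum>j\<le>K. \<Sum>u\<in>F. c j u * orth_proc j n u \<omega>)))
    \<longlonglongrightarrow> complex_of_real (exp (- (\<Sum>j\<le>K. \<Sum>u\<in>F. \<Sum>v\<in>F. c j u * c j v * orth.Kc u v) / 2))"
proof -
  define g where "g j x = (\<Sum>u\<in>F. c j u * (phi u x - DD u))" for j x
  define v where "v = (\<Sum>j\<le>K. \<Sum>u\<in>F. \<Sum>v\<in>F. c j u * c j v * orth.Kc u v)"
  interpret Q: prob_space Qv by (rule prob_space_distr) measurable
  have gm[measurable]: "g j \<in> borel_measurable borel" for j unfolding g_def by measurable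
  have gV: "g j (V i \<omega>) = (\<Sum>u\<in>F. c j u * (ff i u \<omega> - DD u))" for j i \<omega> by (simp add: g_def ff_def)
  define B where "B = 1 + (\<Sum>j\<le>K. \<Sum>u\<in>F. \<bar>c j u\<bar>)"
  have B1: "1 \<le> B" unfolding B_def by (simp add: sum_nonneg)
  have gb: "\<bar>g j x\<bar> \<le> B" if "j \<le> K" for j x
  proof -
    have "\<bar>g j x\<bar> \<le> (\<Sum>u\<in>F. \<bar>c j u * (phi u x - DD u)\<bar>)" unfolding g_def by (rule sum_abs)
    also have "\<dots> \<le> (\<Sum>u\<in>F. \<bar>c j u\<bar> * 1)"
    proof (intro sum_mono, unfold abs_mult, intro mult_left_mono)
      fix u show "\<bar>phi u x - DD u\<bar> \<le> 1" using orth.D_bound[of u] by (auto simp: phi_def)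
    qed auto
    also have "\<dots> \<le> (\<Sum>j\<le>K. \<Sum>u\<in>F. \<bar>c j u\<bar>)"
      using member_le_sum[of j "{..K}" "\<lambda>j. \<Sum>u\<in>F. \<bar>c j u\<bar>"] that by (auto intro: sum_nonneg)
    finally show ?thesis by (simp add: B_def)
  qed
  have gE: "Q.expectation (g j) = 0" for j
  proof -
    have "Q.expectation (g j) = expectation (\<lambda>\<omega>. \<Sum>u\<in>F. c j u * (ff 0 u \<omega> - DD u))"
      by (subst integral_distr) (auto simp: gV)
    also have "\<dots> = 0" using orth.f_integrable orth.f_exp[of 0] by (simp add: Bochner_Integration.integral_sum prob_space)
    finally show ?thesis .
  qed
  have gv: "(\<Sum>j\<le>K. Q.expectation (\<lambda>x. (g j x)\<^sup>2)) = v"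
  proof -
    have "Q.expectation (\<lambda>x. (g j x)\<^sup>2) = (\<Sum>u\<in>F. \<Sum>v\<in>F. c j u * c j v * orth.Kc u v)" for j
    proof -
      have i: "integrable P (\<lambda>\<omega>. c j u * c j v * ((ff 0 u \<omega> - DD u) * (ff 0 v \<omega> - DD v)))" for u v
      proof (intro integrable_mult_right integrable_const_bound[where B=1] AE_I2)
        fix \<omega>
        have "\<bar>ff 0 u \<omega> - DD u\<bar> * \<bar>ff 0 v \<omega> - DD v\<bar> \<le> 1 * 1"
          using orth.f_bound[of 0 u \<omega>] orth.D_bound[of u] orth.f_bound[of 0 v \<omega>] orth.D_bound[of v]
          by (intro mult_mono) auto
        then show "norm ((ff 0 u \<omega> - DD u) * (ff 0 v \<omega> - DD v)) \<le> 1" by (simp add: abs_mult)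
      qed measurable
      have "Q.expectation (\<lambda>x. (g j x)\<^sup>2) = expectation (\<lambda>\<omega>. (\<Sum>u\<in>F. c j u * (ff 0 u \<omega> - DD u))\<^sup>2)"
        by (subst integral_distr) (auto simp: gV)
      also have "\<dots> = expectation (\<lambda>\<omega>. \<Sum>u\<in>F. \<Sum>v\<in>F. c j u * c j v * ((ff 0 u \<omega> - DD u) * (ff 0 v \<omega> - DD v)))"
        by (simp add: power2_eq_square sum_product mult_ac)
      also have "\<dots> = (\<Sum>u\<in>F. \<Sum>v\<in>F. expectation (\<lambda>\<omega>. c j u * c j v * ((ff 0 u \<omega> - DD u) * (ff 0 v \<omega> - DD v))))"
        by (subst Bochner_Integration.integral_sum, intro Bochner_Integration.integrable_sum i,
            subst Bochner_Integration.integral_sum, rule i) simp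
      finally show ?thesis by (simp add: orth.cov_eq)
    qed
    then show ?thesis by (simp add: v_def)
  qed
  have lin: "(\<Sum>j\<le>K. \<Sum>u\<in>F. c j u * orth_proc j n u \<omega>) = (\<Sum>i<n. \<Sum>j\<le>K. proc_weight j n i (WA n \<omega>) * g j (V i \<omega>))" for n \<omega>
  proof -
    have orth_proc_sum: "orth_proc j n u \<omega> = (\<Sum>i<n. proc_weight j n i (WA n \<omega>) * (ff i u \<omega> - DD u))" if "j \<le> K" for j u
    proof -
      have "(\<Sum>i<n. proc_weight j n i (WA n \<omega>) * (ff i u \<omega> - DD u)) = (\<Sum>i<n. (if j = 0 then 1 else wt j n i \<omega>) * (ff i u \<omega> - DD u) / sqrt (real n))"
        using that by (intro sum.cong refl) (auto simp: proc_weight_WA)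
      also have "\<dots> = orth_proc j n u \<omega>"
        by (simp add: orth_proc_def DDn_T weighted_proc_centered orth.T_def sum_divide_distrib)
      finally show ?thesis by simp
    qed
    have "(\<Sum>j\<le>K. \<Sum>u\<in>F. c j u * orth_proc j n u \<omega>) = (\<Sum>j\<le>K. \<Sum>u\<in>F. \<Sum>i<n. proc_weight j n i (WA n \<omega>) * (c j u * (ff i u \<omega> - DD u)))"
      by (intro sum.cong refl) (simp add: orth_proc_sum sum_distrib_left mult_ac)
    also have "\<dots> = (\<Sum>j\<le>K. \<Sum>i<n. \<Sum>u\<in>F. proc_weight j n i (WA n \<omega>) * (c j u * (ff i u \<omega> - DD u)))" by (intro sum.cong refl sum.swap)
    also have "\<dots> = (\<Sum>i<n. \<Sum>j\<le>K. \<Sum>u\<in>F. proc_weight j n i (WA n \<omega>) * (c j u * (ff i u \<omega> - DD u)))" by (rule sum.swap)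
    finally show ?thesis by (simp add: gV sum_distrib_left)
  qed
  let ?C = "real (Suc K) * B"
  have C1: "1 \<le> ?C" using B1 mult_mono[of 1 "real (Suc K)" 1 B] by simp
  define \<Phi> where "\<Phi> n \<omega> = (\<Prod>i<n. \<integral>x. cis (\<Sum>j\<le>K. proc_weight j n i (WA n \<omega>) * g j x) \<partial>Qv)" for n \<omega>
  define z where "z = complex_of_real (exp (- v / 2))"
  have v0: "0 \<le> v" unfolding gv[symmetric] by (intro sum_nonneg Bochner_Integration.integral_nonneg) auto
  have z1: "cmod z \<le> 1" unfolding z_def using v0 by simp
  have \<Phi>1: "cmod (\<Phi> n \<omega>) \<le> 1" for n \<omega>
  proof -
    have "cmod (\<integral>x. cis (h x) \<partial>Qv) \<le> 1" for h
      using integral_norm_bound[of Qv "\<lambda>x. cis (h x)"] Q.prob_space by simp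
    then show ?thesis unfolding \<Phi>_def prod_norm[symmetric] by (intro prod_le_1) auto
  qed
  have \<Phi>m: "\<Phi> n \<in> borel_measurable P" for n
  proof -
    have WAm: "WA n \<in> measurable P (PiM ({1..K} \<times> {..<n}) (\<lambda>_. borel))" using indep_Vn_WA[of n] unfolding indep2_def by auto
    have "(\<lambda>\<omega>. \<integral>x. cis (\<Sum>j\<le>K. proc_weight j n i (WA n \<omega>) * g j x) \<partial>Qv) \<in> borel_measurable P" if i: "i < n" for i
    proof (rule Q.borel_measurable_lebesgue_integral)
      have "(\<lambda>p. \<Sum>j\<le>K. proc_weight j n i (WA n (fst p)) * g j (snd p)) \<in> borel_measurable (P \<Otimes>\<^sub>M Qv)"
      proof (intro borel_measurable_sum borel_measurable_times)
        fix j assume "j \<in> {..K}"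
        then show "(\<lambda>p. proc_weight j n i (WA n (fst p))) \<in> borel_measurable (P \<Otimes>\<^sub>M Qv)"
          using measurable_compose[OF measurable_compose[OF measurable_fst WAm] proc_weight_measurable[of j i n]] i by simp
      qed measurable
      from measurable_compose[OF this cis_borel_measurable]
      show "(\<lambda>(\<omega>, x). cis (\<Sum>j\<le>K. proc_weight j n i (WA n \<omega>) * g j x)) \<in> borel_measurable (P \<Otimes>\<^sub>M Qv)" by (simp add: split_beta')
    qed
    then show ?thesis unfolding \<Phi>_def[abs_def] by (intro borel_measurable_prod) auto
  qed
  show ?thesis
  proof (rule LIM_zero_cancel, rule tendsto_norm_zero_cancel, rule tendstoI)
    fix \<epsilon> :: real assume \<epsilon>: "0 < \<epsilon>"
    \<comment> \<open>The first bound gives \<open>C * e \<le> 1\<close>, the second makes the error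
      \<open>5 * C ^ 3 * e\<close> of the product lemma at most
      \<open>\<epsilon> / 4\<close>.\<close>
    define e where "e = min (1 / ?C) (\<epsilon> / (20 * ?C ^ 3))"
    have e: "0 < e" using \<epsilon> C1 by (auto simp: e_def)
    have eC: "?C * e \<le> 1"
    proof -
      have "?C * e \<le> ?C * (1 / ?C)" using C1 by (intro mult_left_mono) (auto simp: e_def)
      then show ?thesis using C1 B1 by auto
    qed
    have e\<epsilon>: "5 * ?C ^ 3 * e \<le> \<epsilon> / 4"
    proof -
      have "5 * ?C ^ 3 * e \<le> 5 * ?C ^ 3 * (\<epsilon> / (20 * ?C ^ 3))" using C1 by (intro mult_left_mono) (auto simp: e_def)
      also have "\<dots> = \<epsilon> / 4" using C1 by (simp add: field_simps)
      finally show ?thesis .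
    qed
    \<comment> \<open>On the bad event two numbers of modulus at most 1 are compared, so
      \<open>\<epsilon> / 8\<close> there costs at most another
      \<open>\<epsilon> / 4\<close>.\<close>
    have ev1: "\<forall>\<^sub>F n in sequentially. prob (bad_weights e n) < \<epsilon> / 8" using bad_weights_tendsto[OF e] \<epsilon> by (intro order_tendstoD(2)) auto
    have ev2: "\<forall>\<^sub>F n in sequentially. 1 / sqrt (real n) < e" using inv_sqrt_tendsto e by (rule order_tendstoD(2))
    show "\<forall>\<^sub>F n in sequentially. dist (cmod (expectation (\<lambda>\<omega>. cis (\<Sum>j\<le>K. \<Sum>u\<in>F. c j u * orth_proc j n u \<omega>)) -
        complex_of_real (exp (- (\<Sum>j\<le>K. \<Sum>u\<in>F. \<Sum>v\<in>F. c j u * c j v * orth.Kc u v) / 2)))) 0 < \<epsilon>"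
      using ev1 ev2 eventually_gt_at_top[of 0]
    proof eventually_elim
      case (elim n)
      then have n: "0 < n" by simp
      have off: "cmod (\<Phi> n \<omega> - z) \<le> \<epsilon> / 4" if w: "\<omega> \<in> space P" "\<omega> \<notin> bad_weights e n" for \<omega>
      proof -
        have sn: "sqrt (real n) * sqrt (real n) = real n" by simp
        have wm: "wmax j n \<omega> / sqrt (real n) \<le> e" if "j \<in> {1..K}" for j
          using w that e unfolding bad_weights_def by (auto simp: not_less ennreal_le_iff ennreal_less_iff)
        have sq: "\<bar>(\<Sum>i<n. (wt j n i \<omega>)\<^sup>2) / real n - 1\<bar> \<le> e" if "j \<in> {1..K}" for j
          using w that unfolding bad_weights_def by (auto simp: not_less)
        have cr: "\<bar>(\<Sum>i<n. wt j n i \<omega> * wt l n i \<omega>) / real n\<bar> \<le> e" if "j \<in> {1..K}" "l \<in> {1..K}" "j \<noteq> l" for j l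
          using w that unfolding bad_weights_def by (auto simp: not_less)
        have "cmod ((\<Prod>i<n. Q.expectation (\<lambda>x. cis (\<Sum>j\<le>K. proc_weight j n i (WA n \<omega>) * g j x))) - complex_of_real (exp (- (\<Sum>j\<le>K. Q.expectation (\<lambda>x. (g j x)\<^sup>2)) / 2)))
          \<le> 5 * ?C ^ 3 * e"
        proof (rule Q.char_weighted_product[OF _ gb B1 gE _ eC])
          show "\<bar>proc_weight j n i (WA n \<omega>)\<bar> \<le> e" if "j \<le> K" "i < n" for j i
          proof (cases "j = 0")
            case False
            then have "\<bar>wt j n i \<omega>\<bar> / sqrt (real n) \<le> wmax j n \<omega> / sqrt (real n)" using wmax_ge[OF that(2)] by (intro divide_right_mono) auto
            then show ?thesis using wm[of j] False that by (simp add: proc_weight_WA abs_divide)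
          qed (use that elim in \<open>simp add: proc_weight_WA\<close>)
          fix j l assume jl: "j \<le> K" "l \<le> K"
          have sm: "(\<Sum>i<n. proc_weight j n i (WA n \<omega>) * proc_weight l n i (WA n \<omega>)) = (\<Sum>i<n. (if j = 0 then 1 else wt j n i \<omega>) * (if l = 0 then 1 else wt l n i \<omega>)) / real n"
            unfolding sum_divide_distrib using jl n by (intro sum.cong refl) (simp add: proc_weight_WA)
          \<comment> \<open>Row 0 has norm exactly 1, and its product with any other row vanishes
            because centred weights sum to 0. The remaining entries are controlled by the definition
            of the bad event.\<close>
          show "\<bar>(\<Sum>i<n. proc_weight j n i (WA n \<omega>) * proc_weight l n i (WA n \<omega>)) - (if j = l then 1 else 0)\<bar> \<le> e"
            unfolding sm using jl n e sq[of j] cr[of j l] wt_sum[where n=n and \<omega>=\<omega>]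
            by (cases "j = 0"; cases "l = 0"; cases "j = l") (auto simp: power2_eq_square)
        qed (use e in auto)
        then show ?thesis using e\<epsilon> unfolding \<Phi>_def z_def gv by simp
      qed
      have i\<Phi>: "integrable P (\<Phi> n)" by (rule integrable_const_bound[where B=1]) (use \<Phi>1 \<Phi>m in auto)
      have "expectation (\<lambda>\<omega>. cis (\<Sum>j\<le>K. \<Sum>u\<in>F. c j u * orth_proc j n u \<omega>)) = expectation (\<Phi> n)"
        unfolding lin \<Phi>_def by (rule char_fubini[OF gm n])
      then have "cmod (expectation (\<lambda>\<omega>. cis (\<Sum>j\<le>K. \<Sum>u\<in>F. c j u * orth_proc j n u \<omega>)) - z) = cmod (expectation (\<lambda>\<omega>. \<Phi> n \<omega> - z))"
        using i\<Phi> by (simp add: prob_space)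
      also have "\<dots> \<le> expectation (\<lambda>\<omega>. cmod (\<Phi> n \<omega> - z))" by (rule integral_norm_bound)
      also have "\<dots> \<le> expectation (\<lambda>\<omega>. \<epsilon> / 4 + 2 * indicator (bad_weights e n) \<omega>)"
      proof (rule integral_mono)
        show "integrable P (\<lambda>\<omega>. cmod (\<Phi> n \<omega> - z))" using i\<Phi> by auto
        show "integrable P (\<lambda>\<omega>. \<epsilon> / 4 + 2 * indicator (bad_weights e n) \<omega>)" by (auto simp: emeasure_eq_measure)
        show "cmod (\<Phi> n \<omega> - z) \<le> \<epsilon> / 4 + 2 * indicator (bad_weights e n) \<omega>" if "\<omega> \<in> space P" for \<omega>
        proof (cases "\<omega> \<in> bad_weights e n")
          case True
          have "cmod (\<Phi> n \<omega> - z) \<le> cmod (\<Phi> n \<omega>) + cmod z" by (rule norm_triangle_ineq4)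
          then show ?thesis using True z1 \<Phi>1[of n \<omega>] \<epsilon> by simp
        qed (use off that in auto)
      qed
      also have "\<dots> = \<epsilon> / 4 + 2 * prob (bad_weights e n)" by (simp add: prob_space emeasure_eq_measure)
      also have "\<dots> < \<epsilon>" using elim \<epsilon> by simp
      finally show ?case unfolding z_def v_def by simp
    qed
  qed
qed

end

section \<open>Majorants of increments, asymptotic equicontinuity and replacement of
  quantiles\<close>

lemma ennreal_double: "x * ((a + c * w) + (a + c * w)) = 2 * (x * a) + 2 * (c * (x * w))" for a c w x :: ennreal
proof -
  have "x * ((a + c * w) + (a + c * w)) = (x * a + x * a) + (c * (x * w) + c * (x * w))"
    by (simp add: distrib_left ac_simps)
  then show ?thesis by (simp only: mult_2)
qed

context bootstrap_model
begin

definition xpos :: "nat \<Rightarrow> nat \<Rightarrow> nat \<Rightarrow> 'a \<Rightarrow> real" where "xpos j n i \<omega> = max 0 (wt j n i \<omega>)"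
definition xneg :: "nat \<Rightarrow> nat \<Rightarrow> nat \<Rightarrow> 'a \<Rightarrow> real" where "xneg j n i \<omega> = max 0 (- wt j n i \<omega>)"

lemma xpos_measurable[measurable]: "xpos j n i \<in> borel_measurable P" unfolding xpos_def[abs_def] by measurable
lemma xneg_measurable[measurable]: "xneg j n i \<in> borel_measurable P" unfolding xneg_def[abs_def] by measurable

text \<open>A measurable majorant of all increments over distances up to \<open>1 / 2 ^ m\<close>,
  standing in for a supremum over uncountably many pairs of points. It takes values in
  \<open>ennreal\<close> because \<open>mult_maj\<close> is an integral over all
  \<open>t\<close>.\<close>

definition maj :: "nat \<Rightarrow> nat \<Rightarrow> nat \<Rightarrow> 'a \<Rightarrow> ennreal" where
  "maj j n m \<omega> = (if j = 0 then ennreal (1 / sqrt (real n)) * ennreal (orth.Psi {..<n} m \<omega>)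
     else ennreal (1 / sqrt (real n)) * (orth.mult_maj n (xpos j n) m \<omega> + orth.mult_maj n (xneg j n) m \<omega>))"

lemma maj_measurable[measurable]: "maj j n m \<in> borel_measurable P"
proof -
  have [measurable]: "orth.mult_maj n (xpos j n) m \<in> borel_measurable P" "orth.mult_maj n (xneg j n) m \<in> borel_measurable P"
    by (rule orth.mult_maj_measurable, measurable)+
  show ?thesis unfolding maj_def[abs_def] by measurable
qed

lemma maj_modulus:
  assumes u: "u \<in> cube" "v \<in> cube" and near: "\<And>k. \<bar>u $ k - v $ k\<bar> \<le> 1 / 2 ^ m"
  shows "ennreal \<bar>orth_proc j n u \<omega> - orth_proc j n v \<omega>\<bar> \<le> maj j n m \<omega>"
proof (cases "j = 0")
  case True
  have "\<bar>orth_proc j n u \<omega> - orth_proc j n v \<omega>\<bar> = 1 / sqrt (real n) * \<bar>orth.T {..<n} u \<omega> - orth.T {..<n} v \<omega>\<bar>"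
    using True by (simp add: orth_proc_def DDn_T diff_divide_distrib[symmetric] abs_divide)
  also have "\<dots> \<le> 1 / sqrt (real n) * orth.Psi {..<n} m \<omega>"
    by (intro mult_left_mono orth.T_modulus_le_Psi u near) auto
  finally have "ennreal \<bar>orth_proc j n u \<omega> - orth_proc j n v \<omega>\<bar> \<le> ennreal (1 / sqrt (real n) * orth.Psi {..<n} m \<omega>)" by (rule ennreal_leI)
  then show ?thesis using True orth.Psi_nonneg by (simp only: maj_def ennreal_mult' refl if_True) (subst (asm) ennreal_mult', auto)
next
  case False
  let ?d = "\<lambda>i. (ff i u \<omega> - DD u) - (ff i v \<omega> - DD v)"
  have "\<bar>orth_proc j n u \<omega> - orth_proc j n v \<omega>\<bar> = 1 / sqrt (real n) * \<bar>\<Sum>i<n. wt j n i \<omega> * ?d i\<bar>"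
    using False by (simp add: orth_proc_def weighted_proc_centered diff_divide_distrib[symmetric] abs_divide sum_subtractf right_diff_distrib)
  also have "(\<Sum>i<n. wt j n i \<omega> * ?d i) = (\<Sum>i<n. xpos j n i \<omega> * ?d i) - (\<Sum>i<n. xneg j n i \<omega> * ?d i)"
    unfolding sum_subtractf[symmetric] left_diff_distrib[symmetric] by (intro sum.cong refl) (simp add: xpos_def xneg_def max_def)
  also have "1 / sqrt (real n) * \<bar>\<dots>\<bar> \<le> 1 / sqrt (real n) * (\<bar>\<Sum>i<n. xpos j n i \<omega> * ?d i\<bar> + \<bar>\<Sum>i<n. xneg j n i \<omega> * ?d i\<bar>)"
    by (intro mult_left_mono abs_triangle_ineq4) auto
  finally have "ennreal \<bar>orth_proc j n u \<omega> - orth_proc j n v \<omega>\<bar> \<le> ennreal (1 / sqrt (real n) * (\<bar>\<Sum>i<n. xpos j n i \<omega> * ?d i\<bar> + \<bar>\<Sum>i<n. xneg j n i \<omega> * ?d i\<bar>))"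
    by (rule ennreal_leI)
  also have "\<dots> = ennreal (1 / sqrt (real n)) * (ennreal \<bar>\<Sum>i<n. xpos j n i \<omega> * ?d i\<bar> + ennreal \<bar>\<Sum>i<n. xneg j n i \<omega> * ?d i\<bar>)"
    by (subst ennreal_mult') (auto simp: ennreal_plus)
  also have "\<dots> \<le> ennreal (1 / sqrt (real n)) * (orth.mult_maj n (xpos j n) m \<omega> + orth.mult_maj n (xneg j n) m \<omega>)"
    by (intro mult_left_mono add_mono orth.mult_maj_ge u near) (auto simp: xpos_def xneg_def)
  finally show ?thesis using False by (simp add: maj_def)
qed

text \<open>\<open>orth.T\<close> and \<open>orth.Psi\<close> as functionals of the sample alone, on which its independence of the weights
  can act.\<close>
definition TS :: "nat set \<Rightarrow> real^'p \<Rightarrow> (nat \<Rightarrow> (real^'p) \<times> (real^'q)) \<Rightarrow> real" where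
  "TS I u x = (\<Sum>i\<in>I. phi u (x i) - DD u)"

definition PsiS :: "nat set \<Rightarrow> nat \<Rightarrow> (nat \<Rightarrow> (real^'p) \<times> (real^'q)) \<Rightarrow> real" where
  "PsiS I m x = (if card I < 2 ^ m then 2 * 2 ^ m
     else 4 * (\<Sum>l\<in>{m..floor_log (card I)}. Max ((\<lambda>e. \<bar>TS I (snd e) x - TS I (fst e) x\<bar>) ` dpairs l)) + 4 * real CARD('p))"

lemma Psi_Vs: "orth.Psi I m \<omega> = PsiS I m (Vs \<omega>)"
  by (simp add: orth.Psi_def PsiS_def orth.level_max_def orth.T_def TS_def ff_def)

lemma PsiS_measurable: "PsiS I m \<in> borel_measurable (PiM UNIV (\<lambda>_. borel))"
proof -
  have "(\<lambda>x. phi u (x i)) \<in> borel_measurable (PiM UNIV (\<lambda>_. borel))" for u i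
    by (rule measurable_compose[OF measurable_component_singleton[of i UNIV "\<lambda>_. borel"] phi_measurable]) simp
  then have [measurable]: "TS I u \<in> borel_measurable (PiM UNIV (\<lambda>_. borel))" for u
    unfolding TS_def[abs_def] by (intro borel_measurable_sum borel_measurable_diff) auto
  have [measurable]: "(\<lambda>x. Max ((\<lambda>e. \<bar>TS I (snd e) x - TS I (fst e) x\<bar>) ` dpairs l)) \<in> borel_measurable (PiM UNIV (\<lambda>_. borel))" for l
    by (intro borel_measurable_Max dpairs_finite) measurable
  show ?thesis unfolding PsiS_def[abs_def] by measurable
qed

text \<open>For a fixed set \<open>J\<close> the level set event is determined by the weight vector
  and \<open>Psi J\<close> by the sample, so the two factors decouple.\<close>

lemma level_set_Psi_indep:
  assumes j: "j \<in> {1..K}" and J: "J \<subseteq> {..<n}"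
    and \<xi>: "\<And>i \<omega>. i < n \<Longrightarrow> \<xi> i \<omega> = G (cw n i (WV j n \<omega>))" and G[measurable]: "G \<in> borel_measurable borel"
  shows "(\<integral>\<^sup>+\<omega>. ennreal (orth.Psi J m \<omega>) * indicator {\<omega>. orth.level_set n \<xi> t \<omega> = J} \<omega> \<partial>P)
      = emeasure P {\<omega>\<in>space P. orth.level_set n \<xi> t \<omega> = J} * (\<integral>\<^sup>+\<omega>. ennreal (orth.Psi J m \<omega>) \<partial>P)"
proof -
  define E where "E x \<longleftrightarrow> (\<forall>i<n. (t < G (cw n i x)) = (i \<in> J))" for x
  have Em[measurable]: "Measurable.pred (PiM {..<n} (\<lambda>_. borel)) E" unfolding E_def[abs_def] by measurable
  have lvlE: "orth.level_set n \<xi> t \<omega> = J \<longleftrightarrow> E (WV j n \<omega>)" for \<omega>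
  proof -
    have "orth.level_set n \<xi> t \<omega> = {i. i < n \<and> t < G (cw n i (WV j n \<omega>))}"
      unfolding orth.level_set_def by (intro Collect_cong conj_cong refl) (simp only: \<xi>)
    moreover have "{i. i < n \<and> t < G (cw n i (WV j n \<omega>))} = J \<longleftrightarrow> E (WV j n \<omega>)"
      unfolding E_def set_eq_iff mem_Collect_eq using J by blast
    ultimately show ?thesis by (simp only:)
  qed
  let ?g = "\<lambda>x. (if E x then 1 else 0) :: ennreal"
  have gm: "?g \<in> borel_measurable (PiM {..<n} (\<lambda>_. borel))" by measurable
  have "(\<integral>\<^sup>+\<omega>. ennreal (orth.Psi J m \<omega>) * indicator {\<omega>. orth.level_set n \<xi> t \<omega> = J} \<omega> \<partial>P) = (\<integral>\<^sup>+\<omega>. ennreal (PsiS J m (Vs \<omega>)) * ?g (WV j n \<omega>) \<partial>P)"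
    by (intro nn_integral_cong) (simp add: Psi_Vs lvlE indicator_def)
  also have "\<dots> = (\<integral>\<^sup>+\<omega>. ennreal (PsiS J m (Vs \<omega>)) \<partial>P) * (\<integral>\<^sup>+\<omega>. ?g (WV j n \<omega>) \<partial>P)"
    by (rule nn_integral_indep_mult[OF indep_Vs_WV[OF j]]) (use PsiS_measurable gm in auto)
  also have "(\<integral>\<^sup>+\<omega>. ?g (WV j n \<omega>) \<partial>P) = (\<integral>\<^sup>+\<omega>. indicator {\<omega>\<in>space P. orth.level_set n \<xi> t \<omega> = J} \<omega> \<partial>P)"
    by (intro nn_integral_cong) (auto simp: lvlE indicator_def)
  also have "\<dots> = emeasure P {\<omega>\<in>space P. orth.level_set n \<xi> t \<omega> = J}"
    unfolding lvlE by (rule nn_integral_indicator) measurable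
  finally show ?thesis by (simp add: Psi_Vs mult.commute)
qed

lemma tailq_measurable: "tailq n \<in> borel_measurable borel"
proof -
  have "mono (\<lambda>t. - tailq n t)" unfolding tailq_def by (intro monoI, simp) (intro finite_measure_mono, auto)
  from borel_measurable_uminus[OF borel_measurable_mono[OF this]] show ?thesis by simp
qed

lemma mult_maj_bound:
  assumes j: "j \<in> {1..K}" and \<xi>: "\<And>i \<omega>. i < n \<Longrightarrow> \<xi> i \<omega> = G (cw n i (WV j n \<omega>))" and G: "G \<in> borel_measurable borel"
    and le: "\<And>x. G x \<le> \<bar>x\<bar>" and m[measurable]: "\<And>i. i < n \<Longrightarrow> \<xi> i \<in> borel_measurable P"
  shows "(\<integral>\<^sup>+\<omega>. orth.mult_maj n \<xi> m \<omega> \<partial>P) \<le>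
    ennreal (entropy_tail TYPE('p) m * sqrt (real n)) * (\<integral>\<^sup>+t. indicator {0..} t * ennreal (sqrt (tailq n t)) \<partial>lborel)
    + ennreal (4 * real CARD('p) + 2 * 2 ^ m) * (\<integral>\<^sup>+\<omega>. ennreal (wmax j n \<omega>) \<partial>P)"
proof (rule orth.mult_maj_expectation[where X="\<lambda>i \<omega>. \<bar>wt j n i \<omega>\<bar>"])
  show "\<xi> i \<omega> \<le> \<bar>wt j n i \<omega>\<bar>" if "i < n" for i \<omega> unfolding \<xi>[OF that] wt_cw[OF that] by (rule le)
  show "prob {\<omega>\<in>space P. t < \<bar>wt j n i \<omega>\<bar>} \<le> tailq n t" if "i < n" for i t using wt_tail[OF j that] by simp
  show "0 \<le> tailq n t" for t by (simp add: tailq_def)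
qed (auto intro: m level_set_Psi_indep[OF j _ \<xi> G] tailq_measurable wmax_ge)

text \<open>The bound splits into a part uniform in \<open>n\<close> that is small for large
  \<open>m\<close>, and a remainder that vanishes in \<open>n\<close> for fixed \<open>m\<close>: of
  order \<open>1 / sqrt n\<close> for \<open>DDn\<close>, and governed by the maximum condition on
  the weights otherwise.\<close>

lemma maj_limit: "\<exists>C\<ge>0. \<forall>m. \<forall>j\<le>K. \<exists>r. r \<longlonglongrightarrow> (0 :: ennreal) \<and> (\<forall>n\<ge>1. (\<integral>\<^sup>+\<omega>. maj j n m \<omega> \<partial>P) \<le> ennreal (C * entropy_tail TYPE('p) m) + r n)"
proof -
  obtain C0 where C0: "\<And>n. 1 \<le> n \<Longrightarrow> (\<integral>\<^sup>+t. indicator {0..} t * ennreal (sqrt (tailq n t)) \<partial>lborel) \<le> ennreal C0"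
    using condW unfolding cond_W_def tailq_def by blast
  \<comment> \<open>The summand 1 serves \<open>DDn\<close>; the factor 2 accounts for the positive
    and negative parts of the weights. The \<open>max\<close> with 0 is there because the bounding
    constant in the weight condition carries no sign.\<close>
  define C where "C = 1 + 2 * max 0 C0"
  have "\<exists>r. r \<longlonglongrightarrow> (0 :: ennreal) \<and> (\<forall>n\<ge>1. (\<integral>\<^sup>+\<omega>. maj j n m \<omega> \<partial>P) \<le> ennreal (C * entropy_tail TYPE('p) m) + r n)" if j: "j \<le> K" for j m
  proof -
    let ?c = "4 * real CARD('p) + 2 * 2 ^ m :: real" and ?t = "entropy_tail TYPE('p) m"
    have t0: "0 \<le> ?t" by (rule entropy_tail_nonneg)
    show ?thesis
    proof (cases "j = 0")
      case True
      have "(\<integral>\<^sup>+\<omega>. maj j n m \<omega> \<partial>P) \<le> ennreal (C * ?t) + ennreal (?c * (1 / sqrt (real n)))" if n: "1 \<le> n" for n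
      proof -
        have "(\<integral>\<^sup>+\<omega>. maj j n m \<omega> \<partial>P) = ennreal (1 / sqrt (real n)) * (\<integral>\<^sup>+\<omega>. ennreal (orth.Psi {..<n} m \<omega>) \<partial>P)"
          using True by (simp add: maj_def nn_integral_cmult)
        also have "\<dots> \<le> ennreal (1 / sqrt (real n)) * ennreal (?t * sqrt (real (card {..<n})) + ?c)"
          by (intro mult_left_mono orth.Psi_expectation) auto
        also have "\<dots> = ennreal (?t + ?c * (1 / sqrt (real n)))"
          using n t0 by (subst ennreal_mult[symmetric]) (auto simp: field_simps)
        also have "\<dots> \<le> ennreal (C * ?t + ?c * (1 / sqrt (real n)))"
          using t0 mult_right_mono[of 1 C ?t] by (intro ennreal_leI) (auto simp: C_def)
        also have "\<dots> = ennreal (C * ?t) + ennreal (?c * (1 / sqrt (real n)))"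
          using t0 by (intro ennreal_plus) (auto simp: C_def)
        finally show ?thesis .
      qed
      moreover have "(\<lambda>n. ennreal (?c * (1 / sqrt (real n)))) \<longlonglongrightarrow> 0"
        using tendsto_ennrealI[OF tendsto_mult[OF tendsto_const[of ?c] inv_sqrt_tendsto]] by simp
      ultimately show ?thesis by blast
    next
      case False
      then have j1: "j \<in> {1..K}" using j by auto
      have "(\<integral>\<^sup>+\<omega>. maj j n m \<omega> \<partial>P) \<le> ennreal (C * ?t) + ennreal (2 * ?c) * (\<integral>\<^sup>+\<omega>. ennreal (wmax j n \<omega> / sqrt (real n)) \<partial>P)" if n: "1 \<le> n" for n
      proof -
        let ?I = "ennreal (1 / sqrt (real n))" and ?w = "\<integral>\<^sup>+\<omega>. ennreal (wmax j n \<omega>) \<partial>P"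
        let ?B = "ennreal (?t * sqrt (real n)) * (\<integral>\<^sup>+t. indicator {0..} t * ennreal (sqrt (tailq n t)) \<partial>lborel) + ennreal ?c * ?w"
        have [measurable]: "orth.mult_maj n (xpos j n) m \<in> borel_measurable P" "orth.mult_maj n (xneg j n) m \<in> borel_measurable P"
          by (rule orth.mult_maj_measurable, measurable)+
        have p: "(\<integral>\<^sup>+\<omega>. orth.mult_maj n (xpos j n) m \<omega> \<partial>P) \<le> ?B"
          by (rule mult_maj_bound[OF j1, where G="\<lambda>x. max 0 x"]) (auto simp: xpos_def wt_cw)
        have q: "(\<integral>\<^sup>+\<omega>. orth.mult_maj n (xneg j n) m \<omega> \<partial>P) \<le> ?B"
          by (rule mult_maj_bound[OF j1, where G="\<lambda>x. max 0 (- x)"]) (auto simp: xneg_def wt_cw)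
        have B: "?B \<le> ennreal (?t * sqrt (real n) * max 0 C0) + ennreal ?c * ?w"
        proof (rule add_right_mono)
          have "ennreal (?t * sqrt (real n)) * (\<integral>\<^sup>+t. indicator {0..} t * ennreal (sqrt (tailq n t)) \<partial>lborel) \<le> ennreal (?t * sqrt (real n)) * ennreal (max 0 C0)"
            using C0[OF n] by (intro mult_left_mono) (auto intro: order_trans ennreal_leI)
          then show "ennreal (?t * sqrt (real n)) * (\<integral>\<^sup>+t. indicator {0..} t * ennreal (sqrt (tailq n t)) \<partial>lborel) \<le> ennreal (?t * sqrt (real n) * max 0 C0)"
            using t0 by (subst ennreal_mult) auto
        qed
        have "(\<integral>\<^sup>+\<omega>. maj j n m \<omega> \<partial>P) = ?I * ((\<integral>\<^sup>+\<omega>. orth.mult_maj n (xpos j n) m \<omega> \<partial>P) + (\<integral>\<^sup>+\<omega>. orth.mult_maj n (xneg j n) m \<omega> \<partial>P))"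
          using False by (simp add: maj_def nn_integral_cmult nn_integral_add)
        also have "\<dots> \<le> ?I * ((ennreal (?t * sqrt (real n) * max 0 C0) + ennreal ?c * ?w) + (ennreal (?t * sqrt (real n) * max 0 C0) + ennreal ?c * ?w))"
          by (intro mult_left_mono add_mono order_trans[OF p B] order_trans[OF q B]) auto
        also have "\<dots> = 2 * (?I * ennreal (?t * sqrt (real n) * max 0 C0)) + 2 * (ennreal ?c * (?I * ?w))"
          by (rule ennreal_double)
        also have "?I * ennreal (?t * sqrt (real n) * max 0 C0) = ennreal (?t * max 0 C0)"
          using n t0 by (subst ennreal_mult[symmetric]) auto
        also have "?I * ?w = (\<integral>\<^sup>+\<omega>. ennreal (wmax j n \<omega> / sqrt (real n)) \<partial>P)"
          by (subst nn_integral_cmult[symmetric], measurable) (intro nn_integral_cong, subst ennreal_mult'[symmetric], auto)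
        also have "2 * ennreal (?t * max 0 C0) \<le> ennreal (C * ?t)"
        proof -
          have "2 * ennreal (?t * max 0 C0) = ennreal (2 * (?t * max 0 C0))" using t0 by (subst ennreal_mult) auto
          also have "\<dots> \<le> ennreal (C * ?t)" using t0 by (intro ennreal_leI) (simp add: C_def algebra_simps)
          finally show ?thesis .
        qed
        also have "2 * (ennreal ?c * (\<integral>\<^sup>+\<omega>. ennreal (wmax j n \<omega> / sqrt (real n)) \<partial>P)) = ennreal (2 * ?c) * (\<integral>\<^sup>+\<omega>. ennreal (wmax j n \<omega> / sqrt (real n)) \<partial>P)"
        proof -
          have "ennreal (2 * ?c) = ennreal 2 * ennreal ?c" by (rule ennreal_mult) auto
          then show ?thesis by (simp only: ennreal_numeral mult.assoc)
        qed
        finally show ?thesis by (simp add: add_right_mono)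
      qed
      moreover have "(\<lambda>n. ennreal (2 * ?c) * (\<integral>\<^sup>+\<omega>. ennreal (wmax j n \<omega> / sqrt (real n)) \<partial>P)) \<longlonglongrightarrow> 0"
        using ennreal_tendsto_cmult[OF _ wmax_tendsto[OF j1], of "ennreal (2 * ?c)"] by simp
      ultimately show ?thesis by blast
    qed
  qed
  moreover have "0 \<le> C" by (simp add: C_def)
  ultimately show ?thesis by blast
qed

lemma maj_eventually:
  assumes e: "0 < e"
  shows "\<exists>m0. \<forall>m\<ge>m0. \<forall>\<^sub>F n in sequentially. \<forall>j\<le>K. (\<integral>\<^sup>+\<omega>. maj j n m \<omega> \<partial>P) \<le> ennreal e"
proof -
  obtain C where C: "0 \<le> C" "\<And>m j. j \<le> K \<Longrightarrow> \<exists>r. r \<longlonglongrightarrow> (0 :: ennreal) \<and> (\<forall>n\<ge>1. (\<integral>\<^sup>+\<omega>. maj j n m \<omega> \<partial>P) \<le> ennreal (C * entropy_tail TYPE('p) m) + r n)"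
    using maj_limit by blast
  have "(\<lambda>m. C * entropy_tail TYPE('p) m) \<longlonglongrightarrow> C * 0" by (intro tendsto_mult tendsto_const entropy_tail_tendsto)
  then have "\<forall>\<^sub>F m in sequentially. C * entropy_tail TYPE('p) m < e / 2" using e by (intro order_tendstoD(2)) auto
  then obtain m0 where m0: "\<And>m. m0 \<le> m \<Longrightarrow> C * entropy_tail TYPE('p) m < e / 2" unfolding eventually_sequentially by blast
  have "\<forall>\<^sub>F n in sequentially. (\<integral>\<^sup>+\<omega>. maj j n m \<omega> \<partial>P) \<le> ennreal e" if m: "m0 \<le> m" and j: "j \<le> K" for m j
  proof -
    obtain r where r: "r \<longlonglongrightarrow> (0 :: ennreal)" "\<And>n. 1 \<le> n \<Longrightarrow> (\<integral>\<^sup>+\<omega>. maj j n m \<omega> \<partial>P) \<le> ennreal (C * entropy_tail TYPE('p) m) + r n"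
      using C(2)[OF j] by blast
    have "\<forall>\<^sub>F n in sequentially. r n < ennreal (e / 2)" using r(1) by (rule order_tendstoD(2)) (use e in simp)
    then show ?thesis using eventually_ge_at_top[of 1]
    proof eventually_elim
      case (elim n)
      have "(\<integral>\<^sup>+\<omega>. maj j n m \<omega> \<partial>P) \<le> ennreal (C * entropy_tail TYPE('p) m) + r n" by (rule r(2)) (use elim in simp)
      also have "\<dots> \<le> ennreal (e / 2) + ennreal (e / 2)" using m0[OF m] elim by (intro add_mono ennreal_leI) auto
      also have "\<dots> = ennreal e" using e by (subst ennreal_plus[symmetric]) auto
      finally show ?case .
    qed
  qed
  then have "\<forall>\<^sub>F n in sequentially. \<forall>j\<in>{..K}. (\<integral>\<^sup>+\<omega>. maj j n m \<omega> \<partial>P) \<le> ennreal e" if "m0 \<le> m" for m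
    using that by (intro eventually_ball_finite) auto
  then show ?thesis by (intro exI[of _ m0]) (auto simp: Ball_def)
qed

text \<open>At scale 0 increments over the whole cube are covered; this is the source of
  tightness.\<close>

lemma maj_bounded: "\<exists>C>0. \<forall>\<^sub>F n in sequentially. \<forall>j\<le>K. (\<integral>\<^sup>+\<omega>. maj j n 0 \<omega> \<partial>P) \<le> ennreal C"
proof -
  obtain C where C: "0 \<le> C" "\<And>m j. j \<le> K \<Longrightarrow> \<exists>r. r \<longlonglongrightarrow> (0 :: ennreal) \<and> (\<forall>n\<ge>1. (\<integral>\<^sup>+\<omega>. maj j n m \<omega> \<partial>P) \<le> ennreal (C * entropy_tail TYPE('p) m) + r n)"
    using maj_limit by blast
  have t0: "0 \<le> C * entropy_tail TYPE('p) 0" by (rule mult_nonneg_nonneg[OF C(1) entropy_tail_nonneg])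
  have "\<forall>\<^sub>F n in sequentially. (\<integral>\<^sup>+\<omega>. maj j n 0 \<omega> \<partial>P) \<le> ennreal (C * entropy_tail TYPE('p) 0 + 1)" if j: "j \<le> K" for j
  proof -
    obtain r where r: "r \<longlonglongrightarrow> (0 :: ennreal)" "\<And>n. 1 \<le> n \<Longrightarrow> (\<integral>\<^sup>+\<omega>. maj j n 0 \<omega> \<partial>P) \<le> ennreal (C * entropy_tail TYPE('p) 0) + r n"
      using C(2)[OF j] by blast
    have "\<forall>\<^sub>F n in sequentially. r n < 1" using r(1) by (rule order_tendstoD(2)) simp
    then show ?thesis using eventually_ge_at_top[of 1]
    proof eventually_elim
      case (elim n)
      have "(\<integral>\<^sup>+\<omega>. maj j n 0 \<omega> \<partial>P) \<le> ennreal (C * entropy_tail TYPE('p) 0) + r n" by (rule r(2)) (use elim in simp)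
      also have "\<dots> \<le> ennreal (C * entropy_tail TYPE('p) 0) + ennreal 1" using elim by (intro add_left_mono) auto
      also have "\<dots> = ennreal (C * entropy_tail TYPE('p) 0 + 1)" using t0 by (subst ennreal_plus[symmetric]) auto
      finally show ?case .
    qed
  qed
  then have "\<forall>\<^sub>F n in sequentially. \<forall>j\<in>{..K}. (\<integral>\<^sup>+\<omega>. maj j n 0 \<omega> \<partial>P) \<le> ennreal (C * entropy_tail TYPE('p) 0 + 1)"
    by (intro eventually_ball_finite) auto
  then show ?thesis using t0 by (intro exI[of _ "C * entropy_tail TYPE('p) 0 + 1"]) (auto simp: Ball_def)
qed

text \<open>Subtracting \<open>Wbar\<close> times the count of selected observations is the same as
  centring the weights.\<close>

lemma DDstar_wt: "DDstar X Z A (W j) n u \<omega> = (\<Sum>i<n. wt j n i \<omega> * (if sel X Z A n u \<omega> i then 1 else 0)) / sqrt (real n)"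
proof (cases "n = 0")
  case False
  let ?s = "\<lambda>i. if sel X Z A n u \<omega> i then 1 else 0 :: real"
  have "sqrt (real n) * Wbar (W j) n \<omega> * ((\<Sum>i<n. ?s i) / real n) = Wbar (W j) n \<omega> * (\<Sum>i<n. ?s i) / sqrt (real n)"
    using False by (simp add: field_simps real_sqrt_mult_self)
  moreover have "(\<Sum>i<n. wt j n i \<omega> * ?s i) = (\<Sum>i<n. W j n i \<omega> * ?s i) - Wbar (W j) n \<omega> * (\<Sum>i<n. ?s i)"
    by (simp only: wt_def left_diff_distrib sum_subtractf sum_distrib_left)
  ultimately show ?thesis unfolding DDstar_def Dbar_def by (simp only: diff_divide_distrib)
qed (simp add: DDstar_def)

text \<open>For a bootstrap process one majorant pays for moving from the shifted point, which
  reproduces the empirical selection, to \<open>u\<close>, and a second for moving from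
  \<open>u\<close> to its dyadic floor. The condition on \<open>Psi\<close> is that of
  \<open>sel_eq_ff\<close> with tolerance \<open>1 / 2 ^ m\<close>.\<close>

lemma process_close:
  assumes r: "regular \<omega>" and n: "0 < n" and u: "u \<in> cube"
    and s: "orth.Psi {..<n} 0 \<omega> \<le> (1 / 2 ^ m * pA P Z A / 2) * real n"
  shows "ennreal \<bar>(if j = 0 then DDn P X Z A n u \<omega> else DDstar X Z A (W j) n u \<omega>) - orth_proc j n (dfloor m u) \<omega>\<bar> \<le> 2 * maj j n m \<omega>"
proof -
  have d: "\<bar>u $ k - dfloor m u $ k\<bar> \<le> 1 / 2 ^ m" for k using dfloor_le[of m u k] le_dfloor[of u k m] by (simp add: abs_le_iff)
  have dc: "dfloor m u \<in> cube" by (rule dgrid_cube[OF dfloor_grid[OF u]])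
  have 1: "ennreal \<bar>orth_proc j n u \<omega> - orth_proc j n (dfloor m u) \<omega>\<bar> \<le> maj j n m \<omega>" by (rule maj_modulus[OF u dc d])
  show ?thesis
  proof (cases "j = 0")
    case True
    then show ?thesis using order_trans[OF 1, of "2 * maj j n m \<omega>"] by (simp add: orth_proc_def mult_2 add_increasing2)
  next
    case False
    obtain v where v: "v \<in> cube" "\<And>k. \<bar>v $ k - u $ k\<bar> \<le> 1 / 2 ^ m" "\<And>i. (if sel X Z A n u \<omega> i then 1 else 0) = ff i v \<omega>"
      using sel_eq_ff[OF r n _ _ u s] by auto
    have eq: "DDstar X Z A (W j) n u \<omega> = orth_proc j n v \<omega>" using False by (simp only: DDstar_wt v(3) orth_proc_def weighted_proc_def if_False)
    have 2: "ennreal \<bar>orth_proc j n v \<omega> - orth_proc j n u \<omega>\<bar> \<le> maj j n m \<omega>" by (rule maj_modulus[OF v(1) u v(2)])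
    have "ennreal \<bar>orth_proc j n v \<omega> - orth_proc j n (dfloor m u) \<omega>\<bar> \<le> ennreal (\<bar>orth_proc j n v \<omega> - orth_proc j n u \<omega>\<bar> + \<bar>orth_proc j n u \<omega> - orth_proc j n (dfloor m u) \<omega>\<bar>)"
      by (intro ennreal_leI) linarith
    also have "\<dots> \<le> maj j n m \<omega> + maj j n m \<omega>" using 1 2 by (subst ennreal_plus) (auto intro: add_mono)
    finally show ?thesis using False by (simp add: eq mult_2)
  qed
qed

lemma orth_proc_zero: "regular \<omega> \<Longrightarrow> orth_proc j n 0 \<omega> = 0"
  by (simp add: orth_proc_def DDn_T weighted_proc_def orth.T_def ff_zero Dpop_zero)

text \<open>The processes vanish at 0 on regular sample points, so the scale-0 majorant bounds their
  values. Markov's inequality and a union over \<open>K + 1\<close> processes give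
  \<open>R = C * (K + 1) / e\<close>.\<close>

lemma orth_proc_tight:
  assumes e: "0 < e"
  shows "\<exists>R>0. \<forall>\<^sub>F n in sequentially. prob {\<omega>\<in>space P. \<exists>j\<le>K. \<exists>u\<in>dgrid m. R < \<bar>orth_proc j n u \<omega>\<bar>} \<le> e"
proof -
  obtain C where C: "0 < C" "\<forall>\<^sub>F n in sequentially. \<forall>j\<le>K. (\<integral>\<^sup>+\<omega>. maj j n 0 \<omega> \<partial>P) \<le> ennreal C" using maj_bounded by blast
  define R where "R = C * real (Suc K) / e"
  have R: "0 < R" using C e by (simp add: R_def)
  have "\<forall>\<^sub>F n in sequentially. prob {\<omega>\<in>space P. \<exists>j\<le>K. \<exists>u\<in>dgrid m. R < \<bar>orth_proc j n u \<omega>\<bar>} \<le> e"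
    using C(2)
  proof eventually_elim
    case (elim n)
    have fin: "finite (dgrid m :: (real^'p) set)" by (rule dgrid_finite)
    have "prob {\<omega>\<in>space P. \<exists>j\<le>K. \<exists>u\<in>dgrid m. R < \<bar>orth_proc j n u \<omega>\<bar>} \<le> prob (\<Union>j\<in>{..K}. {\<omega>\<in>space P. ennreal R < maj j n 0 \<omega>})"
    proof (rule finite_measure_mono_AE)
      show "AE \<omega> in P. \<omega> \<in> {\<omega>\<in>space P. \<exists>j\<le>K. \<exists>u\<in>dgrid m. R < \<bar>orth_proc j n u \<omega>\<bar>} \<longrightarrow> \<omega> \<in> (\<Union>j\<in>{..K}. {\<omega>\<in>space P. ennreal R < maj j n 0 \<omega>})"
        using regular_AE
      proof eventually_elim
        case reg: (elim \<omega>)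
        have "ennreal R < maj j n 0 \<omega>" if u: "u \<in> dgrid m" "R < \<bar>orth_proc j n u \<omega>\<bar>" for j u
        proof -
          have "ennreal \<bar>orth_proc j n u \<omega> - orth_proc j n 0 \<omega>\<bar> \<le> maj j n 0 \<omega>"
          proof (rule maj_modulus)
            show uc: "u \<in> cube" by (rule dgrid_cube[OF u(1)])
            show "0 \<in> cube" by (simp add: cube_def)
            show "\<bar>u $ k - 0 $ k\<bar> \<le> 1 / 2 ^ 0" for k using uc by (simp add: cube_def)
          qed
          then have "ennreal \<bar>orth_proc j n u \<omega>\<bar> \<le> maj j n 0 \<omega>" by (simp only: orth_proc_zero[OF reg] diff_0_right)
          moreover have "ennreal R < ennreal \<bar>orth_proc j n u \<omega>\<bar>" using u(2) R by (simp add: ennreal_less_iff)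
          ultimately show ?thesis by (rule less_le_trans[rotated])
        qed
        then show ?case by blast
      qed
    qed auto
    also have "\<dots> \<le> (\<Sum>j\<in>{..K}. prob {\<omega>\<in>space P. ennreal R < maj j n 0 \<omega>})" by (rule measure_UNION_le) auto
    also have "\<dots> \<le> (\<Sum>j\<in>{..K}. C / R)" using elim C(1) R by (intro sum_mono markov_ennreal) auto
    also have "\<dots> = e" using C(1) e by (simp add: R_def)
    finally show ?case .
  qed
  then show ?thesis using R by blast
qed

text \<open>The mean of \<open>Psi\<close> grows like \<open>sqrt n\<close> and is compared with a
  multiple of \<open>n\<close>. This is the uniform law of large numbers behind the closeness of the
  empirical margins.\<close>

lemma Psi_small:
  assumes c: "0 < c"
  shows "(\<lambda>n. prob {\<omega>\<in>space P. c * real n < orth.Psi {..<n} 0 \<omega>}) \<longlonglongrightarrow> 0"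
proof -
  let ?t = "entropy_tail TYPE('p) 0" and ?b = "4 * real CARD('p) + 2 * 2 ^ 0 :: real"
  have t0: "0 \<le> ?t" by (rule entropy_tail_nonneg)
  have "prob {\<omega>\<in>space P. c * real n < orth.Psi {..<n} 0 \<omega>} \<le> (?t + ?b) / c * (1 / sqrt (real n))" if n: "1 \<le> n" for n
  proof -
    have "{\<omega>\<in>space P. c * real n < orth.Psi {..<n} 0 \<omega>} = {\<omega>\<in>space P. ennreal (c * real n) < ennreal (orth.Psi {..<n} 0 \<omega>)}"
      using c by (auto simp: ennreal_less_iff)
    also have "prob \<dots> \<le> (?t * sqrt (real n) + ?b) / (c * real n)"
      by (rule markov_ennreal) (use orth.Psi_expectation[of "{..<n}" 0] c n t0 in auto)
    also have "\<dots> \<le> ((?t + ?b) * sqrt (real n)) / (c * real n)"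
    proof (rule divide_right_mono)
      have "?b * 1 \<le> ?b * sqrt (real n)" using n by (intro mult_left_mono) auto
      then show "?t * sqrt (real n) + ?b \<le> (?t + ?b) * sqrt (real n)" by (simp add: distrib_right)
    qed (use c in simp)
    also have "\<dots> = (?t + ?b) / c * (1 / sqrt (real n))" 
    proof -
      have "(y * z) / (c * (z * z)) = y / c * (1 / z)" if "0 < z" for y z :: real using c that by (simp add: field_simps)
      from this[of "sqrt (real n)"] show ?thesis using n by simp
    qed
    finally show ?thesis .
  qed
  then have le: "\<forall>\<^sub>F n in sequentially. prob {\<omega>\<in>space P. c * real n < orth.Psi {..<n} 0 \<omega>} \<le> (?t + ?b) / c * (1 / sqrt (real n))"
    by (rule eventually_sequentiallyI)
  have lim: "(\<lambda>n. (?t + ?b) / c * (1 / sqrt (real n))) \<longlonglongrightarrow> 0"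
    using tendsto_mult[OF tendsto_const[of "(?t + ?b) / c"] inv_sqrt_tendsto] by simp
  show ?thesis by (rule tendsto_sandwich[OF _ le tendsto_const lim]) simp
qed

end

section \<open>The limit process\<close>

lemma prob_space_std_normal: "prob_space std_normal_distribution"
  using real_dist_normal_dist unfolding real_distribution_def by blast

lemma Tidx_nonempty: "Tidx K \<noteq> {}"
proof -
  have "((\<lambda>i\<in>{..K}. 0 :: real^'p), 0) \<in> Tidx K" by (auto simp: Tidx_def cube_def)
  then show ?thesis by blast
qed

text \<open>Levy's uniqueness theorem, after standardization when \<open>v\<close> is positive. For
  \<open>v = 0\<close> the law is the point mass at 0.\<close>

lemma gaussian_law_of_char:
  fixes Y :: "'w \<Rightarrow> real"
  assumes N: "prob_space N" and Y[measurable]: "Y \<in> borel_measurable N"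
    and ch: "\<And>t. (\<integral>\<omega>. cis (t * Y \<omega>) \<partial>N) = complex_of_real (exp (- (t\<^sup>2 * v) / 2))"
  shows "if v > 0 then distributed N lborel Y (\<lambda>x. ennreal (normal_density 0 (sqrt v) x)) else (AE \<omega> in N. Y \<omega> = 0)"
proof -
  interpret N: prob_space N by fact
  have rd: "real_distribution (distr N borel Y)" if "Y \<in> borel_measurable N" for Y using that by (rule N.real_distribution_distr)
  have chd: "char (distr N borel Y') t = (\<integral>\<omega>. cis (t * Y' \<omega>) \<partial>N)" if "Y' \<in> borel_measurable N" for Y' t
    unfolding char_def using that by (subst integral_distr) (auto simp: cis_conv_exp)
  show ?thesis
  proof (cases "v > 0")
    case True
    define Y' where "Y' \<omega> = (Y \<omega> - 0) / sqrt v" for \<omega>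
    have Y'[measurable]: "Y' \<in> borel_measurable N" unfolding Y'_def by measurable
    have "char (distr N borel Y') = char std_normal_distribution"
    proof
      fix t
      have "char (distr N borel Y') t = (\<integral>\<omega>. cis ((t / sqrt v) * Y \<omega>) \<partial>N)" unfolding chd[OF Y'] by (simp add: Y'_def)
      also have "\<dots> = complex_of_real (exp (- (t\<^sup>2) / 2))" unfolding ch using True by (simp add: power_divide)
      finally show "char (distr N borel Y') t = char std_normal_distribution t" by (simp add: char_std_normal_distribution)
    qed
    then have "distr N borel Y' = std_normal_distribution"
      by (intro Levy_uniqueness rd Y' real_dist_normal_dist)
    then have "distr N lborel Y' = std_normal_distribution" by (simp cong: distr_cong)
    then have "distributed N lborel Y' std_normal_density" unfolding distributed_def by simp
    then show ?thesis using True N.normal_standard_normal_convert[of "sqrt v" Y 0] by (simp add: Y'_def[abs_def])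
  next
    case False
    \<comment> \<open>A negative \<open>v\<close> is impossible, since a characteristic function has
      modulus at most 1.\<close>
    have "v = 0"
    proof -
      have "cmod (\<integral>\<omega>. cis (1 * Y \<omega>) \<partial>N) \<le> (\<integral>\<omega>. cmod (cis (1 * Y \<omega>)) \<partial>N)" by (rule integral_norm_bound)
      then have "exp (- v / 2) \<le> 1" unfolding ch by (simp add: N.prob_space)
      then show ?thesis using False by simp
    qed
    interpret R: prob_space "return borel (0::real)" by (rule prob_space_return) simp
    have "real_distribution (return borel (0::real))" by standard auto
    moreover have "char (distr N borel Y) = char (return borel 0)"
    proof
      fix t
      show "char (distr N borel Y) t = char (return borel 0) t"
        unfolding chd[OF Y] ch using \<open>v = 0\<close> by (simp add: char_def integral_return)
    qed
    ultimately have eq: "distr N borel Y = return borel 0" by (intro Levy_uniqueness rd Y) auto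
    have "AE y in distr N borel Y. y = 0" unfolding eq by (subst AE_return) auto
    then have "AE \<omega> in N. Y \<omega> = 0" by (subst (asm) AE_distr_iff) auto
    then show ?thesis using False by simp
  qed
qed

context bootstrap_model
begin

abbreviation NG :: "(real^'p \<Rightarrow> real) measure" where "NG \<equiv> PiM UNIV (\<lambda>_. std_normal_distribution)"
abbreviation NN :: "(nat \<Rightarrow> real^'p \<Rightarrow> real) measure" where "NN \<equiv> PiM UNIV (\<lambda>_. NG)"

definition BB :: "nat \<Rightarrow> real^'p \<Rightarrow> (nat \<Rightarrow> real^'p \<Rightarrow> real) \<Rightarrow> real" where "BB j u \<omega> = orth.gauss_path u (\<omega> j)"

lemma prob_NG: "prob_space NG" by (rule prob_space_PiM) (rule prob_space_std_normal)
lemma prob_NN: "prob_space NN" by (rule prob_space_PiM) (rule prob_NG)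

lemma coord_NN: "(\<lambda>\<omega>. \<omega> j) \<in> measurable NN NG" by (rule measurable_component_singleton) simp

lemma BB_measurable[measurable]: "u \<in> cube \<Longrightarrow> BB j u \<in> borel_measurable NN"
  unfolding BB_def[abs_def] by (rule measurable_compose[OF coord_NN orth.gauss_path_measurable])

lemma NN_indep: "prob_space.indep_vars NN (\<lambda>_. NG) (\<lambda>j \<omega>. \<omega> j) UNIV"
  by (rule indep_vars_PiM_coords) (rule prob_NG)

lemma BB_indep: "prob_space.indep_vars NN (\<lambda>_. PiM cube (\<lambda>_. borel)) (\<lambda>j \<omega>. \<lambda>u\<in>cube. BB j u \<omega>) {..K}"
proof -
  interpret NN: prob_space NN by (rule prob_NN)
  have "(\<lambda>x. \<lambda>u\<in>cube. orth.gauss_path u x) \<in> measurable NG (PiM cube (\<lambda>_. borel))"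
    by (rule measurable_restrict) (rule orth.gauss_path_measurable)
  then show ?thesis unfolding BB_def
    using NN.indep_vars_compose2[OF NN.indep_vars_subset[OF NN_indep, of "{..K}"], of "\<lambda>_ x. \<lambda>u\<in>cube. orth.gauss_path u x" "\<lambda>_. PiM cube (\<lambda>_. borel)"] by simp
qed

lemma BB_char_single:
  assumes F: "finite F" "F \<subseteq> cube"
  shows "(\<integral>\<omega>. cis (\<Sum>u\<in>F. c u * BB j u \<omega>) \<partial>NN) = complex_of_real (exp (- (\<Sum>u\<in>F. \<Sum>v\<in>F. c u * c v * orth.Kc u v) / 2))"
proof -
  have m: "(\<lambda>x. cis (\<Sum>u\<in>F. c u * orth.gauss_path u x)) \<in> borel_measurable NG"
  proof -
    have "(\<lambda>x. \<Sum>u\<in>F. c u * orth.gauss_path u x) \<in> borel_measurable NG"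
      using F orth.gauss_path_measurable by (intro borel_measurable_sum borel_measurable_times) auto
    from measurable_compose[OF this cis_borel_measurable] show ?thesis .
  qed
  have "(\<integral>\<omega>. cis (\<Sum>u\<in>F. c u * BB j u \<omega>) \<partial>NN) = (\<integral>x. cis (\<Sum>u\<in>F. c u * orth.gauss_path u x) \<partial>distr NN NG (\<lambda>\<omega>. \<omega> j))"
    unfolding BB_def by (rule integral_distr[OF coord_NN m, symmetric])
  also have "distr NN NG (\<lambda>\<omega>. \<omega> j) = NG" by (rule distr_PiM_component) (auto intro: prob_NG)
  finally show ?thesis using orth.gauss_path_char[OF F] by simp
qed

lemma BB_char:
  assumes F: "finite F" "F \<subseteq> cube"
  shows "(\<integral>\<omega>. cis (\<Sum>j\<le>K. \<Sum>u\<in>F. c j u * BB j u \<omega>) \<partial>NN)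
    = complex_of_real (exp (- (\<Sum>j\<le>K. \<Sum>u\<in>F. \<Sum>v\<in>F. c j u * c j v * orth.Kc u v) / 2))"
proof -
  interpret NN: prob_space NN by (rule prob_NN)
  let ?h = "\<lambda>j x. cis (\<Sum>u\<in>F. c j u * orth.gauss_path u x)"
  have m: "?h j \<in> borel_measurable NG" for j
  proof -
    have "(\<lambda>x. \<Sum>u\<in>F. c j u * orth.gauss_path u x) \<in> borel_measurable NG"
      using F orth.gauss_path_measurable by (intro borel_measurable_sum borel_measurable_times) auto
    from measurable_compose[OF this cis_borel_measurable] show ?thesis .
  qed
  have ind: "NN.indep_vars (\<lambda>_. borel) (\<lambda>j \<omega>. ?h j (\<omega> j)) {..K}"
    by (rule NN.indep_vars_compose2[OF NN.indep_vars_subset[OF NN_indep]]) (use m in auto)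
  have int: "integrable NN (\<lambda>\<omega>. ?h j (\<omega> j))" for j
    by (rule NN.integrable_const_bound[where B=1]) (use measurable_compose[OF coord_NN m] in auto)
  have "(\<integral>\<omega>. cis (\<Sum>j\<le>K. \<Sum>u\<in>F. c j u * BB j u \<omega>) \<partial>NN) = (\<integral>\<omega>. (\<Prod>j\<le>K. ?h j (\<omega> j)) \<partial>NN)"
    unfolding BB_def by (simp add: cis_conv_exp exp_sum sum_distrib_left)
  also have "\<dots> = (\<Prod>j\<le>K. \<integral>\<omega>. ?h j (\<omega> j) \<partial>NN)"
    by (rule NN.indep_vars_lebesgue_integral[OF _ ind int]) simp
  also have "\<dots> = (\<Prod>j\<le>K. complex_of_real (exp (- (\<Sum>u\<in>F. \<Sum>v\<in>F. c j u * c j v * orth.Kc u v) / 2)))"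
    using BB_char_single[OF F] unfolding BB_def by simp
  also have "\<dots> = complex_of_real (exp (- (\<Sum>j\<le>K. \<Sum>u\<in>F. \<Sum>v\<in>F. c j u * c j v * orth.Kc u v) / 2))"
  proof -
    have "(\<Prod>j\<le>K. exp (- h j / 2)) = exp (- (\<Sum>j\<le>K. h j) / 2)" for h :: "nat \<Rightarrow> real"
      by (subst exp_sum[symmetric]) (auto simp: sum_negf sum_divide_distrib)
    then show ?thesis by (simp only: of_real_prod[symmetric])
  qed
  finally show ?thesis .
qed

lemma covB_Kc: "covB P X Z A u v = orth.Kc u v"
  using pA_pos by (simp add: covB_def Ccop_def orth.Kc_def power2_eq_square)

lemma BB_gaussian: "centered_gaussian_process NN cube (BB j) (covB P X Z A)"
  unfolding centered_gaussian_process_def Let_def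
proof (intro conjI ballI allI impI)
  fix F :: "(real^'p) set" and c :: "real^'p \<Rightarrow> real" assume F: "finite F" "F \<subseteq> cube"
  show "if 0 < (\<Sum>s\<in>F. \<Sum>t\<in>F. c s * c t * covB P X Z A s t)
        then distributed NN lborel (\<lambda>\<omega>. \<Sum>t\<in>F. c t * BB j t \<omega>)
              (\<lambda>x. ennreal (normal_density 0 (sqrt (\<Sum>s\<in>F. \<Sum>t\<in>F. c s * c t * covB P X Z A s t)) x))
        else AE \<omega> in NN. (\<Sum>t\<in>F. c t * BB j t \<omega>) = 0"
  proof (rule gaussian_law_of_char[OF prob_NN])
    show "(\<lambda>\<omega>. \<Sum>t\<in>F. c t * BB j t \<omega>) \<in> borel_measurable NN"
      using F BB_measurable by (intro borel_measurable_sum borel_measurable_times) auto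
    fix t
    have "(\<integral>\<omega>. cis (t * (\<Sum>u\<in>F. c u * BB j u \<omega>)) \<partial>NN) = (\<integral>\<omega>. cis (\<Sum>u\<in>F. (t * c u) * BB j u \<omega>) \<partial>NN)"
      by (simp add: sum_distrib_left mult.assoc)
    also have "\<dots> = complex_of_real (exp (- (\<Sum>u\<in>F. \<Sum>v\<in>F. (t * c u) * (t * c v) * orth.Kc u v) / 2))" by (rule BB_char_single[OF F])
    also have "(\<Sum>u\<in>F. \<Sum>v\<in>F. (t * c u) * (t * c v) * orth.Kc u v) = t\<^sup>2 * (\<Sum>u\<in>F. \<Sum>v\<in>F. c u * c v * orth.Kc u v)"
      by (simp add: sum_distrib_left power2_eq_square mult_ac)
    finally show "(\<integral>\<omega>. cis (t * (\<Sum>u\<in>F. c u * BB j u \<omega>)) \<partial>NN) = complex_of_real (exp (- (t\<^sup>2 * (\<Sum>s\<in>F. \<Sum>u\<in>F. c s * c u * covB P X Z A s u)) / 2))"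
      by (simp add: covB_Kc)
  qed
qed (rule BB_measurable)

section \<open>Discretization and weak convergence\<close>

abbreviation PG :: "nat \<Rightarrow> (nat \<times> (real^'p)) set" where "PG m \<equiv> {..K} \<times> dgrid m"
definition grid_index :: "nat \<Rightarrow> nat \<times> (real^'p) \<Rightarrow> nat" where "grid_index m = to_nat_on (PG m)"
definition grid_enum :: "nat \<Rightarrow> nat \<Rightarrow> nat \<times> (real^'p)" where "grid_enum m = from_nat_into (PG m)"

text \<open>Grid values are enumerated by an initial segment of the naturals, the format of the
  finite-dimensional lemmas; the function is constant on dyadic cells with its value taken at the
  dyadic floor.\<close>

definition step_fun :: "nat \<Rightarrow> (nat \<Rightarrow> real) \<Rightarrow> (nat \<Rightarrow> real^'p) \<times> nat \<Rightarrow> real" where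
  "step_fun m x = (\<lambda>(us, j). if (us, j) \<in> Tidx K then x (grid_index m (j, dfloor m (us j))) else 0)"

definition grid_sample :: "nat \<Rightarrow> (nat \<Rightarrow> real^'p \<Rightarrow> real) \<Rightarrow> nat \<Rightarrow> real" where
  "grid_sample m z i = z (fst (grid_enum m i)) (snd (grid_enum m i))"

lemma PG_finite: "finite (PG m)" using dgrid_finite by blast

lemma grid_enum_bij: "bij_betw (grid_enum m) {..<card (PG m)} (PG m)"
  unfolding grid_enum_def by (rule bij_betw_from_nat_into_finite[OF PG_finite])

lemma grid_index_less: "x \<in> PG m \<Longrightarrow> grid_index m x < card (PG m)"
  using to_nat_on_finite[OF PG_finite] unfolding grid_index_def bij_betw_def by blast

lemma grid_enum_grid_index: "x \<in> PG m \<Longrightarrow> grid_enum m (grid_index m x) = x"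
  unfolding grid_enum_def grid_index_def by (rule from_nat_into_to_nat_on[OF countable_finite[OF PG_finite]])

lemma Tidx_PG: "(us, j) \<in> Tidx K \<Longrightarrow> (j, dfloor m (us j)) \<in> PG m \<and> us j \<in> cube \<and> j \<le> K"
  by (auto simp: Tidx_def PiE_iff intro!: dfloor_grid)

lemma step_fun_grid_sample: "(us, j) \<in> Tidx K \<Longrightarrow> step_fun m (grid_sample m z) (us, j) = z j (dfloor m (us j))"
  using Tidx_PG[of us j m] by (simp add: step_fun_def grid_sample_def grid_enum_grid_index)

lemma step_fun_linf: "step_fun m x \<in> linf (Tidx K)"
proof -
  have "step_fun m x ` Tidx K \<subseteq> x ` {..<card (PG m)}"
  proof clarify
    fix us :: "nat \<Rightarrow> real^'p" and j assume t: "(us, j) \<in> Tidx K"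
    then show "step_fun m x (us, j) \<in> x ` {..<card (PG m)}"
      using grid_index_less[of "(j, dfloor m (us j))" m] Tidx_PG[OF t, of m] by (auto simp: step_fun_def)
  qed
  then have "bounded (step_fun m x ` Tidx K)" by (rule bounded_subset[OF finite_imp_bounded, rotated]) simp
  then show ?thesis by (auto simp: linf_def step_fun_def)
qed

lemma step_fun_dist: "sup_dist (Tidx K) (step_fun m x) (step_fun m y) \<le> (\<Sum>i<card (PG m). \<bar>x i - y i\<bar>)"
proof (rule sup_dist_le[OF Tidx_nonempty], clarify)
  fix us :: "nat \<Rightarrow> real^'p" and j assume t: "(us, j) \<in> Tidx K"
  have "grid_index m (j, dfloor m (us j)) < card (PG m)" using grid_index_less Tidx_PG[OF t, of m] by blast
  then have "\<bar>x (grid_index m (j, dfloor m (us j))) - y (grid_index m (j, dfloor m (us j)))\<bar> \<le> (\<Sum>i<card (PG m). \<bar>x i - y i\<bar>)"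
    by (intro member_le_sum[of _ _ "\<lambda>i. \<bar>x i - y i\<bar>"]) auto
  then show "\<bar>step_fun m x (us, j) - step_fun m y (us, j)\<bar> \<le> (\<Sum>i<card (PG m). \<bar>x i - y i\<bar>)" using t by (simp add: step_fun_def)
qed

text \<open>A uniformly continuous path stays within 1 of its values on a sufficiently fine finite
  grid, hence is bounded.\<close>

lemma Gproc_linf: "Gproc K BB \<omega> \<in> linf (Tidx K)"
proof -
  have "\<exists>b. \<forall>u\<in>cube. \<bar>BB j u \<omega>\<bar> \<le> b" for j
  proof -
    obtain m where m: "\<And>u v. u \<in> cube \<Longrightarrow> v \<in> cube \<Longrightarrow> (\<And>k. \<bar>u $ k - v $ k\<bar> \<le> 1 / 2 ^ m) \<Longrightarrow> \<bar>orth.gauss_path u (\<omega> j) - orth.gauss_path v (\<omega> j)\<bar> \<le> 1"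
      using orth.gauss_path_unif_cont[of 1 "\<omega> j"] by auto
    have "\<bar>BB j u \<omega>\<bar> \<le> 1 + (\<Sum>a\<in>dgrid m. \<bar>BB j a \<omega>\<bar>)" if u: "u \<in> cube" for u
    proof -
      have "\<bar>orth.gauss_path u (\<omega> j) - orth.gauss_path (dfloor m u) (\<omega> j)\<bar> \<le> 1"
      proof (rule m[OF u dgrid_cube[OF dfloor_grid[OF u]]])
        show "\<bar>u $ k - dfloor m u $ k\<bar> \<le> 1 / 2 ^ m" for k using dfloor_le[of m u k] le_dfloor[of u k m] by (simp add: abs_le_iff)
      qed
      moreover have "\<bar>BB j (dfloor m u) \<omega>\<bar> \<le> (\<Sum>a\<in>dgrid m. \<bar>BB j a \<omega>\<bar>)"
        by (rule member_le_sum[of _ _ "\<lambda>a. \<bar>BB j a \<omega>\<bar>"]) (auto intro: dfloor_grid[OF u] dgrid_finite)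
      ultimately show ?thesis unfolding BB_def by linarith
    qed
    then show ?thesis by blast
  qed
  then obtain b where b: "\<And>j u. u \<in> cube \<Longrightarrow> \<bar>BB j u \<omega>\<bar> \<le> b j" by metis
  have "\<bar>Gproc K BB \<omega> t\<bar> \<le> (\<Sum>j\<le>K. \<bar>b j\<bar>)" if t: "t \<in> Tidx K" for t
  proof -
    obtain us j where tt: "t = (us, j)" by (cases t)
    have j: "us j \<in> cube" "j \<le> K" using Tidx_PG[of us j] t tt by auto
    have "\<bar>Gproc K BB \<omega> t\<bar> \<le> \<bar>b j\<bar>" using b[OF j(1), of j] t tt by (simp add: Gproc_def)
    also have "\<dots> \<le> (\<Sum>j\<le>K. \<bar>b j\<bar>)" using j by (intro member_le_sum[of j "{..K}" "\<lambda>j. \<bar>b j\<bar>"]) auto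
    finally show ?thesis .
  qed
  then have "bounded (Gproc K BB \<omega> ` Tidx K)" by (intro boundedI[where B="\<Sum>j\<le>K. \<bar>b j\<bar>"]) auto
  then show ?thesis by (auto simp: linf_def Gproc_def)
qed

lemma Gproc_step_fun_tendsto:
  "(\<lambda>m. sup_dist (Tidx K) (Gproc K BB \<omega>) (step_fun m (grid_sample m (\<lambda>j u. BB j u \<omega>)))) \<longlonglongrightarrow> 0"
proof (rule LIMSEQ_I)
  fix e :: real assume e: "0 < e"
  have "\<forall>j. \<exists>m. \<forall>u\<in>cube. \<forall>v\<in>cube. (\<forall>k. \<bar>u $ k - v $ k\<bar> \<le> 1 / 2 ^ m) \<longrightarrow> \<bar>orth.gauss_path u (\<omega> j) - orth.gauss_path v (\<omega> j)\<bar> \<le> e / 2"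
    using orth.gauss_path_unif_cont[of "e / 2"] e by simp
  then obtain M where M: "\<And>j u v. u \<in> cube \<Longrightarrow> v \<in> cube \<Longrightarrow> (\<forall>k. \<bar>u $ k - v $ k\<bar> \<le> 1 / 2 ^ M j) \<Longrightarrow> \<bar>orth.gauss_path u (\<omega> j) - orth.gauss_path v (\<omega> j)\<bar> \<le> e / 2"
    by metis
  \<comment> \<open>A sum of naturals is a convenient common upper bound of the finitely many
    scales.\<close>
  define m0 where "m0 = (\<Sum>j\<le>K. M j)"
  have "norm (sup_dist (Tidx K) (Gproc K BB \<omega>) (step_fun m (grid_sample m (\<lambda>j u. BB j u \<omega>))) - 0) < e" if m: "m0 \<le> m" for m
  proof -
    have "sup_dist (Tidx K) (Gproc K BB \<omega>) (step_fun m (grid_sample m (\<lambda>j u. BB j u \<omega>))) \<le> e / 2"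
    proof (rule sup_dist_le[OF Tidx_nonempty], clarify)
      fix us :: "nat \<Rightarrow> real^'p" and j assume t: "(us, j) \<in> Tidx K"
      have u: "us j \<in> cube" "j \<le> K" using Tidx_PG[OF t] by auto
      have "M j \<le> m0" unfolding m0_def using u by (intro member_le_sum) auto
      then have "M j \<le> m" using m by simp
      then have p: "1 / 2 ^ m \<le> (1 / 2 ^ M j :: real)" by (intro divide_left_mono power_increasing) auto
      have "\<bar>orth.gauss_path (us j) (\<omega> j) - orth.gauss_path (dfloor m (us j)) (\<omega> j)\<bar> \<le> e / 2"
      proof (rule M[OF u(1) dgrid_cube[OF dfloor_grid[OF u(1)]]], rule allI)
        fix k
        have "\<bar>us j $ k - dfloor m (us j) $ k\<bar> \<le> 1 / 2 ^ m" using dfloor_le[of m "us j" k] le_dfloor[of "us j" k m] by (simp add: abs_le_iff)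
        then show "\<bar>us j $ k - dfloor m (us j) $ k\<bar> \<le> 1 / 2 ^ M j" using p by linarith
      qed
      then show "\<bar>Gproc K BB \<omega> (us, j) - step_fun m (grid_sample m (\<lambda>j u. BB j u \<omega>)) (us, j)\<bar> \<le> e / 2"
        using t step_fun_grid_sample[OF t] by (simp add: Gproc_def BB_def)
    qed
    then show ?thesis using sup_dist_nonneg[OF Tidx_nonempty Gproc_linf step_fun_linf, of \<omega> m "grid_sample m (\<lambda>j u. BB j u \<omega>)"] e by simp
  qed
  then show "\<exists>m0. \<forall>m\<ge>m0. norm (sup_dist (Tidx K) (Gproc K BB \<omega>) (step_fun m (grid_sample m (\<lambda>j u. BB j u \<omega>))) - 0) < e" by blast
qed

lemma step_fun_lipschitz:
  assumes h: "lip_bdd (Tidx K) k c h"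
  shows "\<bar>h (step_fun m x) - h (step_fun m y)\<bar> \<le> k * (\<Sum>i<card (PG m). \<bar>x i - y i\<bar>)" "\<bar>h (step_fun m x)\<bar> \<le> c"
proof -
  have "\<bar>h (step_fun m x) - h (step_fun m y)\<bar> \<le> k * sup_dist (Tidx K) (step_fun m x) (step_fun m y)"
    using h step_fun_linf unfolding lip_bdd_def by blast
  also have "\<dots> \<le> k * (\<Sum>i<card (PG m). \<bar>x i - y i\<bar>)" using h step_fun_dist unfolding lip_bdd_def by (intro mult_left_mono) auto
  finally show "\<bar>h (step_fun m x) - h (step_fun m y)\<bar> \<le> k * (\<Sum>i<card (PG m). \<bar>x i - y i\<bar>)" .
  show "\<bar>h (step_fun m x)\<bar> \<le> c" using h step_fun_linf unfolding lip_bdd_def by blast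
qed

lemma grid_enum_PG: "i < card (PG m) \<Longrightarrow> fst (grid_enum m i) \<le> K \<and> snd (grid_enum m i) \<in> dgrid m"
  using bij_betwE[OF grid_enum_bij[of m]] by (metis SigmaE atMost_iff fst_conv lessThan_iff snd_conv)

lemma grid_sample_BB_measurable: "i < card (PG m) \<Longrightarrow> (\<lambda>\<omega>. grid_sample m (\<lambda>j u. BB j u \<omega>) i) \<in> borel_measurable NN"
  unfolding grid_sample_def using grid_enum_PG[of i m] dgrid_cube by (intro BB_measurable) auto

lemma h_step_fun_BB_measurable:
  assumes h: "lip_bdd (Tidx K) k c h"
  shows "(\<lambda>\<omega>. h (step_fun m (grid_sample m (\<lambda>j u. BB j u \<omega>)))) \<in> borel_measurable NN"
  by (rule lipschitz_coords_measurable[where \<phi>="\<lambda>x. h (step_fun m x)" and d="card (PG m)", OF step_fun_lipschitz(1)[OF h] grid_sample_BB_measurable])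

lemma h_step_fun_BB_tendsto:
  assumes h: "lip_bdd (Tidx K) k c h"
  shows "(\<lambda>m. h (step_fun m (grid_sample m (\<lambda>j u. BB j u \<omega>)))) \<longlonglongrightarrow> h (Gproc K BB \<omega>)"
proof -
  have lim: "(\<lambda>m. k * sup_dist (Tidx K) (Gproc K BB \<omega>) (step_fun m (grid_sample m (\<lambda>j u. BB j u \<omega>)))) \<longlonglongrightarrow> 0"
    using tendsto_mult[OF tendsto_const Gproc_step_fun_tendsto, of k \<omega>] by simp
  have "(\<lambda>m. h (step_fun m (grid_sample m (\<lambda>j u. BB j u \<omega>))) - h (Gproc K BB \<omega>)) \<longlonglongrightarrow> 0"
  proof (rule Lim_null_comparison[OF _ lim], rule always_eventually, rule allI)
    fix m
    have "\<bar>h (Gproc K BB \<omega>) - h (step_fun m (grid_sample m (\<lambda>j u. BB j u \<omega>)))\<bar> \<le> k * sup_dist (Tidx K) (Gproc K BB \<omega>) (step_fun m (grid_sample m (\<lambda>j u. BB j u \<omega>)))"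
      using h step_fun_linf Gproc_linf unfolding lip_bdd_def by blast
    then show "norm (h (step_fun m (grid_sample m (\<lambda>j u. BB j u \<omega>))) - h (Gproc K BB \<omega>)) \<le> k * sup_dist (Tidx K) (Gproc K BB \<omega>) (step_fun m (grid_sample m (\<lambda>j u. BB j u \<omega>)))"
      by (simp add: abs_minus_commute)
  qed
  then show ?thesis by (rule LIM_zero_cancel)
qed

lemma h_Gproc_measurable:
  assumes h: "lip_bdd (Tidx K) k c h"
  shows "(\<lambda>\<omega>. h (Gproc K BB \<omega>)) \<in> borel_measurable NN"
  by (rule borel_measurable_LIMSEQ_real[OF h_step_fun_BB_tendsto[OF h] h_step_fun_BB_measurable[OF h]])

text \<open>An open set is the positivity set of the distance to its complement, which is Lipschitz.\<close>
lemma Gproc_borel: "Gproc K BB \<in> measurable NN (linf_borel (Tidx K))"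
  unfolding linf_borel_def
proof (rule measurable_measure_of)
  let ?I = "Tidx K :: ((nat \<Rightarrow> real^'p) \<times> nat) set"
  show "{S. linf_open ?I S} \<subseteq> Pow (linf ?I)" by (auto simp: linf_open_def)
  show "Gproc K BB \<in> space NN \<rightarrow> linf ?I" using Gproc_linf by auto
  fix S assume "S \<in> {S. linf_open ?I S}"
  then have S: "linf_open ?I S" by simp
  show "Gproc K BB -` S \<inter> space NN \<in> sets NN"
  proof (cases "linf ?I - S = {}")
    case True
    then have "Gproc K BB -` S \<inter> space NN = space NN" using Gproc_linf by blast
    then show ?thesis by (simp only: sets.top)
  next
    case False
    define d where "d f = (INF g\<in>linf ?I - S. sup_dist ?I f g)" for f
    have bdd: "bdd_below (sup_dist ?I f ` (linf ?I - S))" if "f \<in> linf ?I" for f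
      using sup_dist_nonneg[OF Tidx_nonempty that] by (intro bdd_belowI[of _ 0]) auto
    have d0: "0 \<le> d f" if "f \<in> linf ?I" for f
      unfolding d_def using sup_dist_nonneg[OF Tidx_nonempty that] False by (intro cINF_greatest) auto
    have dl: "d f \<le> d g + sup_dist ?I f g" if fg: "f \<in> linf ?I" "g \<in> linf ?I" for f g
    proof -
      have "d f - sup_dist ?I f g \<le> d g"
        unfolding d_def[of g]
      proof (rule cINF_greatest[OF False])
        fix e assume e: "e \<in> linf ?I - S"
        have "d f \<le> sup_dist ?I f e" unfolding d_def by (rule cINF_lower[OF bdd[OF fg(1)] e])
        also have "\<dots> \<le> sup_dist ?I f g + sup_dist ?I g e" by (rule sup_dist_triangle[OF Tidx_nonempty fg]) (use e in auto)
        finally show "d f - sup_dist ?I f g \<le> sup_dist ?I g e" by simp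
      qed
      then show ?thesis by simp
    qed
    have iff: "f \<in> S \<longleftrightarrow> 0 < d f" if f: "f \<in> linf ?I" for f
    proof
      assume "f \<in> S"
      then obtain e where e: "0 < e" "\<And>g. g \<in> linf ?I \<Longrightarrow> sup_dist ?I f g < e \<Longrightarrow> g \<in> S" using S unfolding linf_open_def by blast
      have "e \<le> d f" unfolding d_def by (rule cINF_greatest[OF False]) (use e(2) in \<open>auto simp: not_less[symmetric]\<close>)
      then show "0 < d f" using e(1) by linarith
    next
      assume pos: "0 < d f"
      show "f \<in> S"
      proof (rule ccontr)
        assume "f \<notin> S"
        then have "d f \<le> sup_dist ?I f f" unfolding d_def using f by (intro cINF_lower bdd) auto
        then show False using pos by (simp add: sup_dist_refl[OF Tidx_nonempty])
      qed
    qed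
    have "lip_bdd ?I 1 1 (\<lambda>f. min 1 (d f))"
      unfolding lip_bdd_def
    proof (intro conjI ballI)
      fix f g assume fg: "f \<in> linf ?I" "g \<in> linf ?I"
      show "\<bar>min 1 (d f) - min 1 (d g)\<bar> \<le> 1 * sup_dist ?I f g"
        using dl[OF fg] dl[OF fg(2,1)] sup_dist_nonneg[OF Tidx_nonempty fg] by (simp add: sup_dist_commute[of _ g f] min_def abs_le_iff)
    qed (use d0 in \<open>auto simp: min_def\<close>)
    from h_Gproc_measurable[OF this] have [measurable]: "(\<lambda>\<omega>. min 1 (d (Gproc K BB \<omega>))) \<in> borel_measurable NN" .
    have "Gproc K BB -` S \<inter> space NN = {\<omega>\<in>space NN. 0 < min 1 (d (Gproc K BB \<omega>))}"
      using iff[OF Gproc_linf] by auto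
    also have "\<dots> \<in> sets NN" by measurable
    finally show ?thesis .
  qed
qed

lemma sum_grid_sample: "(\<Sum>i<card (PG m). c i * grid_sample m z i) = (\<Sum>j\<le>K. \<Sum>u\<in>dgrid m. c (grid_index m (j, u)) * z j u)"
proof -
  have "(\<Sum>j\<le>K. \<Sum>u\<in>dgrid m. c (grid_index m (j, u)) * z j u) = (\<Sum>x\<in>PG m. c (grid_index m x) * z (fst x) (snd x))"
    by (simp add: sum.cartesian_product split_beta')
  also have "\<dots> = (\<Sum>i<card (PG m). c (grid_index m (grid_enum m i)) * z (fst (grid_enum m i)) (snd (grid_enum m i)))"
    by (rule sum.reindex_bij_betw[OF grid_enum_bij, symmetric])
  also have "\<dots> = (\<Sum>i<card (PG m). c i * grid_sample m z i)"
  proof (rule sum.cong)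
    fix i assume "i \<in> {..<card (PG m)}"
    then have i: "i < card (PG m)" by simp
    have P: "grid_enum m i \<in> PG m" using bij_betwE[OF grid_enum_bij[of m]] i by blast
    have "grid_index m (grid_enum m i) = i"
      by (rule inj_onD[OF bij_betw_imp_inj_on[OF grid_enum_bij[of m]]]) (use grid_enum_grid_index[OF P] grid_index_less[OF P] i in auto)
    then show "c (grid_index m (grid_enum m i)) * z (fst (grid_enum m i)) (snd (grid_enum m i)) = c i * grid_sample m z i" by (simp add: grid_sample_def)
  qed simp
  finally show ?thesis by simp
qed

lemma step_fun_conv:
  assumes h: "lip_bdd (Tidx K) k c h"
  shows "(\<lambda>n. expectation (\<lambda>\<omega>. h (step_fun m (grid_sample m (\<lambda>j u. orth_proc j n u \<omega>))))) \<longlonglongrightarrow> (\<integral>\<omega>. h (step_fun m (grid_sample m (\<lambda>j u. BB j u \<omega>))) \<partial>NN)"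
proof (rule integral_tendsto_of_char_tendsto[where \<phi>="\<lambda>x. h (step_fun m x)" and d="card (PG m)", OF prob_space_axioms prob_NN _ grid_sample_BB_measurable _ _ step_fun_lipschitz[OF h]])
  show "(\<lambda>\<omega>. grid_sample m (\<lambda>j u. orth_proc j n u \<omega>) i) \<in> borel_measurable P" for n i unfolding grid_sample_def by measurable
  show "(\<lambda>n. expectation (\<lambda>\<omega>. cis (\<Sum>i<card (PG m). b i * grid_sample m (\<lambda>j u. orth_proc j n u \<omega>) i))) \<longlonglongrightarrow>
        (\<integral>\<omega>. cis (\<Sum>i<card (PG m). b i * grid_sample m (\<lambda>j u. BB j u \<omega>) i) \<partial>NN)" for b
  proof -
    have sub: "dgrid m \<subseteq> (cube :: (real^'p) set)" using dgrid_cube by blast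
    show ?thesis unfolding sum_grid_sample BB_char[OF dgrid_finite sub] by (rule fidi_char[OF dgrid_finite])
  qed
  fix e :: real assume e: "0 < e"
  obtain R where R: "\<forall>\<^sub>F n in sequentially. prob {\<omega>\<in>space P. \<exists>j\<le>K. \<exists>u\<in>dgrid m. R < \<bar>orth_proc j n u \<omega>\<bar>} \<le> e" using orth_proc_tight[OF e, of m] by blast
  show "\<exists>R. \<forall>\<^sub>F n in sequentially. prob {\<omega>\<in>space P. \<exists>i<card (PG m). R < \<bar>grid_sample m (\<lambda>j u. orth_proc j n u \<omega>) i\<bar>} \<le> e"
  proof (rule exI[of _ R], use R in eventually_elim)
    case (elim n)
    have fin: "finite (dgrid m :: (real^'p) set)" by (rule dgrid_finite)
    have "prob {\<omega>\<in>space P. \<exists>i<card (PG m). R < \<bar>grid_sample m (\<lambda>j u. orth_proc j n u \<omega>) i\<bar>} \<le> prob {\<omega>\<in>space P. \<exists>j\<le>K. \<exists>u\<in>dgrid m. R < \<bar>orth_proc j n u \<omega>\<bar>}"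
      using fin grid_enum_PG[of _ m] by (intro finite_measure_mono) (auto simp: grid_sample_def)
    then show ?case using elim by linarith
  qed
qed

lemma Dproc_linf: "Dproc P X Z A W K n \<omega> \<in> linf (Tidx K)"
proof -
  define b where "b = sqrt (real n) * 2 + (\<Sum>j\<le>K. (\<Sum>i<n. \<bar>wt j n i \<omega>\<bar>) / sqrt (real n))"
  have bn: "0 \<le> (\<Sum>i<n. \<bar>wt j n i \<omega>\<bar>) / sqrt (real n)" for j by (simp add: sum_nonneg)
  have "\<bar>Dproc P X Z A W K n \<omega> t\<bar> \<le> b" if t: "t \<in> Tidx K" for t
  proof -
    obtain us j where tt: "t = (us, j)" by (cases t)
    have j: "us j \<in> cube" "j \<le> K" using Tidx_PG[of us j] t tt by auto
    show ?thesis
    proof (cases "j = 0")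
      case True
      have "\<bar>DDn P X Z A n (us 0) \<omega>\<bar> = \<bar>\<Sum>i<n. ff i (us 0) \<omega> - DD (us 0)\<bar> / sqrt (real n)" by (simp add: DDn_T orth.T_def abs_divide)
      also have "\<dots> \<le> (\<Sum>i<n. 2) / sqrt (real n)"
      proof (intro divide_right_mono order_trans[OF sum_abs] sum_mono)
        fix i show "\<bar>ff i (us 0) \<omega> - DD (us 0)\<bar> \<le> 2" using orth.f_bound[of i "us 0" \<omega>] orth.D_bound[of "us 0"] by linarith
      qed simp
      also have "\<dots> = sqrt (real n) * 2" by (simp add: real_div_sqrt field_simps) (metis mult.commute real_div_sqrt of_nat_0_le_iff times_divide_eq_left)
      also have "\<dots> \<le> b" unfolding b_def using bn by (simp add: sum_nonneg)
      finally show ?thesis using t tt True by (simp add: Dproc_def)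
    next
      case False
      have "\<bar>DDstar X Z A (W j) n (us j) \<omega>\<bar> \<le> (\<Sum>i<n. \<bar>wt j n i \<omega>\<bar>) / sqrt (real n)"
        unfolding DDstar_wt abs_divide using sum_abs[of "\<lambda>i. wt j n i \<omega> * (if sel X Z A n (us j) \<omega> i then 1 else 0)" "{..<n}"]
        by (auto intro!: divide_right_mono order_trans[OF sum_abs] sum_mono simp: abs_mult)
      also have "\<dots> \<le> (\<Sum>j\<le>K. (\<Sum>i<n. \<bar>wt j n i \<omega>\<bar>) / sqrt (real n))"
        using j bn by (intro member_le_sum[of j "{..K}" "\<lambda>j. (\<Sum>i<n. \<bar>wt j n i \<omega>\<bar>) / sqrt (real n)"]) auto
      also have "\<dots> \<le> b" by (simp add: b_def)
      finally show ?thesis using t tt False by (simp add: Dproc_def)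
    qed
  qed
  then have "bounded (Dproc P X Z A W K n \<omega> ` Tidx K)" by (intro boundedI[where B=b]) auto
  then show ?thesis by (auto simp: linf_def Dproc_def)
qed

text \<open>The scale \<open>m\<close> is fixed before \<open>n\<close> grows. The bad event is
  measurable although the processes need not be, and off it the estimate holds for all arguments
  simultaneously.\<close>

lemma Dproc_close:
  assumes \<eta>: "0 < \<eta>" and e: "0 < e"
  shows "\<exists>m0. \<forall>m\<ge>m0. \<exists>bad. (\<forall>n. bad n \<in> sets P) \<and> (\<forall>\<^sub>F n in sequentially. prob (bad n) \<le> e) \<and>
    (\<forall>n>0. \<forall>\<omega>\<in>space P - bad n. sup_dist (Tidx K) (Dproc P X Z A W K n \<omega>) (step_fun m (grid_sample m (\<lambda>j u. orth_proc j n u \<omega>))) \<le> \<eta>)"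
proof -
  \<comment> \<open>Markov's inequality is applied at \<open>\<eta> / 2\<close>, because the
    approximation costs two majorants, and is shared among \<open>K + 1\<close> processes; the other
    half of \<open>e\<close> is reserved for the event where \<open>Psi\<close> is large.\<close>
  define \<epsilon> where "\<epsilon> = e / 2 * (\<eta> / 2) / real (Suc K)"
  have \<epsilon>: "0 < \<epsilon>" using \<eta> e by (simp add: \<epsilon>_def)
  obtain m0 where m0: "\<And>m. m0 \<le> m \<Longrightarrow> \<forall>\<^sub>F n in sequentially. \<forall>j\<le>K. (\<integral>\<^sup>+\<omega>. maj j n m \<omega> \<partial>P) \<le> ennreal \<epsilon>" using maj_eventually[OF \<epsilon>] by blast
  \<comment> \<open>The irregular points are enclosed in a measurable null set, since the bad event
    has to be measurable.\<close>
  obtain N0 where N0: "{\<omega>\<in>space P. \<not> regular \<omega>} \<subseteq> N0" "emeasure P N0 = 0" "N0 \<in> sets P" using AE_E[OF regular_AE] by auto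
  have main: "\<exists>bad. (\<forall>n. bad n \<in> sets P) \<and> (\<forall>\<^sub>F n in sequentially. prob (bad n) \<le> e) \<and>
    (\<forall>n>0. \<forall>\<omega>\<in>space P - bad n. sup_dist (Tidx K) (Dproc P X Z A W K n \<omega>) (step_fun m (grid_sample m (\<lambda>j u. orth_proc j n u \<omega>))) \<le> \<eta>)" if m: "m0 \<le> m" for m
  proof -
    let ?c = "1 / 2 ^ m * pA P Z A / 2"
    define S where "S n = {\<omega>\<in>space P. ?c * real n < orth.Psi {..<n} 0 \<omega>}" for n
    define Rj where "Rj n j = {\<omega>\<in>space P. ennreal (\<eta> / 2) < maj j n m \<omega>}" for n j
    define bad where "bad n = N0 \<union> S n \<union> (\<Union>j\<le>K. Rj n j)" for n
    have Sm[measurable]: "S n \<in> sets P" and Rm[measurable]: "Rj n j \<in> sets P" for n j unfolding S_def Rj_def by measurable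
    have bm: "bad n \<in> sets P" for n unfolding bad_def using N0(3) by (intro sets.Un sets.finite_UN) auto
    have "(\<lambda>n. prob (S n)) \<longlonglongrightarrow> 0" unfolding S_def by (rule Psi_small) (use pA_pos in simp)
    then have "\<forall>\<^sub>F n in sequentially. prob (S n) < e / 2" using e by (intro order_tendstoD(2)) auto
    then have ev: "\<forall>\<^sub>F n in sequentially. prob (bad n) \<le> e" using m0[OF m]
    proof eventually_elim
      case (elim n)
      have "prob (bad n) \<le> prob (N0 \<union> S n) + prob (\<Union>j\<le>K. Rj n j)" unfolding bad_def by (rule measure_Un_le) (use N0(3) in auto)
      also have "prob (N0 \<union> S n) \<le> prob N0 + prob (S n)" by (rule measure_Un_le) (use N0(3) in auto)
      also have "prob N0 = 0" using N0(2) by (simp add: measure_def)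
      also have "prob (\<Union>j\<le>K. Rj n j) \<le> (\<Sum>j\<le>K. prob (Rj n j))" by (rule measure_UNION_le) auto
      also have "\<dots> \<le> (\<Sum>j\<le>K. \<epsilon> / (\<eta> / 2))" unfolding Rj_def using elim \<epsilon> \<eta> by (intro sum_mono markov_ennreal) auto
      also have "\<dots> = e / 2"
      proof -
        have "\<epsilon> / (\<eta> / 2) = e / 2 / real (Suc K)" using \<eta> by (simp add: \<epsilon>_def del: of_nat_Suc)
        then show ?thesis by (simp del: of_nat_Suc)
      qed
      finally show ?case using elim by simp
    qed
    have "sup_dist (Tidx K) (Dproc P X Z A W K n \<omega>) (step_fun m (grid_sample m (\<lambda>j u. orth_proc j n u \<omega>))) \<le> \<eta>" if n: "0 < n" and w: "\<omega> \<in> space P - bad n" for n \<omega>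
    proof (rule sup_dist_le[OF Tidx_nonempty], clarify)
      fix us :: "nat \<Rightarrow> real^'p" and j assume t: "(us, j) \<in> Tidx K"
      have u: "us j \<in> cube" "j \<le> K" using Tidx_PG[OF t] by auto
      have r: "regular \<omega>" using w N0(1) unfolding bad_def by auto
      have s: "orth.Psi {..<n} 0 \<omega> \<le> ?c * real n" using w unfolding bad_def S_def by (auto simp: not_less)
      have mj: "maj j n m \<omega> \<le> ennreal (\<eta> / 2)" using w u(2) unfolding bad_def Rj_def by (auto simp: not_less)
      have "ennreal \<bar>(if j = 0 then DDn P X Z A n (us j) \<omega> else DDstar X Z A (W j) n (us j) \<omega>) - orth_proc j n (dfloor m (us j)) \<omega>\<bar> \<le> 2 * maj j n m \<omega>"
        by (rule process_close[OF r n u(1) s])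
      also have "\<dots> \<le> 2 * ennreal (\<eta> / 2)" by (intro mult_left_mono mj) simp
      also have "\<dots> = ennreal \<eta>" using \<eta> by (simp flip: ennreal_numeral ennreal_mult)
      finally have "\<bar>(if j = 0 then DDn P X Z A n (us j) \<omega> else DDstar X Z A (W j) n (us j) \<omega>) - orth_proc j n (dfloor m (us j)) \<omega>\<bar> \<le> \<eta>"
        using \<eta> by (simp add: ennreal_le_iff)
      moreover have "Dproc P X Z A W K n \<omega> (us, j) = (if j = 0 then DDn P X Z A n (us j) \<omega> else DDstar X Z A (W j) n (us j) \<omega>)"
        using t by (simp add: Dproc_def)
      ultimately show "\<bar>Dproc P X Z A W K n \<omega> (us, j) - step_fun m (grid_sample m (\<lambda>j u. orth_proc j n u \<omega>)) (us, j)\<bar> \<le> \<eta>"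
        by (simp only: step_fun_grid_sample[OF t])
    qed
    then show ?thesis using bm ev by blast
  qed
  then show ?thesis by blast
qed

text \<open>Three comparisons: the process with its step approximation, inside the outer
  expectation; convergence of the measurable step approximation at fixed \<open>m\<close>; and the
  step approximation of the limit with the limit itself.\<close>

lemma outer_conv:
  assumes h: "lip_bdd (Tidx K) k c h"
  shows "(\<lambda>n. outer_exp P (\<lambda>\<omega>. h (Dproc P X Z A W K n \<omega>))) \<longlonglongrightarrow> (\<integral>\<omega>. h (Gproc K BB \<omega>) \<partial>NN)"
proof (rule tendstoI)
  fix e :: real assume e: "0 < e"
  interpret NN: prob_space NN by (rule prob_NN)
  have k0: "0 \<le> k" and hb: "\<And>f. f \<in> linf (Tidx K) \<Longrightarrow> \<bar>h f\<bar> \<le> c"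
    and hl: "\<And>f g. f \<in> linf (Tidx K) \<Longrightarrow> g \<in> linf (Tidx K) \<Longrightarrow> \<bar>h f - h g\<bar> \<le> k * sup_dist (Tidx K) f g"
    using h unfolding lip_bdd_def by auto
  have c0: "0 \<le> c" using hb[OF step_fun_linf[of 0 "\<lambda>_. 0"]] by linarith
  \<comment> \<open>The first comparison costs \<open>k * \<eta>\<close> off the bad event and
    \<open>2 * c\<close> on it, each contributing at most \<open>e / 8\<close>. The other two cost
    less than \<open>e / 4\<close> each, so the total stays below \<open>e\<close>.\<close>
  define \<eta> where "\<eta> = e / (8 * (k + 1))"
  define \<epsilon> where "\<epsilon> = e / (16 * (c + 1))"
  have \<eta>: "0 < \<eta>" "k * \<eta> \<le> e / 8"
  proof -
    show "0 < \<eta>" using e k0 by (simp add: \<eta>_def)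
    have "k * \<eta> \<le> (k + 1) * \<eta>" using \<open>0 < \<eta>\<close> by (intro mult_right_mono) auto
    also have "\<dots> = e / 8"
    proof -
      have "x * (e / (8 * x)) = e / 8" if "x \<noteq> 0" for x :: real using that by simp
      from this[of "k + 1"] k0 show ?thesis unfolding \<eta>_def by (metis add_nonneg_pos less_irrefl zero_less_one)
    qed
    finally show "k * \<eta> \<le> e / 8" .
  qed
  have \<epsilon>: "0 < \<epsilon>" "2 * c * \<epsilon> \<le> e / 8"
  proof -
    show "0 < \<epsilon>" using e c0 by (simp add: \<epsilon>_def)
    have "2 * c * \<epsilon> \<le> 2 * (c + 1) * \<epsilon>" using \<open>0 < \<epsilon>\<close> by (intro mult_right_mono) auto
    also have "\<dots> = e / 8"
    proof -
      have "2 * x * (e / (16 * x)) = e / 8" if "x \<noteq> 0" for x :: real using that by simp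
      from this[of "c + 1"] c0 show ?thesis unfolding \<epsilon>_def by (metis add_nonneg_pos less_irrefl zero_less_one)
    qed
    finally show "2 * c * \<epsilon> \<le> e / 8" .
  qed
  have "(\<lambda>m. \<integral>\<omega>. h (step_fun m (grid_sample m (\<lambda>j u. BB j u \<omega>))) \<partial>NN) \<longlonglongrightarrow> (\<integral>\<omega>. h (Gproc K BB \<omega>) \<partial>NN)"
    by (rule integral_dominated_convergence[where w="\<lambda>_. c"])
       (use h_Gproc_measurable[OF h] h_step_fun_BB_measurable[OF h] h_step_fun_BB_tendsto[OF h] step_fun_lipschitz(2)[OF h] in auto)
  from tendstoD[OF this, of "e / 4"] e obtain m1 where m1: "\<And>m. m1 \<le> m \<Longrightarrow> dist (\<integral>\<omega>. h (step_fun m (grid_sample m (\<lambda>j u. BB j u \<omega>))) \<partial>NN) (\<integral>\<omega>. h (Gproc K BB \<omega>) \<partial>NN) < e / 4"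
    unfolding eventually_sequentially by auto
  obtain m0 where m0: "\<And>m. m0 \<le> m \<Longrightarrow> \<exists>bad. (\<forall>n. bad n \<in> sets P) \<and> (\<forall>\<^sub>F n in sequentially. prob (bad n) \<le> \<epsilon>) \<and>
    (\<forall>n>0. \<forall>\<omega>\<in>space P - bad n. sup_dist (Tidx K) (Dproc P X Z A W K n \<omega>) (step_fun m (grid_sample m (\<lambda>j u. orth_proc j n u \<omega>))) \<le> \<eta>)"
    using Dproc_close[OF \<eta>(1) \<epsilon>(1)] by blast
  define m where "m = max m0 m1"
  obtain bad where bad: "\<And>n. bad n \<in> sets P" "\<forall>\<^sub>F n in sequentially. prob (bad n) \<le> \<epsilon>"
    "\<And>n \<omega>. 0 < n \<Longrightarrow> \<omega> \<in> space P - bad n \<Longrightarrow> sup_dist (Tidx K) (Dproc P X Z A W K n \<omega>) (step_fun m (grid_sample m (\<lambda>j u. orth_proc j n u \<omega>))) \<le> \<eta>"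
    using m0[of m] unfolding m_def by auto
  have "\<forall>\<^sub>F n in sequentially. dist (expectation (\<lambda>\<omega>. h (step_fun m (grid_sample m (\<lambda>j u. orth_proc j n u \<omega>))))) (\<integral>\<omega>. h (step_fun m (grid_sample m (\<lambda>j u. BB j u \<omega>))) \<partial>NN) < e / 4"
    by (rule tendstoD[OF step_fun_conv[OF h]]) (use e in simp)
  then show "\<forall>\<^sub>F n in sequentially. dist (outer_exp P (\<lambda>\<omega>. h (Dproc P X Z A W K n \<omega>))) (\<integral>\<omega>. h (Gproc K BB \<omega>) \<partial>NN) < e"
    using bad(2) eventually_gt_at_top[of 0]
  proof eventually_elim
    case (elim n)
    let ?Y = "\<lambda>\<omega>. h (step_fun m (grid_sample m (\<lambda>j u. orth_proc j n u \<omega>)))"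
    have Ym: "?Y \<in> borel_measurable P"
    proof (rule lipschitz_coords_measurable[where \<phi>="\<lambda>x. h (step_fun m x)" and d="card (PG m)", OF step_fun_lipschitz(1)[OF h]])
      show "(\<lambda>\<omega>. grid_sample m (\<lambda>j u. orth_proc j n u \<omega>) i) \<in> borel_measurable P" for i unfolding grid_sample_def by measurable
    qed
    have "\<bar>outer_exp P (\<lambda>\<omega>. h (Dproc P X Z A W K n \<omega>)) - expectation ?Y\<bar> \<le> expectation (\<lambda>\<omega>. k * \<eta> + 2 * c * indicator (bad n) \<omega>)"
    proof (rule outer_exp_approx)
      show "integrable P ?Y" by (rule integrable_const_bound[where B=c]) (use Ym step_fun_lipschitz(2)[OF h] in auto)
      show "integrable P (\<lambda>\<omega>. k * \<eta> + 2 * c * indicator (bad n) \<omega>)" using bad(1)[of n] by (auto simp: emeasure_eq_measure)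
      fix \<omega> assume w: "\<omega> \<in> space P"
      show "\<bar>h (Dproc P X Z A W K n \<omega>) - ?Y \<omega>\<bar> \<le> k * \<eta> + 2 * c * indicator (bad n) \<omega>"
      proof (cases "\<omega> \<in> bad n")
        case True
        have "\<bar>h (Dproc P X Z A W K n \<omega>) - ?Y \<omega>\<bar> \<le> 2 * c"
          using hb[OF Dproc_linf[of n \<omega>]] hb[OF step_fun_linf[of m "grid_sample m (\<lambda>j u. orth_proc j n u \<omega>)"]] by linarith
        then show ?thesis using True k0 \<eta>(1) by (simp add: add_increasing)
      next
        case False
        have "\<bar>h (Dproc P X Z A W K n \<omega>) - ?Y \<omega>\<bar> \<le> k * sup_dist (Tidx K) (Dproc P X Z A W K n \<omega>) (step_fun m (grid_sample m (\<lambda>j u. orth_proc j n u \<omega>)))"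
          by (rule hl[OF Dproc_linf step_fun_linf])
        also have "\<dots> \<le> k * \<eta>" using bad(3)[of n \<omega>] elim False w k0 by (intro mult_left_mono) auto
        finally show ?thesis using False by simp
      qed
    qed
    also have "\<dots> = k * \<eta> + 2 * c * prob (bad n)" using bad(1)[of n] by (simp add: prob_space emeasure_eq_measure)
    also have "\<dots> \<le> k * \<eta> + 2 * c * \<epsilon>" using elim c0 by (intro add_left_mono mult_left_mono) auto
    also have "\<dots> \<le> e / 4" using \<eta>(2) \<epsilon>(2) by linarith
    finally show ?case using elim(1) m1[of m] e unfolding m_def dist_real_def by linarith
  qed
qed

theorem weak_convergence:
  assumes h: "linf_bcont (Tidx K) h"
  shows "(\<lambda>n. outer_exp P (\<lambda>\<omega>. h (Dproc P X Z A W K n \<omega>))) \<longlonglongrightarrow> (\<integral>\<omega>. h (Gproc K BB \<omega>) \<partial>NN)"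
  by (rule outer_exp_tendsto_of_lipschitz[OF prob_space_axioms prob_NN Tidx_nonempty Dproc_linf Gproc_linf h_Gproc_measurable outer_conv h])

end

theorem theorem4:
  fixes P :: "'a measure"
    and X :: "nat \<Rightarrow> 'a \<Rightarrow> real^'p"
    and Z :: "nat \<Rightarrow> 'a \<Rightarrow> real^'q"
    and A :: "(real^'q) set"
    and W :: "nat \<Rightarrow> nat \<Rightarrow> nat \<Rightarrow> 'a \<Rightarrow> real"
    and M :: nat
  assumes P: "prob_space P"
    and M: "M \<ge> 2"
    and X_meas: "\<And>i. X i \<in> borel_measurable P"
    and Z_meas: "\<And>i. Z i \<in> borel_measurable P"
    and iid_indep: "prob_space.indep_vars P (\<lambda>_. borel) (\<lambda>i \<omega>. (X i \<omega>, Z i \<omega>)) UNIV"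
    and iid_distr: "\<And>i. distr P borel (\<lambda>\<omega>. (X i \<omega>, Z i \<omega>)) = distr P borel (\<lambda>\<omega>. (X 0 \<omega>, Z 0 \<omega>))"
    and A: "A \<in> sets borel"
    and pA_pos: "pA P Z A > 0"
    and margins_cont: "\<And>k. continuous_on UNIV (Fcond P X Z A k)"
    and W_meas: "\<And>j n i. W j n i \<in> borel_measurable P"
    and W_nonneg: "\<And>j n i \<omega>. \<omega> \<in> space P \<Longrightarrow> W j n i \<omega> \<ge> 0"
    and W_exch: "\<And>n \<pi>. \<pi> permutes {..<n} \<Longrightarrow>
        distr P (PiM {..<n} (\<lambda>_. borel)) (\<lambda>\<omega>. \<lambda>i\<in>{..<n}. W 1 n (\<pi> i) \<omega>)
      = distr P (PiM {..<n} (\<lambda>_. borel)) (\<lambda>\<omega>. \<lambda>i\<in>{..<n}. W 1 n i \<omega>)"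
    and W_copies: "\<And>j n. j \<in> {1..M} \<Longrightarrow>
        distr P (PiM {..<n} (\<lambda>_. borel)) (\<lambda>\<omega>. \<lambda>i\<in>{..<n}. W j n i \<omega>)
      = distr P (PiM {..<n} (\<lambda>_. borel)) (\<lambda>\<omega>. \<lambda>i\<in>{..<n}. W 1 n i \<omega>)"
    and W_indep: "\<And>n. prob_space.indep_sets P
        (\<lambda>c. case c of
               None \<Rightarrow> {(\<lambda>\<omega>. \<lambda>i. (X i \<omega>, Z i \<omega>)) -` S \<inter> space P | S. S \<in> sets (PiM UNIV (\<lambda>_. borel))}
             | Some j \<Rightarrow> {(\<lambda>\<omega>. \<lambda>i\<in>{..<n}. W j n i \<omega>) -` S \<inter> space P | S. S \<in> sets (PiM {..<n} (\<lambda>_. borel))})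
        (insert None (Some ` {1..M}))"
    and condW: "cond_W P (W 1)"
  shows "\<exists>(N :: (nat \<Rightarrow> real^'p \<Rightarrow> real) measure) B.
           prob_space N \<and>
           (\<forall>j\<le>M. centered_gaussian_process N cube (B j) (covB P X Z A)) \<and>
           prob_space.indep_vars N (\<lambda>_. PiM cube (\<lambda>_. borel)) (\<lambda>j \<omega>. \<lambda>u\<in>cube. B j u \<omega>) {..M} \<and>
           Gproc M B \<in> measurable N (linf_borel (Tidx M)) \<and>
           (\<forall>h. linf_bcont (Tidx M) h \<longrightarrow>
              (\<lambda>n. outer_exp P (\<lambda>\<omega>. h (Dproc P X Z A W M n \<omega>)))
                \<longlonglongrightarrow> (\<integral>\<omega>. h (Gproc M B \<omega>) \<partial>N))"
proof -
  interpret bootstrap_model P X Z A W M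
    by (intro bootstrap_model.intro sampling_model.intro sampling_model_axioms.intro bootstrap_model_axioms.intro; fact)
  show ?thesis
    by (intro exI[of _ NN] exI[of _ BB] conjI allI impI prob_NN BB_gaussian BB_indep Gproc_borel weak_convergence)
qed

end
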